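(* Let $L$ be the Hilbert space defined in the context. Let $g\in L$ be such that the function $s\mapsto s\,g(s)$ also belongs to $L$ (i.e. $g$ is in the domain of multiplication by $s$). For each non-trivial zero $\rho$ of $\zeta$, let $m_\rho(g)\ge 0$ be the multiplicity of $\rho$ as a zero of (the meromorphic continuation of) $g$, with $m_\rho(g)=0$ if $g(\rho)\neq0$. Then $g$ belongs to the closed linear span in $L$ of the functions $\frac{\zeta(s)}{(s-\rho)^k}$, where $\rho$ ranges over the non-trivial zeros of $\zeta$ and $1\le k\le m_\rho-m_\rho(g)$.
   Context: The non-trivial zeros of the Riemann zeta function $\zeta$ are denoted $\rho$, and $m_\rho$ denotes the multiplicity of $\rho$ as a zero of $\zeta$. The Hilbert space $L$ is the subspace of $L^2(\tfrac12+i\mathbb{R};\tfrac{|ds|}{2\pi})$ consisting of the Mellin transforms $g(s)=\widehat f(s)=\int_0^\infty f(x)x^{-s}\,dx$ (in the $L^2$ sense on the critical line $\Re(s)=\frac12$) of functions $f\in L^2(0,\infty;dx)$ such that $f$ is constant on $(0,1)$ and its Fourier cosine transform $y\mapsto\int_0^\infty 2\cos(2\pi xy)f(x)\,dx$ is also constant on $(0,1)$. Every $g\in L$ extends to a meromorphic function on $\mathbb{C}$ whose only possible pole is at $s=1$; in particular it is holomorphic at each $\rho$. The functions $\zeta(s)/(s-\rho)^k$, $1\le k\le m_\rho$, belong to $L$. *)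

theory Defs
  imports "HOL-Complex_Analysis.Complex_Analysis" "HOL-Library.Function_Algebras"
    "HOL-Library.Extended_Nat"
begin

text \<open>
  Being nicely meromorphic fixes the value at a pole to be 0 and excludes removable
  discontinuities, so that a meromorphic continuation is unique as a function.
\<close>

definition riemann_zeta :: "complex \<Rightarrow> complex" where
  "riemann_zeta = (THE Z. Z nicely_meromorphic_on UNIV \<and>
     (\<forall>s. Re s > 1 \<longrightarrow> Z s = (\<Sum>n. of_nat (Suc n) powr (- s))))"

definition nontrivial_zeros :: "complex set" where
  "nontrivial_zeros = {\<rho>. 0 < Re \<rho> \<and> Re \<rho> < 1 \<and> riemann_zeta \<rho> = 0}"

text \<open>
  For \<open>f\<close> holomorphic near \<open>z\<close>: the multiplicity is 0 if \<open>f z \<noteq> 0\<close>, and infinite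
  if \<open>f\<close> vanishes identically near \<open>z\<close> (where \<open>zorder\<close> is unspecified).
\<close>

definition zero_mult :: "(complex \<Rightarrow> complex) \<Rightarrow> complex \<Rightarrow> enat" where
  "zero_mult f z =
     (if eventually (\<lambda>w. f w = 0) (at z) then \<infinity> else enat (nat (zorder f z)))"

text \<open>
  Elements of \<open>L\<^sup>2(M)\<close> are represented by functions, any two of which are the same
  element if they agree almost everywhere; all notions below respect this.
\<close>

definition L2 :: "'a measure \<Rightarrow> ('a \<Rightarrow> complex) set" where
  "L2 M = {f. f \<in> borel_measurable M \<and> integrable M (\<lambda>x. (norm (f x))\<^sup>2)}"

definition L2_dist_sq :: "'a measure \<Rightarrow> ('a \<Rightarrow> complex) \<Rightarrow> ('a \<Rightarrow> complex) \<Rightarrow> ennreal" where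
  "L2_dist_sq M f g = (\<integral>\<^sup>+x. ennreal ((norm (f x - g x))\<^sup>2) \<partial>M)"

definition halfline :: "real measure" where
  "halfline = restrict_space lborel {0<..}"

text \<open>The measure \<open>|ds|/(2\<pi>)\<close> on the line \<open>Re s = 1/2\<close>, as a Borel measure on the plane.\<close>

definition crit_line :: "complex measure" where
  "crit_line = distr (density lborel (\<lambda>_. ennreal (1 / (2 * pi)))) borel (\<lambda>t. Complex (1/2) t)"

definition is_mellin_transform :: "(real \<Rightarrow> complex) \<Rightarrow> (complex \<Rightarrow> complex) \<Rightarrow> bool" where
  "is_mellin_transform f g \<longleftrightarrow>
     ((\<lambda>T. L2_dist_sq crit_line
             (\<lambda>s. LINT x:{1/T..T}|lborel. f x * complex_of_real x powr (- s)) g)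
        \<longlongrightarrow> 0) at_top"

definition is_cosine_transform :: "(real \<Rightarrow> complex) \<Rightarrow> (real \<Rightarrow> complex) \<Rightarrow> bool" where
  "is_cosine_transform f h \<longleftrightarrow>
     ((\<lambda>T. L2_dist_sq halfline
             (\<lambda>y. LINT x:{0<..T}|lborel. complex_of_real (2 * cos (2 * pi * x * y)) * f x) h)
        \<longlongrightarrow> 0) at_top"

definition const_on_unit :: "(real \<Rightarrow> complex) \<Rightarrow> bool" where
  "const_on_unit f \<longleftrightarrow> (\<exists>c. AE x in lborel. 0 < x \<and> x < 1 \<longrightarrow> f x = c)"

definition L_space :: "(complex \<Rightarrow> complex) set" where
  "L_space = {g \<in> L2 crit_line. \<exists>f\<in>L2 halfline. \<exists>h\<in>L2 halfline.
     is_cosine_transform f h \<and> const_on_unit f \<and> const_on_unit h \<and> is_mellin_transform f g}"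

definition mero_continuation :: "(complex \<Rightarrow> complex) \<Rightarrow> complex \<Rightarrow> complex" where
  "mero_continuation g =
     (THE G. G nicely_meromorphic_on UNIV \<and> (AE s in crit_line. G s = g s))"

definition closed_span_L :: "(complex \<Rightarrow> complex) set \<Rightarrow> (complex \<Rightarrow> complex) set" where
  "closed_span_L S = {g \<in> L_space. \<forall>\<epsilon>>0.
     \<exists>h \<in> module.span (\<lambda>(c::complex) \<phi> s. c * \<phi> s) S. L2_dist_sq crit_line g h < ennreal \<epsilon>}"

end

theory Submission imports Defs "HOL-Probability.Probability" begin

text \<open>
  Write \<open>\<zeta> = a Z\<close> with \<open>a\<close> the archimedean factor and \<open>Z\<close> entire. The functional equation of Mellin transforms
  of cosine pairs gives \<open>g = a X\<close> on the line with \<open>X\<close> entire. Let \<open>\<phi>\<close> be orthogonal to the span. The function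
  \<open>N w = \<integral> (\<zeta> s X w - g s Z w) / (s - w) cnj (\<phi> s)\<close> is entire, and orthogonality makes \<open>N / Z\<close> entire: the
  multiplicities of the zeros of \<open>X\<close> account for the powers that are missing in the span. Away from the critical
  strip \<open>N / Z\<close> grows at most linearly, because \<open>s g s\<close> belongs to the space as well; inside the strip a
  Harnack-type estimate for quotients of entire functions allows the Phragmen-Lindelof principle, so \<open>N / Z\<close> is
  affine, and it vanishes since it tends to 0 along the positive reals. Comparing the asymptotics of
  \<open>\<integral> g s / (s - w) cnj (\<phi> s)\<close> and \<open>X w / Z w * (\<integral> \<zeta> s / (s - w) cnj (\<phi> s))\<close> for \<open>w\<close> to infinity gives
  \<open>\<integral> g cnj \<phi> = 0\<close>, and Hilbert space duality concludes.
\<close>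

section \<open>Duality in Hilbert space\<close>

text \<open>The duality takes place in the ambient L^2 space of the line:
  \<open>closed_span_L\<close> asks for \<open>g\<close> in \<open>L_space\<close> and for
  approximation in norm, so \<phi> ranges over all of \<open>L2 crit_line\<close>. Neither the
  Cauchy transform of \<zeta> against \<phi> nor that of \<open>g\<close> continues across the
  critical line in general; the combination defining \<open>N\<close> does, since its integrand has
  no pole at s = w. The main obstacle is the strip, where \<zeta> has zeros and no usable lower
  bound. Two facts replace one: \<zeta> is bounded below on Re s = 3/2, by the 3-4-1 inequality, and
  \<open>N\<close> and \<open>Z\<close> grow at most exponentially in the height. A disc of radius 6
  centred on that line is large enough for a third of it to cover the width of the strip, and
  dividing the zeros out of \<open>Z\<close> and of the product of \<open>Z\<close> with the
  quotient together bounds the quotient. Multiplication by s supplies one extra power of decay: w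
  X(w) / Z(w) stays bounded far to the right, so that the \<zeta> term vanishes to higher order than
  1/w and the integral of \<open>g\<close> is isolated.\<close>

lemma L2_I:
  assumes "f \<in> borel_measurable M" "h \<in> borel_measurable M" "integrable M (\<lambda>x. (norm (h x))\<^sup>2)"
    "AE x in M. norm (f x) \<le> C * norm (h x)"
  shows "f \<in> L2 M"
  unfolding L2_def
proof safe
  show "integrable M (\<lambda>x. (norm (f x))\<^sup>2)"
  proof (rule Bochner_Integration.integrable_bound)
    show "integrable M (\<lambda>x. C\<^sup>2 * (norm (h x))\<^sup>2)" using assms(3) by simp
    show "(\<lambda>x. (norm (f x))\<^sup>2) \<in> borel_measurable M" using assms(1) by measurable
    show "AE x in M. norm ((norm (f x))\<^sup>2) \<le> norm (C\<^sup>2 * (norm (h x))\<^sup>2)"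
      using assms(4)
    proof eventually_elim
      case (elim x)
      have "(norm (f x))\<^sup>2 \<le> (C * norm (h x))\<^sup>2" using elim by (intro power_mono) auto
      then show ?case by (simp add: power_mult_distrib)
    qed
  qed
qed (use assms in auto)

lemma L2_measurable: "f \<in> L2 M \<Longrightarrow> f \<in> borel_measurable M"
  and L2_integrable: "f \<in> L2 M \<Longrightarrow> integrable M (\<lambda>x. (norm (f x))\<^sup>2)"
  by (auto simp: L2_def)

lemma L2_bounded_by:
  assumes "f \<in> borel_measurable M" "h \<in> L2 M" "AE x in M. norm (f x) \<le> C * norm (h x)"
  shows "f \<in> L2 M"
  using L2_I[OF assms(1) L2_measurable[OF assms(2)] L2_integrable[OF assms(2)] assms(3)] .

lemma L2_cmult: "f \<in> L2 M \<Longrightarrow> (\<lambda>x. c * f x) \<in> L2 M"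
  by (rule L2_bounded_by[of _ _ f "norm c"]) (auto simp: norm_mult dest: L2_measurable)

lemma norm_add_square_le: "(norm (a + b :: complex))\<^sup>2 \<le> 2 * (norm a)\<^sup>2 + 2 * (norm b)\<^sup>2"
proof -
  have "(norm (a + b))\<^sup>2 \<le> (norm a + norm b)\<^sup>2" by (intro power_mono norm_triangle_ineq) auto
  also have "\<dots> \<le> 2 * (norm a)\<^sup>2 + 2 * (norm b)\<^sup>2"
    using sum_squares_bound[of "norm a" "norm b"] by (simp add: power2_sum)
  finally show ?thesis .
qed

lemma L2_add:
  assumes "f \<in> L2 M" "h \<in> L2 M"
  shows "(\<lambda>x. f x + h x) \<in> L2 M"
  unfolding L2_def
proof safe
  note [measurable] = assms[THEN L2_measurable]
  show "(\<lambda>x. f x + h x) \<in> borel_measurable M" by measurable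
  show "integrable M (\<lambda>x. (norm (f x + h x))\<^sup>2)"
  proof (rule Bochner_Integration.integrable_bound)
    show "integrable M (\<lambda>x. 2 * (norm (f x))\<^sup>2 + 2 * (norm (h x))\<^sup>2)"
      using assms[THEN L2_integrable] by simp
    show "AE x in M. norm ((norm (f x + h x))\<^sup>2) \<le> norm (2 * (norm (f x))\<^sup>2 + 2 * (norm (h x))\<^sup>2)"
      using norm_add_square_le by auto
  qed measurable
qed

lemma L2_diff:
  assumes "f \<in> L2 M" "h \<in> L2 M"
  shows "(\<lambda>x. f x - h x) \<in> L2 M"
  using L2_add[OF assms(1) L2_cmult[OF assms(2), of "-1"]] by simp

lemma borel_measurable_cnj [measurable (raw)]:
  "f \<in> borel_measurable M \<Longrightarrow> (\<lambda>x. cnj (f x)) \<in> borel_measurable M"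
  by (rule measurable_compose[of f M borel cnj borel])
    (auto intro: borel_measurable_continuous_onI continuous_on_cnj continuous_on_id)

lemma L2_cnj: "f \<in> L2 M \<Longrightarrow> (\<lambda>x. cnj (f x)) \<in> L2 M"
  by (rule L2_bounded_by[of _ _ f 1]) (auto dest: L2_measurable)

lemma L2_norm: "f \<in> L2 M \<Longrightarrow> (\<lambda>x. of_real (norm (f x))) \<in> L2 M"
  by (rule L2_bounded_by[of _ _ f 1]) (auto dest: L2_measurable)

lemma L2_norm_mult_integrable:
  assumes "u \<in> L2 M" "v \<in> L2 M"
  shows "integrable M (\<lambda>x. norm (u x) * norm (v x))"
proof (rule Bochner_Integration.integrable_bound)
  note [measurable] = assms[THEN L2_measurable]
  show "integrable M (\<lambda>x. (norm (u x))\<^sup>2 + (norm (v x))\<^sup>2)"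
    using assms[THEN L2_integrable] by simp
  show "(\<lambda>x. norm (u x) * norm (v x)) \<in> borel_measurable M" by measurable
  have "norm (norm (u x) * norm (v x)) \<le> norm ((norm (u x))\<^sup>2 + (norm (v x))\<^sup>2)" for x
  proof -
    have "2 * norm (u x) * norm (v x) \<le> (norm (u x))\<^sup>2 + (norm (v x))\<^sup>2" by (rule sum_squares_bound)
    moreover have "0 \<le> norm (u x) * norm (v x)" by simp
    ultimately have "norm (u x) * norm (v x) \<le> (norm (u x))\<^sup>2 + (norm (v x))\<^sup>2" by linarith
    then show ?thesis by (simp add: abs_mult)
  qed
  then show "AE x in M. norm (norm (u x) * norm (v x)) \<le> norm ((norm (u x))\<^sup>2 + (norm (v x))\<^sup>2)" by simp
qed

lemma L2_mult_integrable:
  assumes "u \<in> L2 M" "v \<in> L2 M"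
  shows "integrable M (\<lambda>x. u x * v x)"
  using L2_norm_mult_integrable[OF assms] assms[THEN L2_measurable]
  by (rule_tac Bochner_Integration.integrable_bound) (auto simp: norm_mult)

text \<open>The integral of (t |u| - |v|)^2 is a nonnegative quadratic in t; t = P / A is its
  minimum, and A = 0 forces P = 0 because the bound is then linear in t.\<close>

lemma L2_Cauchy_Schwarz:
  assumes "u \<in> L2 M" "v \<in> L2 M"
  shows "(norm (\<integral>x. u x * v x \<partial>M))\<^sup>2 \<le> (\<integral>x. (norm (u x))\<^sup>2 \<partial>M) * (\<integral>x. (norm (v x))\<^sup>2 \<partial>M)"
    (is "_ \<le> ?A * ?B")
proof -
  define P where "P = (\<integral>x. norm (u x) * norm (v x) \<partial>M)"
  have nn: "?A \<ge> 0" "?B \<ge> 0" "P \<ge> 0" by (auto simp: P_def)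
  have P: "norm (\<integral>x. u x * v x \<partial>M) \<le> P"
    unfolding P_def norm_mult[symmetric] by (rule integral_norm_bound)
  have quad: "?A * t\<^sup>2 + ?B \<ge> 2 * t * P" for t
  proof -
    have "0 \<le> (\<integral>x. (t * norm (u x) - norm (v x))\<^sup>2 \<partial>M)" by simp
    also have "(\<lambda>x. (t * norm (u x) - norm (v x))\<^sup>2) =
        (\<lambda>x. t\<^sup>2 * (norm (u x))\<^sup>2 - 2 * t * (norm (u x) * norm (v x)) + (norm (v x))\<^sup>2)"
      by (auto simp: power2_diff power_mult_distrib algebra_simps)
    also have "(\<integral>x. t\<^sup>2 * (norm (u x))\<^sup>2 - 2 * t * (norm (u x) * norm (v x)) + (norm (v x))\<^sup>2 \<partial>M)
       = t\<^sup>2 * ?A - 2 * t * P + ?B"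
      unfolding P_def using L2_norm_mult_integrable[OF assms] assms[THEN L2_integrable] by simp
    finally show ?thesis by (simp add: algebra_simps)
  qed
  have "P\<^sup>2 \<le> ?A * ?B"
  proof (cases "?A = 0")
    case True
    then have "2 * t * P \<le> ?B" for t using quad[of t] by simp
    from this[of "?B / P"] this[of "1/P"] have "P = 0 \<or> ?B \<le> 0"
      using nn by (auto simp: field_simps split: if_splits)
    moreover have "P = 0" if "?B \<le> 0"
    proof -
      have "2 * P \<le> ?B" using \<open>\<And>t. 2 * t * P \<le> ?B\<close>[of 1] by simp
      then show ?thesis using nn that by linarith
    qed
    ultimately show ?thesis using nn by auto
  next
    case False
    then have A: "?A > 0" using nn(1) by linarith
    have "2 * (P / ?A) * P \<le> ?A * (P / ?A)\<^sup>2 + ?B" by (rule quad)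
    then have "P\<^sup>2 / ?A \<le> ?B" using A by (simp add: power2_eq_square field_simps)
    then show ?thesis using A by (simp add: field_simps)
  qed
  moreover have "(norm (\<integral>x. u x * v x \<partial>M))\<^sup>2 \<le> P\<^sup>2" using P by (intro power_mono) auto
  ultimately show ?thesis by linarith
qed

lemma L2_parallelogram:
  assumes "u \<in> L2 M" "v \<in> L2 M"
  shows "(\<integral>x. (norm (u x + v x))\<^sup>2 \<partial>M) + (\<integral>x. (norm (u x - v x))\<^sup>2 \<partial>M)
     = 2 * (\<integral>x. (norm (u x))\<^sup>2 \<partial>M) + 2 * (\<integral>x. (norm (v x))\<^sup>2 \<partial>M)"
proof -
  have "(norm (a + b))\<^sup>2 + (norm (a - b))\<^sup>2 = 2 * (norm a)\<^sup>2 + 2 * (norm b)\<^sup>2" for a b :: complex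
    unfolding cmod_power2 by (simp add: power2_eq_square algebra_simps)
  then have "(\<integral>x. (norm (u x + v x))\<^sup>2 + (norm (u x - v x))\<^sup>2 \<partial>M)
     = (\<integral>x. 2 * (norm (u x))\<^sup>2 + 2 * (norm (v x))\<^sup>2 \<partial>M)" by simp
  then show ?thesis
    using L2_integrable[OF L2_add[OF assms]] L2_integrable[OF L2_diff[OF assms]] assms[THEN L2_integrable]
    by simp
qed

text \<open>
  The speed of convergence replaces the usual extraction of a subsequence: the functions
  \<open>2 ^ n * \<bar>k (n + 1) - k n\<bar>\<^sup>2\<close> have a finite integral in total, which forces convergence almost everywhere.
\<close>

lemma L2_fast_Cauchy_limit:
  assumes k: "\<And>n. k n \<in> L2 M"
    and fast: "\<And>m n. n \<le> m \<Longrightarrow> (\<integral>x. (norm (k m x - k n x))\<^sup>2 \<partial>M) \<le> C / 4 ^ n"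
  obtains \<phi> where "\<phi> \<in> L2 M" "\<And>n. (\<integral>x. (norm (\<phi> x - k n x))\<^sup>2 \<partial>M) \<le> C / 4 ^ n"
proof -
  note [measurable] = k[THEN L2_measurable]
  have C0: "0 \<le> C" 
  proof -
    have "0 \<le> (\<integral>x. (norm (k 0 x - k 0 x))\<^sup>2 \<partial>M)" by simp
    also have "\<dots> \<le> C" using fast[of 0 0] by simp
    finally show ?thesis .
  qed
  have nn: "(\<integral>\<^sup>+x. ennreal ((norm (k m x - k n x))\<^sup>2) \<partial>M) \<le> ennreal (C / 4 ^ n)" if "n \<le> m" for m n
    using fast[OF that] L2_integrable[OF L2_diff[OF k k]]
    by (subst nn_integral_eq_integral) (auto intro!: ennreal_leI)
  have "(\<integral>\<^sup>+x. (\<Sum>n. ennreal (2 ^ n * (norm (k (Suc n) x - k n x))\<^sup>2)) \<partial>M)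
      = (\<Sum>n. \<integral>\<^sup>+x. ennreal (2 ^ n * (norm (k (Suc n) x - k n x))\<^sup>2) \<partial>M)"
    by (rule nn_integral_suminf) measurable
  also have "\<dots> \<le> (\<Sum>n. ennreal (C * (1/2) ^ n))"
  proof (intro suminf_le)
    fix n
    have "(\<integral>\<^sup>+x. ennreal (2 ^ n * (norm (k (Suc n) x - k n x))\<^sup>2) \<partial>M)
       = ennreal (2 ^ n) * (\<integral>\<^sup>+x. ennreal ((norm (k (Suc n) x - k n x))\<^sup>2) \<partial>M)"
      by (subst nn_integral_cmult[symmetric]) (auto simp: ennreal_mult)
    also have "\<dots> \<le> ennreal (2 ^ n) * ennreal (C / 4 ^ n)" by (intro mult_left_mono nn) auto
    also have "\<dots> = ennreal (C * (1/2) ^ n)"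
    proof -
      have "(4::real) ^ n = 2 ^ n * 2 ^ n" by (simp flip: power_mult_distrib)
      then have "2 ^ n * (C / 4 ^ n) = C * (1/2) ^ n" by (simp add: field_simps power_divide)
      then show ?thesis using C0 by (simp flip: ennreal_mult)
    qed
    finally show "(\<integral>\<^sup>+x. ennreal (2 ^ n * (norm (k (Suc n) x - k n x))\<^sup>2) \<partial>M) \<le> ennreal (C * (1/2) ^ n)" .
  qed auto
  also have "\<dots> < \<infinity>"
    using C0 by (subst suminf_ennreal2) (auto intro!: summable_mult summable_geometric)
  finally have fin: "(\<integral>\<^sup>+x. (\<Sum>n. ennreal (2 ^ n * (norm (k (Suc n) x - k n x))\<^sup>2)) \<partial>M) \<noteq> \<infinity>" by simp
  have ae: "AE x in M. (\<Sum>n. ennreal (2 ^ n * (norm (k (Suc n) x - k n x))\<^sup>2)) \<noteq> \<infinity>"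
    by (rule nn_integral_PInf_AE[OF _ fin]) measurable
  have conv: "AE x in M. convergent (\<lambda>n. k n x)"
    using ae
  proof eventually_elim
    case (elim x)
    define d where "d n = norm (k (Suc n) x - k n x)" for n
    have sm: "summable (\<lambda>n. 2 ^ n * (d n)\<^sup>2)"
      by (rule summable_suminf_not_top) (use elim in \<open>auto simp: d_def\<close>)
    have "summable d"
    proof (rule summable_comparison_test')
      show "summable (\<lambda>n. 2 ^ n * (d n)\<^sup>2 + (1/2) ^ n)"
        using sm by (intro summable_add summable_geometric) auto
      fix n
      \<comment> \<open>Arithmetic-geometric mean with the weights \<open>sqrt 2 ^ n\<close> and
        \<open>sqrt (1/2) ^ n\<close>, whose product is 1: the weighted squares and a geometric
        series together dominate \<open>d n\<close>.\<close>
      have "2 * (sqrt 2 ^ n * d n) * (sqrt (1/2)) ^ n \<le> (sqrt 2 ^ n * d n)\<^sup>2 + (sqrt (1/2) ^ n)\<^sup>2"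
        by (rule sum_squares_bound)
      moreover have "(sqrt 2 ^ n * d n) * (sqrt (1/2)) ^ n = d n"
        by (simp add: real_sqrt_divide power_divide)
      moreover have "(sqrt 2 ^ n * d n)\<^sup>2 = 2 ^ n * (d n)\<^sup>2" "(sqrt (1/2) ^ n)\<^sup>2 = (1/2) ^ n"
        by (simp_all add: power_mult_distrib flip: real_sqrt_power)
      moreover have "d n \<ge> 0" by (simp add: d_def)
      ultimately show "norm (d n) \<le> 2 ^ n * (d n)\<^sup>2 + (1/2) ^ n"
        unfolding real_norm_def mult.assoc by linarith
    qed
    then have "summable (\<lambda>n. k (Suc n) x - k n x)"
      unfolding d_def by (rule summable_norm_cancel)
    then have "convergent (\<lambda>n. \<Sum>i<n. k (Suc i) x - k i x)" by (simp add: summable_iff_convergent)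
    then have "convergent (\<lambda>n. k n x - k 0 x)" by (simp only: sum_lessThan_telescope[of "\<lambda>n. k n x"])
    then show ?case using convergent_diff_const_right_iff[of "\<lambda>n. k n x" "k 0 x"] by simp
  qed
  define \<phi> where "\<phi> = (\<lambda>x. lim (\<lambda>n. k n x))"
  have [measurable]: "\<phi> \<in> borel_measurable M" unfolding \<phi>_def by measurable
  \<comment> \<open>Fatou's lemma in m carries the estimate for k m - k n over to the limit
    \<phi>.\<close>
  have nn\<phi>: "(\<integral>\<^sup>+x. ennreal ((norm (\<phi> x - k n x))\<^sup>2) \<partial>M) \<le> ennreal (C / 4 ^ n)" for n
  proof -
    have "(\<integral>\<^sup>+x. ennreal ((norm (\<phi> x - k n x))\<^sup>2) \<partial>M)
       = (\<integral>\<^sup>+x. liminf (\<lambda>m. ennreal ((norm (k m x - k n x))\<^sup>2)) \<partial>M)"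
    proof (rule nn_integral_cong_AE)
      show "AE x in M. ennreal ((norm (\<phi> x - k n x))\<^sup>2) = liminf (\<lambda>m. ennreal ((norm (k m x - k n x))\<^sup>2))"
        using conv
      proof eventually_elim
        case (elim x)
        then have "(\<lambda>m. k m x) \<longlonglongrightarrow> \<phi> x" unfolding \<phi>_def by (simp add: convergent_LIMSEQ_iff)
        then have "(\<lambda>m. ennreal ((norm (k m x - k n x))\<^sup>2)) \<longlonglongrightarrow> ennreal ((norm (\<phi> x - k n x))\<^sup>2)"
          by (intro tendsto_ennrealI tendsto_intros)
        then show ?case using lim_imp_Liminf[OF sequentially_bot] by metis
      qed
    qed
    also have "\<dots> \<le> liminf (\<lambda>m. \<integral>\<^sup>+x. ennreal ((norm (k m x - k n x))\<^sup>2) \<partial>M)"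
      by (rule nn_integral_liminf) measurable
    also have "\<dots> \<le> ennreal (C / 4 ^ n)"
    proof -
      have "eventually (\<lambda>m. (\<integral>\<^sup>+x. ennreal ((norm (k m x - k n x))\<^sup>2) \<partial>M) \<le> ennreal (C / 4 ^ n)) sequentially"
        using eventually_ge_at_top[of n] by eventually_elim (rule nn)
      then have "liminf (\<lambda>m. \<integral>\<^sup>+x. ennreal ((norm (k m x - k n x))\<^sup>2) \<partial>M) \<le> liminf (\<lambda>m. ennreal (C / 4 ^ n))"
        by (rule Liminf_mono)
      also have "liminf (\<lambda>m. ennreal (C / 4 ^ n)) = ennreal (C / 4 ^ n)"
        by (rule Liminf_const[OF sequentially_bot])
      finally show ?thesis .
    qed
    finally show ?thesis .
  qed
  have d: "integrable M (\<lambda>x. (norm (\<phi> x - k n x))\<^sup>2)" for n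
    using nn\<phi>[of n] by (intro integrableI_bounded) (auto simp: less_top[symmetric] top_unique intro: le_less_trans)
  have "(\<lambda>x. \<phi> x - k 0 x) \<in> L2 M" using d[of 0] by (simp add: L2_def)
  from L2_add[OF this k[of 0]] have "\<phi> \<in> L2 M" by simp
  moreover have "(\<integral>x. (norm (\<phi> x - k n x))\<^sup>2 \<partial>M) \<le> C / 4 ^ n" for n
    using nn\<phi>[of n] C0 by (simp add: nn_integral_eq_integral[OF d] ennreal_le_iff)
  ultimately show ?thesis using that by blast
qed

text \<open>The residuals of a minimising sequence converge to a function \<phi> orthogonal to
  \<open>V\<close>. The duality hypothesis makes \<phi> orthogonal to \<open>g\<close> as well,
  hence to every residual \<open>k n\<close>, and Pythagoras then forces \<phi> and the residuals to
  0.\<close>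

lemma L2_approximation_by_duality:
  assumes V: "V \<subseteq> L2 M" "V \<noteq> {}" "\<And>u v. u \<in> V \<Longrightarrow> v \<in> V \<Longrightarrow> (\<lambda>x. u x + v x) \<in> V"
      "\<And>c u. u \<in> V \<Longrightarrow> (\<lambda>x. c * u x) \<in> V"
    and g: "g \<in> L2 M"
    and dual: "\<And>\<phi>. \<phi> \<in> L2 M \<Longrightarrow> (\<And>v. v \<in> V \<Longrightarrow> (\<integral>x. v x * cnj (\<phi> x) \<partial>M) = 0) \<Longrightarrow>
        (\<integral>x. g x * cnj (\<phi> x) \<partial>M) = 0"
    and e: "e > 0"
  shows "\<exists>h\<in>V. (\<integral>x. (norm (g x - h x))\<^sup>2 \<partial>M) < e"
proof -
  define q :: "('a \<Rightarrow> complex) \<Rightarrow> real" where "q u = (\<integral>x. (norm (u x))\<^sup>2 \<partial>M)" for u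
  have q0: "q u \<ge> 0" for u by (simp add: q_def)
  define d where "d = Inf ((\<lambda>h. q (\<lambda>x. g x - h x)) ` V)"
  have bdd: "bdd_below ((\<lambda>h. q (\<lambda>x. g x - h x)) ` V)" using q0 by (intro bdd_belowI2[of _ 0]) auto
  have dle: "d \<le> q (\<lambda>x. g x - h x)" if "h \<in> V" for h
    unfolding d_def using bdd that by (intro cInf_lower) auto
  have "\<exists>h\<in>V. q (\<lambda>x. g x - h x) < d + 1 / 4 ^ n" for n
  proof -
    have "\<exists>y\<in>(\<lambda>h. q (\<lambda>x. g x - h x)) ` V. y < d + 1 / 4 ^ n"
      using V(2) by (intro cInf_lessD) (auto simp: d_def)
    then show ?thesis by auto
  qed
  then obtain h where h: "\<And>n. h n \<in> V" "\<And>n. q (\<lambda>x. g x - h n x) < d + 1 / 4 ^ n" by metis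
  define k where "k n x = g x - h n x" for n x
  have hL: "h n \<in> L2 M" for n using h V by auto
  have kL: "k n \<in> L2 M" for n unfolding k_def by (rule L2_diff[OF g hL])
  have qk: "q (k n) < d + 1 / 4 ^ n" for n using h(2)[of n] by (simp add: k_def[abs_def])
  have qkd: "q (\<lambda>x. k n x - v x) \<ge> d" if "v \<in> V" for n v
  proof -
    have "q (\<lambda>x. k n x - v x) = q (\<lambda>x. g x - (h n x + v x))" by (simp add: k_def algebra_simps)
    then show ?thesis using dle[OF V(3)[OF h(1)[of n] that]] by simp
  qed
  \<comment> \<open>Parallelogram identity: the midpoint of \<open>h m\<close> and
    \<open>h n\<close> lies in \<open>V\<close>, so the sum of the two residuals has squared norm at
    least 4 d.\<close>
  have fast: "(\<integral>x. (norm (k m x - k n x))\<^sup>2 \<partial>M) \<le> 4 / 4 ^ n" if "n \<le> m" for m n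
  proof -
    have "(\<integral>x. (norm (k m x + k n x))\<^sup>2 \<partial>M) + (\<integral>x. (norm (k m x - k n x))\<^sup>2 \<partial>M)
       = 2 * q (k m) + 2 * q (k n)"
      unfolding q_def by (rule L2_parallelogram[OF kL kL])
    moreover have "(\<integral>x. (norm (k m x + k n x))\<^sup>2 \<partial>M) \<ge> 4 * d"
    proof -
      have "(norm (k m x + k n x))\<^sup>2 = 4 * (norm (g x - (1/2) * (h m x + h n x)))\<^sup>2" for x
      proof -
        have "k m x + k n x = 2 * (g x - (1/2) * (h m x + h n x))" by (simp add: k_def field_simps)
        then show ?thesis by (simp only: norm_mult power_mult_distrib) simp
      qed
      then have "(\<integral>x. (norm (k m x + k n x))\<^sup>2 \<partial>M) = 4 * q (\<lambda>x. g x - (1/2) * (h m x + h n x))"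
        by (simp add: q_def)
      moreover have "(\<lambda>x. (1/2) * (h m x + h n x)) \<in> V" by (intro V h)
      ultimately show ?thesis using dle by fastforce
    qed
    moreover have "1 / 4 ^ m \<le> 1 / (4::real) ^ n" using that by (simp add: field_simps)
    ultimately show ?thesis using qk[of m] qk[of n] by simp
  qed
  obtain \<phi> where \<phi>: "\<phi> \<in> L2 M" "\<And>n. (\<integral>x. (norm (\<phi> x - k n x))\<^sup>2 \<partial>M) \<le> 4 / 4 ^ n"
    using L2_fast_Cauchy_limit[OF kL fast] by blast
  define ip where "ip u v = (\<integral>x. u x * cnj (v x) \<partial>M)" for u v :: "'a \<Rightarrow> complex"
  have ip_diff: "ip u (\<lambda>x. v x - w x) = ip u v - ip u w" if "u \<in> L2 M" "v \<in> L2 M" "w \<in> L2 M" for u v w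
    unfolding ip_def using that by (simp add: algebra_simps L2_mult_integrable L2_cnj)
  have ip_bound: "(norm (ip u v))\<^sup>2 \<le> q u * q v" if "u \<in> L2 M" "v \<in> L2 M" for u v
    unfolding ip_def q_def using L2_Cauchy_Schwarz[OF that(1) L2_cnj[OF that(2)]] by simp
  have lim0: "(\<lambda>n. c / 4 ^ n) \<longlonglongrightarrow> 0" for c :: real
  proof -
    have "(\<lambda>n. c * (1/4) ^ n) \<longlonglongrightarrow> c * 0" by (intro tendsto_intros LIMSEQ_power_zero) auto
    then show ?thesis by (simp add: power_divide)
  qed
  have orth: "ip v \<phi> = 0" if v: "v \<in> V" for v
  proof -
    have vL: "v \<in> L2 M" using v V by auto
    have small: "(norm (ip v (k n)))\<^sup>2 \<le> (1 / 4 ^ n) * q v" for n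
    proof (cases "q v = 0")
      case True
      then show ?thesis using ip_bound[OF vL kL, of n] by simp
    next
      case False
      define Q where "Q = q v"
      have Q: "Q > 0" using False q0[of v] by (simp add: Q_def)
      define z where "z = ip v (k n)"
      have exp: "q (\<lambda>x. k n x - c * v x) = q (k n) - 2 * Re (c * z) + (norm c)\<^sup>2 * Q" for c
      proof -
        have pt: "(norm (k n x - c * v x))\<^sup>2 = (norm (k n x))\<^sup>2 - 2 * Re (c * (v x * cnj (k n x))) + (norm c)\<^sup>2 * (norm (v x))\<^sup>2" for x
          unfolding cmod_power2 by (simp add: power2_eq_square algebra_simps)
        have i: "integrable M (\<lambda>x. v x * cnj (k n x))" by (intro L2_mult_integrable vL L2_cnj kL)
        define r where "r x = Re (c * (v x * cnj (k n x)))" for x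
        have r: "integrable M r" unfolding r_def using i by (intro integrable_Re integrable_mult_right)
        have "Re (c * z) = (\<integral>x. r x \<partial>M)"
          unfolding z_def ip_def r_def using i by (subst Bochner_Integration.integral_Re) auto
        then show ?thesis
          unfolding q_def pt Q_def r_def[symmetric]
          using r L2_integrable[OF kL[of n]] L2_integrable[OF vL] by simp
      qed
      \<comment> \<open>The multiplier cnj z / Q minimises the quadratic in \<open>exp\<close>. As
        \<open>q (k n)\<close> exceeds the infimum by less than 1 / 4 ^ n, the component of
        \<open>k n\<close> along \<open>v\<close> is that small.\<close>
      have "d \<le> q (\<lambda>x. k n x - (cnj z / Q) * v x)" by (intro qkd V v)
      also have "\<dots> = q (k n) - 2 * (norm z)\<^sup>2 / Q + (norm z)\<^sup>2 / Q"
      proof -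
        have "Re (cnj z / Q * z) = (norm z)\<^sup>2 / Q"
          unfolding cmod_power2 by (simp add: power2_eq_square add_divide_distrib)
        moreover have "(norm (cnj z / Q))\<^sup>2 * Q = (norm z)\<^sup>2 / Q"
          using Q by (simp add: norm_divide power2_eq_square)
        ultimately show ?thesis unfolding exp by (simp only: times_divide_eq_right)
      qed
      finally have "(norm z)\<^sup>2 / Q \<le> 1 / 4 ^ n" using qk[of n] by simp
      then show ?thesis using Q by (simp add: z_def Q_def field_simps)
    qed
    have "(norm (ip v \<phi>))\<^sup>2 \<le> 10 * q v / 4 ^ n" for n
    proof -
      have "ip v (\<lambda>x. \<phi> x - k n x) = ip v \<phi> - ip v (k n)" by (rule ip_diff[OF vL \<phi>(1) kL])
      then have "ip v \<phi> = ip v (\<lambda>x. \<phi> x - k n x) + ip v (k n)" by simp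
      then have "(norm (ip v \<phi>))\<^sup>2 \<le> 2 * (norm (ip v (\<lambda>x. \<phi> x - k n x)))\<^sup>2 + 2 * (norm (ip v (k n)))\<^sup>2"
        using norm_add_square_le by simp
      moreover have "(norm (ip v (\<lambda>x. \<phi> x - k n x)))\<^sup>2 \<le> q v * (4 / 4 ^ n)"
        using ip_bound[OF vL L2_diff[OF \<phi>(1) kL[of n]]] mult_left_mono[OF \<phi>(2)[of n] q0[of v]]
        by (simp add: q_def)
      moreover have "q v * (4 / 4 ^ n) = 4 * (q v / 4 ^ n)" by simp
      moreover have "(norm (ip v (k n)))\<^sup>2 \<le> q v / 4 ^ n" using small[of n] by simp
      moreover have "x \<le> 2 * a + 2 * b \<Longrightarrow> a \<le> y \<Longrightarrow> y = 4 * t \<Longrightarrow> b \<le> t \<Longrightarrow> x \<le> 10 * t" for x a b y t :: real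
        by linarith
      ultimately have "(norm (ip v \<phi>))\<^sup>2 \<le> 10 * (q v / 4 ^ n)" by blast
      then show ?thesis by simp
    qed
    then have "(norm (ip v \<phi>))\<^sup>2 \<le> 0"
      by (intro LIMSEQ_le_const[OF lim0[of "10 * q v"]]) auto
    then show ?thesis by simp
  qed
  have g\<phi>: "ip g \<phi> = 0" unfolding ip_def by (rule dual[OF \<phi>(1)]) (use orth in \<open>auto simp: ip_def\<close>)
  have k\<phi>: "ip (k n) \<phi> = 0" for n
  proof -
    have "ip (k n) \<phi> = ip g \<phi> - ip (h n) \<phi>"
      unfolding ip_def k_def left_diff_distrib using g hL[of n] \<phi>(1) by (intro Bochner_Integration.integral_diff L2_mult_integrable L2_cnj)
    then show ?thesis using g\<phi> orth[OF h(1)] by simp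
  qed
  \<comment> \<open>Pythagoras: \<open>k n\<close> is orthogonal to \<phi>, so the two squared norms
    add up to that of the difference.\<close>
  have q\<phi>: "q \<phi> \<le> 4 / 4 ^ n" for n
  proof -
    have "(norm a)\<^sup>2 + (norm b)\<^sup>2 - (norm (a - b))\<^sup>2 = 2 * Re (b * cnj a)" for a b :: complex
      unfolding cmod_power2 by (simp add: power2_eq_square algebra_simps)
    then have "(\<integral>x. (norm (\<phi> x))\<^sup>2 + (norm (k n x))\<^sup>2 - (norm (\<phi> x - k n x))\<^sup>2 \<partial>M) = (\<integral>x. 2 * Re (k n x * cnj (\<phi> x)) \<partial>M)"
      by simp
    also have "\<dots> = 2 * Re (ip (k n) \<phi>)"
      unfolding ip_def integral_mult_right_zero
      by (simp only: Bochner_Integration.integral_Re[OF L2_mult_integrable[OF kL[of n] L2_cnj[OF \<phi>(1)]]])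
    finally have "q \<phi> + q (k n) = (\<integral>x. (norm (\<phi> x - k n x))\<^sup>2 \<partial>M)"
      using k\<phi> L2_integrable[OF \<phi>(1)] L2_integrable[OF kL[of n]] L2_integrable[OF L2_diff[OF \<phi>(1) kL[of n]]]
      by (simp add: q_def)
    then show ?thesis using \<phi>(2)[of n] q0[of "k n"] by linarith
  qed
  have "q (k n) \<le> 16 / 4 ^ n" for n
  proof -
    have "(norm (k n x))\<^sup>2 \<le> 2 * (norm (\<phi> x - k n x))\<^sup>2 + 2 * (norm (\<phi> x))\<^sup>2" for x
      using norm_add_square_le[of "k n x - \<phi> x" "\<phi> x"] by (simp add: norm_minus_commute)
    then have "q (k n) \<le> (\<integral>x. 2 * (norm (\<phi> x - k n x))\<^sup>2 + 2 * (norm (\<phi> x))\<^sup>2 \<partial>M)"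
      unfolding q_def using L2_integrable[OF \<phi>(1)] L2_integrable[OF kL[of n]] L2_integrable[OF L2_diff[OF \<phi>(1) kL[of n]]]
      by (intro integral_mono) auto
    also have "\<dots> = 2 * (\<integral>x. (norm (\<phi> x - k n x))\<^sup>2 \<partial>M) + 2 * q \<phi>"
      unfolding q_def using L2_integrable[OF \<phi>(1)] L2_integrable[OF L2_diff[OF \<phi>(1) kL[of n]]] by simp
    finally show ?thesis using \<phi>(2)[of n] q\<phi>[of n] by simp
  qed
  moreover obtain n where "16 / 4 ^ n < e"
    using order_tendstoD(2)[OF lim0[of 16] e] by (auto simp: eventually_sequentially)
  ultimately have "q (k n) < e" using le_less_trans by blast
  then show ?thesis using h(1)[of n] unfolding q_def k_def by blast
qed

section \<open>Integrals of holomorphic functions and Fourier analysis\<close>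

text \<open>Differentiation under the integral from a bound on the functions themselves: Cauchy's
  inequality on discs of radius r/4 turns it into a bound for the difference quotients, to which
  dominated convergence applies along every sequence.\<close>

lemma holomorphic_on_integral:
  fixes F :: "complex \<Rightarrow> 'a \<Rightarrow> complex"
  assumes U: "open U"
    and meas: "\<And>w. w \<in> U \<Longrightarrow> F w \<in> borel_measurable M"
    and hol: "AE x in M. (\<lambda>w. F w x) holomorphic_on U"
    and dom: "\<And>w0. w0 \<in> U \<Longrightarrow> \<exists>r>0. \<exists>b. integrable M b \<and> (AE x in M. \<forall>w\<in>ball w0 r \<inter> U. norm (F w x) \<le> b x)"
  shows "(\<lambda>w. \<integral>x. F w x \<partial>M) holomorphic_on U"
proof -
  have "(\<lambda>w. \<integral>x. F w x \<partial>M) field_differentiable at w0" if w0: "w0 \<in> U" for w0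
  proof -
    obtain r0 b where r0: "r0 > 0" and b: "integrable M b"
      and ae: "AE x in M. \<forall>w\<in>ball w0 r0 \<inter> U. norm (F w x) \<le> b x"
      using dom[OF w0] by blast
    obtain r1 where r1: "r1 > 0" "ball w0 r1 \<subseteq> U" using U w0 openE by blast
    define r where "r = min r0 r1"
    have r: "r > 0" "ball w0 r \<subseteq> U" "ball w0 r \<subseteq> ball w0 r0" using r0 r1 by (auto simp: r_def)
    \<comment> \<open>A fixed sequence in \<open>U\<close> tending to \<open>w0\<close>: its
      difference quotients are measurable, hence so is their limit \<open>D\<close>, which
      represents the derivative almost everywhere.\<close>
    define Z where "Z n = w0 + of_real (r / 4 * (1 / real (Suc n)))" for n
    have Z: "Z n \<in> U" "Z n \<noteq> w0" for n
    proof -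
      have "r / 4 * (1 / real (Suc n)) \<le> r / 4 * 1" using r(1) by (intro mult_left_mono) auto
      moreover have dist_eq: "dist w0 (Z n) = r / 4 * (1 / real (Suc n))"
        unfolding dist_norm norm_minus_commute[of w0] Z_def add_diff_cancel_left' norm_of_real using r(1) by simp
      moreover have "r / 4 * 1 < r" using r(1) by simp
      ultimately have "Z n \<in> ball w0 r" unfolding mem_ball by linarith
      then show "Z n \<in> U" using r(2) by auto
      have "0 < r / 4 * (1 / real (Suc n))" using r(1) by simp
      then show "Z n \<noteq> w0" using dist_eq by force
    qed
    have "(\<lambda>n. r / 4 * (1 / real (Suc n))) \<longlonglongrightarrow> r / 4 * 0"
      by (intro tendsto_mult tendsto_const LIMSEQ_Suc[OF lim_1_over_n])
    then have "Z \<longlonglongrightarrow> w0 + of_real (r / 4 * 0)" unfolding Z_def by (rule tendsto_add[OF tendsto_const tendsto_of_real])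
    then have Zlim: "filterlim Z (at w0) sequentially"
      using Z(2) by (simp add: filterlim_at)
    define D where "D x = lim (\<lambda>n. (F (Z n) x - F w0 x) / (Z n - w0))" for x
    have [measurable]: "F w0 \<in> borel_measurable M" "\<And>n. F (Z n) \<in> borel_measurable M"
      using meas w0 Z by auto
    have [measurable]: "D \<in> borel_measurable M" unfolding D_def by measurable
    have quot: "AE x in M. (\<forall>w\<in>ball w0 (r/2) - {w0}. norm ((F w x - F w0 x) / (w - w0)) \<le> 4 / r * b x)
        \<and> ((\<lambda>w. (F w x - F w0 x) / (w - w0)) \<longlongrightarrow> D x) (at w0)"
      using ae hol
    proof eventually_elim
      case (elim x)
      have le: "norm (F w x) \<le> b x" if "w \<in> ball w0 r" for w using elim(1) r that by blast
      have d: "norm (deriv (\<lambda>w. F w x) w) \<le> 4 / r * b x" if w: "w \<in> ball w0 (r/2)" for w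
      proof -
        have sub: "cball w (r/4) \<subseteq> ball w0 r"
        proof
          fix y assume "y \<in> cball w (r/4)"
          then show "y \<in> ball w0 r" using w r(1) dist_triangle[of w0 y w] by auto
        qed
        have h: "(\<lambda>w. F w x) holomorphic_on cball w (r/4)"
          using elim(2) sub r(2) by (meson holomorphic_on_subset order_trans)
        have "norm ((deriv ^^ 1) (\<lambda>w. F w x) w) \<le> fact 1 * b x / (r/4) ^ 1"
        proof (rule Cauchy_inequality)
          show "(\<lambda>w. F w x) holomorphic_on ball w (r/4)" using h by (rule holomorphic_on_subset) auto
          show "continuous_on (cball w (r/4)) (\<lambda>w. F w x)" using h by (rule holomorphic_on_imp_continuous_on)
          fix z assume "norm (w - z) = r/4"
          then have "z \<in> cball w (r/4)" by (simp add: dist_norm)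
          then show "norm (F z x) \<le> b x" using le sub by blast
        qed (use r in auto)
        then show ?thesis by (simp add: field_simps)
      qed
      have "norm ((F w x - F w0 x) / (w - w0)) \<le> 4 / r * b x" if "w \<in> ball w0 (r/2) - {w0}" for w
      proof -
        have "norm (F w x - F w0 x) \<le> 4 / r * b x * norm (w - w0)"
        proof (rule field_differentiable_bound[where S = "ball w0 (r/2)" and f' = "deriv (\<lambda>w. F w x)"])
          fix z assume z: "z \<in> ball w0 (r/2)"
          then have "z \<in> U" using r by (auto simp: subset_iff)
          then show "((\<lambda>w. F w x) has_field_derivative deriv (\<lambda>w. F w x) z) (at z within ball w0 (r/2))"
            using holomorphic_derivI[OF elim(2) U] by (meson has_field_derivative_at_within)
        qed (use d r that in auto)
        then show ?thesis using that by (simp add: norm_divide field_simps)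
      qed
      moreover have lim: "((\<lambda>w. (F w x - F w0 x) / (w - w0)) \<longlongrightarrow> deriv (\<lambda>w. F w x) w0) (at w0)"
        using holomorphic_derivI[OF elim(2) U w0] by (simp add: has_field_derivative_iff)
      moreover have "D x = deriv (\<lambda>w. F w x) w0"
        unfolding D_def by (rule limI) (rule filterlim_compose[OF lim Zlim])
      ultimately show ?case by auto
    qed
    have int: "integrable M (F w)" if "w \<in> ball w0 r" for w
    proof (rule Bochner_Integration.integrable_bound[OF b])
      show "F w \<in> borel_measurable M" using meas r that by auto
      show "AE x in M. norm (F w x) \<le> norm (b x)"
        using ae by eventually_elim (use r that in force)
    qed
    have "((\<lambda>w. ((\<integral>x. F w x \<partial>M) - (\<integral>x. F w0 x \<partial>M)) / (w - w0)) \<longlongrightarrow> (\<integral>x. D x \<partial>M)) (at w0)"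
      unfolding tendsto_at_iff_sequentially comp_def
    proof (intro allI impI)
      fix X :: "nat \<Rightarrow> complex"
      assume X: "\<forall>i. X i \<in> UNIV - {w0}" "X \<longlonglongrightarrow> w0"
      have "eventually (\<lambda>n. X n \<in> ball w0 (r/2)) sequentially"
        using topological_tendstoD[OF X(2), of "ball w0 (r/2)"] r by auto
      then obtain N where N: "\<And>n. n \<ge> N \<Longrightarrow> X n \<in> ball w0 (r/2)" by (auto simp: eventually_sequentially)
      define Y where "Y n = X (n + N)" for n
      have Y: "Y n \<in> ball w0 (r/2)" "Y n \<noteq> w0" "Y n \<in> U" for n
        using N[of "n+N"] X(1) r by (auto simp: Y_def)
      have Y': "Y n \<in> ball w0 r" for n using Y(1)[of n] r by auto
      have Ylim: "filterlim Y (at w0) sequentially"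
        using LIMSEQ_ignore_initial_segment[OF X(2), of N] Y(2) by (simp add: Y_def[abs_def] filterlim_at)
      have [measurable]: "F w0 \<in> borel_measurable M" "\<And>n. F (Y n) \<in> borel_measurable M"
        using meas w0 Y by auto
      have "(\<lambda>n. \<integral>x. (F (Y n) x - F w0 x) / (Y n - w0) \<partial>M) \<longlonglongrightarrow> (\<integral>x. D x \<partial>M)"
      proof (rule integral_dominated_convergence)
        show "integrable M (\<lambda>x. 4 / r * b x)" using b by simp
        show "AE x in M. (\<lambda>n. (F (Y n) x - F w0 x) / (Y n - w0)) \<longlonglongrightarrow> D x"
          using quot by eventually_elim (use filterlim_compose[OF _ Ylim] in auto)
        show "AE x in M. norm ((F (Y n) x - F w0 x) / (Y n - w0)) \<le> 4 / r * b x" for n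
          using quot by eventually_elim (use Y in blast)
      qed measurable
      moreover have "(\<integral>x. (F (Y n) x - F w0 x) / (Y n - w0) \<partial>M) = ((\<integral>x. F (Y n) x \<partial>M) - (\<integral>x. F w0 x \<partial>M)) / (Y n - w0)" for n
        using int[OF Y'] int[of w0] r by simp
      ultimately have "(\<lambda>n. ((\<integral>x. F (Y n) x \<partial>M) - (\<integral>x. F w0 x \<partial>M)) / (Y n - w0)) \<longlonglongrightarrow> (\<integral>x. D x \<partial>M)"
        by (simp only:)
      then show "(\<lambda>n. ((\<integral>x. F (X n) x \<partial>M) - (\<integral>x. F w0 x \<partial>M)) / (X n - w0)) \<longlonglongrightarrow> (\<integral>x. D x \<partial>M)"
        unfolding Y_def by (rule LIMSEQ_offset)
    qed
    then have "((\<lambda>w. \<integral>x. F w x \<partial>M) has_field_derivative (\<integral>x. D x \<partial>M)) (at w0)"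
      by (simp add: has_field_derivative_iff)
    then show ?thesis by (auto simp: field_differentiable_def)
  qed
  then show ?thesis by (auto simp: holomorphic_on_def intro: field_differentiable_at_within)
qed

text \<open>Integrable factors and a bounded kernel make the joint integrand integrable; the
  Fourier, cosine and Mellin-Gauss interchanges below have this shape.\<close>

lemma Fubini_bounded_kernel:
  fixes a :: "'a \<Rightarrow> complex" and b :: "'b \<Rightarrow> complex" and K :: "'a \<Rightarrow> 'b \<Rightarrow> complex"
  assumes sf: "sigma_finite_measure M" "sigma_finite_measure N"
    and a: "integrable M a" and b: "integrable N b"
    and K: "case_prod K \<in> borel_measurable (M \<Otimes>\<^sub>M N)"
    and bd: "\<And>x y. x \<in> space M \<Longrightarrow> y \<in> space N \<Longrightarrow> norm (K x y) \<le> C"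
  shows "(\<integral>x. a x * (\<integral>y. b y * K x y \<partial>N) \<partial>M) = (\<integral>y. b y * (\<integral>x. a x * K x y \<partial>M) \<partial>N)"
proof -
  interpret pair_sigma_finite M N using sf by (simp add: pair_sigma_finite_def)
  have [measurable]: "a \<in> borel_measurable M" "b \<in> borel_measurable N" using a b by auto
  note [measurable] = K
  have m[measurable]: "case_prod (\<lambda>x y. a x * b y * K x y) \<in> borel_measurable (M \<Otimes>\<^sub>M N)" by measurable
  have *: "integrable (M \<Otimes>\<^sub>M N) (case_prod (\<lambda>x y. a x * b y * K x y))"
  proof (rule Bochner_Integration.integrable_bound)
    show "integrable (M \<Otimes>\<^sub>M N) (\<lambda>(x,y). C * (a x * b y))"
    proof (rule Fubini_integrable)
      show "(\<lambda>(x,y). C * (a x * b y)) \<in> borel_measurable (M \<Otimes>\<^sub>M N)" by measurable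
      show "integrable M (\<lambda>x. \<integral>y. norm (case (x, y) of (x, y) \<Rightarrow> C * (a x * b y)) \<partial>N)"
        using a b by (simp add: norm_mult)
      show "AE x in M. integrable N (\<lambda>y. case (x, y) of (x, y) \<Rightarrow> C * (a x * b y))"
        using b by auto
    qed
    have "norm (a x * b y * K x y) \<le> norm (C * (a x * b y))" if "x \<in> space M" "y \<in> space N" for x y
    proof -
      have "norm (a x * b y * K x y) = norm (a x * b y) * norm (K x y)" by (simp add: norm_mult)
      also have "\<dots> \<le> norm (a x * b y) * C" by (intro mult_left_mono bd that) auto
      also have "\<dots> \<le> norm (a x * b y) * \<bar>C\<bar>" by (intro mult_left_mono) auto
      finally show ?thesis by (simp add: norm_mult mult.commute)
    qed
    then show "AE x in M \<Otimes>\<^sub>M N. norm (case x of (x, y) \<Rightarrow> a x * b y * K x y) \<le> norm (case x of (x, y) \<Rightarrow> C * (a x * b y))"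
      by (intro AE_I2) (auto simp: space_pair_measure)
  qed (rule m)
  have "(\<integral>y. (\<integral>x. a x * b y * K x y \<partial>M) \<partial>N) = (\<integral>x. (\<integral>y. a x * b y * K x y \<partial>N) \<partial>M)"
    by (rule Fubini_integral[OF *])
  moreover have "(\<integral>x. a x * b y * K x y \<partial>M) = b y * (\<integral>x. a x * K x y \<partial>M)" for y
    by (subst integral_mult_right_zero[symmetric]) (simp add: mult_ac)
  moreover have "(\<integral>y. a x * b y * K x y \<partial>N) = a x * (\<integral>y. b y * K x y \<partial>N)" for x
    by (subst integral_mult_right_zero[symmetric]) (simp add: mult_ac)
  ultimately show ?thesis by simp
qed

section \<open>Fourier transforms on the line: Gaussians, uniqueness, the Plancherel
  inequality\<close>

lemma gaussian_Fourier:
  assumes e: "e > 0"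
  shows "(CLINT t|lborel. of_real (exp (- (e * t)\<^sup>2 / 2)) * iexp (t * v)) = of_real (sqrt (2 * pi) / e * exp (- (v / e)\<^sup>2 / 2))"
    and "integrable lborel (\<lambda>t. exp (- (e * t)\<^sup>2 / 2))"
proof -
  have std: "(CLINT x|lborel. of_real (exp (- x\<^sup>2 / 2)) * iexp (x * u)) = of_real (sqrt (2 * pi) * exp (- u\<^sup>2 / 2))" for u
  proof -
    have "of_real (exp (- u\<^sup>2 / 2)) = char std_normal_distribution u"
      by (simp add: char_std_normal_distribution)
    also have "\<dots> = (CLINT x|lborel. std_normal_density x *\<^sub>R iexp (u * x))"
      unfolding char_def by (subst integral_density) (auto simp: normal_density_nonneg)
    also have "\<dots> = (CLINT x|lborel. of_real (1 / sqrt (2 * pi)) * (of_real (exp (- x\<^sup>2 / 2)) * iexp (x * u)))"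
      by (intro Bochner_Integration.integral_cong) (simp_all add: std_normal_density_def scaleR_conv_of_real mult_ac)
    also have "\<dots> = of_real (1 / sqrt (2 * pi)) * (CLINT x|lborel. of_real (exp (- x\<^sup>2 / 2)) * iexp (x * u))"
      by (rule integral_mult_right_zero)
    finally show ?thesis by (simp add: field_simps flip: of_real_mult)
  qed
  have std_int: "integrable lborel (\<lambda>x::real. exp (- x\<^sup>2 / 2))"
  proof -
    have "integrable lborel (\<lambda>x. sqrt (2 * pi) * std_normal_density x)"
      using integrable_normal_density[of 1 0] by simp
    then show ?thesis by (simp add: std_normal_density_def)
  qed
  show "integrable lborel (\<lambda>t. exp (- (e * t)\<^sup>2 / 2))"
    using lborel_integrable_real_affine[OF std_int, of e 0] e by simp
  have "(CLINT x|lborel. of_real (exp (- x\<^sup>2 / 2)) * iexp (x * (v/e)))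
      = \<bar>e\<bar> *\<^sub>R (CLINT t|lborel. of_real (exp (- (0 + e * t)\<^sup>2 / 2)) * iexp ((0 + e * t) * (v/e)))"
    using e by (intro lborel_integral_real_affine) auto
  also have "(\<lambda>t. of_real (exp (- (0 + e * t)\<^sup>2 / 2)) * iexp ((0 + e * t) * (v/e)))
      = (\<lambda>t. of_real (exp (- (e * t)\<^sup>2 / 2)) * iexp (t * v))" using e by (auto simp: field_simps)
  finally show "(CLINT t|lborel. of_real (exp (- (e * t)\<^sup>2 / 2)) * iexp (t * v)) = of_real (sqrt (2 * pi) / e * exp (- (v / e)\<^sup>2 / 2))"
    using e std[of "v/e"] by (simp add: scaleR_conv_of_real field_simps)
qed

text \<open>The positive and negative parts of \<open>D\<close> have the same mass \<open>m\<close>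
  (take u = 0). Divided by \<open>m\<close> they are probability densities with equal characteristic
  functions, which Levy's uniqueness theorem identifies; mass 0 is separate because of the
  division.\<close>

lemma Fourier_unique_real:
  fixes D :: "real \<Rightarrow> real"
  assumes D: "integrable lborel D" and z: "\<And>u. (CLINT t|lborel. of_real (D t) * iexp (u * t)) = 0"
  shows "AE t in lborel. D t = 0"
proof -
  have [measurable]: "D \<in> borel_measurable borel" using D by auto
  define P where "P t = max 0 (D t)" for t
  define N where "N t = max 0 (- D t)" for t
  have [measurable]: "P \<in> borel_measurable borel" "N \<in> borel_measurable borel"
    unfolding P_def N_def by measurable
  have P: "integrable lborel P" and N: "integrable lborel N"
    using D unfolding P_def N_def by (auto intro!: integrable_max)
  have nn: "P t \<ge> 0" "N t \<ge> 0" for t by (auto simp: P_def N_def)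
  have DPN: "D t = P t - N t" for t by (auto simp: P_def N_def)
  have bdd: "integrable lborel (\<lambda>t. of_real (f t) * iexp (u * t))" if "integrable lborel f" for f :: "real \<Rightarrow> real" and u
    by (rule Bochner_Integration.integrable_bound[OF that]) (use that in \<open>auto simp: norm_mult\<close>)
  have eq: "(CLINT t|lborel. of_real (P t) * iexp (u * t)) = (CLINT t|lborel. of_real (N t) * iexp (u * t))" for u
  proof -
    have "(CLINT t|lborel. of_real (D t) * iexp (u * t)) = (CLINT t|lborel. of_real (P t) * iexp (u * t) - of_real (N t) * iexp (u * t))"
      by (simp add: DPN left_diff_distrib)
    also have "\<dots> = (CLINT t|lborel. of_real (P t) * iexp (u * t)) - (CLINT t|lborel. of_real (N t) * iexp (u * t))"
      by (intro Bochner_Integration.integral_diff bdd P N)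
    finally show ?thesis using z by simp
  qed
  define m where "m = (\<integral>t. P t \<partial>lborel)"
  have m': "m = (\<integral>t. N t \<partial>lborel)"
  proof -
    have "complex_of_real m = of_real (\<integral>t. N t \<partial>lborel)"
      using eq[of 0] unfolding m_def by (simp add: integral_complex_of_real)
    then show ?thesis by (simp only: of_real_eq_iff)
  qed
  have m0: "m \<ge> 0" unfolding m_def using nn by simp
  show ?thesis
  proof (cases "m = 0")
    case True
    then have "AE t in lborel. P t = 0" "AE t in lborel. N t = 0"
      using integral_nonneg_eq_0_iff_AE[OF P] integral_nonneg_eq_0_iff_AE[OF N] nn m' by (auto simp: m_def)
    then show ?thesis by eventually_elim (simp add: DPN)
  next
    case False
    then have m: "m > 0" using m0 by simp
    have rd: "real_distribution (density lborel (\<lambda>t. ennreal (f t / m)))"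
      if f: "integrable lborel f" "\<And>t. f t \<ge> 0" "m = (\<integral>t. f t \<partial>lborel)" for f :: "real \<Rightarrow> real"
    proof -
      have [measurable]: "f \<in> borel_measurable borel" using f by auto
      have "(\<integral>\<^sup>+t. ennreal (f t / m) \<partial>lborel) = ennreal (\<integral>t. f t / m \<partial>lborel)"
        using f m by (intro nn_integral_eq_integral) auto
      also have "\<dots> = 1" using f m by simp
      finally have "prob_space (density lborel (\<lambda>t. ennreal (f t / m)))"
        by (intro prob_spaceI) (simp add: emeasure_density)
      then show ?thesis by (simp add: real_distribution_def real_distribution_axioms_def)
    qed
    have ch: "char (density lborel (\<lambda>t. ennreal (f t / m))) u = of_real (1 / m) * (CLINT t|lborel. of_real (f t) * iexp (u * t))"
      if f: "integrable lborel f" "\<And>t. f t \<ge> 0" for f :: "real \<Rightarrow> real" and u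
    proof -
      have [measurable]: "f \<in> borel_measurable borel" using f by auto
      have "char (density lborel (\<lambda>t. ennreal (f t / m))) u = (CLINT t|lborel. (f t / m) *\<^sub>R iexp (u * t))"
        unfolding char_def using f m by (subst integral_density) auto
      also have "\<dots> = (CLINT t|lborel. of_real (1 / m) * (of_real (f t) * iexp (u * t)))"
        by (intro Bochner_Integration.integral_cong) (simp_all add: scaleR_conv_of_real)
      also have "\<dots> = of_real (1 / m) * (CLINT t|lborel. of_real (f t) * iexp (u * t))" by (rule integral_mult_right_zero)
      finally show ?thesis .
    qed
    have "density lborel (\<lambda>t. ennreal (P t / m)) = density lborel (\<lambda>t. ennreal (N t / m))"
      by (rule Levy_uniqueness[OF rd[OF P nn(1) m_def] rd[OF N nn(2) m']])
        (simp only: fun_eq_iff ch[OF P nn(1)] ch[OF N nn(2)] eq simp_thms)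
    then have "AE t in lborel. ennreal (P t / m) = ennreal (N t / m)"
      by (subst (asm) sigma_finite_measure.density_unique_iff[OF sigma_finite_lborel]) auto
    then show ?thesis
    proof eventually_elim
      case (elim t)
      then have "P t / m = N t / m" using nn m by (subst (asm) ennreal_inj) auto
      then show ?case using m by (simp add: DPN)
    qed
  qed
qed

text \<open>The transform of the conjugate at u is the conjugate of the transform at -u, so the real
  and imaginary parts have vanishing transforms too.\<close>

lemma Fourier_unique:
  fixes D :: "real \<Rightarrow> complex"
  assumes D: "integrable lborel D" and z: "\<And>u. (CLINT t|lborel. D t * iexp (u * t)) = 0"
  shows "AE t in lborel. D t = 0"
proof -
  have i: "integrable lborel (\<lambda>t. D t * iexp (u * t))" for u
    by (rule Bochner_Integration.integrable_bound[OF D]) (use D in \<open>auto simp: norm_mult\<close>)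
  have i': "integrable lborel (\<lambda>t. cnj (D t) * iexp (u * t))" for u
    by (rule Bochner_Integration.integrable_bound[OF D]) (use D in \<open>auto simp: norm_mult\<close>)
  have z': "(CLINT t|lborel. cnj (D t) * iexp (u * t)) = 0" for u
  proof -
    have "(CLINT t|lborel. cnj (D t) * iexp (u * t)) = (CLINT t|lborel. cnj (D t * iexp ((-u) * t)))"
      by (simp add: exp_cnj)
    also have "\<dots> = cnj (CLINT t|lborel. D t * iexp ((-u) * t))" by (rule Bochner_Integration.integral_cnj)
    finally show ?thesis using z[of "-u"] by simp
  qed
  have re: "AE t in lborel. Re (D t) = 0"
  proof (rule Fourier_unique_real)
    fix u
    have "(CLINT t|lborel. of_real (Re (D t)) * iexp (u * t)) = (CLINT t|lborel. (1/2) * (D t * iexp (u * t) + cnj (D t) * iexp (u * t)))"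
      by (intro Bochner_Integration.integral_cong) (auto simp: complex_add_cnj simp flip: distrib_right)
    also have "\<dots> = 0" using z z' i i' by simp
    finally show "(CLINT t|lborel. of_real (Re (D t)) * iexp (u * t)) = 0" .
  qed (use D in auto)
  have im: "AE t in lborel. Im (D t) = 0"
  proof (rule Fourier_unique_real)
    fix u
    have "of_real (Im (D t)) * e = (1/(2*\<i>)) * (D t * e - cnj (D t) * e)" for t e
    proof -
      have "complex_of_real (Im (D t)) = (1/(2*\<i>)) * (D t - cnj (D t))" by (simp add: complex_eq_iff)
      then show ?thesis by (simp only: left_diff_distrib mult.assoc)
    qed
    then have "(CLINT t|lborel. of_real (Im (D t)) * iexp (u * t)) = (CLINT t|lborel. (1/(2*\<i>)) * (D t * iexp (u * t) - cnj (D t) * iexp (u * t)))"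
      by simp
    also have "\<dots> = (1/(2*\<i>)) * (CLINT t|lborel. D t * iexp (u * t) - cnj (D t) * iexp (u * t))"
      by (rule integral_mult_right_zero)
    also have "\<dots> = 0" using z z' i i' by simp
    finally show "(CLINT t|lborel. of_real (Im (D t)) * iexp (u * t)) = 0" .
  qed (use D in auto)
  show ?thesis using re im by eventually_elim (simp add: complex_eq_iff)
qed

lemma ennreal_norm_integral_le:
  fixes f :: "'a \<Rightarrow> complex"
  shows "ennreal (norm (\<integral>x. f x \<partial>M)) \<le> (\<integral>\<^sup>+x. ennreal (norm (f x)) \<partial>M)"
  by (cases "integrable M f") (auto intro: integral_norm_bound_ennreal simp: not_integrable_integral_eq)

text \<open>The factor \<open>gs e\<close> makes Fubini available and replaces the oscillating
  kernel by the Gaussian \<open>h\<close> of total mass 2 pi. Schur's test, with |k u| |k v| at most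
  (|k u|^2 + |k v|^2) / 2, bounds the smoothed integral uniformly in \<open>e\<close>; Fatou's lemma
  removes the smoothing.\<close>

lemma Plancherel_inequality:
  fixes k :: "real \<Rightarrow> complex"
  assumes k: "integrable lborel k" and k2: "integrable lborel (\<lambda>u. (norm (k u))\<^sup>2)"
  shows "(\<integral>\<^sup>+t. ennreal ((norm (CLINT u|lborel. k u * iexp (t * u)))\<^sup>2) \<partial>lborel)
     \<le> ennreal (2 * pi * (\<integral>u. (norm (k u))\<^sup>2 \<partial>lborel))"
proof -
  define K where "K t = (CLINT u|lborel. k u * iexp (t * u))" for t
  define B where "B = (\<integral>u. norm (k u) \<partial>lborel)"
  have [measurable]: "k \<in> borel_measurable borel" using k by auto
  have [measurable]: "K \<in> borel_measurable borel" unfolding K_def by measurable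
  have KB: "norm (K t) \<le> B" for t
  proof -
    have "norm (K t) \<le> (\<integral>u. norm (k u * iexp (t * u)) \<partial>lborel)" unfolding K_def by (rule integral_norm_bound)
    then show ?thesis by (simp add: norm_mult B_def)
  qed
  define Q where "Q = (\<integral>u. (norm (k u))\<^sup>2 \<partial>lborel)"
  have Q: "(\<integral>\<^sup>+u. ennreal ((norm (k u))\<^sup>2) \<partial>lborel) = ennreal Q"
    unfolding Q_def by (rule nn_integral_eq_integral[OF k2]) simp
  have Q0: "Q \<ge> 0" by (simp add: Q_def)
  define gs where "gs e t = exp (- (e * t)\<^sup>2 / 2)" for e t :: real
  have bound: "(\<integral>t. gs e t * (norm (K t))\<^sup>2 \<partial>lborel) \<le> 2 * pi * Q"
    and int: "integrable lborel (\<lambda>t. gs e t * (norm (K t))\<^sup>2)" if e: "e > 0" for e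
  proof -
    have gi: "integrable lborel (gs e)" unfolding gs_def by (rule gaussian_Fourier[OF e])
    have [measurable]: "gs e \<in> borel_measurable borel" using gi by auto
    have gK: "integrable lborel (\<lambda>t. of_real (gs e t) * cnj (K t))"
    proof (rule Bochner_Integration.integrable_bound)
      show "integrable lborel (\<lambda>t. B * gs e t)" using gi by simp
      show "AE t in lborel. norm (of_real (gs e t) * cnj (K t)) \<le> norm (B * gs e t)"
        using KB by (auto simp: norm_mult abs_mult gs_def intro!: mult_right_mono order_trans[OF KB abs_ge_self] simp: mult.commute)
    qed measurable
    have gKK: "integrable lborel (\<lambda>t. gs e t * (norm (K t))\<^sup>2)"
    proof (rule Bochner_Integration.integrable_bound)
      show "integrable lborel (\<lambda>t. B\<^sup>2 * gs e t)" using gi by simp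
      have "(norm (K t))\<^sup>2 \<le> B\<^sup>2" for t using KB by (intro power_mono) auto
      then show "AE t in lborel. norm (gs e t * (norm (K t))\<^sup>2) \<le> norm (B\<^sup>2 * gs e t)"
        by (auto simp: abs_mult gs_def mult.commute intro!: mult_left_mono)
    qed measurable
    then show "integrable lborel (\<lambda>t. gs e t * (norm (K t))\<^sup>2)" .
    define h where "h v = sqrt (2 * pi) / e * exp (- (v / e)\<^sup>2 / 2)" for v
    have hn: "h v \<ge> 0" for v using e by (simp add: h_def)
    have hs: "h (u - v) = h (v - u)" for u v by (simp add: h_def power2_commute power_divide)
    \<comment> \<open>The kernel is 2 pi times the normal density with mean u and standard deviation
      \<open>e\<close>.\<close>
    have hint: "(\<integral>\<^sup>+v. ennreal (h (v - u)) \<partial>lborel) = ennreal (2 * pi)" for u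
    proof -
      have "h (v - u) = 2 * pi * normal_density u e v" for v
        using e by (simp add: h_def normal_density_def real_sqrt_mult power_divide field_simps)
      then have "(\<integral>\<^sup>+v. ennreal (h (v - u)) \<partial>lborel) = ennreal (2 * pi) * (\<integral>\<^sup>+v. ennreal (normal_density u e v) \<partial>lborel)"
        by (subst nn_integral_cmult[symmetric]) (auto simp: ennreal_mult normal_density_nonneg)
      also have "(\<integral>\<^sup>+v. ennreal (normal_density u e v) \<partial>lborel) = 1"
        using e by (subst nn_integral_eq_integral) (auto simp: integral_normal_density normal_density_nonneg)
      finally show ?thesis by simp
    qed
    have J: "(CLINT t|lborel. (of_real (gs e t) * cnj (K t)) * iexp (t * u)) = (CLINT v|lborel. cnj (k v) * of_real (h (u - v)))" for u
    proof -
      have cK: "cnj (K t) = (CLINT v|lborel. cnj (k v) * iexp (- (t * v)))" for t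
      proof -
        have "cnj (K t) = (CLINT v|lborel. cnj (k v * iexp (t * v)))" unfolding K_def by (rule Bochner_Integration.integral_cnj[symmetric])
        then show ?thesis by (simp add: exp_cnj)
      qed
      have "(CLINT t|lborel. (of_real (gs e t) * cnj (K t)) * iexp (t * u))
         = (CLINT t|lborel. of_real (gs e t) * (CLINT v|lborel. cnj (k v) * iexp (t * (u - v))))"
      proof (rule Bochner_Integration.integral_cong[OF refl])
        fix t
        have "(of_real (gs e t) * cnj (K t)) * iexp (t * u) = of_real (gs e t) * (CLINT v|lborel. cnj (k v) * iexp (- (t * v)) * iexp (t * u))"
          unfolding cK by simp
        also have "(\<lambda>v. cnj (k v) * iexp (- (t * v)) * iexp (t * u)) = (\<lambda>v. cnj (k v) * iexp (t * (u - v)))"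
          by (simp add: fun_eq_iff mult.assoc algebra_simps flip: exp_add)
        finally show "(of_real (gs e t) * cnj (K t)) * iexp (t * u) = of_real (gs e t) * (CLINT v|lborel. cnj (k v) * iexp (t * (u - v)))" .
      qed
      also have "\<dots> = (CLINT v|lborel. cnj (k v) * (CLINT t|lborel. of_real (gs e t) * iexp (t * (u - v))))"
      proof (rule Fubini_bounded_kernel[where C = 1])
        show "integrable lborel (\<lambda>t. complex_of_real (gs e t))" using gi by simp
        show "integrable lborel (\<lambda>v. cnj (k v))" using k by simp
      qed (auto intro: sigma_finite_lborel)
      also have "\<dots> = (CLINT v|lborel. cnj (k v) * of_real (h (u - v)))"
        unfolding gs_def h_def by (subst gaussian_Fourier(1)[OF e]) simp
      finally show ?thesis .
    qed
    have "of_real (\<integral>t. gs e t * (norm (K t))\<^sup>2 \<partial>lborel) = (CLINT t|lborel. of_real (gs e t * (norm (K t))\<^sup>2))"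
      by (rule integral_complex_of_real[symmetric])
    also have "\<dots> = (CLINT t|lborel. (of_real (gs e t) * cnj (K t)) * (CLINT u|lborel. k u * iexp (t * u)))"
      unfolding K_def[symmetric] by (intro Bochner_Integration.integral_cong) (simp_all add: complex_norm_square mult_ac flip: of_real_power)
    also have "\<dots> = (CLINT u|lborel. k u * (CLINT t|lborel. (of_real (gs e t) * cnj (K t)) * iexp (t * u)))"
      by (rule Fubini_bounded_kernel[OF _ _ gK k, where C = 1]) (auto intro: sigma_finite_lborel)
    finally have eq: "of_real (\<integral>t. gs e t * (norm (K t))\<^sup>2 \<partial>lborel) = (CLINT u|lborel. k u * (CLINT v|lborel. cnj (k v) * of_real (h (u - v))))"
      by (simp only: J)
    have "ennreal (\<integral>t. gs e t * (norm (K t))\<^sup>2 \<partial>lborel) = ennreal (norm (complex_of_real (\<integral>t. gs e t * (norm (K t))\<^sup>2 \<partial>lborel)))"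
      by (simp add: gs_def)
    also have "\<dots> \<le> (\<integral>\<^sup>+u. ennreal (norm (k u * (CLINT v|lborel. cnj (k v) * of_real (h (u - v))))) \<partial>lborel)"
      unfolding eq by (rule ennreal_norm_integral_le)
    also have "\<dots> \<le> (\<integral>\<^sup>+u. (\<integral>\<^sup>+v. ennreal (((norm (k u))\<^sup>2 / 2 + (norm (k v))\<^sup>2 / 2) * h (u - v)) \<partial>lborel) \<partial>lborel)"
    proof (rule nn_integral_mono)
      fix u
      have "ennreal (norm (k u * (CLINT v|lborel. cnj (k v) * of_real (h (u - v))))) 
         = ennreal (norm (k u)) * ennreal (norm (CLINT v|lborel. cnj (k v) * of_real (h (u - v))))"
        by (simp only: norm_mult ennreal_mult norm_ge_zero)
      also have "\<dots> \<le> ennreal (norm (k u)) * (\<integral>\<^sup>+v. ennreal (norm (cnj (k v) * of_real (h (u - v)))) \<partial>lborel)"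
        by (intro mult_left_mono ennreal_norm_integral_le) simp
      also have "\<dots> = (\<integral>\<^sup>+v. ennreal (norm (k u) * norm (k v) * h (u - v)) \<partial>lborel)"
      proof -
        have [measurable]: "h \<in> borel_measurable borel" unfolding h_def by measurable
        have "ennreal (norm (k u)) * ennreal (norm (cnj (k v) * of_real (h (u - v)))) = ennreal (norm (k u) * norm (k v) * h (u - v))" for v
          using hn[of "u - v"] by (simp add: norm_mult mult.assoc flip: ennreal_mult)
        moreover have "ennreal (norm (k u)) * (\<integral>\<^sup>+v. ennreal (norm (cnj (k v) * of_real (h (u - v)))) \<partial>lborel)
           = (\<integral>\<^sup>+v. ennreal (norm (k u)) * ennreal (norm (cnj (k v) * of_real (h (u - v)))) \<partial>lborel)"
          by (rule nn_integral_cmult[symmetric]) measurable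
        ultimately show ?thesis by simp
      qed
      also have "\<dots> \<le> (\<integral>\<^sup>+v. ennreal (((norm (k u))\<^sup>2 / 2 + (norm (k v))\<^sup>2 / 2) * h (u - v)) \<partial>lborel)"
      proof (intro nn_integral_mono ennreal_leI mult_right_mono hn)
        fix v
        show "norm (k u) * norm (k v) \<le> (norm (k u))\<^sup>2 / 2 + (norm (k v))\<^sup>2 / 2"
          using sum_squares_bound[of "norm (k u)" "norm (k v)"] by (simp add: field_simps)
      qed
      finally show "ennreal (norm (k u * (CLINT v|lborel. cnj (k v) * of_real (h (u - v)))))
         \<le> (\<integral>\<^sup>+v. ennreal (((norm (k u))\<^sup>2 / 2 + (norm (k v))\<^sup>2 / 2) * h (u - v)) \<partial>lborel)" .
    qed
    also have "\<dots> = (\<integral>\<^sup>+u. (\<integral>\<^sup>+v. ennreal ((norm (k u))\<^sup>2 / 2) * ennreal (h (v - u)) \<partial>lborel) + (\<integral>\<^sup>+v. ennreal ((norm (k v))\<^sup>2 / 2) * ennreal (h (u - v)) \<partial>lborel) \<partial>lborel)"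
    proof (rule nn_integral_cong)
      fix u
      have "ennreal (((norm (k u))\<^sup>2 / 2 + (norm (k v))\<^sup>2 / 2) * h (u - v)) = 
         ennreal ((norm (k u))\<^sup>2 / 2) * ennreal (h (v - u)) + ennreal ((norm (k v))\<^sup>2 / 2) * ennreal (h (u - v))" for v
      proof -
        have "ennreal ((A + B) * h (u - v)) = ennreal A * ennreal (h (v - u)) + ennreal B * ennreal (h (u - v))"
          if "A \<ge> 0" "B \<ge> 0" for A B :: real
          using that hn[of "u - v"] hs[of u v] by (simp add: distrib_right flip: ennreal_plus ennreal_mult)
        then show ?thesis by simp
      qed
      then show "(\<integral>\<^sup>+v. ennreal (((norm (k u))\<^sup>2 / 2 + (norm (k v))\<^sup>2 / 2) * h (u - v)) \<partial>lborel) =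
         (\<integral>\<^sup>+v. ennreal ((norm (k u))\<^sup>2 / 2) * ennreal (h (v - u)) \<partial>lborel) + (\<integral>\<^sup>+v. ennreal ((norm (k v))\<^sup>2 / 2) * ennreal (h (u - v)) \<partial>lborel)"
        unfolding h_def by (simp only:) (subst nn_integral_add, auto)
    qed
    also have "\<dots> = (\<integral>\<^sup>+u. (\<integral>\<^sup>+v. ennreal ((norm (k u))\<^sup>2 / 2) * ennreal (h (v - u)) \<partial>lborel) \<partial>lborel)
        + (\<integral>\<^sup>+u. (\<integral>\<^sup>+v. ennreal ((norm (k v))\<^sup>2 / 2) * ennreal (h (u - v)) \<partial>lborel) \<partial>lborel)"
      unfolding h_def by (rule nn_integral_add) measurable
    also have "(\<integral>\<^sup>+u. (\<integral>\<^sup>+v. ennreal ((norm (k v))\<^sup>2 / 2) * ennreal (h (u - v)) \<partial>lborel) \<partial>lborel)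
       = (\<integral>\<^sup>+v. (\<integral>\<^sup>+u. ennreal ((norm (k v))\<^sup>2 / 2) * ennreal (h (u - v)) \<partial>lborel) \<partial>lborel)"
      unfolding h_def by (rule lborel_pair.Fubini') measurable
    also have "(\<integral>\<^sup>+u. (\<integral>\<^sup>+v. ennreal ((norm (k u))\<^sup>2 / 2) * ennreal (h (v - u)) \<partial>lborel) \<partial>lborel) = ennreal (pi * Q)"
    proof -
      have "(\<integral>\<^sup>+v. ennreal ((norm (k u))\<^sup>2 / 2) * ennreal (h (v - u)) \<partial>lborel) = ennreal ((norm (k u))\<^sup>2 / 2) * ennreal (2 * pi)" for u
        by (subst nn_integral_cmult) (auto simp: hint, auto simp: h_def)
      also have "ennreal ((norm (k u))\<^sup>2 / 2) * ennreal (2 * pi) = ennreal pi * ennreal ((norm (k u))\<^sup>2)" for u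
        by (simp add: mult.commute flip: ennreal_mult)
      finally have "(\<integral>\<^sup>+u. (\<integral>\<^sup>+v. ennreal ((norm (k u))\<^sup>2 / 2) * ennreal (h (v - u)) \<partial>lborel) \<partial>lborel) = ennreal pi * ennreal Q"
        unfolding Q[symmetric] by (simp add: nn_integral_cmult)
      then show ?thesis using Q0 by (simp add: ennreal_mult)
    qed
    finally have "ennreal (\<integral>t. gs e t * (norm (K t))\<^sup>2 \<partial>lborel) \<le> ennreal (pi * Q) + ennreal (pi * Q)" by simp
    also have "\<dots> = ennreal (2 * pi * Q)" using Q0 by (simp flip: ennreal_plus)
    finally show "(\<integral>t. gs e t * (norm (K t))\<^sup>2 \<partial>lborel) \<le> 2 * pi * Q" using Q0 by (subst (asm) ennreal_le_iff) auto
  qed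
  define E where "E n = 1 / real (Suc n)" for n
  have E: "E n > 0" for n by (simp add: E_def)
  have "(\<integral>\<^sup>+t. ennreal ((norm (K t))\<^sup>2) \<partial>lborel) = (\<integral>\<^sup>+t. liminf (\<lambda>n. ennreal (gs (E n) t * (norm (K t))\<^sup>2)) \<partial>lborel)"
  proof (rule nn_integral_cong)
    fix t
    have "E \<longlonglongrightarrow> 0" unfolding E_def by (intro LIMSEQ_Suc lim_1_over_n)
    then have "(\<lambda>n. exp (- (E n * t)\<^sup>2 / 2) * (norm (K t))\<^sup>2) \<longlonglongrightarrow> exp (- (0 * t)\<^sup>2 / 2) * (norm (K t))\<^sup>2"
      by (intro tendsto_intros) auto
    then have "(\<lambda>n. ennreal (gs (E n) t * (norm (K t))\<^sup>2)) \<longlonglongrightarrow> ennreal ((norm (K t))\<^sup>2)"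
      unfolding gs_def by (intro tendsto_ennrealI) simp
    then show "ennreal ((norm (K t))\<^sup>2) = liminf (\<lambda>n. ennreal (gs (E n) t * (norm (K t))\<^sup>2))"
      using lim_imp_Liminf[OF sequentially_bot] by metis
  qed
  also have "\<dots> \<le> liminf (\<lambda>n. \<integral>\<^sup>+t. ennreal (gs (E n) t * (norm (K t))\<^sup>2) \<partial>lborel)"
    unfolding gs_def by (rule nn_integral_liminf) measurable
  also have "\<dots> \<le> liminf (\<lambda>n. ennreal (2 * pi * Q))"
  proof (rule Liminf_mono, rule always_eventually, rule allI)
    fix n
    have "(\<integral>\<^sup>+t. ennreal (gs (E n) t * (norm (K t))\<^sup>2) \<partial>lborel) = ennreal (\<integral>t. gs (E n) t * (norm (K t))\<^sup>2 \<partial>lborel)"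
      by (rule nn_integral_eq_integral[OF int[OF E]]) (auto simp: gs_def)
    also have "\<dots> \<le> ennreal (2 * pi * Q)" by (intro ennreal_leI bound E)
    finally show "(\<integral>\<^sup>+t. ennreal (gs (E n) t * (norm (K t))\<^sup>2) \<partial>lborel) \<le> ennreal (2 * pi * Q)" .
  qed
  also have "liminf (\<lambda>n::nat. ennreal (2 * pi * Q)) = ennreal (2 * pi * Q)" by (rule Liminf_const[OF sequentially_bot])
  finally show ?thesis unfolding K_def Q_def .
qed

section \<open>The theta function\<close>

text \<open>Monotone convergence on both sides reduces the claim to the substitution rule on compact
  intervals. The offset 1 keeps the interval for n = 0 nondegenerate.\<close>

lemma nn_integral_exp_substitution:
  assumes [measurable]: "f \<in> borel_measurable borel"
  shows "(\<integral>\<^sup>+x. f x * indicator {0<..} x \<partial>lborel) = (\<integral>\<^sup>+u. f (exp u) * ennreal (exp u) \<partial>(lborel :: real measure))"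
proof -
  have inc: "incseq (\<lambda>n x. f x * indicator {exp (- real n - 1)..exp (real n + 1)} x)"
  proof (intro incseq_SucI le_funI mult_left_mono)
    fix n and x :: real
    have "{exp (- real n - 1)..exp (real n + 1)} \<subseteq> {exp (- real (Suc n) - 1)..exp (real (Suc n) + 1)}" by simp
    moreover have "A \<subseteq> B \<Longrightarrow> indicator A x \<le> (indicator B x :: ennreal)" for A B :: "real set"
      by (auto split: split_indicator)
    ultimately show "indicator {exp (- real n - 1)..exp (real n + 1)} x \<le> (indicator {exp (- real (Suc n) - 1)..exp (real (Suc n) + 1)} x :: ennreal)"
      by blast
  qed simp
  have "(\<integral>\<^sup>+x. (SUP n::nat. f x * indicator {exp (- real n - 1)..exp (real n + 1)} x) \<partial>lborel)
      = (SUP n::nat. \<integral>\<^sup>+x. f x * indicator {exp (- real n - 1)..exp (real n + 1)} x \<partial>lborel)"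
    by (rule nn_integral_monotone_convergence_SUP[OF inc]) measurable
  also have "\<dots> = (SUP n::nat. \<integral>\<^sup>+u. f (exp u) * ennreal (exp u) * indicator {- real n - 1..real n + 1} u \<partial>lborel)"
    by (intro SUP_cong refl nn_integral_substitution_aux) (auto intro!: derivative_eq_intros continuous_intros)
  also have "\<dots> = (\<integral>\<^sup>+u. (SUP n::nat. f (exp u) * ennreal (exp u) * indicator {- real n - 1..real n + 1} u) \<partial>lborel)"
    by (rule nn_integral_monotone_convergence_SUP[symmetric])
      (auto simp: incseq_def le_fun_def split: split_indicator)
  also have "(\<lambda>u. SUP n::nat. f (exp u) * ennreal (exp u) * indicator {- real n - 1..real n + 1} u) = (\<lambda>u. f (exp u) * ennreal (exp u))"
  proof
    fix u :: real
    obtain n :: nat where n: "\<bar>u\<bar> \<le> real n" using real_arch_simple by blast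
    show "(SUP n::nat. f (exp u) * ennreal (exp u) * indicator {- real n - 1..real n + 1} u) = f (exp u) * ennreal (exp u)"
    proof (rule antisym)
      show "(SUP n::nat. f (exp u) * ennreal (exp u) * indicator {- real n - 1..real n + 1} u) \<le> f (exp u) * ennreal (exp u)"
        by (intro SUP_least) (auto split: split_indicator)
      have "f (exp u) * ennreal (exp u) = f (exp u) * ennreal (exp u) * indicator {- real n - 1..real n + 1} u"
        using n by (auto split: split_indicator)
      also have "\<dots> \<le> (SUP n::nat. f (exp u) * ennreal (exp u) * indicator {- real n - 1..real n + 1} u)"
        by (rule SUP_upper) auto
      finally show "f (exp u) * ennreal (exp u) \<le> (SUP n::nat. f (exp u) * ennreal (exp u) * indicator {- real n - 1..real n + 1} u)" .
    qed
  qed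
  also have "(\<lambda>x. SUP n::nat. f x * indicator {exp (- real n - 1)..exp (real n + 1)} x) = (\<lambda>x. f x * indicator {0<..} x)"
  proof
    fix x :: real
    show "(SUP n::nat. f x * indicator {exp (- real n - 1)..exp (real n + 1)} x) = f x * indicator {0<..} x"
    proof (cases "x > 0")
      case True
      obtain n :: nat where n: "\<bar>ln x\<bar> \<le> real n" using real_arch_simple by blast
      have x: "x \<in> {exp (- real n - 1)..exp (real n + 1)}"
      proof -
        have "exp (- real n - 1) \<le> exp (ln x)" "exp (ln x) \<le> exp (real n + 1)"
          using n by (simp_all only: exp_le_cancel_iff)
        then show ?thesis using True by simp
      qed
      show ?thesis
      proof (rule antisym)
        show "(SUP n::nat. f x * indicator {exp (- real n - 1)..exp (real n + 1)} x) \<le> f x * indicator {0<..} x"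
          using True by (intro SUP_least) (auto split: split_indicator)
        have "f x * indicator {0<..} x = f x * indicator {exp (- real n - 1)..exp (real n + 1)} x"
          using x True by auto
        also have "\<dots> \<le> (SUP n::nat. f x * indicator {exp (- real n - 1)..exp (real n + 1)} x)"
          by (rule SUP_upper) auto
        finally show "f x * indicator {0<..} x \<le> (SUP n::nat. f x * indicator {exp (- real n - 1)..exp (real n + 1)} x)" .
      qed
    next
      case False
      then have "x \<notin> {exp (- real n - 1)..exp (real n + 1)}" for n :: nat
      proof -
        have "x < exp (- real n - 1)" using exp_gt_zero[of "- real n - 1"] False by linarith
        then show ?thesis by simp
      qed
      then show ?thesis using False by simp
    qed
  qed
  finally show ?thesis .
qed

text \<open>As an identity of measures, the substitution x = exp u transfers integrability and
  values of complex integrands at once.\<close>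

lemma density_positive_eq_distr_exp:
  "density lborel (\<lambda>x. indicator {0<..} x) = distr (density lborel (\<lambda>u. ennreal (exp u))) (borel :: real measure) exp"
proof (rule measure_eqI)
  fix A assume "A \<in> sets (density lborel (\<lambda>x::real. indicator {0<..} x :: ennreal))"
  then have [measurable]: "A \<in> sets borel" by simp
  have [measurable]: "exp -` A \<in> sets borel" by (rule measurable_sets_borel[of exp borel A]) measurable
  have "emeasure (density lborel (\<lambda>x. indicator {0<..} x)) A = (\<integral>\<^sup>+x. indicator A x * indicator {0<..} x \<partial>lborel)"
    by (subst emeasure_density) (auto simp: mult.commute)
  also have "\<dots> = (\<integral>\<^sup>+u. indicator A (exp u) * ennreal (exp u) \<partial>(lborel :: real measure))"
    by (rule nn_integral_exp_substitution) measurable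
  also have "\<dots> = emeasure (distr (density lborel (\<lambda>u. ennreal (exp u))) borel exp) A"
    by (subst emeasure_distr, measurable, simp)
      (subst emeasure_density, auto intro!: nn_integral_cong simp: mult.commute split: split_indicator)
  finally show "emeasure (density lborel (\<lambda>x. indicator {0<..} x)) A = emeasure (distr (density lborel (\<lambda>u. ennreal (exp u))) borel exp) A" .
qed simp

lemma set_integral_exp_substitution:
  fixes f :: "real \<Rightarrow> complex"
  assumes [measurable]: "f \<in> borel_measurable borel"
  shows "set_integrable lborel {0<..} f \<longleftrightarrow> integrable lborel (\<lambda>u. of_real (exp u) * f (exp u))" (is ?A)
    and "(LINT x:{0<..}|lborel. f x) = (LINT u|lborel. of_real (exp u) * f (exp u))" (is ?B)
proof -
  have ind: "(indicator {0<..} x :: ennreal) = ennreal (indicator {0<..} (x::real))" for x by (simp split: split_indicator)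
  have "set_integrable lborel {0<..} f \<longleftrightarrow> integrable (density lborel (\<lambda>x. ennreal (indicator {0<..} x))) f"
    unfolding set_integrable_def by (subst integrable_density) auto
  also have "\<dots> \<longleftrightarrow> integrable (density lborel (\<lambda>u. ennreal (exp u))) (\<lambda>u. f (exp u))"
    unfolding ind[symmetric] density_positive_eq_distr_exp by (subst integrable_distr_eq) auto
  also have "\<dots> \<longleftrightarrow> integrable lborel (\<lambda>u. exp u *\<^sub>R f (exp u))"
    by (subst integrable_density) auto
  finally show ?A by (simp add: scaleR_conv_of_real)
  have "(LINT x:{0<..}|lborel. f x) = (LINT x|density lborel (\<lambda>x. ennreal (indicator {0<..} x)). f x)"
    unfolding set_lebesgue_integral_def by (subst integral_density) auto
  also have "\<dots> = (LINT u|density lborel (\<lambda>u. ennreal (exp u)). f (exp u))"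
    unfolding ind[symmetric] density_positive_eq_distr_exp by (subst integral_distr) auto
  also have "\<dots> = (LINT u|lborel. exp u *\<^sub>R f (exp u))"
    by (subst integral_density) auto
  finally show ?B by (simp add: scaleR_conv_of_real)
qed

text \<open>Euler's integral in the variable t = l exp u: the exponential substitution gives the
  case l = 1, and the translation by ln l contributes the power of l.\<close>

lemma Gamma_integral_log:
  assumes z: "Re z > 0" and l: "l > 0"
  shows "integrable lborel (\<lambda>u. exp (of_real u * z - of_real (l * exp u)))"
    and "(LINT u|lborel. exp (of_real u * z - of_real (l * exp u))) = of_real l powr (- z) * Gamma z"
proof -
  let ?f = "\<lambda>t. complex_of_real t powr (z - 1) / of_real (exp t)"
  have [measurable]: "?f \<in> borel_measurable borel" by measurable
  have ai: "?f absolutely_integrable_on {0<..}" by (rule absolutely_integrable_Gamma_integral'[OF z])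
  then have si: "set_integrable lborel {0<..} ?f"
    unfolding set_integrable_def by (subst (asm) integrable_completion) auto
  have G: "(LINT x:{0<..}|lborel. ?f x) = Gamma z"
    unfolding set_borel_integral_eq_integral[OF si] using Gamma_integral_complex'[OF z] by (rule integral_unique)
  have f: "of_real (exp u) * ?f (exp u) = exp (of_real u * z - of_real (exp u))" for u :: real
    by (simp add: powr_def exp_diff[symmetric] exp_add[symmetric] Ln_of_real[symmetric] algebra_simps exp_of_real[symmetric] del: exp_of_real)
  have i1: "integrable lborel (\<lambda>u. exp (of_real u * z - of_real (exp u)))"
    using si unfolding set_integral_exp_substitution(1)[OF \<open>?f \<in> borel_measurable borel\<close>] f .
  have G1: "(LINT u|lborel. exp (of_real u * z - of_real (exp u))) = Gamma z"
    using G unfolding set_integral_exp_substitution(2)[OF \<open>?f \<in> borel_measurable borel\<close>] f .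
  have tr: "exp (of_real (ln l + 1 * u) * z - of_real (exp (ln l + 1 * u))) = of_real l powr z * exp (of_real u * z - of_real (l * exp u))" for u
    using l by (simp add: exp_add powr_def Ln_of_real exp_diff algebra_simps)
  have "integrable lborel (\<lambda>u. exp (of_real (ln l + 1 * u) * z - of_real (exp (ln l + 1 * u))))"
    by (rule lborel_integrable_real_affine[OF i1]) auto
  then have "integrable lborel (\<lambda>u. of_real l powr (- z) * exp (of_real (ln l + 1 * u) * z - of_real (exp (ln l + 1 * u))))"
    by (rule integrable_mult_right)
  moreover have "integrable lborel (\<lambda>u. exp (of_real u * z - of_real (l * exp u)))"
    if "integrable lborel (\<lambda>u. of_real l powr (- z) * exp (of_real (ln l + 1 * u) * z - of_real (exp (ln l + 1 * u))))"
  proof -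
    have "of_real l powr (- z) * (of_real l powr z * w) = w" for w using l by (simp add: powr_minus field_simps)
    with that show ?thesis by (simp only: tr)
  qed
  ultimately show "integrable lborel (\<lambda>u. exp (of_real u * z - of_real (l * exp u)))" by blast
  have "Gamma z = (LINT u|lborel. exp (of_real (ln l + 1 * u) * z - of_real (exp (ln l + 1 * u))))"
    unfolding G1[symmetric] by (subst lborel_integral_real_affine[where c = 1 and t = "ln l"]) auto
  also have "\<dots> = of_real l powr z * (LINT u|lborel. exp (of_real u * z - of_real (l * exp u)))"
    unfolding tr by simp
  finally show "(LINT u|lborel. exp (of_real u * z - of_real (l * exp u))) = of_real l powr (- z) * Gamma z"
    using l by (simp add: powr_minus field_simps)
qed

section \<open>Fourier series and Poisson summation for the Gaussian\<close>

text \<open>The interval of length 1 is centred at 0; \<open>h\<close> need not be periodic, since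
  the series is evaluated only at that centre.\<close>

definition Fourier_coeff :: "(complex \<Rightarrow> complex) \<Rightarrow> int \<Rightarrow> complex" where
  "Fourier_coeff h k = (LINT x:{-(1/2)..1/2}|lborel. h (of_real x) * exp (- (2 * of_real pi * \<i> * of_int k * of_real x)))"

text \<open>One integration by parts: the boundary terms and the integral of the derivative all
  carry a factor of modulus 1 / (2 pi |k|).\<close>

lemma Riemann_Lebesgue_holomorphic:
  assumes q: "q holomorphic_on ball 0 1"
  shows "\<exists>C. \<forall>k. k \<noteq> 0 \<longrightarrow> norm (Fourier_coeff q k) \<le> C / \<bar>real_of_int k\<bar>"
proof -
  let ?I = "{-(1/2)..1/2} :: real set"
  have I: "of_real x \<in> ball (0::complex) 1" if "x \<in> ?I" for x using that by (auto simp: norm_of_real)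
  have I': "complex_of_real ` ?I \<subseteq> ball 0 1" using I by blast
  have dq: "deriv q holomorphic_on ball 0 1" using q by (intro holomorphic_deriv) auto
  have cq: "continuous_on ?I (\<lambda>x. q (of_real x))" "continuous_on ?I (\<lambda>x. deriv q (of_real x))"
    using I' by (auto intro!: continuous_on_compose2[OF holomorphic_on_imp_continuous_on[OF q]] continuous_on_compose2[OF holomorphic_on_imp_continuous_on[OF dq]] continuous_intros)
  obtain B1 where B1: "\<And>x. x \<in> ?I \<Longrightarrow> norm (q (of_real x)) \<le> B1"
    using compact_continuous_image[OF cq(1)] compact_imp_bounded bounded_iff[of "(\<lambda>x. q (of_real x)) ` ?I"] by fastforce
  obtain B2 where B2: "\<And>x. x \<in> ?I \<Longrightarrow> norm (deriv q (of_real x)) \<le> B2"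
    using compact_continuous_image[OF cq(2)] compact_imp_bounded bounded_iff[of "(\<lambda>x. deriv q (of_real x)) ` ?I"] by fastforce
  have "norm (Fourier_coeff q k) \<le> (2 * B1 + B2) / \<bar>real_of_int k\<bar>" if k: "k \<noteq> 0" for k
  proof -
    define c where "c = - (2 * of_real pi * \<i> * of_int k)"
    have c0: "c \<noteq> 0" using k by (simp add: c_def)
    have nc: "norm c \<ge> \<bar>real_of_int k\<bar>"
    proof -
      have "norm c = 2 * pi * \<bar>real_of_int k\<bar>" by (simp add: c_def norm_mult)
      moreover have "2 * pi \<ge> 1" using pi_gt3 by simp
      ultimately show ?thesis using mult_right_mono[of 1 "2 * pi" "\<bar>real_of_int k\<bar>"] by simp
    qed
    have ne: "norm (exp (c * of_real x)) = 1" for x :: real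
      by (simp add: c_def)
    let ?F = "\<lambda>x::real. q (of_real x) * exp (c * of_real x) / c"
    let ?f = "\<lambda>x::real. deriv q (of_real x) * exp (c * of_real x) / c + q (of_real x) * exp (c * of_real x)"
    have der: "(?F has_vector_derivative ?f x) (at x within ?I)" if "x \<in> ?I" for x
    proof -
      have "((\<lambda>z. q z * exp (c * z) / c) has_field_derivative (deriv q (of_real x) * exp (c * of_real x) / c + q (of_real x) * exp (c * of_real x))) (at (of_real x))"
        using c0 by (auto intro!: derivative_eq_intros holomorphic_derivI[OF q _ I[OF that]] simp: field_simps)
      then show ?thesis by (rule has_vector_derivative_real_field)
    qed
    have ce: "continuous_on ?I (\<lambda>x. exp (c * of_real x))" by (intro continuous_intros)
    have "(LINT x:?I|lborel. ?f x) = ?F (1/2) - ?F (-(1/2))"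
      unfolding set_lebesgue_integral_def
      by (rule integral_FTC_atLeastAtMost) (use der cq ce c0 in \<open>auto intro!: continuous_intros\<close>)
    moreover have "(LINT x:?I|lborel. ?f x) = (LINT x:?I|lborel. deriv q (of_real x) * exp (c * of_real x) / c) + (LINT x:?I|lborel. q (of_real x) * exp (c * of_real x))"
      by (rule set_integral_add) (use cq ce c0 in \<open>auto intro!: borel_integrable_atLeastAtMost' continuous_intros\<close>)
    moreover have "Fourier_coeff q k = (LINT x:?I|lborel. q (of_real x) * exp (c * of_real x))"
      by (simp add: Fourier_coeff_def c_def)
    ultimately have eq: "Fourier_coeff q k = ?F (1/2) - ?F (-(1/2)) - (LINT x:?I|lborel. deriv q (of_real x) * exp (c * of_real x) / c)"
      by (simp add: algebra_simps)
    have nF: "norm (?F x) \<le> B1 / \<bar>real_of_int k\<bar>" if "x \<in> ?I" for x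
    proof -
      have "norm (?F x) = norm (q (of_real x)) / norm c" by (simp only: norm_mult norm_divide ne mult_1_right)
      also have "\<dots> \<le> B1 / \<bar>real_of_int k\<bar>" using B1[OF that] nc k order_trans[OF norm_ge_zero B1[OF that]] by (intro frac_le) auto
      finally show ?thesis .
    qed
    have "norm (LINT x:?I|lborel. deriv q (of_real x) * exp (c * of_real x) / c) \<le> (LINT x:?I|lborel. norm (deriv q (of_real x) * exp (c * of_real x) / c))"
      by (rule set_integral_norm_bound) (use cq ce c0 in \<open>auto intro!: borel_integrable_atLeastAtMost' continuous_intros\<close>)
    also have "\<dots> \<le> (LINT x:?I|lborel. B2 / \<bar>real_of_int k\<bar>)"
    proof (rule set_integral_mono)
      fix x :: real assume x: "x \<in> ?I"
      have "norm (deriv q (of_real x) * exp (c * of_real x) / c) = norm (deriv q (of_real x)) / norm c" by (simp only: norm_mult norm_divide ne mult_1_right)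
      also have "\<dots> \<le> B2 / \<bar>real_of_int k\<bar>" using B2[OF x] nc k order_trans[OF norm_ge_zero B2[OF x]] by (intro frac_le) auto
      finally show "norm (deriv q (of_real x) * exp (c * of_real x) / c) \<le> B2 / \<bar>real_of_int k\<bar>" .
    qed (use cq ce c0 in \<open>auto intro!: borel_integrable_atLeastAtMost' continuous_intros\<close>)
    also have "\<dots> = B2 / \<bar>real_of_int k\<bar>" by (simp add: set_lebesgue_integral_def)
    finally have "norm (Fourier_coeff q k) \<le> B1 / \<bar>real_of_int k\<bar> + B1 / \<bar>real_of_int k\<bar> + B2 / \<bar>real_of_int k\<bar>"
      unfolding eq using nF[of "1/2"] nF[of "-(1/2)"]
      by (intro norm_triangle_le_diff add_mono) (auto intro: norm_triangle_le_diff)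
    then show ?thesis by (simp add: add_divide_distrib)
  qed
  then show ?thesis by blast
qed

lemma Fourier_coeff_const: "Fourier_coeff (\<lambda>_. a) k = (if k = 0 then a else 0)"
proof (cases "k = 0")
  case True
  then show ?thesis by (simp add: Fourier_coeff_def set_lebesgue_integral_def)
next
  case False
  define c where "c = - (2 * of_real pi * \<i> * of_int k)"
  have c0: "c \<noteq> 0" using False by (simp add: c_def)
  let ?I = "{-(1/2)..1/2} :: real set"
  have "Fourier_coeff (\<lambda>_. a) k = (LINT x:?I|lborel. a * exp (c * of_real x))"
    by (simp add: Fourier_coeff_def c_def)
  also have "\<dots> = a * exp (c * of_real (1/2)) / c - a * exp (c * of_real (-(1/2))) / c"
    unfolding set_lebesgue_integral_def
  proof (rule integral_FTC_atLeastAtMost)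
    fix x :: real
    have "((\<lambda>z. a * exp (c * z) / c) has_field_derivative (a * exp (c * of_real x))) (at (of_real x))"
      using c0 by (auto intro!: derivative_eq_intros)
    then show "((\<lambda>x. a * exp (c * of_real x) / c) has_vector_derivative a * exp (c * of_real x)) (at x within ?I)"
      by (rule has_vector_derivative_real_field)
  qed (auto intro!: continuous_intros)
  also have "\<dots> = a * exp (c * of_real (-(1/2))) / c * (exp c - 1)"
    by (simp add: right_diff_distrib flip: exp_add)
  also have "exp c = 1" by (auto simp: exp_eq_1 c_def intro!: exI[of _ "- k"])
  finally show ?thesis using False by simp
qed

text \<open>
  Chernoff's argument: dividing \<open>h - h 0\<close> by \<open>exp (2 * pi * \<i> * z) - 1\<close> turns the symmetric partial sums into
  a telescoping sum.
\<close>

lemma Fourier_series_at_0: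
  assumes h: "h holomorphic_on ball 0 1"
  shows "(\<lambda>N. Fourier_coeff h 0 + (\<Sum>k<N. Fourier_coeff h (int (Suc k)) + Fourier_coeff h (- int (Suc k)))) \<longlonglongrightarrow> h 0"
proof -
  define H where "H z = (if z = 0 then deriv h 0 else (h z - h 0) / (z - 0))" for z
  define E where "E z = (if z = 0 then deriv (\<lambda>z. exp (2 * of_real pi * \<i> * z)) 0 else (exp (2 * of_real pi * \<i> * z) - exp (2 * of_real pi * \<i> * 0)) / (z - 0))" for z
  have H: "H holomorphic_on ball 0 1" unfolding H_def by (rule pole_lemma_open[OF h]) auto
  have E: "E holomorphic_on ball 0 1" unfolding E_def by (rule pole_lemma_open) (auto intro!: holomorphic_intros)
  have "deriv (\<lambda>z. exp (2 * of_real pi * \<i> * z)) 0 = 2 * of_real pi * \<i>"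
    by (rule DERIV_imp_deriv) (auto intro!: derivative_eq_intros)
  \<comment> \<open>In the unit disc exp (2 pi i z) = 1 only at z = 0, where the divided difference
    takes the value 2 pi i; so \<open>q\<close> below has no poles.\<close>
  then have E0: "E z \<noteq> 0" if "z \<in> ball 0 1" for z
  proof (cases "z = 0")
    case False
    have "exp (2 * of_real pi * \<i> * z) \<noteq> 1"
    proof
      assume "exp (2 * of_real pi * \<i> * z) = 1"
      then obtain n :: int where n: "Re (2 * of_real pi * \<i> * z) = 0" "Im (2 * of_real pi * \<i> * z) = of_int (2 * n) * pi"
        by (auto simp: exp_eq_1)
      then have "Im z = 0" "Re z = of_int n" by auto
      moreover have "\<bar>Re z\<bar> < 1" using that abs_Re_le_cmod[of z] by simp
      ultimately have "n = 0" by (simp flip: of_int_abs)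
      then show False using False \<open>Im z = 0\<close> \<open>Re z = of_int n\<close> by (simp add: complex_eq_iff)
    qed
    then show ?thesis using False by (simp add: E_def)
  qed (simp add: E_def)
  define q where "q z = H z / E z" for z
  have q: "q holomorphic_on ball 0 1" unfolding q_def using H E E0 by (intro holomorphic_intros) auto
  have hq: "h z = h 0 + q z * (exp (2 * of_real pi * \<i> * z) - 1)" if "z \<in> ball 0 1" for z
  proof (cases "z = 0")
    case False
    have "E z * z = exp (2 * of_real pi * \<i> * z) - 1" "H z * z = h z - h 0"
      using False by (auto simp: E_def H_def)
    moreover have "q z * E z = H z" using E0[OF that] by (simp add: q_def)
    ultimately show ?thesis by (metis add.commute diff_add_cancel mult.assoc)
  qed simp
  have I: "of_real x \<in> ball (0::complex) 1" if "x \<in> {-(1/2)..1/2}" for x :: real using that by (auto simp: norm_of_real)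
  have I': "complex_of_real ` {-(1/2)..1/2} \<subseteq> ball 0 1" using I by blast
  have cq: "continuous_on {-(1/2)..1/2} (\<lambda>x. q (complex_of_real x))"
    using I' by (auto intro!: continuous_on_compose2[OF holomorphic_on_imp_continuous_on[OF q]] continuous_intros)
  have coeff: "Fourier_coeff h k = Fourier_coeff (\<lambda>_. h 0) k + Fourier_coeff q (k - 1) - Fourier_coeff q k" for k
  proof -
    let ?e = "\<lambda>k x. exp (- (2 * of_real pi * \<i> * of_int k * complex_of_real x))"
    let ?I = "{-(1/2)..1/2} :: real set"
    have "Fourier_coeff h k = (LINT x:?I|lborel. h 0 * ?e k x + (q (of_real x) * ?e (k - 1) x - q (of_real x) * ?e k x))"
      unfolding Fourier_coeff_def
    proof (rule set_lebesgue_integral_cong)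
      show "\<forall>x. x \<in> ?I \<longrightarrow> h (of_real x) * ?e k x = h 0 * ?e k x + (q (of_real x) * ?e (k - 1) x - q (of_real x) * ?e k x)"
      proof (intro allI impI)
        fix x assume x: "x \<in> ?I"
        have "?e (k - 1) x = exp (2 * of_real pi * \<i> * of_real x) * ?e k x"
          by (simp add: algebra_simps flip: exp_add)
        then show "h (of_real x) * ?e k x = h 0 * ?e k x + (q (of_real x) * ?e (k - 1) x - q (of_real x) * ?e k x)"
          by (subst hq[OF I[OF x]]) (simp add: algebra_simps)
      qed
    qed auto
    also have "\<dots> = (LINT x:?I|lborel. h 0 * ?e k x) + ((LINT x:?I|lborel. q (of_real x) * ?e (k - 1) x) - (LINT x:?I|lborel. q (of_real x) * ?e k x))"
      using cq by (subst set_integral_add, (auto intro!: borel_integrable_atLeastAtMost' continuous_intros)[2])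
         (subst set_integral_diff, auto intro!: borel_integrable_atLeastAtMost' continuous_intros)
    finally show ?thesis unfolding Fourier_coeff_def by simp
  qed
  \<comment> \<open>The index shift in \<open>coeff\<close> telescopes: only the two outermost
    coefficients of \<open>q\<close> survive, and these tend to 0.\<close>
  have S: "Fourier_coeff h 0 + (\<Sum>k<N. Fourier_coeff h (int (Suc k)) + Fourier_coeff h (- int (Suc k)))
      = h 0 + Fourier_coeff q (- int (Suc N)) - Fourier_coeff q (int N)" for N
  proof (induction N)
    case 0
    then show ?case by (simp add: coeff[of 0] Fourier_coeff_const)
  next
    case (Suc N)
    have h1: "Fourier_coeff h (int (Suc N)) = Fourier_coeff q (int N) - Fourier_coeff q (int (Suc N))"
      using coeff[of "int (Suc N)"] by (simp add: Fourier_coeff_const)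
    have h2: "Fourier_coeff h (- int (Suc N)) = Fourier_coeff q (- int (Suc (Suc N))) - Fourier_coeff q (- int (Suc N))"
      using coeff[of "- int (Suc N)"] by (simp add: Fourier_coeff_const algebra_simps)
    show ?case unfolding sum.lessThan_Suc add.assoc[symmetric] Suc.IH h1 h2 by simp
  qed
  obtain C where C: "\<And>k. k \<noteq> 0 \<Longrightarrow> norm (Fourier_coeff q k) \<le> C / \<bar>real_of_int k\<bar>"
    using Riemann_Lebesgue_holomorphic[OF q] by blast
  have l0: "(\<lambda>N. C / real N) \<longlonglongrightarrow> 0" by (rule lim_const_over_n)
  have "(\<lambda>N. Fourier_coeff q (int N)) \<longlonglongrightarrow> 0"
  proof (rule Lim_null_comparison[OF _ l0])
    show "\<forall>\<^sub>F N in sequentially. norm (Fourier_coeff q (int N)) \<le> C / real N"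
      using eventually_gt_at_top[of 0] by eventually_elim (use C[of "int _"] in auto)
  qed
  moreover have "(\<lambda>N. Fourier_coeff q (- int (Suc N))) \<longlonglongrightarrow> 0"
    by (rule Lim_null_comparison[OF _ LIMSEQ_Suc[OF l0]]) (use C[of "- int (Suc _)"] in \<open>auto intro!: always_eventually simp: add.commute\<close>)
  ultimately have "(\<lambda>N. h 0 + Fourier_coeff q (- int (Suc N)) - Fourier_coeff q (int N)) \<longlonglongrightarrow> h 0 + 0 - 0"
    by (intro tendsto_intros)
  then show ?thesis unfolding S by simp
qed

text \<open>A bound for the translates that is uniform in a complex disc: (Re z + t)^2 is at least
  t^2 / 2 - (Re z)^2, and what remains is bounded and goes into the constant.\<close>

lemma Gaussian_translate_bound:
  assumes a: "a > 0" and z: "norm z < 1"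
  shows "norm (exp (- of_real (pi * a) * (z + of_real t)\<^sup>2) :: complex) \<le> exp (4 * pi * a) * exp (- (pi * a / 2) * t\<^sup>2)"
proof -
  have "(Im z)\<^sup>2 \<le> 1" "(Re z)\<^sup>2 \<le> 1"
    using z abs_Re_le_cmod[of z] abs_Im_le_cmod[of z] by (auto simp: abs_square_le_1)
  have "t\<^sup>2 \<le> 2 * (Re z + t)\<^sup>2 + 2 * (Re z)\<^sup>2"
    using zero_le_power2[of "t + 2 * Re z"] by (simp add: power2_eq_square algebra_simps)
  then have "t\<^sup>2 / 2 - 2 \<le> (Re z + t)\<^sup>2 - (Im z)\<^sup>2"
    using \<open>(Im z)\<^sup>2 \<le> 1\<close> \<open>(Re z)\<^sup>2 \<le> 1\<close> by linarith
  then have "pi * a * (t\<^sup>2 / 2 - 4) \<le> pi * a * ((Re z + t)\<^sup>2 - (Im z)\<^sup>2)"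
    using a by (intro mult_left_mono) auto
  moreover have "Re (- of_real (pi * a) * (z + of_real t)\<^sup>2) = - (pi * a * ((Re z + t)\<^sup>2 - (Im z)\<^sup>2))"
    by (simp add: power2_eq_square algebra_simps)
  ultimately have "Re (- of_real (pi * a) * (z + of_real t)\<^sup>2) \<le> 4 * pi * a + - (pi * a / 2) * t\<^sup>2"
    by (simp add: algebra_simps)
  then show ?thesis unfolding norm_exp_eq_Re exp_add[symmetric] by simp
qed

lemma summable_Gaussian:
  assumes "b > 0"
  shows "summable (\<lambda>n. exp (- b * (real (Suc n))\<^sup>2))"
proof (rule summable_comparison_test')
  show "summable (\<lambda>n. exp (- b) ^ n)" using assms by (intro summable_geometric) simp
  fix n :: nat
  have "real n \<le> (real (Suc n))\<^sup>2" by (simp add: power2_eq_square algebra_simps)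
  then have "- b * (real (Suc n))\<^sup>2 \<le> real n * (- b)" using assms by simp
  then show "norm (exp (- b * (real (Suc n))\<^sup>2)) \<le> exp (- b) ^ n"
    unfolding exp_of_nat_mult[symmetric] by simp
qed

text \<open>The sum over positive integers only, so that 1 + 2 * \<open>theta_tail a\<close> is
  Jacobi's theta function.\<close>

definition theta_tail :: "real \<Rightarrow> real" where
  "theta_tail a = (\<Sum>n. exp (- (pi * a) * (real (Suc n))\<^sup>2))"

text \<open>Poisson summation for the Gaussian. The periodisation \<open>h\<close> is holomorphic in
  the unit disc, its Fourier coefficients unfold to Fourier transforms of \<open>u\<close> over the
  whole line, and the Fourier series at 0 equates the two theta series.\<close>

lemma theta_tail_modular:
  assumes a: "a > 0"
  shows "1 + 2 * theta_tail a = (1 + 2 * theta_tail (1 / a)) / sqrt a"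
proof -
  define u :: "complex \<Rightarrow> complex" where "u z = exp (- of_real (pi * a) * z\<^sup>2)" for z
  define f where "f n z = u (z + of_real (real (Suc n))) + u (z + of_real (- real (Suc n)))" for n z
  define b where "b n = 2 * exp (4 * pi * a) * exp (- (pi * a / 2) * (real (Suc n))\<^sup>2)" for n
  have b: "summable b" unfolding b_def using a by (intro summable_mult summable_Gaussian) auto
  have b0: "b n \<ge> 0" for n by (simp add: b_def)
  have fb: "norm (f n z) \<le> b n" if "norm z < 1" for n z
  proof -
    have "norm (f n z) \<le> norm (u (z + of_real (real (Suc n)))) + norm (u (z + of_real (- real (Suc n))))"
      unfolding f_def by (rule norm_triangle_ineq)
    also have "\<dots> \<le> exp (4 * pi * a) * exp (- (pi * a / 2) * (real (Suc n))\<^sup>2) + exp (4 * pi * a) * exp (- (pi * a / 2) * (- real (Suc n))\<^sup>2)"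
      unfolding u_def by (intro add_mono Gaussian_translate_bound[OF a that])
    finally show ?thesis by (simp only: b_def power2_minus mult_2 distrib_right)
  qed
  have sf: "summable (\<lambda>n. f n z)" if "norm z < 1" for z
    by (rule summable_comparison_test'[OF b]) (use fb[OF that] in auto)
  define h where "h z = u z + (\<Sum>n. f n z)" for z
  have ucont: "continuous_on A u" for A unfolding u_def by (intro continuous_intros)
  have uhol: "u holomorphic_on A" for A unfolding u_def by (intro holomorphic_intros)
  have fhol: "f n holomorphic_on A" for n A unfolding f_def u_def by (intro holomorphic_intros)
  have hhol: "h holomorphic_on ball 0 1"
  proof -
    \<comment> \<open>The series is an integral over the counting measure, so that its holomorphy
      comes from \<open>holomorphic_on_integral\<close>.\<close>
    have "(\<lambda>z. \<integral>n. f n z \<partial>count_space UNIV) holomorphic_on ball 0 1"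
    proof (rule holomorphic_on_integral)
      show "AE n in count_space UNIV. (\<lambda>z. f n z) holomorphic_on ball 0 1" using fhol by auto
      fix w0 :: complex assume "w0 \<in> ball 0 1"
      have "integrable (count_space UNIV) b" using b b0 by (simp add: integrable_count_space_nat_iff)
      moreover have "AE n in count_space UNIV. \<forall>w\<in>ball w0 1 \<inter> ball 0 1. norm (f n w) \<le> b n"
        using fb by auto
      ultimately show "\<exists>r>0. \<exists>b. integrable (count_space UNIV) b \<and> (AE n in count_space UNIV. \<forall>w\<in>ball w0 r \<inter> ball 0 1. norm (f n w) \<le> b n)"
        by (intro exI[of _ 1]) auto
    qed auto
    moreover have "(\<integral>n. f n z \<partial>count_space UNIV) = (\<Sum>n. f n z)" if "z \<in> ball 0 1" for z
      by (rule integral_count_space_nat)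
        (use that fb in \<open>auto simp: integrable_count_space_nat_iff intro: summable_comparison_test'[OF b]\<close>)
    ultimately have "(\<lambda>z. \<Sum>n. f n z) holomorphic_on ball 0 1" by (rule holomorphic_transform)
    then show ?thesis unfolding h_def by (intro holomorphic_intros uhol)
  qed
  define e :: "int \<Rightarrow> real \<Rightarrow> complex" where "e k x = exp (- (2 * of_real pi * \<i> * of_int k * of_real x))" for k x
  have enorm: "norm (e k x) = 1" for k x by (simp add: e_def)
  have econt: "continuous_on A (e k)" for A k unfolding e_def by (intro continuous_intros)
  have eper: "e k (x + of_int m) = e k x" for k x m
  proof -
    have "e k (x + of_int m) = e k x * exp (2 * of_real pi * \<i> * of_int (- (k * m)))"
      unfolding e_def by (simp add: algebra_simps flip: exp_add)
    also have "exp (2 * of_real pi * \<i> * of_int (- (k * m))) = 1"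
      by (subst exp_eq_1) (auto simp: mult_ac intro!: exI[of _ "- (k * m)"])
    finally show ?thesis by simp
  qed
  \<comment> \<open>A Gaussian with parameter \<open>sqrt (2 * pi * a)\<close> at the frequency -2
    pi k, the form evaluated by \<open>gaussian_Fourier\<close>.\<close>
  have rg: "u (of_real x) * e k x = of_real (exp (- (sqrt (2 * pi * a) * x)\<^sup>2 / 2)) * iexp (x * (- (2 * pi * of_int k)))" for x k
  proof -
    have "(sqrt (2 * pi * a) * x)\<^sup>2 / 2 = pi * a * x\<^sup>2" using a by (simp add: power_mult_distrib)
    then show ?thesis unfolding u_def e_def by (simp add: exp_of_real[symmetric] mult_ac flip: exp_add)
  qed
  have sq: "sqrt (2 * pi * a) > 0" using a by simp
  have uint: "integrable lborel (\<lambda>x. u (of_real x) * e k x)" for k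
    unfolding rg
    by (rule Bochner_Integration.integrable_bound[OF gaussian_Fourier(2)[OF sq]]) (auto simp: norm_mult)
  have uval: "(LINT x|lborel. u (of_real x) * e k x) = of_real (exp (- (pi / a) * (of_int k)\<^sup>2) / sqrt a)" for k
  proof -
    have "sqrt (2 * pi) / sqrt (2 * pi * a) = 1 / sqrt a" using a by (simp add: real_sqrt_mult)
    moreover have "- (- (2 * pi * of_int k) / sqrt (2 * pi * a))\<^sup>2 / 2 = - (pi / a) * (of_int k)\<^sup>2"
      using a by (simp add: power_divide power_mult_distrib field_simps power2_eq_square)
    ultimately show ?thesis unfolding rg by (subst gaussian_Fourier(1)[OF sq]) simp
  qed
  let ?I = "{-(1/2)..1/2} :: real set"
  define J where "J n = {-(1/2) - real n..real n + 1/2}" for n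
  have si: "set_integrable lborel {p..r} (\<lambda>x. u (of_real x + of_real t) * e k x)" for p r t k
    by (intro borel_integrable_atLeastAtMost' continuous_intros continuous_on_compose2[OF ucont[of UNIV]] econt) auto
  have shift: "(LINT x:{-(1/2)..1/2}|lborel. u (of_real x + of_real (of_int m)) * e k x) = (LINT x:{of_int m - 1/2..of_int m + 1/2}|lborel. u (of_real x) * e k x)" for m :: int and k
  proof -
    have "(LINT x:{of_int m - 1/2..of_int m + 1/2}|lborel. u (of_real x) * e k x)
       = (LINT x|lborel. indicator {of_int m - 1/2..of_int m + 1/2} (of_int m + 1 * x) *\<^sub>R (u (of_real (of_int m + 1 * x)) * e k (of_int m + 1 * x)))"
      unfolding set_lebesgue_integral_def by (subst lborel_integral_real_affine[where c = 1 and t = "of_int m"]) auto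
    also have "\<dots> = (LINT x:{-(1/2)..1/2}|lborel. u (of_real x + of_real (of_int m)) * e k x)"
      unfolding set_lebesgue_integral_def
      by (intro Bochner_Integration.integral_cong refl arg_cong2[where f = "(*\<^sub>R)"] arg_cong2[where f = "(*)"])
        (auto simp: indicator_def add.commute eper)
    finally show ?thesis by simp
  qed
  \<comment> \<open>Unfolding: the unit interval around 0 and its translates by the integers from -N
    to N tile \<open>J N\<close>.\<close>
  have hN: "(LINT x:?I|lborel. (u (of_real x) + (\<Sum>n<N. f n (of_real x))) * e k x) = (LINT x:J N|lborel. u (of_real x) * e k x)" for N k
  proof (induction N)
    case 0
    then show ?case by (simp add: J_def)
  next
    case (Suc N)
    have i1: "set_integrable lborel ?I (\<lambda>x. (u (of_real x) + (\<Sum>n<N. f n (of_real x))) * e k x)"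
      unfolding f_def
      by (intro borel_integrable_atLeastAtMost' continuous_intros continuous_on_compose2[OF ucont[of UNIV]] econt) auto
    have "(LINT x:?I|lborel. (u (of_real x) + (\<Sum>n<Suc N. f n (of_real x))) * e k x)
       = (LINT x:?I|lborel. (u (of_real x) + (\<Sum>n<N. f n (of_real x))) * e k x + (u (of_real x + of_real (of_int (int (Suc N)))) * e k x + u (of_real x + of_real (of_int (- int (Suc N)))) * e k x))"
      by (intro arg_cong[where f = "set_lebesgue_integral lborel ?I"] ext) (simp add: f_def algebra_simps)
    also have "\<dots> = (LINT x:J N|lborel. u (of_real x) * e k x) + ((LINT x:{of_int (int (Suc N)) - 1/2..of_int (int (Suc N)) + 1/2}|lborel. u (of_real x) * e k x)
        + (LINT x:{of_int (- int (Suc N)) - 1/2..of_int (- int (Suc N)) + 1/2}|lborel. u (of_real x) * e k x))"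
      unfolding Suc.IH[symmetric] shift[symmetric]
      by (subst set_integral_add(2)[OF i1 set_integral_add(1)[OF si si]], subst set_integral_add(2)[OF si si]) (rule refl)
    also have "\<dots> = (LINT x:J (Suc N)|lborel. u (of_real x) * e k x)"
    proof -
      have si0: "set_integrable lborel {p..r} (\<lambda>x. u (of_real x) * e k x)" for p r
        using si[of p r 0] by simp
      have split: "(LINT x:{p..r}|lborel. u (of_real x) * e k x) = (LINT x:{p..q}|lborel. u (of_real x) * e k x) + (LINT x:{q..r}|lborel. u (of_real x) * e k x)"
        if "p \<le> q" "q \<le> r" for p q r
        unfolding set_lebesgue_integral_def
      proof (subst Bochner_Integration.integral_add[symmetric])
        show "integrable lborel (\<lambda>x. indicator {p..q} x *\<^sub>R (u (of_real x) * e k x))" "integrable lborel (\<lambda>x. indicator {q..r} x *\<^sub>R (u (of_real x) * e k x))"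
          using si0 unfolding set_integrable_def by blast+
        have "AE x in lborel. x \<noteq> q" by (rule AE_lborel_singleton)
        then show "(LINT x|lborel. indicator {p..r} x *\<^sub>R (u (of_real x) * e k x)) = (LINT x|lborel. indicator {p..q} x *\<^sub>R (u (of_real x) * e k x) + indicator {q..r} x *\<^sub>R (u (of_real x) * e k x))"
          using that by (intro integral_cong_AE) (auto split: split_indicator simp: u_def e_def)
      qed
      have "(LINT x:J (Suc N)|lborel. u (of_real x) * e k x) = (LINT x:{-(1/2) - real (Suc N)..-(1/2) - real N}|lborel. u (of_real x) * e k x) +
          ((LINT x:J N|lborel. u (of_real x) * e k x) + (LINT x:{real N + 1/2..real (Suc N) + 1/2}|lborel. u (of_real x) * e k x))"
        unfolding J_def by (subst split[of _ "-(1/2) - real N"], simp, simp, subst split[of "-(1/2) - real N" "real N + 1/2"]) auto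
      then show ?thesis by (simp add: algebra_simps)
    qed
    finally show ?case .
  qed
  have coeff: "Fourier_coeff h k = of_real (exp (- (pi / a) * (of_int k)\<^sup>2) / sqrt a)" for k
  proof -
    have "(\<lambda>N. LINT x:?I|lborel. (u (of_real x) + (\<Sum>n<N. f n (of_real x))) * e k x) \<longlonglongrightarrow> (LINT x:?I|lborel. h (of_real x) * e k x)"
      unfolding set_lebesgue_integral_def
    proof (rule integral_dominated_convergence)
      have I: "norm (complex_of_real x) < 1" if "x \<in> ?I" for x using that by (auto simp: norm_of_real)
      have [measurable]: "e k \<in> borel_measurable borel" unfolding e_def by measurable
      have [measurable]: "u \<in> borel_measurable borel" unfolding u_def by measurable
      have [measurable]: "(\<lambda>x. f n (complex_of_real x)) \<in> borel_measurable borel" for n unfolding f_def by measurable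
      show "(\<lambda>x. indicator ?I x *\<^sub>R (h (of_real x) * e k x)) \<in> borel_measurable lborel" unfolding h_def by measurable
      show "(\<lambda>x. indicator ?I x *\<^sub>R ((u (of_real x) + (\<Sum>n<N. f n (of_real x))) * e k x)) \<in> borel_measurable lborel" for N by measurable
      show "integrable lborel (\<lambda>x. indicator ?I x *\<^sub>R (exp (4 * pi * a) + suminf b))"
        by (intro borel_integrable_compact) auto
      show "AE x in lborel. (\<lambda>N. indicator ?I x *\<^sub>R ((u (of_real x) + (\<Sum>n<N. f n (of_real x))) * e k x)) \<longlonglongrightarrow> indicator ?I x *\<^sub>R (h (of_real x) * e k x)"
      proof (rule AE_I2)
        fix x :: real
        show "(\<lambda>N. indicator ?I x *\<^sub>R ((u (of_real x) + (\<Sum>n<N. f n (of_real x))) * e k x)) \<longlonglongrightarrow> indicator ?I x *\<^sub>R (h (of_real x) * e k x)"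
        proof (cases "x \<in> ?I")
          case True
          have "(\<lambda>N. \<Sum>n<N. f n (of_real x)) \<longlonglongrightarrow> (\<Sum>n. f n (of_real x))" by (rule summable_LIMSEQ[OF sf[OF I[OF True]]])
          then show ?thesis unfolding h_def by (intro tendsto_intros)
        qed (auto simp: indicator_def)
      qed
      fix N
      show "AE x in lborel. norm (indicator ?I x *\<^sub>R ((u (of_real x) + (\<Sum>n<N. f n (of_real x))) * e k x)) \<le> indicator ?I x *\<^sub>R (exp (4 * pi * a) + suminf b)"
      proof (rule AE_I2)
        fix x :: real
        show "norm (indicator ?I x *\<^sub>R ((u (of_real x) + (\<Sum>n<N. f n (of_real x))) * e k x)) \<le> indicator ?I x *\<^sub>R (exp (4 * pi * a) + suminf b)"
        proof (cases "x \<in> ?I")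
          case True
          have "norm (\<Sum>n<N. f n (of_real x)) \<le> (\<Sum>n<N. b n)"
            by (rule order_trans[OF norm_sum sum_mono]) (use fb I[OF True] in auto)
          also have "\<dots> \<le> suminf b" by (rule sum_le_suminf[OF b]) (use b0 in auto)
          finally have 1: "norm (\<Sum>n<N. f n (of_real x)) \<le> suminf b" .
          have "norm (u (of_real x)) \<le> exp (4 * pi * a)"
            using Gaussian_translate_bound[OF a I[OF True], of 0] by (simp add: u_def)
          with 1 have "norm (u (of_real x) + (\<Sum>n<N. f n (of_real x))) \<le> exp (4 * pi * a) + suminf b"
            by (intro norm_triangle_le add_mono)
          then show ?thesis using True by (simp add: norm_mult enorm)
        qed (auto simp: indicator_def)
      qed
    qed
    moreover have "(\<lambda>N. LINT x:J N|lborel. u (of_real x) * e k x) \<longlonglongrightarrow> (LINT x|lborel. u (of_real x) * e k x)"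
      unfolding set_lebesgue_integral_def
    proof (rule integral_dominated_convergence)
      show "integrable lborel (\<lambda>x. norm (u (of_real x) * e k x))" using uint by simp
      show "AE x in lborel. (\<lambda>N. indicator (J N) x *\<^sub>R (u (of_real x) * e k x)) \<longlonglongrightarrow> u (of_real x) * e k x"
      proof (rule AE_I2, rule tendsto_eventually)
        fix x :: real
        obtain N0 :: nat where N0: "\<bar>x\<bar> \<le> real N0" using real_arch_simple by blast
        show "\<forall>\<^sub>F N in sequentially. indicator (J N) x *\<^sub>R (u (of_real x) * e k x) = u (of_real x) * e k x"
          using eventually_ge_at_top[of N0]
        proof eventually_elim
          case (elim N)
          then have "x \<in> J N" using N0 by (auto simp: J_def)
          then show ?case by simp
        qed
      qed
    qed (use uint in \<open>auto simp: J_def split: split_indicator\<close>)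
    ultimately have "(LINT x:?I|lborel. h (of_real x) * e k x) = (LINT x|lborel. u (of_real x) * e k x)"
      unfolding hN by (rule LIMSEQ_unique)
    then have "(LINT x:?I|lborel. h (of_real x) * e k x) = of_real (exp (- (pi / a) * (of_int k)\<^sup>2) / sqrt a)"
      unfolding uval .
    then show ?thesis by (simp only: Fourier_coeff_def e_def)
  qed
  have "(\<lambda>N. Fourier_coeff h 0 + (\<Sum>k<N. Fourier_coeff h (int (Suc k)) + Fourier_coeff h (- int (Suc k)))) \<longlonglongrightarrow> h 0"
    by (rule Fourier_series_at_0[OF hhol])
  moreover have "(\<lambda>N. Fourier_coeff h 0 + (\<Sum>k<N. Fourier_coeff h (int (Suc k)) + Fourier_coeff h (- int (Suc k)))) \<longlonglongrightarrow> of_real ((1 + 2 * theta_tail (1 / a)) / sqrt a)"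
  proof -
    have "summable (\<lambda>n. exp (- (pi * (1 / a)) * (real (Suc n))\<^sup>2))" using a by (intro summable_Gaussian) auto
    then have "(\<lambda>N. \<Sum>n<N. exp (- (pi * (1 / a)) * (real (Suc n))\<^sup>2)) \<longlonglongrightarrow> theta_tail (1 / a)"
      unfolding theta_tail_def by (rule summable_LIMSEQ)
    then have "(\<lambda>N. of_real ((1 + 2 * (\<Sum>n<N. exp (- (pi * (1 / a)) * (real (Suc n))\<^sup>2))) / sqrt a)) \<longlonglongrightarrow> complex_of_real ((1 + 2 * theta_tail (1 / a)) / sqrt a)"
      using a by (intro tendsto_intros) auto
    moreover have "Fourier_coeff h 0 + (\<Sum>k<N. Fourier_coeff h (int (Suc k)) + Fourier_coeff h (- int (Suc k)))
        = of_real ((1 + 2 * (\<Sum>n<N. exp (- (pi * (1 / a)) * (real (Suc n))\<^sup>2))) / sqrt a)" for N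
    proof -
      have "Fourier_coeff h (int (Suc n)) + Fourier_coeff h (- int (Suc n)) = of_real (2 * exp (- (pi * (1 / a)) * (real (Suc n))\<^sup>2) / sqrt a)" for n
      proof -
        have "(of_int (- int (Suc n)) :: real)\<^sup>2 = (real (Suc n))\<^sup>2" by (simp only: of_int_minus of_int_of_nat_eq power2_minus)
        moreover have "(of_int (int (Suc n)) :: real) = real (Suc n)" by simp
        ultimately show ?thesis unfolding coeff by (simp only: of_real_add[symmetric]) simp
      qed
      moreover have "Fourier_coeff h 0 = of_real (1 / sqrt a)" by (simp add: coeff)
      ultimately show ?thesis
        by (simp only: flip: of_real_sum of_real_add) (simp add: add_divide_distrib sum_distrib_left sum_divide_distrib)
    qed
    ultimately show ?thesis by simp
  qed
  ultimately have "h 0 = of_real ((1 + 2 * theta_tail (1 / a)) / sqrt a)" by (rule LIMSEQ_unique)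
  moreover have "h 0 = of_real (1 + 2 * theta_tail a)"
  proof -
    have "f n 0 = of_real (2 * exp (- (pi * a) * (real (Suc n))\<^sup>2))" for n
    proof -
      have "u (0 + of_real t) = of_real (exp (- (pi * a) * t\<^sup>2))" for t
        unfolding u_def by (simp add: exp_of_real[symmetric])
      then show ?thesis unfolding f_def by (simp only: power2_minus mult_2 of_real_add)
    qed
    then have "(\<Sum>n. f n 0) = of_real (\<Sum>n. 2 * exp (- (pi * a) * (real (Suc n))\<^sup>2))"
      using summable_mult[OF summable_Gaussian[of "pi * a"], of 2] a by (simp add: suminf_of_real del: of_real_mult)
    also have "(\<Sum>n. 2 * exp (- (pi * a) * (real (Suc n))\<^sup>2)) = 2 * theta_tail a"
      unfolding theta_tail_def using summable_Gaussian[of "pi * a"] a by (intro suminf_mult) auto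
    finally show ?thesis by (simp add: h_def u_def)
  qed
  ultimately show ?thesis by (simp only: of_real_eq_iff)
qed

section \<open>Completed Mellin transforms\<close>

lemma set_integrable_exp_minus: "set_integrable lborel {0..} (\<lambda>u::real. exp (- u))"
proof -
  have "(\<lambda>u::real. exp (- 1 * u)) absolutely_integrable_on {0..}"
    using has_integral_exp_minus_to_infinity[of 1 0]
    by (intro nonnegative_absolutely_integrable_1) (auto simp: has_integral_integrable)
  then show ?thesis unfolding set_integrable_def by (subst (asm) integrable_completion) auto
qed

lemma integral_exp_minus_complex:
  assumes z: "Re z > 0"
  shows "set_integrable lborel {0..} (\<lambda>u. exp (- (of_real u * z)))"
    and "(LINT u:{0..}|lborel. exp (- (of_real u * z))) = 1 / z"
proof -
  define a where "a = Re z"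
  have a: "a > 0" using z by (simp add: a_def)
  have int: "integrable lborel (\<lambda>u. indicator {0..} u *\<^sub>R exp (- (a * u)))"
  proof -
    have "integrable lborel (\<lambda>u::real. indicator {0..} (0 + a * u) *\<^sub>R exp (- (0 + a * u)))"
      using set_integrable_exp_minus a unfolding set_integrable_def by (intro lborel_integrable_real_affine) auto
    moreover have "indicator {0..} (0 + a * u) = (indicator {0..} u :: real)" for u
      using a by (auto simp: indicator_def zero_le_mult_iff)
    ultimately show ?thesis by simp
  qed
  have nrm: "norm (exp (- (of_real u * z))) = exp (- (a * u))" for u by (simp add: a_def mult.commute)
  show i: "set_integrable lborel {0..} (\<lambda>u. exp (- (of_real u * z)))"
    unfolding set_integrable_def
    by (rule Bochner_Integration.integrable_bound[OF int]) (auto simp: a_def mult.commute)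
  have z0: "z \<noteq> 0" using z by auto
  have L1: "(\<lambda>N. LINT u:{0..real N}|lborel. exp (- (of_real u * z))) \<longlonglongrightarrow> (LINT u:{0..}|lborel. exp (- (of_real u * z)))"
    unfolding set_lebesgue_integral_def
  proof (rule integral_dominated_convergence[OF _ _ int])
    show "AE u in lborel. (\<lambda>N. indicator {0..real N} u *\<^sub>R exp (- (of_real u * z))) \<longlonglongrightarrow> indicator {0..} u *\<^sub>R exp (- (of_real u * z))"
    proof (rule AE_I2, rule tendsto_eventually)
      fix u :: real
      obtain N0 :: nat where N0: "u \<le> real N0" using real_arch_simple by blast
      show "\<forall>\<^sub>F N in sequentially. indicator {0..real N} u *\<^sub>R exp (- (of_real u * z)) = indicator {0..} u *\<^sub>R exp (- (of_real u * z))"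
        using eventually_ge_at_top[of N0] by eventually_elim (use N0 in \<open>auto simp: indicator_def\<close>)
    qed
    show "AE u in lborel. norm (indicator {0..real N} u *\<^sub>R exp (- (of_real u * z))) \<le> indicator {0..} u *\<^sub>R exp (- (a * u))" for N
      by (auto simp: indicator_def a_def mult.commute)
  qed auto
  have eqN: "(LINT u:{0..real N}|lborel. exp (- (of_real u * z))) = 1 / z - exp (- (of_real (real N) * z)) / z" for N
  proof -
    have "(LINT u:{0..real N}|lborel. exp (- (of_real u * z))) = - exp (- (of_real (real N) * z)) / z - (- exp (- (of_real 0 * z)) / z)"
      unfolding set_lebesgue_integral_def
    proof (rule integral_FTC_atLeastAtMost)
      fix u :: real
      have "((\<lambda>w. - exp (- (w * z)) / z) has_field_derivative exp (- (of_real u * z))) (at (of_real u))"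
        using z0 by (auto intro!: derivative_eq_intros)
      then show "((\<lambda>u. - exp (- (of_real u * z)) / z) has_vector_derivative exp (- (of_real u * z))) (at u within {0..real N})"
        by (rule has_vector_derivative_real_field)
    qed (auto intro!: continuous_intros)
    then show ?thesis by simp
  qed
  have L2: "(\<lambda>N. 1 / z - exp (- (of_real (real N) * z)) / z) \<longlonglongrightarrow> 1 / z - 0 / z"
  proof (intro tendsto_intros z0)
    have "norm (exp (- z)) < 1" using z by simp
    then have "(\<lambda>N. exp (- z) ^ N) \<longlonglongrightarrow> 0" by (rule LIMSEQ_power_zero)
    then show "(\<lambda>N. exp (- (of_real (real N) * z))) \<longlonglongrightarrow> 0"
      by (simp add: exp_of_nat_mult[symmetric])
  qed
  show "(LINT u:{0..}|lborel. exp (- (of_real u * z))) = 1 / z"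
    using LIMSEQ_unique[OF L1[unfolded eqN] L2] by simp
qed

text \<open>From exp u \<ge> u^2 / 2 by completing the square; the constant is exp (K^2 / (2
  b)).\<close>

lemma exp_neg_exp_le:
  fixes b :: real
  assumes b: "b > 0"
  shows "\<exists>C. \<forall>u\<ge>0. exp (- b * exp u) \<le> C * exp (- K * u)"
proof (intro exI allI impI)
  fix u :: real assume u: "u \<ge> 0"
  have "u\<^sup>2 / 2 \<le> exp u" using exp_lower_Taylor_quadratic[OF u] u by linarith
  then have "b * (u\<^sup>2 / 2) \<le> b * exp u" using b by (intro mult_left_mono) auto
  moreover have "0 \<le> (b / 2) * (u - K / b)\<^sup>2" using b by simp
  moreover have "(b / 2) * (u - K / b)\<^sup>2 = b * (u\<^sup>2 / 2) - K * u + K\<^sup>2 / (2 * b)"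
    using b by (simp add: power2_eq_square field_simps)
  ultimately have "- b * exp u \<le> K\<^sup>2 / (2 * b) + - K * u" by simp
  then show "exp (- b * exp u) \<le> exp (K\<^sup>2 / (2 * b)) * exp (- K * u)" by (simp flip: exp_add)
qed

text \<open>Decay faster than every exponential in the logarithmic variable, which makes
  \<open>Mellin_tail\<close> entire.\<close>

definition rapid :: "(real \<Rightarrow> complex) \<Rightarrow> bool" where
  "rapid p \<longleftrightarrow> p \<in> borel_measurable borel \<and> (\<forall>K. \<exists>C. \<forall>u\<ge>0. norm (p u) \<le> C * exp (- K * u))"

text \<open>The part over x \<ge> 1 of the Mellin integral of p(ln x) x^(s/2 - 1), in the variable u
  = ln x.\<close>

definition Mellin_tail :: "(real \<Rightarrow> complex) \<Rightarrow> complex \<Rightarrow> complex" where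
  "Mellin_tail p s = (LINT u:{0..}|lborel. p u * exp (of_real u * s / 2))"

lemma rapid_bound:
  assumes "rapid p"
  obtains C where "C \<ge> 0" "\<And>u s. u \<ge> 0 \<Longrightarrow> Re s \<le> K \<Longrightarrow> norm (p u * exp (of_real u * s / 2)) \<le> C * exp (- u)"
proof -
  \<comment> \<open>The rate K / 2 + 1 absorbs exp (u Re s / 2) for all Re s \<le> K and leaves the
    integrable factor exp (- u).\<close>
  obtain C where C: "\<And>u. u \<ge> 0 \<Longrightarrow> norm (p u) \<le> C * exp (- (K / 2 + 1) * u)"
    using assms unfolding rapid_def by blast
  have C0: "C \<ge> 0" using order_trans[OF norm_ge_zero C[of 0]] by simp
  have "norm (p u * exp (of_real u * s / 2)) \<le> C * exp (- u)" if "u \<ge> 0" "Re s \<le> K" for u s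
  proof -
    have "norm (p u * exp (of_real u * s / 2)) = norm (p u) * exp (u * Re s / 2)" by (simp add: norm_mult)
    also have "\<dots> \<le> (C * exp (- (K / 2 + 1) * u)) * exp (u * K / 2)"
      using that C0 by (intro mult_mono C) (auto intro!: mult_left_mono divide_right_mono)
    also have "\<dots> = C * exp (- u)" by (simp add: algebra_simps flip: exp_add)
    finally show ?thesis .
  qed
  with C0 that show ?thesis by blast
qed

lemma Mellin_tail_integrable:
  assumes "rapid p"
  shows "set_integrable lborel {0..} (\<lambda>u. p u * exp (of_real u * s / 2))"
proof -
  obtain C where C: "C \<ge> 0" "\<And>u. u \<ge> 0 \<Longrightarrow> norm (p u * exp (of_real u * s / 2)) \<le> C * exp (- u)"
    using rapid_bound[OF assms, of "Re s"] by (metis order_refl)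
  have [measurable]: "p \<in> borel_measurable borel" using assms by (simp add: rapid_def)
  have "integrable lborel (\<lambda>u. C * (indicator {0..} u *\<^sub>R exp (- u)))"
    using set_integrable_exp_minus unfolding set_integrable_def by (intro integrable_mult_right)
  then show ?thesis unfolding set_integrable_def
    by (rule Bochner_Integration.integrable_bound) (use C in \<open>auto simp: indicator_def\<close>)
qed

lemma Mellin_tail_bounded:
  assumes "rapid p"
  shows "\<exists>B. \<forall>s. Re s \<le> K \<longrightarrow> norm (Mellin_tail p s) \<le> B"
proof -
  obtain C where C: "C \<ge> 0" "\<And>u s. u \<ge> 0 \<Longrightarrow> Re s \<le> K \<Longrightarrow> norm (p u * exp (of_real u * s / 2)) \<le> C * exp (- u)"
    using rapid_bound[OF assms, of K] by metis
  have i: "integrable lborel (\<lambda>u. C * (indicator {0..} u *\<^sub>R exp (- u)))"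
    using set_integrable_exp_minus unfolding set_integrable_def by (intro integrable_mult_right)
  have "norm (Mellin_tail p s) \<le> (LINT u|lborel. C * (indicator {0..} u *\<^sub>R exp (- u)))" if "Re s \<le> K" for s
    unfolding Mellin_tail_def set_lebesgue_integral_def
  proof (rule Bochner_Integration.integral_norm_bound_integral)
    show "integrable lborel (\<lambda>u. C * (indicator {0..} u *\<^sub>R exp (- u)))" by (rule i)
    show "integrable lborel (\<lambda>u. indicator {0..} u *\<^sub>R (p u * exp (of_real u * s / 2)))"
      using Mellin_tail_integrable[OF assms] unfolding set_integrable_def .
  qed (use C that in \<open>auto simp: indicator_def\<close>)
  then show ?thesis by blast
qed

lemma Mellin_tail_holomorphic:
  assumes "rapid p"
  shows "Mellin_tail p holomorphic_on A"
proof -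
  have [measurable]: "p \<in> borel_measurable borel" using assms by (simp add: rapid_def)
  have "Mellin_tail p holomorphic_on UNIV"
    unfolding Mellin_tail_def[abs_def] set_lebesgue_integral_def
  proof (rule holomorphic_on_integral)
    show "AE u in lborel. (\<lambda>s. indicator {0..} u *\<^sub>R (p u * exp (of_real u * s / 2))) holomorphic_on UNIV"
      by (auto intro!: holomorphic_intros simp: scaleR_conv_of_real)
    fix w0 :: complex
    obtain C where C: "C \<ge> 0" "\<And>u s. u \<ge> 0 \<Longrightarrow> Re s \<le> Re w0 + 1 \<Longrightarrow> norm (p u * exp (of_real u * s / 2)) \<le> C * exp (- u)"
      using rapid_bound[OF assms, of "Re w0 + 1"] by metis
    have i: "integrable lborel (\<lambda>u. C * (indicator {0..} u *\<^sub>R exp (- u)))"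
      using set_integrable_exp_minus unfolding set_integrable_def by (intro integrable_mult_right)
    have "Re w \<le> Re w0 + 1" if "w \<in> ball w0 1" for w
      using that abs_Re_le_cmod[of "w - w0"] by (auto simp: dist_norm norm_minus_commute)
    then have "AE u in lborel. \<forall>w\<in>ball w0 1 \<inter> UNIV. norm (indicator {0..} u *\<^sub>R (p u * exp (of_real u * w / 2))) \<le> C * (indicator {0..} u *\<^sub>R exp (- u))"
      using C by (auto simp: indicator_def)
    with i show "\<exists>r>0. \<exists>b. integrable lborel b \<and> (AE u in lborel. \<forall>w\<in>ball w0 r \<inter> UNIV. norm (indicator {0..} u *\<^sub>R (p u * exp (of_real u * w / 2))) \<le> b u)"
      by (intro exI[of _ 1] exI[of _ "\<lambda>u. C * (indicator {0..} u *\<^sub>R exp (- u))"]) auto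
  qed (auto)
  then show ?thesis by (rule holomorphic_on_subset) auto
qed

text \<open>Riemann's continuation. Splitting a Mellin integral at u = 0 and folding the negative
  half by a modular relation between \<open>p\<close> and \<open>q\<close> gives the two tails plus
  c / (1 - s) + d / s; the factor s (s - 1) clears these poles.\<close>

definition Mellin_complete :: "(real \<Rightarrow> complex) \<Rightarrow> complex \<Rightarrow> (real \<Rightarrow> complex) \<Rightarrow> complex \<Rightarrow> complex \<Rightarrow> complex" where
  "Mellin_complete p c q d s = s * (s - 1) * (Mellin_tail p s + Mellin_tail q (1 - s)) - c * s + d * (s - 1)"

lemma Mellin_complete_reflect: "Mellin_complete p c q d (1 - s) = Mellin_complete q d p c s"
  by (simp add: Mellin_complete_def algebra_simps)

lemma Mellin_complete_holomorphic:
  assumes "rapid p" "rapid q"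
  shows "Mellin_complete p c q d holomorphic_on A"
proof -
  have *: "(\<lambda>s. Mellin_tail q (1 - s)) holomorphic_on UNIV"
    using holomorphic_on_compose[of "\<lambda>s. 1 - s" UNIV "Mellin_tail q", OF _ Mellin_tail_holomorphic[OF assms(2)]]
    by (simp add: o_def holomorphic_intros)
  have "Mellin_complete p c q d holomorphic_on UNIV"
    unfolding Mellin_complete_def[abs_def] by (intro holomorphic_intros Mellin_tail_holomorphic assms *)
  then show ?thesis by (rule holomorphic_on_subset) auto
qed

text \<open>The tails are bounded in vertical strips, so the growth is that of the factor s (s -
  1).\<close>

lemma Mellin_complete_bound:
  assumes "rapid p" "rapid q"
  shows "\<exists>C. \<forall>s. \<bar>Re s\<bar> \<le> K \<longrightarrow> norm (Mellin_complete p c q d s) \<le> C * (1 + norm s)\<^sup>2"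
proof -
  obtain B1 where B1: "\<And>s. Re s \<le> K \<Longrightarrow> norm (Mellin_tail p s) \<le> B1"
    using Mellin_tail_bounded[OF assms(1)] by metis
  obtain B2 where B2: "\<And>s. Re s \<le> K + 1 \<Longrightarrow> norm (Mellin_tail q s) \<le> B2"
    using Mellin_tail_bounded[OF assms(2)] by metis
  have "norm (Mellin_complete p c q d s) \<le> (\<bar>B1\<bar> + \<bar>B2\<bar> + norm c + norm d) * (1 + norm s)\<^sup>2" if s: "\<bar>Re s\<bar> \<le> K" for s
  proof -
    have n: "norm s \<le> 1 + norm s" "norm (s - 1) \<le> 1 + norm s" "1 \<le> 1 + norm s"
      using norm_triangle_ineq4[of s 1] by auto
    have B1': "norm (Mellin_tail p s) \<le> \<bar>B1\<bar>" using B1[of s] s by linarith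
    have B2': "norm (Mellin_tail q (1 - s)) \<le> \<bar>B2\<bar>" using B2[of "1 - s"] s by fastforce
    have sq: "1 + norm s \<le> (1 + norm s)\<^sup>2" by (rule self_le_power) auto
    have "norm (s * (s - 1) * (Mellin_tail p s + Mellin_tail q (1 - s))) \<le> ((1 + norm s) * (1 + norm s)) * (\<bar>B1\<bar> + \<bar>B2\<bar>)"
      unfolding norm_mult using n B1' B2' by (intro mult_mono norm_triangle_le add_mono) auto
    moreover have "norm (c * s) \<le> norm c * (1 + norm s)\<^sup>2" unfolding norm_mult using n sq by (intro mult_left_mono) auto
    moreover have "norm (d * (s - 1)) \<le> norm d * (1 + norm s)\<^sup>2" unfolding norm_mult using n sq by (intro mult_left_mono) auto
    moreover have "norm (Mellin_complete p c q d s) \<le> norm (s * (s - 1) * (Mellin_tail p s + Mellin_tail q (1 - s))) + norm (c * s) + norm (d * (s - 1))"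
      unfolding Mellin_complete_def by (intro norm_triangle_le add_mono order_refl norm_triangle_le_diff)
    ultimately show ?thesis by (simp add: power2_eq_square algebra_simps)
  qed
  then show ?thesis by blast
qed

lemma integral_split_at_0:
  fixes F :: "real \<Rightarrow> complex"
  assumes F: "F \<in> borel_measurable borel" and i: "set_integrable lborel {0..} F" "set_integrable lborel {0..} (\<lambda>u. F (- u))"
  shows "integrable lborel F" "(LINT u|lborel. F u) = (LINT u:{0..}|lborel. F u) + (LINT u:{0..}|lborel. F (- u))"
proof -
  define G where "G u = indicator {0..} u *\<^sub>R F (- u)" for u
  have G: "integrable lborel G" using i(2) unfolding set_integrable_def G_def .
  have G1: "integrable lborel (\<lambda>u. G (0 + (- 1) * u))" by (rule lborel_integrable_real_affine[OF G]) auto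
  have G2: "(LINT u|lborel. G u) = (LINT u|lborel. G (0 + (- 1) * u))" by (subst lborel_integral_real_affine[where c = "-1" and t = 0]) auto
  have ae: "AE u in lborel. F u = indicator {0..} u *\<^sub>R F u + G (0 + (- 1) * u)"
    using AE_lborel_singleton[of 0] by eventually_elim (auto simp: G_def indicator_def)
  have i1: "integrable lborel (\<lambda>u. indicator {0..} u *\<^sub>R F u)" using i(1) unfolding set_integrable_def .
  have [measurable]: "G \<in> borel_measurable borel" unfolding G_def using F by measurable
  show "integrable lborel F"
    by (subst integrable_cong_AE[OF _ _ ae]) (use F i1 G1 in \<open>auto intro: Bochner_Integration.integrable_add\<close>)
  have "(LINT u|lborel. F u) = (LINT u|lborel. indicator {0..} u *\<^sub>R F u + G (0 + (- 1) * u))"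
    by (rule integral_cong_AE[OF _ _ ae]) (use F in auto)
  also have "\<dots> = (LINT u|lborel. indicator {0..} u *\<^sub>R F u) + (LINT u|lborel. G (0 + (- 1) * u))"
    by (rule Bochner_Integration.integral_add[OF i1 G1])
  finally show "(LINT u|lborel. F u) = (LINT u:{0..}|lborel. F u) + (LINT u:{0..}|lborel. F (- u))"
    unfolding G2[symmetric] by (simp add: set_lebesgue_integral_def G_def[abs_def])
qed

text \<open>With the exponential term added back to \<open>p\<close>, the positive half contains an
  exponential of rate (1 - s) / 2 and the negative half, by \<open>rel\<close>, one of rate s / 2.
  Both decay for 0 < Re s < 1 and integrate to the polar terms.\<close>

lemma Mellin_complete_strip:
  assumes p: "rapid p" and q: "rapid q"
    and rel: "\<And>u. p u + c / 2 * exp (- of_real u / 2) = exp (- of_real u / 2) * q (- u) + d / 2"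
    and s: "0 < Re s" "Re s < 1"
  shows "s * (s - 1) * (LINT u|lborel. (p u + c / 2 * exp (- of_real u / 2)) * exp (of_real u * s / 2)) = Mellin_complete p c q d s"
proof -
  define F where "F u = (p u + c / 2 * exp (- of_real u / 2)) * exp (of_real u * s / 2)" for u :: real
  have [measurable]: "p \<in> borel_measurable borel" using p by (simp add: rapid_def)
  have e1: "Re ((1 - s) / 2) > 0" "Re (s / 2) > 0" using s by auto
  note ie = integral_exp_minus_complex[OF e1(1)] integral_exp_minus_complex[OF e1(2)]
  have F1: "F u = p u * exp (of_real u * s / 2) + c / 2 * exp (- (of_real u * ((1 - s) / 2)))" for u
  proof -
    have "exp (- of_real u / 2) * exp (of_real u * s / 2) = exp (- (of_real u * ((1 - s) / 2)))"
    proof -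
      have "- of_real u / 2 + of_real u * s / 2 = - (of_real u * ((1 - s) / 2))" by (simp add: field_simps)
      then show ?thesis by (simp only: exp_add[symmetric])
    qed
    then show ?thesis by (simp add: F_def distrib_right mult.assoc)
  qed
  have F2: "F (- u) = q u * exp (of_real u * (1 - s) / 2) + d / 2 * exp (- (of_real u * (s / 2)))" for u
  proof -
    have "F (- u) = (exp (of_real u / 2) * q u + d / 2) * exp (- (of_real u * s / 2))"
      unfolding F_def rel by simp
    also have "\<dots> = q u * (exp (of_real u / 2) * exp (- (of_real u * s / 2))) + d / 2 * exp (- (of_real u * s / 2))"
    proof -
      have "(A * x + y) * E = x * (A * E) + y * E" for A x y E :: complex by (simp add: algebra_simps)
      then show ?thesis by blast
    qed
    also have "exp (of_real u / 2) * exp (- (of_real u * s / 2)) = exp (of_real u * (1 - s) / 2)"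
      by (simp add: field_simps flip: exp_add)
    also have "of_real u * s / 2 = of_real u * (s / 2)" by simp
    finally show ?thesis .
  qed
  have i1: "set_integrable lborel {0..} F" 
    unfolding F1[abs_def] using Mellin_tail_integrable[OF p] ie(1) by (intro set_integral_add set_integrable_mult_right) auto
  have i2: "set_integrable lborel {0..} (\<lambda>u. F (- u))"
    unfolding F2[abs_def] using Mellin_tail_integrable[OF q] ie(3) by (intro set_integral_add set_integrable_mult_right) auto
  have Fm: "F \<in> borel_measurable borel" unfolding F_def by measurable
  have "(LINT u:{0..}|lborel. F u) = Mellin_tail p s + c / 2 * (1 / ((1 - s) / 2))"
    unfolding F1 Mellin_tail_def using Mellin_tail_integrable[OF p] ie(1,2)
    by (subst set_integral_add(2)) (auto intro: set_integrable_mult_right simp del: divide_divide_eq_right)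
  moreover have "(LINT u:{0..}|lborel. F (- u)) = Mellin_tail q (1 - s) + d / 2 * (1 / (s / 2))"
    unfolding F2 Mellin_tail_def using Mellin_tail_integrable[OF q] ie(3,4)
    by (subst set_integral_add(2)) (auto intro: set_integrable_mult_right simp del: divide_divide_eq_right)
  ultimately have eq: "(LINT u|lborel. F u) = Mellin_tail p s + Mellin_tail q (1 - s) + c / (1 - s) + d / s"
    using integral_split_at_0(2)[OF Fm i1 i2] by simp
  have "s \<noteq> 0" "1 - s \<noteq> 0" using s by auto
  then have "s * (s - 1) * (c / (1 - s)) = - c * s" "s * (s - 1) * (d / s) = d * (s - 1)" by (auto simp: field_simps)
  then have "s * (s - 1) * (LINT u|lborel. F u) = Mellin_complete p c q d s"
    unfolding eq Mellin_complete_def by (simp add: distrib_left)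
  then show ?thesis by (simp add: F_def)
qed

text \<open>To the right of 1 the function \<open>p\<close> alone is integrable, because exp (u s /
  2) now tames its term in exp (- u / 2) at minus infinity. That term yields - c / (s - 1), which
  equals the c / (1 - s) of the strip, so the same completed function appears.\<close>

lemma Mellin_complete_right:
  assumes p: "rapid p" and q: "rapid q"
    and rel: "\<And>u. p u + c / 2 * exp (- of_real u / 2) = exp (- of_real u / 2) * q (- u) + d / 2"
    and s: "1 < Re s"
  shows "s * (s - 1) * (LINT u|lborel. p u * exp (of_real u * s / 2)) = Mellin_complete p c q d s"
proof -
  define F where "F u = p u * exp (of_real u * s / 2)" for u :: real
  have [measurable]: "p \<in> borel_measurable borel" using p by (simp add: rapid_def)
  have e1: "Re ((s - 1) / 2) > 0" "Re (s / 2) > 0" using s by auto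
  note ie = integral_exp_minus_complex[OF e1(1)] integral_exp_minus_complex[OF e1(2)]
  have F2: "F (- u) = q u * exp (of_real u * (1 - s) / 2) + d / 2 * exp (- (of_real u * (s / 2))) + (- c / 2) * exp (- (of_real u * ((s - 1) / 2)))" for u
  proof -
    have "p (- u) = exp (of_real u / 2) * q u + d / 2 - c / 2 * exp (of_real u / 2)"
      using rel[of "- u"] by (simp add: eq_diff_eq)
    then have "F (- u) = (exp (of_real u / 2) * q u + d / 2 - c / 2 * exp (of_real u / 2)) * exp (- (of_real u * s / 2))"
      unfolding F_def by simp
    also have "\<dots> = q u * (exp (of_real u / 2) * exp (- (of_real u * s / 2))) + d / 2 * exp (- (of_real u * (s / 2)))
        + (- c / 2) * (exp (of_real u / 2) * exp (- (of_real u * s / 2)))"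
    proof -
      have "(A * x + y - w / 2 * A) * E = x * (A * E) + y * E + (- w / 2) * (A * E)" for A x y w E :: complex
        by (simp add: algebra_simps)
      then show ?thesis by simp
    qed
    also have "exp (of_real u / 2) * exp (- (of_real u * s / 2)) = exp (of_real u * (1 - s) / 2)"
      by (simp add: field_simps flip: exp_add)
    also have "q u * exp (of_real u * (1 - s) / 2) + d / 2 * exp (- (of_real u * (s / 2))) + (- c / 2) * exp (of_real u * (1 - s) / 2)
       = q u * exp (of_real u * (1 - s) / 2) + d / 2 * exp (- (of_real u * (s / 2))) + (- c / 2) * exp (- (of_real u * ((s - 1) / 2)))"
    proof -
      have "of_real u * (1 - s) / 2 = - (of_real u * ((s - 1) / 2))" by (simp add: algebra_simps diff_divide_distrib)
      then show ?thesis by (simp only:)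
    qed
    finally show ?thesis .
  qed
  have i1: "set_integrable lborel {0..} F" 
    unfolding F_def using Mellin_tail_integrable[OF p] by auto
  have i2: "set_integrable lborel {0..} (\<lambda>u. F (- u))"
    unfolding F2[abs_def] using Mellin_tail_integrable[OF q] ie by (intro set_integral_add set_integrable_mult_right) auto
  have Fm: "F \<in> borel_measurable borel" unfolding F_def by measurable
  have "(LINT u:{0..}|lborel. F u) = Mellin_tail p s"
    unfolding F_def Mellin_tail_def by simp
  moreover have "(LINT u:{0..}|lborel. F (- u)) = Mellin_tail q (1 - s) + d / 2 * (1 / (s / 2)) + (- c / 2) * (1 / ((s - 1) / 2))"
    unfolding F2 Mellin_tail_def ie(2,4)[symmetric] set_integral_mult_right[symmetric] using Mellin_tail_integrable[OF q] ie(1,3)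
    by (subst set_integral_add(2); (intro set_integral_add set_integrable_mult_right)?; simp?)+
  ultimately have eq: "(LINT u|lborel. F u) = Mellin_tail p s + Mellin_tail q (1 - s) - c / (s - 1) + d / s"
    using integral_split_at_0(2)[OF Fm i1 i2] by simp
  have "s \<noteq> 0" "s - 1 \<noteq> 0" using s by auto
  then have "s * (s - 1) * (c / (s - 1)) = c * s" "s * (s - 1) * (d / s) = d * (s - 1)" by (auto simp: field_simps)
  then have "s * (s - 1) * (LINT u|lborel. F u) = Mellin_complete p c q d s"
    unfolding eq Mellin_complete_def by (simp add: distrib_left right_diff_distrib)
  then show ?thesis by (simp add: F_def)
qed

section \<open>The completed zeta function\<close>

definition theta_log :: "real \<Rightarrow> complex" where
  "theta_log u = of_real (theta_tail (exp u))"

lemma theta_tail_nonneg: "a > 0 \<Longrightarrow> theta_tail a \<ge> 0"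
  unfolding theta_tail_def using summable_Gaussian[of "pi * a"] by (intro suminf_nonneg) auto

lemma rapid_theta_log: "rapid theta_log"
  unfolding rapid_def
proof (intro conjI allI)
  show "theta_log \<in> borel_measurable borel"
    unfolding theta_log_def theta_tail_def by measurable
  fix K :: real
  obtain C where C: "\<And>u. u \<ge> 0 \<Longrightarrow> exp (- 1 * exp u) \<le> C * exp (- K * u)"
    using exp_neg_exp_le[of 1 K] by auto
  define S where "S = (\<Sum>n. exp (- 1 * (real (Suc n))\<^sup>2))"
  have sS: "summable (\<lambda>n. exp (- 1 * (real (Suc n))\<^sup>2))" by (rule summable_Gaussian) simp
  have S0: "S \<ge> 0" unfolding S_def using sS by (intro suminf_nonneg) auto
  have "norm (theta_log u) \<le> (C * S) * exp (- K * u)" if u: "u \<ge> 0" for u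
  proof -
    have "theta_tail (exp u) \<le> (\<Sum>n. exp (- exp u) * exp (- 1 * (real (Suc n))\<^sup>2))"
      unfolding theta_tail_def
    proof (rule suminf_le)
      fix n :: nat
      have eu: "1 \<le> exp u" using u by simp
      have m: "1 \<le> (real (Suc n))\<^sup>2" by (simp add: one_le_power)
      have "exp u * 1 \<le> exp u * (real (Suc n))\<^sup>2" by (rule mult_left_mono[OF m]) simp
      moreover have "1 * (real (Suc n))\<^sup>2 \<le> exp u * (real (Suc n))\<^sup>2" by (rule mult_right_mono[OF eu]) simp
      moreover have "3 * (exp u * (real (Suc n))\<^sup>2) \<le> pi * (exp u * (real (Suc n))\<^sup>2)"
        using pi_gt3 by (intro mult_right_mono) auto
      moreover have "0 \<le> exp u * (real (Suc n))\<^sup>2" by simp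
      \<comment> \<open>Both exp u and (n + 1)^2 are at least 1, so their product dominates each of
        them; pi > 3 leaves room to split the exponent into a part in u and a summable part in
        n.\<close>
      ultimately have "exp u + (real (Suc n))\<^sup>2 \<le> pi * (exp u * (real (Suc n))\<^sup>2)" by linarith
      then show "exp (- (pi * exp u) * (real (Suc n))\<^sup>2) \<le> exp (- exp u) * exp (- 1 * (real (Suc n))\<^sup>2)"
        unfolding exp_add[symmetric] by (simp add: mult.assoc)
    next
      show "summable (\<lambda>n. exp (- (pi * exp u) * (real (Suc n))\<^sup>2))" by (rule summable_Gaussian) simp
      show "summable (\<lambda>n. exp (- exp u) * exp (- 1 * (real (Suc n))\<^sup>2))" by (intro summable_mult sS)
    qed
    also have "\<dots> = exp (- exp u) * S" unfolding S_def by (rule suminf_mult[OF sS])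
    also have "\<dots> \<le> (C * exp (- K * u)) * S" using C[OF u] S0 by (intro mult_right_mono) auto
    finally show ?thesis using theta_tail_nonneg[of "exp u"] by (simp add: theta_log_def mult_ac)
  qed
  then show "\<exists>C. \<forall>u\<ge>0. norm (theta_log u) \<le> C * exp (- K * u)" by blast
qed

text \<open>Jacobi's identity in the logarithmic variable, in the shape of the relation that
  completes Mellin transforms, with p = q and c = d = -1.\<close>

lemma theta_log_modular:
  "theta_log u + (- 1) / 2 * exp (- of_real u / 2) = exp (- of_real u / 2) * theta_log (- u) + (- 1) / 2"
proof -
  have "sqrt (exp u) = exp (u / 2)"
    by (rule real_sqrt_unique) (auto simp flip: exp_double)
  then have "1 + 2 * theta_tail (exp u) = (1 + 2 * theta_tail (exp (- u))) * exp (- u / 2)"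
    using theta_tail_modular[of "exp u"] by (simp add: exp_minus field_simps)
  then have "theta_tail (exp u) + (- 1) / 2 * exp (- u / 2) = exp (- u / 2) * theta_tail (exp (- u)) + (- 1) / 2"
    by (simp add: field_simps)
  then have "complex_of_real (theta_tail (exp u) + (- 1) / 2 * exp (- u / 2)) = of_real (exp (- u / 2) * theta_tail (exp (- u)) + (- 1) / 2)"
    by (simp only:)
  then show ?thesis by (simp add: theta_log_def exp_of_real[symmetric])
qed

text \<open>The entire function s (s - 1) pi^(-s/2) Gamma(s/2) \<zeta>(s), twice Riemann's
  xi.\<close>

definition completed_zeta :: "complex \<Rightarrow> complex" where
  "completed_zeta = Mellin_complete theta_log (- 1) theta_log (- 1)"

text \<open>
  With this factor \<open>arch s * s * (s - 1)\<close> is the reciprocal of \<open>pi powr (- s / 2) * Gamma (s / 2)\<close>. The division by 0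
  makes the value at the pole \<open>s = 1\<close> equal to 0.
\<close>

definition arch :: "complex \<Rightarrow> complex" where
  "arch s = of_real pi powr (s / 2) * rGamma (s / 2 + 1) / (2 * (s - 1))"

lemma arch_mult:
  assumes "Re s > 0" "s \<noteq> 1"
  shows "arch s * (s * (s - 1) * (of_real pi powr (- s / 2) * Gamma (s / 2) * w)) = w"
proof -
  have "s / 2 \<notin> \<int>\<^sub>\<le>\<^sub>0" using assms(1) by (auto elim!: nonpos_Ints_cases simp: complex_eq_iff)
  then have g: "rGamma (s / 2) * Gamma (s / 2) = 1" by (simp add: rGamma_inverse_Gamma Gamma_eq_zero_iff)
  have "(s / 2) * rGamma (s / 2 + 1) = rGamma (s / 2)" by (rule rGamma_plus1)
  then have g': "s * rGamma (s / 2 + 1) * Gamma (s / 2) = 2" using g by (simp add: field_simps)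
  have p: "of_real pi powr (s / 2) * of_real pi powr (- s / 2) = (1::complex)"
    by (simp add: powr_minus)
  have "arch s * (s * (s - 1) * (of_real pi powr (- s / 2) * Gamma (s / 2) * w))
     = (of_real pi powr (s / 2) * of_real pi powr (- s / 2)) * (s * rGamma (s / 2 + 1) * Gamma (s / 2)) * w * ((s - 1) / (2 * (s - 1)))"
    by (simp add: arch_def)
  also have "(s - 1) / (2 * (s - 1)) = 1 / 2" using assms(2) by simp
  also have "(of_real pi powr (s / 2) * of_real pi powr (- s / 2)) * (s * rGamma (s / 2 + 1) * Gamma (s / 2)) * w * (1 / 2) = w"
    unfolding p g' by simp
  finally show ?thesis .
qed

lemma arch_holomorphic: "arch holomorphic_on - {1}"
  unfolding arch_def[abs_def] by (intro holomorphic_intros) auto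

text \<open>The first zero of the reciprocal Gamma factor is at s = -2, the first trivial zero of
  \<zeta>.\<close>

lemma arch_nonzero:
  assumes "Re s > - 2" "s \<noteq> 1"
  shows "arch s \<noteq> 0"
proof -
  have "s / 2 + 1 \<notin> \<int>\<^sub>\<le>\<^sub>0"
  proof
    assume "s / 2 + 1 \<in> \<int>\<^sub>\<le>\<^sub>0"
    then obtain n where "s / 2 + 1 = of_int n" "n \<le> 0" by (auto elim!: nonpos_Ints_cases)
    then have "Re (s / 2 + 1) \<le> 0" by simp
    then show False using assms(1) by simp
  qed
  then show ?thesis using assms(2) by (simp add: arch_def rGamma_eq_zero_iff)
qed

section \<open>The Dirichlet series and its continuation\<close>

definition Dirichlet_zeta :: "complex \<Rightarrow> complex" where
  "Dirichlet_zeta s = (\<Sum>n. of_nat (Suc n) powr (- s))"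

lemma summable_norm_Dirichlet:
  assumes "Re s > 1"
  shows "summable (\<lambda>n. norm (of_nat (Suc n) powr (- s) :: complex))"
proof -
  have "summable (\<lambda>n. real n powr (- Re s))" using assms by (simp add: summable_real_powr_iff)
  then have "summable (\<lambda>n. real (Suc n) powr (- Re s))" by (subst summable_Suc_iff)
  moreover have "norm (of_nat (Suc n) powr (- s) :: complex) = real (Suc n) powr (- Re s)" for n
    using norm_powr_real_powr[of "of_nat (Suc n)" "- s"] by simp
  ultimately show ?thesis by (simp only:)
qed

text \<open>Termwise integration by the Gamma integral with l = pi (n + 1)^2. The norms of the terms
  integrate to the modulus of the same expression at Re s, so absolute convergence of the Dirichlet
  series justifies the interchange.\<close>

lemma Mellin_theta_log:
  assumes s: "Re s > 1"
  shows "(LINT u|lborel. theta_log u * exp (of_real u * s / 2)) = of_real pi powr (- s / 2) * Gamma (s / 2) * Dirichlet_zeta s"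
proof -
  define l where "l n = pi * (real (Suc n))\<^sup>2" for n
  define F where "F n u = exp (of_real u * (s / 2) - of_real (l n * exp u))" for n and u :: real
  have l: "l n > 0" for n by (simp add: l_def)
  have z: "Re (s / 2) > 0" "Re (complex_of_real (Re s / 2)) > 0" using s by auto
  have lp: "complex_of_real (l n) powr (- w / 2) = of_real pi powr (- w / 2) * of_nat (Suc n) powr (- w)" for n w
  proof -
    have "ln (l n) = ln pi + 2 * ln (real (Suc n))"
      unfolding l_def by (subst ln_mult) (auto simp: ln_realpow)
    moreover have "Ln (of_real (l n)) = of_real (ln (l n))" using l by (rule Ln_of_real)
    moreover have "Ln (of_real pi) = of_real (ln pi)" by (rule Ln_of_real) simp
    moreover have "Ln (of_nat (Suc n)) = of_real (ln (real (Suc n)))" using Ln_of_real[of "real (Suc n)"] by simp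
    moreover have "l n \<noteq> 0" using l[of n] by simp
    ultimately show ?thesis by (simp add: powr_def exp_add[symmetric] algebra_simps del: of_nat_Suc)
  qed
  have i: "integrable lborel (F n)" for n unfolding F_def by (rule Gamma_integral_log(1)[OF z(1) l])
  have v: "(LINT u|lborel. F n u) = of_real pi powr (- s / 2) * Gamma (s / 2) * of_nat (Suc n) powr (- s)" for n
    unfolding F_def using Gamma_integral_log(2)[OF z(1) l[of n]] lp[of n s] by simp
  have nv: "(LINT u|lborel. norm (F n u)) = norm (of_real pi powr (- of_real (Re s) / 2) * Gamma (of_real (Re s / 2)) :: complex) * norm (of_nat (Suc n) powr (- s) :: complex)" for n
  proof -
    have e: "complex_of_real (norm (F n u)) = exp (of_real u * of_real (Re s / 2) - of_real (l n * exp u))" for u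
      unfolding F_def norm_exp_eq_Re by (simp flip: exp_of_real)
    have "complex_of_real (LINT u|lborel. norm (F n u)) = of_real (l n) powr (- of_real (Re s / 2)) * Gamma (of_real (Re s / 2))"
      using Gamma_integral_log(2)[OF z(2) l[of n]] unfolding e[symmetric] integral_complex_of_real .
    then have "norm (complex_of_real (LINT u|lborel. norm (F n u))) = norm (of_real pi powr (- of_real (Re s) / 2) * of_nat (Suc n) powr (- of_real (Re s)) * Gamma (of_real (Re s / 2)) :: complex)"
      using lp[of n "of_real (Re s)"] by simp
    moreover have "(LINT u|lborel. norm (F n u)) \<ge> 0" by simp
    moreover have "norm (of_nat (Suc n) powr (- of_real (Re s)) :: complex) = norm (of_nat (Suc n) powr (- s) :: complex)"
      using norm_powr_real_powr[of "of_nat (Suc n)" "- s"] norm_powr_real_powr[of "of_nat (Suc n)" "- of_real (Re s)"] by simp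
    ultimately show ?thesis by (simp add: norm_mult mult_ac del: of_nat_Suc)
  qed
  have th: "theta_log u * exp (of_real u * s / 2) = (\<Sum>n. F n u)" and su: "summable (\<lambda>n. norm (F n u))" for u
  proof -
    have sg: "summable (\<lambda>n. exp (- (pi * exp u) * (real (Suc n))\<^sup>2))" by (rule summable_Gaussian) simp
    have Fe: "F n u = of_real (exp (- (pi * exp u) * (real (Suc n))\<^sup>2)) * exp (of_real u * s / 2)" for n
      unfolding F_def exp_of_real[symmetric] exp_add[symmetric] l_def by (simp add: algebra_simps)
    show "summable (\<lambda>n. norm (F n u))"
      unfolding Fe norm_mult using sg by (intro summable_mult2) simp
    show "theta_log u * exp (of_real u * s / 2) = (\<Sum>n. F n u)"
      unfolding Fe theta_log_def theta_tail_def using sg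
      by (subst suminf_mult2[symmetric]) (simp_all only: suminf_of_real[symmetric] summable_of_real)
  qed
  have "(LINT u|lborel. theta_log u * exp (of_real u * s / 2)) = (LINT u|lborel. (\<Sum>n. F n u))"
    by (simp only: th)
  also have "\<dots> = (\<Sum>n. LINT u|lborel. F n u)"
    by (rule integral_suminf[OF i]) (use su nv summable_mult[OF summable_norm_Dirichlet[OF s]] in auto)
  also have "\<dots> = of_real pi powr (- s / 2) * Gamma (s / 2) * Dirichlet_zeta s"
    unfolding v Dirichlet_zeta_def by (rule suminf_mult) (rule summable_norm_cancel[OF summable_norm_Dirichlet[OF s]])
  finally show ?thesis .
qed

lemma arch_completed_zeta_right:
  assumes s: "Re s > 1"
  shows "arch s * completed_zeta s = Dirichlet_zeta s"
proof -
  have "completed_zeta s = s * (s - 1) * (of_real pi powr (- s / 2) * Gamma (s / 2) * Dirichlet_zeta s)"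
    unfolding completed_zeta_def Mellin_theta_log[OF s, symmetric]
    by (rule Mellin_complete_right[symmetric, OF rapid_theta_log rapid_theta_log theta_log_modular s])
  then show ?thesis using arch_mult[of s] s by force
qed

lemma completed_zeta_holomorphic: "completed_zeta holomorphic_on A"
  unfolding completed_zeta_def by (intro Mellin_complete_holomorphic rapid_theta_log)

lemma completed_zeta_reflect: "completed_zeta (1 - s) = completed_zeta s"
  unfolding completed_zeta_def by (rule Mellin_complete_reflect)

text \<open>The difference vanishes frequently near one point, hence identically once its
  singularities are removed. A nicely meromorphic function agrees with its own
  \<open>remove_sings\<close> everywhere, poles included, since both take the value 0 there.\<close>

lemma nicely_meromorphic_unique:
  assumes F: "F nicely_meromorphic_on UNIV" and G: "G nicely_meromorphic_on UNIV"
    and eq: "\<exists>\<^sub>F w in at z0. F w = G w"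
  shows "F = G"
proof
  fix z
  define D where "D w = F w - G w" for w
  have mer: "F meromorphic_on UNIV" "G meromorphic_on UNIV" using F G by (auto simp: nicely_meromorphic_on_def)
  have D: "D meromorphic_on UNIV" unfolding D_def by (intro meromorphic_on_diff mer)
  have Di: "isolated_singularity_at D w" "not_essential D w" for w
    using D meromorphic_on_subset[of D UNIV "{w}"] by (auto simp: meromorphic_at_iff)
  have ev: "\<forall>\<^sub>F w in at x. remove_sings D w = D w" for x
    by (rule eventually_remove_sings_eq_at[OF Di(1)])
  have "\<exists>\<^sub>F w in at z0. remove_sings D w = 0"
  proof -
    have "\<exists>\<^sub>F w in at z0. D w = 0" using eq by (simp add: D_def)
    then show ?thesis by (rule frequently_rev_mp) (use ev[of z0] in \<open>auto elim: eventually_mono\<close>)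
  qed
  then have D0: "remove_sings D w = 0" for w
    by (rule frequently_eq_meromorphic_imp_constant[where A = UNIV]) (use remove_sings_nicely_meromorphic[OF D] in auto)
  have "\<forall>\<^sub>F w in at z. F w = G w"
    using ev[of z] by eventually_elim (simp add: D0, simp add: D_def)
  then have rs: "remove_sings F z = remove_sings G z" by (rule remove_sings_cong) simp
  have "remove_sings H z = H z" if H: "H nicely_meromorphic_on UNIV" for H
  proof (cases "is_pole H z")
    case True
    then have "\<not> H \<midarrow>z\<rightarrow> H z"
      using not_tendsto_and_filterlim_at_infinity[of "at z" H "H z"] by (auto simp: is_pole_def)
    then show ?thesis using True H by (auto simp: nicely_meromorphic_on_def)
  next
    case False
    then show ?thesis using nicely_meromorphic_on_imp_analytic_at[OF H, of z] by simp
  qed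
  then show "F z = G z" using rs F G by metis
qed

text \<open>Resolves the definite description: \<open>remove_sings\<close> of the product satisfies
  it, and any other solution agrees with it near s = 2.\<close>

lemma riemann_zeta_eq:
  assumes "s \<noteq> 1"
  shows "riemann_zeta s = arch s * completed_zeta s"
proof -
  define f where "f s = arch s * completed_zeta s" for s
  have fh: "f holomorphic_on - {1}"
    unfolding f_def by (intro holomorphic_intros arch_holomorphic completed_zeta_holomorphic)
  have fan: "f analytic_on {s}" if "s \<noteq> 1" for s
    using fh that by (auto simp: analytic_at intro!: exI[of _ "- {1}"])
  have fm: "f meromorphic_on UNIV"
    unfolding f_def arch_def
    by (intro meromorphic_intros analytic_on_imp_meromorphic_on[OF analytic_on_subset[of _ UNIV]])
      (auto simp: analytic_on_open intro!: holomorphic_intros completed_zeta_holomorphic)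
  have rn: "remove_sings f nicely_meromorphic_on UNIV" by (rule remove_sings_nicely_meromorphic[OF fm])
  have rf: "remove_sings f s = f s" if "s \<noteq> 1" for s using fan[OF that] by simp
  have fD: "f s = (\<Sum>n. of_nat (Suc n) powr (- s))" if "Re s > 1" for s
    unfolding f_def using arch_completed_zeta_right[OF that] by (simp add: Dirichlet_zeta_def)
  have fD': "remove_sings f s = (\<Sum>n. of_nat (Suc n) powr (- s))" if "Re s > 1" for s
    using rf[of s] fD[OF that] that by force
  have "riemann_zeta = remove_sings f"
    unfolding riemann_zeta_def
  proof (rule the_equality)
    show "remove_sings f nicely_meromorphic_on UNIV \<and> (\<forall>s. 1 < Re s \<longrightarrow> remove_sings f s = (\<Sum>n. of_nat (Suc n) powr (- s)))"
      using rn fD' by auto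
    fix Z assume Z: "Z nicely_meromorphic_on UNIV \<and> (\<forall>s. 1 < Re s \<longrightarrow> Z s = (\<Sum>n. of_nat (Suc n) powr (- s)))"
    show "Z = remove_sings f"
    proof (rule nicely_meromorphic_unique[where ?z0.0 = 2])
      have "eventually (\<lambda>w. w \<in> {w. Re w > 1}) (at (2::complex))"
        by (intro eventually_at_in_open' open_halfspace_Re_gt) auto
      then have "eventually (\<lambda>w. Z w = remove_sings f w) (at 2)"
        by eventually_elim (use Z fD' in auto)
      then show "\<exists>\<^sub>F w in at 2. Z w = remove_sings f w" by (rule eventually_frequently[rotated]) simp
    qed (use Z rn in auto)
  qed
  then show ?thesis using rf[OF assms] by (simp add: f_def)
qed


section \<open>The critical line\<close>

lemma crit_line_sets [simp, measurable_cong]: "sets crit_line = sets borel"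
  by (simp add: crit_line_def)

lemma crit_line_space [simp]: "space crit_line = UNIV"
  by (simp add: crit_line_def)

lemma Complex_half_measurable [measurable]: "(\<lambda>t. Complex (1/2) t) \<in> borel_measurable borel"
proof -
  have "(\<lambda>t. Complex (1/2) t) = (\<lambda>t. of_real (1/2) + \<i> * of_real t)" by (auto simp: complex_eq_iff)
  then show ?thesis by simp
qed


lemma crit_line_integrable_iff:
  fixes f :: "complex \<Rightarrow> 'b :: {banach, second_countable_topology}"
  assumes [measurable]: "f \<in> borel_measurable borel"
  shows "integrable crit_line f \<longleftrightarrow> integrable lborel (\<lambda>t. f (Complex (1/2) t))"
proof -
  have "integrable lborel g" if "integrable lborel (\<lambda>t. (1 / (2 * pi)) *\<^sub>R g t)" for g :: "real \<Rightarrow> 'b"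
    using integrable_scaleR_right[of "2 * pi", OF that] by simp
  from this[of "\<lambda>t. f (Complex (1/2) t)"] integrable_scaleR_right[of "1 / (2 * pi)" lborel "\<lambda>t. f (Complex (1/2) t)"]
  have "integrable lborel (\<lambda>t. (1 / (2 * pi)) *\<^sub>R f (Complex (1/2) t)) \<longleftrightarrow> integrable lborel (\<lambda>t. f (Complex (1/2) t))"
    by (intro iffI)
  moreover have "integrable crit_line f \<longleftrightarrow> integrable (density lborel (\<lambda>_. ennreal (1 / (2 * pi)))) (\<lambda>t. f (Complex (1/2) t))"
    unfolding crit_line_def by (rule integrable_distr_eq) measurable
  moreover have "\<dots> \<longleftrightarrow> integrable lborel (\<lambda>t. (1 / (2 * pi)) *\<^sub>R f (Complex (1/2) t))"
  proof (rule integrable_density)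
    show "AE t in lborel. (0::real) \<le> 1 / (2 * pi)" by simp
  qed measurable
  ultimately show ?thesis by (simp only:)
qed

lemma crit_line_integral:
  fixes f :: "complex \<Rightarrow> complex"
  assumes [measurable]: "f \<in> borel_measurable borel"
  shows "(\<integral>s. f s \<partial>crit_line) = of_real (1 / (2 * pi)) * (\<integral>t. f (Complex (1/2) t) \<partial>lborel)"
proof -
  have "(\<integral>s. f s \<partial>crit_line) = (\<integral>t. f (Complex (1/2) t) \<partial>density lborel (\<lambda>_. ennreal (1 / (2 * pi))))"
    unfolding crit_line_def by (rule integral_distr) measurable
  also have "\<dots> = (\<integral>t. (1 / (2 * pi)) *\<^sub>R f (Complex (1/2) t) \<partial>lborel)"
  proof (rule integral_density)
    show "AE t in lborel. (0::real) \<le> 1 / (2 * pi)" by simp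
  qed measurable
  finally show ?thesis by (simp only: integral_scaleR_right scaleR_conv_of_real integral_mult_right_zero)
qed

lemma AE_crit_line_iff:
  assumes [measurable]: "Measurable.pred borel P"
  shows "(AE s in crit_line. P s) \<longleftrightarrow> (AE t in lborel. P (Complex (1/2) t))"
  unfolding crit_line_def
  by (subst AE_distr_iff) (auto simp: AE_density)

lemma AE_crit_line_Re: "AE s in crit_line. Re s = 1/2"
  by (subst AE_crit_line_iff) auto

lemma AE_crit_line_neq: "AE s in crit_line. s \<noteq> w"
proof (subst AE_crit_line_iff)
  show "AE t in lborel. Complex (1/2) t \<noteq> w"
    using AE_lborel_singleton[of "Im w"] by eventually_elim auto
qed measurable


text \<open>On Re s = 1/2 this is a Fourier transform of k(u) exp (- u / 2) on the half-line, a
  function in L^1 and L^2, so the Plancherel inequality applies.\<close>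

lemma Laplace_transform_L2:
  fixes k :: "real \<Rightarrow> complex"
  assumes [measurable]: "k \<in> borel_measurable borel" and k: "\<And>u. norm (k u) \<le> 1"
  shows "(\<lambda>s. LINT u:{0..}|lborel. k u * exp (- (of_real u * s))) \<in> L2 crit_line"
proof -
  define K where "K s = (LINT u:{0..}|lborel. k u * exp (- (of_real u * s)))" for s
  define \<kappa> where "\<kappa> u = indicator {0..} u *\<^sub>R (k u * of_real (exp (- (u / 2))))" for u
  have [measurable]: "\<kappa> \<in> borel_measurable borel" unfolding \<kappa>_def by measurable
  have [measurable]: "K \<in> borel_measurable borel" unfolding K_def set_lebesgue_integral_def by measurable
  have e: "integrable lborel (\<lambda>u::real. indicator {0..} u *\<^sub>R exp (- u))"
    using set_integrable_exp_minus unfolding set_integrable_def .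
  have "integrable lborel (\<lambda>u::real. indicator {0..} (0 + (1/2) * u) *\<^sub>R exp (- (0 + (1/2) * u)))"
    by (rule lborel_integrable_real_affine[OF e]) auto
  moreover have "indicator {0..} (0 + (1/2) * u) = (indicator {0..} u :: real)" for u :: real
    by (auto simp: indicator_def)
  ultimately have e2: "integrable lborel (\<lambda>u::real. indicator {0..} u *\<^sub>R exp (- (u / 2)))" by simp
  have i1: "integrable lborel \<kappa>"
    by (rule Bochner_Integration.integrable_bound[OF e2]) (use k in \<open>auto simp: \<kappa>_def indicator_def norm_mult\<close>)
  have i2: "integrable lborel (\<lambda>u. (norm (\<kappa> u))\<^sup>2)"
  proof (rule Bochner_Integration.integrable_bound[OF e])
    have "(norm (\<kappa> u))\<^sup>2 \<le> indicator {0..} u *\<^sub>R exp (- u)" for u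
    proof (cases "u \<ge> 0")
      case True
      have "norm (\<kappa> u) \<le> exp (- (u / 2))" using k[of u] True by (simp add: \<kappa>_def norm_mult)
      then have "(norm (\<kappa> u))\<^sup>2 \<le> (exp (- (u / 2)))\<^sup>2" by (intro power_mono) auto
      then show ?thesis using True by (simp add: exp_double[symmetric])
    qed (simp add: \<kappa>_def)
    then show "AE u in lborel. norm ((norm (\<kappa> u))\<^sup>2) \<le> norm (indicator {0..} u *\<^sub>R exp (- u))"
      by (intro AE_I2) (auto simp: abs_of_nonneg)
  qed measurable
  have KK: "K (Complex (1/2) t) = (CLINT u|lborel. \<kappa> u * iexp ((- t) * u))" for t
    unfolding K_def set_lebesgue_integral_def \<kappa>_def
  proof (intro Bochner_Integration.integral_cong refl)
    fix u :: real
    have "- (of_real u * Complex (1/2) t) = of_real (- (u / 2)) + \<i> * (of_real (- t) * of_real u)"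
      by (simp add: complex_eq_iff)
    then have "exp (- (of_real u * Complex (1/2) t)) = of_real (exp (- (u / 2))) * exp (\<i> * (of_real (- t) * of_real u))"
      by (simp only: exp_add exp_of_real)
    then show "indicator {0..} u *\<^sub>R (k u * exp (- (of_real u * Complex (1/2) t))) = indicator {0..} u *\<^sub>R (k u * of_real (exp (- (u / 2)))) * iexp (- t * u)"
      by simp
  qed
  have "(\<integral>\<^sup>+t. ennreal ((norm (K (Complex (1/2) t)))\<^sup>2) \<partial>lborel) = (\<integral>\<^sup>+t. ennreal ((norm (CLINT u|lborel. \<kappa> u * iexp ((- t) * u)))\<^sup>2) \<partial>lborel)"
    unfolding KK ..
  also have "\<dots> = (\<integral>\<^sup>+t. ennreal ((norm (CLINT u|lborel. \<kappa> u * iexp (t * u)))\<^sup>2) \<partial>lborel)"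
    by (subst (2) nn_integral_real_affine[where c = "-1" and t = 0]) auto
  also have "\<dots> < \<infinity>"
    using Plancherel_inequality[OF i1 i2] by (rule le_less_trans) simp
  finally have "integrable lborel (\<lambda>t. (norm (K (Complex (1/2) t)))\<^sup>2)"
    by (intro integrableI_bounded) auto
  then show ?thesis unfolding K_def[symmetric] L2_def
    by (simp add: crit_line_integrable_iff measurable_cong_sets[OF crit_line_sets refl])
qed

text \<open>1 / s is the Laplace transform of the constant 1.\<close>

lemma inverse_L2: "(\<lambda>s. 1 / s) \<in> L2 crit_line"
proof -
  have K: "(\<lambda>s. LINT u:{0..}|lborel. 1 * exp (- (of_real u * s))) \<in> L2 crit_line"
    by (rule Laplace_transform_L2) auto
  show ?thesis
  proof (rule L2_bounded_by[OF _ K])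
    show "(\<lambda>s. 1 / s) \<in> borel_measurable crit_line" by measurable
    show "AE s in crit_line. norm (1 / s) \<le> 1 * norm (LINT u:{0..}|lborel. 1 * exp (- (of_real u * s)))"
      using AE_crit_line_Re by eventually_elim (subst mult_1, subst integral_exp_minus_complex(2), auto)
  qed
qed

section \<open>Quotients of entire functions\<close>

text \<open>Write u = exp h with Re h < 0 and put a = h 0. The map (h - a) / (h + cnj a) sends the
  left half-plane into the disc and a to 0, so Schwarz's lemma bounds it by |w|; solving for Re h
  gives Harnack's factor (1 + |w|) / (1 - |w|).\<close>

lemma Harnack_disc:
  assumes u: "u holomorphic_on ball 0 1" "\<And>z. norm z < 1 \<Longrightarrow> u z \<noteq> 0" "\<And>z. norm z < 1 \<Longrightarrow> norm (u z) < 1"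
    and w: "norm w < 1"
  shows "norm (u w) \<ge> norm (u 0) powr ((1 + norm w) / (1 - norm w))"
proof -
  obtain h where h: "h holomorphic_on ball 0 1" and hu: "\<And>z. z \<in> ball 0 1 \<Longrightarrow> u z = exp (h z)"
  proof -
    obtain h where "h holomorphic_on ball 0 1" "\<And>z. z \<in> ball 0 1 \<Longrightarrow> exp (h z) = u z"
      by (rule holomorphic_logarithm_exists[of "ball 0 1" u 0]) (use u in auto)
    then show ?thesis using that by metis
  qed
  have re: "Re (h z) < 0" if "norm z < 1" for z
    using u(3)[OF that] hu[of z] that by simp
  define a where "a = h 0"
  have a: "Re a < 0" using re[of 0] by (simp add: a_def)
  define \<phi> where "\<phi> z = (h z - a) / (h z + cnj a)" for z
  have den: "h z + cnj a \<noteq> 0" if "norm z < 1" for z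
    using re[OF that] a by (auto simp: complex_eq_iff)
  have ph: "\<phi> holomorphic_on ball 0 1"
    unfolding \<phi>_def using den by (intro holomorphic_intros h) auto
  have p0: "\<phi> 0 = 0" by (simp add: \<phi>_def a_def)
  have p1: "norm (\<phi> z) < 1" if "norm z < 1" for z
  proof -
    have "(norm (h z - a))\<^sup>2 < (norm (h z + cnj a))\<^sup>2"
      using mult_neg_neg[OF re[OF that] a] unfolding cmod_power2 by (simp add: power2_eq_square algebra_simps)
    then have "norm (h z - a) < norm (h z + cnj a)" by (rule power_less_imp_less_base) simp
    then show ?thesis using den[OF that] by (simp add: \<phi>_def norm_divide)
  qed
  define r where "r = norm w"
  have r: "0 \<le> r" "r < 1" using w by (auto simp: r_def)
  have "norm (\<phi> w) \<le> r" unfolding r_def by (rule Schwarz_Lemma(1)[OF ph p0 p1 w])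
  then have "norm (h w - a) \<le> r * norm (h w + cnj a)"
    using den[OF w] by (simp add: \<phi>_def norm_divide divide_le_eq)
  then have sq: "(norm (h w - a))\<^sup>2 \<le> r\<^sup>2 * (norm (h w + cnj a))\<^sup>2"
    using power_mono[of "norm (h w - a)" "r * norm (h w + cnj a)" 2] by (simp add: power_mult_distrib)
  define X where "X = - Re (h w)"
  define A where "A = - Re a"
  define Y where "Y = Im (h w) - Im a"
  have XA: "X > 0" "A > 0" using re[OF w] a by (auto simp: X_def A_def)
  have "(X - A)\<^sup>2 + Y\<^sup>2 \<le> r\<^sup>2 * ((X + A)\<^sup>2 + Y\<^sup>2)"
    using sq unfolding cmod_power2 X_def A_def Y_def by (simp add: power2_commute power2_eq_square algebra_simps)
  \<comment> \<open>The imaginary parts drop out of the inequality in the right direction, because r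
    \<le> 1.\<close>
  moreover have "r\<^sup>2 * Y\<^sup>2 \<le> 1 * Y\<^sup>2" using r by (intro mult_right_mono) (auto simp: power_le_one)
  ultimately have "(X - A)\<^sup>2 \<le> r\<^sup>2 * (X + A)\<^sup>2" by (simp add: distrib_left)
  then have "(X - A)\<^sup>2 \<le> (r * (X + A))\<^sup>2" by (simp add: power_mult_distrib)
  then have "X - A \<le> r * (X + A)" by (rule power2_le_imp_le) (use r XA in auto)
  then have "X * (1 - r) \<le> A * (1 + r)" by (simp add: algebra_simps)
  then have XA': "X \<le> A * ((1 + r) / (1 - r))" using r by (simp add: field_simps)
  have "norm (u 0) = exp (- A)" "norm (u w) = exp (- X)"
    using hu[of 0] hu[of w] w by (auto simp: A_def X_def a_def)
  then show ?thesis using XA' by (simp add: powr_def r_def mult.commute)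
qed

section \<open>Blaschke factors and the bound for quotients\<close>

definition Blaschke :: "complex \<Rightarrow> complex \<Rightarrow> complex" where
  "Blaschke a z = (z - a) / (1 - cnj a * z)"

lemma Blaschke_denominator:
  assumes "norm a < 1" "norm z \<le> 1"
  shows "1 - cnj a * z \<noteq> 0"
proof
  assume "1 - cnj a * z = 0"
  then have "norm (cnj a * z) = 1" by simp
  moreover have "norm (cnj a * z) \<le> norm a * 1" unfolding norm_mult complex_mod_cnj using assms by (intro mult_left_mono) auto
  ultimately show False using assms by simp
qed

lemma Blaschke_norm_identity:
  "(norm (1 - cnj a * z))\<^sup>2 - (norm (z - a))\<^sup>2 = (1 - (norm a)\<^sup>2) * (1 - (norm z)\<^sup>2)"
  unfolding cmod_power2 by (simp add: power2_eq_square algebra_simps)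


lemma Blaschke_norm_eq:
  assumes "norm a < 1" "norm z = 1"
  shows "norm (Blaschke a z) = 1"
proof -
  have "(norm (z - a))\<^sup>2 = (norm (1 - cnj a * z))\<^sup>2"
    using Blaschke_norm_identity[of a z] assms by simp
  then have "norm (z - a) = norm (1 - cnj a * z)" by simp
  then show ?thesis using Blaschke_denominator[of a z] assms by (simp add: Blaschke_def norm_divide)
qed

lemma norm_bound_from_unit_circle:
  assumes k: "k holomorphic_on UNIV" and M: "\<And>z. norm z = 1 \<Longrightarrow> norm (k z) \<le> M" and z: "norm z \<le> 1"
  shows "norm (k z) \<le> M"
proof (rule maximum_modulus_frontier[of k "cball 0 1"])
  show "k holomorphic_on interior (cball 0 1)" using k by (rule holomorphic_on_subset) auto
  show "continuous_on (closure (cball 0 1)) k"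
    by (rule continuous_on_subset[OF holomorphic_on_imp_continuous_on[OF k]]) auto
qed (use M z in auto)

text \<open>The cofactor (1 - cnj a z) f(z) / (z - a) is again entire, so the division can be
  repeated.\<close>

lemma Blaschke_divide:
  assumes f: "f holomorphic_on UNIV" and a: "norm a < 1" "f a = 0"
  obtains k where "k holomorphic_on UNIV" "\<And>z. norm z \<le> 1 \<Longrightarrow> f z = Blaschke a z * k z"
proof -
  define g where "g z = (if z = a then deriv f a else (f z - f a) / (z - a))" for z
  have g: "g holomorphic_on UNIV" unfolding g_def by (rule pole_lemma_open[OF f]) auto
  have fg: "f z = (z - a) * g z" for z using a by (simp add: g_def)
  define k where "k z = (1 - cnj a * z) * g z" for z
  have k: "k holomorphic_on UNIV" unfolding k_def by (intro holomorphic_intros g)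
  have "f z = Blaschke a z * k z" if "norm z \<le> 1" for z
    using Blaschke_denominator[OF a(1) that] by (simp add: Blaschke_def k_def fg)
  with k that show ?thesis by blast
qed

text \<open>
  The zeros of \<open>Z\<close> in the disc of radius \<open>\<rho>\<close> are divided out of \<open>Z\<close> and of its multiple \<open>F * Z\<close> simultaneously, which keeps
  the bounds. Each division increases \<open>\<bar>Z 0\<bar>\<close> by the factor \<open>1 / \<rho>\<close> at least, so the process stops; Harnack's
  inequality then bounds the remaining zero-free factor from below.
\<close>

lemma quotient_bound_unit_disc:
  assumes F: "F holomorphic_on UNIV" and Z: "Z holomorphic_on UNIV"
    and M: "\<And>z. norm z \<le> 1 \<Longrightarrow> norm (Z z) \<le> M" "\<And>z. norm z \<le> 1 \<Longrightarrow> norm (F z * Z z) \<le> M"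
    and \<mu>: "0 < \<mu>" "\<mu> \<le> norm (Z 0)" and \<rho>: "0 < \<rho>" "\<rho> < 1" and m: "\<rho> ^ m * M < norm (Z 0)"
    and w: "norm w < \<rho>"
  shows "norm (F w) \<le> (2 * M / \<mu>) powr ((\<rho> + norm w) / (\<rho> - norm w))"
  using Z M \<mu>(2) m
proof (induction m arbitrary: Z)
  \<comment> \<open>No division is left: the counting hypothesis with exponent 0 contradicts |Z 0|
    \<le> M.\<close>
  case 0
  have "norm (Z 0) \<le> M" by (rule 0(2)) simp
  moreover have "M < norm (Z 0)" using 0(5) by simp
  ultimately show ?case by linarith
next
  case (Suc m)
  note Z = Suc.prems(1) and M = Suc.prems(2,3) and \<mu>' = Suc.prems(4) and m = Suc.prems(5)
  show ?case
  proof (cases "\<exists>a. norm a \<le> \<rho> \<and> Z a = 0")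
    case True
    then obtain a where a: "norm a \<le> \<rho>" "Z a = 0" by blast
    then have a1: "norm a < 1" using \<rho> by simp
    obtain k where k: "k holomorphic_on UNIV" "\<And>z. norm z \<le> 1 \<Longrightarrow> Z z = Blaschke a z * k z"
      using Blaschke_divide[OF Z a1 a(2)] by blast
    \<comment> \<open>Unimodularity on the circle and the maximum principle keep the bound
      \<open>M\<close> for \<open>k\<close> and for F * k, while \<open>F\<close> itself never
      changes.\<close>
    have circ: "norm (k z) = norm (Z z)" if "norm z = 1" for z
      using k(2)[of z] that Blaschke_norm_eq[OF a1 that] by (simp add: norm_mult)
    have "norm (Z 0) = norm a * norm (k 0)" using k(2)[of 0] by (simp add: Blaschke_def norm_mult)
    then have Z0: "norm (Z 0) \<le> \<rho> * norm (k 0)" using a(1) by (simp add: mult_right_mono)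
    show ?thesis
    proof (rule Suc.IH[OF k(1)])
      show "norm (k z) \<le> M" if "norm z \<le> 1" for z
        by (rule norm_bound_from_unit_circle[OF k(1) _ that]) (use circ M(1) in auto)
      show "norm (F z * k z) \<le> M" if "norm z \<le> 1" for z
        by (rule norm_bound_from_unit_circle[OF _ _ that]) (use circ M(2) in \<open>auto intro!: holomorphic_intros F k simp: norm_mult\<close>)
      have "\<rho> * norm (k 0) \<le> 1 * norm (k 0)" using \<rho> by (intro mult_right_mono) auto
      then show "\<mu> \<le> norm (k 0)" using Z0 \<mu>' by linarith
      have "\<rho> * (\<rho> ^ m * M) < \<rho> * norm (k 0)" using m Z0 by (simp add: mult.assoc)
      then show "\<rho> ^ m * M < norm (k 0)" using \<rho> by simp
    qed
  next
    case False
    \<comment> \<open>Rescaling by \<rho> moves the zero-free disc onto the unit disc; the 2 in 2 M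
      makes |u| < 1 strict.\<close>
    define u where "u z = Z (of_real \<rho> * z) / of_real (2 * M)" for z
    have M0: "M > 0" using M(1)[of 0] \<mu>(1) \<mu>' by simp
    have rz: "norm (of_real \<rho> * z) \<le> \<rho>" if "norm z < 1" for z :: complex
      using that \<rho> by (simp add: norm_mult)
    have uh: "u holomorphic_on ball 0 1"
    proof -
      have "(Z \<circ> (\<lambda>z. of_real \<rho> * z)) holomorphic_on ball 0 1"
        by (rule holomorphic_on_compose) (auto intro!: holomorphic_intros holomorphic_on_subset[OF Z])
      then show ?thesis unfolding u_def using M0 by (intro holomorphic_intros) (auto simp: o_def)
    qed
    have u1: "norm (u z) < 1" if "norm z < 1" for z
      using M(1)[of "of_real \<rho> * z"] rz[OF that] \<rho> M0 by (simp add: u_def norm_divide)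
    have u0: "u z \<noteq> 0" if "norm z < 1" for z
      using False rz[OF that] M0 by (auto simp: u_def)
    define v where "v = w / of_real \<rho>"
    have nv: "norm v = norm w / \<rho>" using \<rho> by (simp add: v_def norm_divide)
    have v: "norm v < 1" using w \<rho> by (simp add: nv)
    have wv: "w = of_real \<rho> * v" using \<rho> by (simp add: v_def)
    define \<kappa> where "\<kappa> = (\<rho> + norm w) / (\<rho> - norm w)"
    have \<kappa>: "(1 + norm v) / (1 - norm v) = \<kappa>" unfolding nv \<kappa>_def using \<rho> w by (simp add: field_simps)
    have \<kappa>0: "\<kappa> \<ge> 0" unfolding \<kappa>_def using w \<rho> by (intro divide_nonneg_nonneg) auto
    have H: "norm (u v) \<ge> norm (u 0) powr \<kappa>" using Harnack_disc[OF uh u0 u1 v] by (simp add: \<kappa>)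
    have uu: "norm (u 0) = norm (Z 0) / (2 * M)" "norm (u v) = norm (Z w) / (2 * M)"
      using M0 by (auto simp: u_def wv norm_divide)
    have Zw: "norm (Z w) > 0" using False w by auto
    have "norm (F w) * norm (Z w) \<le> M" using M(2)[of w] w \<rho> by (simp add: norm_mult)
    then have "norm (F w) \<le> M / norm (Z w)" using Zw by (simp add: field_simps)
    also have "\<dots> \<le> (2 * M) / norm (Z w)" using M0 by (intro divide_right_mono) auto
    also have "\<dots> = inverse (norm (u v))" unfolding uu using M0 by simp
    also have "\<dots> \<le> inverse (norm (u 0) powr \<kappa>)"
      using H u0[of 0] by (intro le_imp_inverse_le) auto
    also have "\<dots> = (inverse (norm (u 0))) powr \<kappa>"
      using u0[of 0] by (simp add: inverse_powr)
    also have "inverse (norm (u 0)) = 2 * M / norm (Z 0)" unfolding uu by simp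
    also have "(2 * M / norm (Z 0)) powr \<kappa> \<le> (2 * M / \<mu>) powr \<kappa>"
    proof -
      have "0 < norm (Z 0)" using \<mu>(1) \<mu>' by linarith
      then show ?thesis using \<mu>(1) \<mu>' M0 \<kappa>0 by (intro powr_mono2 divide_left_mono mult_pos_pos) auto
    qed
    finally show ?thesis by (simp add: \<kappa>_def)
  qed
qed

text \<open>Rescaled to the unit disc, with \<rho> = 2/3: for |v| \<le> 1/3 the Harnack exponent is
  at most (2/3 + 1/3) / (2/3 - 1/3) = 3. The number of divisions is finite but does not enter the
  bound.\<close>

lemma quotient_bound_disc:
  assumes F: "F holomorphic_on UNIV" and Z: "Z holomorphic_on UNIV" and R: "R > 0"
    and M: "\<And>z. z \<in> cball c R \<Longrightarrow> norm (Z z) \<le> M" "\<And>z. z \<in> cball c R \<Longrightarrow> norm (F z * Z z) \<le> M"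
    and Zc: "Z c \<noteq> 0" and w: "norm (w - c) \<le> R / 3"
  shows "norm (F w) \<le> (2 * M / norm (Z c)) ^ 3"
proof -
  define h where "h z = c + of_real R * z" for z
  have hh: "h holomorphic_on UNIV" unfolding h_def by (intro holomorphic_intros)
  have hb: "h z \<in> cball c R" if "norm z \<le> 1" for z
    using that R by (simp add: h_def dist_norm norm_mult)
  have comp: "(\<lambda>z. f (h z)) holomorphic_on UNIV" if "f holomorphic_on UNIV" for f
    using holomorphic_on_compose_gen[OF hh that] by (simp add: o_def)
  define v where "v = (w - c) / of_real R"
  have hv: "h v = w" using R by (simp add: h_def v_def)
  have nv: "norm v \<le> 1/3" using w R by (simp add: v_def norm_divide field_simps)
  have Z0: "norm (Z (h 0)) > 0" "h 0 = c" using Zc by (auto simp: h_def)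
  have MZ: "norm (Z c) \<le> M" using M(1)[of c] R by simp
  have "(\<lambda>m. (2/3) ^ m * M) \<longlonglongrightarrow> 0 * M" by (intro tendsto_intros LIMSEQ_power_zero) auto
  then have "eventually (\<lambda>m. (2/3) ^ m * M < norm (Z (h 0))) sequentially"
    using Z0(1) by (intro order_tendstoD(2)) auto
  then obtain m where m: "(2/3) ^ m * M < norm (Z (h 0))" by (auto simp: eventually_sequentially)
  have "norm (F (h v)) \<le> (2 * M / norm (Z (h 0))) powr ((2/3 + norm v) / (2/3 - norm v))"
    by (rule quotient_bound_unit_disc[OF comp[OF F] comp[OF Z] _ _ Z0(1) order_refl _ _ m]) (use M hb nv in auto)
  also have "\<dots> \<le> (2 * M / norm (Z (h 0))) powr 3"
  proof (rule powr_mono)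
    show "(2/3 + norm v) / (2/3 - norm v) \<le> 3" using nv by (simp add: divide_le_eq)
    have "norm (Z c) \<le> 2 * M" using MZ norm_ge_zero[of "Z c"] by linarith
    then show "1 \<le> 2 * M / norm (Z (h 0))" using Zc by (simp add: Z0(2) le_divide_eq)
  qed
  also have "\<dots> = (2 * M / norm (Z c)) ^ 3"
  proof -
    have "0 < norm (Z c)" using Zc by simp
    moreover from this have "0 < M" using MZ by linarith
    ultimately have "0 < 2 * M / norm (Z c)" by simp
    then show ?thesis unfolding Z0(2) by (subst powr_numeral) auto
  qed
  finally show ?thesis by (simp add: hv)
qed

text \<open>The multiplier exp (e z^2) decays like exp (- e (Im z)^2) in the strip and beats the
  exponential growth on the horizontal sides of a high rectangle. Its cost, the factor exp (e K),
  disappears as e tends to 0.\<close>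

lemma Phragmen_Lindelof_strip:
  assumes F: "F holomorphic_on UNIV"
    and edge: "\<And>w. Re w = a \<or> Re w = b \<Longrightarrow> norm (F w) \<le> C"
    and growth: "\<And>w. a \<le> Re w \<Longrightarrow> Re w \<le> b \<Longrightarrow> norm (F w) \<le> B * exp (B * \<bar>Im w\<bar>)"
    and w: "a \<le> Re w" "Re w \<le> b"
  shows "norm (F w) \<le> C"
proof -
  define K where "K = max (a\<^sup>2) (b\<^sup>2)"
  have C0: "C \<ge> 0" using edge[of "of_real a"] norm_ge_zero order_trans by (metis Re_complex_of_real)
  have K0: "K \<ge> 0" by (simp add: K_def le_max_iff_disj)
  have reK: "(Re z)\<^sup>2 \<le> K" if "a \<le> Re z" "Re z \<le> b" for z
  proof (cases "Re z \<ge> 0")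
    case True
    then have "(Re z)\<^sup>2 \<le> b\<^sup>2" using that by (intro power_mono) auto
    then show ?thesis by (simp add: K_def)
  next
    case False
    then have "(- Re z)\<^sup>2 \<le> (- a)\<^sup>2" using that by (intro power_mono) auto
    then show ?thesis by (simp add: K_def)
  qed
  have ne: "norm (exp (of_real e * z\<^sup>2)) \<le> exp (e * K) * exp (- e * (Im z)\<^sup>2)" if "e > 0" "a \<le> Re z" "Re z \<le> b" for e z
  proof -
    have "e * (Re z)\<^sup>2 \<le> e * K" using reK[OF that(2,3)] that(1) by (intro mult_left_mono) auto
    moreover have "Re (of_real e * z\<^sup>2) = e * (Re z)\<^sup>2 - e * (Im z)\<^sup>2" by (simp add: power2_eq_square algebra_simps)
    ultimately show ?thesis by (simp flip: exp_add)
  qed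
  have main: "norm (F w * exp (of_real e * w\<^sup>2)) \<le> (C + e) * exp (e * K)" if e: "e > 0" for e
  proof -
    \<comment> \<open>High enough for e Y \<ge> |B| + 1, hence B Y - e Y^2 \<le> - Y, which keeps
      the contribution of the horizontal sides below e up to the factor exp (e K).\<close>
    define Y where "Y = \<bar>Im w\<bar> + 1 + (\<bar>B\<bar> + 1) / e"
    have Y1: "Y \<ge> \<bar>Im w\<bar>" and Y2: "Y \<ge> (\<bar>B\<bar> + 1) / e" and Y0: "Y > 0"
      using e by (auto simp: Y_def intro!: add_nonneg_pos add_nonneg_nonneg divide_nonneg_pos)
    have small: "B * exp (B * Y) * exp (- e * Y\<^sup>2) \<le> e"
    proof -
      have eY: "\<bar>B\<bar> + 1 \<le> e * Y" using Y2 e by (simp add: divide_le_eq mult.commute)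
      have "(\<bar>B\<bar> + 1) * Y \<le> (e * Y) * Y" using Y0 eY by (intro mult_right_mono) auto
      moreover have "B * Y \<le> \<bar>B\<bar> * Y" using Y0 by (intro mult_right_mono) auto
      ultimately have "B * Y + - e * Y\<^sup>2 \<le> - Y" by (simp add: power2_eq_square algebra_simps)
      then have "\<bar>B\<bar> * exp (B * Y + - e * Y\<^sup>2) \<le> \<bar>B\<bar> * exp (- Y)" by (intro mult_left_mono) auto
      moreover have "\<bar>B\<bar> * exp (- Y) \<le> e"
      proof -
        have "\<bar>B\<bar> \<le> e * Y" using eY by simp
        also have "Y \<le> exp Y" using exp_ge_add_one_self[of Y] by linarith
        then have "e * Y \<le> e * exp Y" using e by (intro mult_left_mono) auto
        finally show ?thesis by (simp add: exp_minus field_simps)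
      qed
      moreover have "B * exp (B * Y) * exp (- e * Y\<^sup>2) \<le> \<bar>B\<bar> * exp (B * Y + - e * Y\<^sup>2)"
        unfolding exp_add mult.assoc by (intro mult_right_mono) auto
      ultimately show ?thesis by linarith
    qed
    let ?S = "cbox (Complex a (- Y)) (Complex b Y)"
    let ?f = "\<lambda>z. F z * exp (of_real e * z\<^sup>2)"
    have fh: "?f holomorphic_on UNIV" by (intro holomorphic_intros F)
    show ?thesis
    proof (rule maximum_modulus_frontier[of ?f ?S])
      show "?f holomorphic_on interior ?S" using fh by (rule holomorphic_on_subset) auto
      show "continuous_on (closure ?S) ?f" by (rule continuous_on_subset[OF holomorphic_on_imp_continuous_on[OF fh]]) auto
      show "bounded ?S" by (rule bounded_cbox)
      show "w \<in> ?S" using w Y1 by (auto simp: in_cbox_complex_iff)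
      fix z assume "z \<in> frontier ?S"
      then have z: "z \<in> ?S" "z \<notin> box (Complex a (- Y)) (Complex b Y)"
        by (auto simp: frontier_def interior_cbox)
      then have zr: "a \<le> Re z" "Re z \<le> b" "\<bar>Im z\<bar> \<le> Y" by (auto simp: in_cbox_complex_iff)
      consider "Re z = a \<or> Re z = b" | "\<bar>Im z\<bar> = Y"
        using z by (auto simp: in_cbox_complex_iff in_box_complex_iff)
      then show "norm (?f z) \<le> (C + e) * exp (e * K)"
      proof cases
        case 1
        have "exp (e * K) * exp (- e * (Im z)\<^sup>2) \<le> exp (e * K) * 1" using e by (intro mult_left_mono) auto
        then have "norm (exp (of_real e * z\<^sup>2)) \<le> exp (e * K)" using ne[OF e zr(1,2)] by linarith
        then have "norm (F z) * norm (exp (of_real e * z\<^sup>2)) \<le> (C + e) * exp (e * K)"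
          using edge[OF 1] e C0 by (intro mult_mono) auto
        then show ?thesis by (simp only: norm_mult)
      next
        case 2
        have "norm (F z) * norm (exp (of_real e * z\<^sup>2)) \<le> (B * exp (B * Y)) * (exp (e * K) * exp (- e * Y\<^sup>2))"
          using growth[OF zr(1,2)] ne[OF e zr(1,2)] order_trans[OF norm_ge_zero growth[OF zr(1,2)]]
          by (intro mult_mono) (auto simp: 2 simp flip: 2)
        also have "\<dots> = (B * exp (B * Y) * exp (- e * Y\<^sup>2)) * exp (e * K)" by (simp add: mult_ac)
        also have "\<dots> \<le> (C + e) * exp (e * K)" using small C0 by (intro mult_right_mono) auto
        finally show ?thesis by (simp only: norm_mult)
      qed
    qed
  qed
  have "((\<lambda>e. norm (F w * exp (of_real e * w\<^sup>2))) \<longlongrightarrow> norm (F w * exp (of_real 0 * w\<^sup>2))) (at_right 0)"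
    by (intro tendsto_intros)
  moreover have "((\<lambda>e. (C + e) * exp (e * K)) \<longlongrightarrow> (C + 0) * exp (0 * K)) (at_right 0)"
    by (intro tendsto_intros)
  moreover have "eventually (\<lambda>e. norm (F w * exp (of_real e * w\<^sup>2)) \<le> (C + e) * exp (e * K)) (at_right 0)"
    using eventually_at_right_less[of 0] by eventually_elim (rule main)
  ultimately have "norm (F w * exp (of_real 0 * w\<^sup>2)) \<le> (C + 0) * exp (0 * K)"
    by (intro tendsto_le[OF trivial_limit_at_right_real])
  then show ?thesis by simp
qed

section \<open>Zeros of the zeta function\<close>

text \<open>- ln |1 - r v| is the sum of r^n / n Re (v^n), and 3 + 4 cos x + cos 2x = 2 (1 + cos
  x)^2 makes every term of the combined series nonnegative.\<close>

lemma trigonometric_341: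
  fixes z :: complex and r :: real
  assumes z: "norm z = 1" and r: "0 \<le> r" "r < 1"
  shows "norm (1 - of_real r :: complex) ^ 3 * norm (1 - of_real r * z) ^ 4 * norm (1 - of_real r * z\<^sup>2) \<le> 1"
proof -
  have S: "(\<lambda>n. Re (of_real (r ^ n / of_nat n) * v ^ n)) sums (- ln (norm (1 - of_real r * v)))"
    and P: "norm (1 - of_real r * v) > 0" if v: "norm v = 1" for v :: complex
  proof -
    have n: "norm (- (of_real r * v)) < 1" using v r by (simp add: norm_mult)
    have ne: "1 - of_real r * v \<noteq> 0"
    proof
      assume "1 - of_real r * v = 0"
      then have "norm (of_real r * v) = 1" by simp
      then show False using v r by (simp add: norm_mult)
    qed
    then show "norm (1 - of_real r * v) > 0" by simp
    have "(\<lambda>n. (-1) ^ Suc n / of_nat n * (- (of_real r * v)) ^ n) sums Ln (1 + - (of_real r * v))"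
      by (rule Ln_series[OF n])
    then have "(\<lambda>n. - Re ((-1) ^ Suc n / of_nat n * (- (of_real r * v)) ^ n)) sums (- Re (Ln (1 + - (of_real r * v))))"
      by (intro sums_minus sums_Re)
    moreover have "- Re ((-1) ^ Suc n / of_nat n * (- (of_real r * v)) ^ n) = Re (of_real (r ^ n / of_nat n) * v ^ n)" for n
    proof -
      have m: "(-1::complex) ^ Suc n * (-1) ^ n = -1" by (simp flip: power_mult_distrib)
      have "(-1) ^ Suc n / of_nat n * (- (of_real r * v)) ^ n = ((-1) ^ Suc n * (-1) ^ n) * ((of_real r * v) ^ n / of_nat n)"
        by (subst power_minus) simp
      also have "\<dots> = - (of_real (r ^ n / of_nat n) * v ^ n)" unfolding m by (simp add: power_mult_distrib)
      finally have e: "(-1) ^ Suc n / of_nat n * (- (of_real r * v)) ^ n = - (of_real (r ^ n / of_nat n) * v ^ n)" .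
      show ?thesis unfolding e by simp
    qed
    moreover have "Re (Ln (1 + - (of_real r * v))) = ln (norm (1 - of_real r * v))" using ne by (subst Re_Ln) auto
    ultimately show "(\<lambda>n. Re (of_real (r ^ n / of_nat n) * v ^ n)) sums (- ln (norm (1 - of_real r * v)))" by (simp only:)
  qed
  have z2: "norm (z\<^sup>2) = 1" using z by (simp add: norm_power)
  note S1 = S[of 1] and S2 = S[OF z] and S3 = S[OF z2]
  have S123: "(\<lambda>n. 3 * Re (of_real (r ^ n / of_nat n) * 1 ^ n) + 4 * Re (of_real (r ^ n / of_nat n) * z ^ n) + Re (of_real (r ^ n / of_nat n) * (z\<^sup>2) ^ n))
     sums (3 * (- ln (norm (1 - of_real r * 1 :: complex))) + 4 * (- ln (norm (1 - of_real r * z))) + (- ln (norm (1 - of_real r * z\<^sup>2))))"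
    by (intro sums_add sums_mult S1 S2 S3) simp
  have nn: "0 \<le> 3 * Re (of_real (r ^ n / of_nat n) * 1 ^ n) + 4 * Re (of_real (r ^ n / of_nat n) * z ^ n) + Re (of_real (r ^ n / of_nat n) * (z\<^sup>2) ^ n)" for n
  proof -
    have rm: "Re (of_real a * w) = a * Re w" for a w by simp
    define c where "c = Re (z ^ n)"
    have "norm (z ^ n) = 1" using z by (simp add: norm_power)
    then have "(Re (z ^ n))\<^sup>2 + (Im (z ^ n))\<^sup>2 = 1" by (simp add: cmod_power2[symmetric])
    moreover have "(z\<^sup>2) ^ n = (z ^ n)\<^sup>2" by (simp add: power_mult[symmetric] mult.commute)
    ultimately have "Re ((z\<^sup>2) ^ n) = 2 * c\<^sup>2 - 1" by (simp add: Re_power2 c_def)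
    moreover have "3 * (a * 1) + 4 * (a * c) + a * (2 * c\<^sup>2 - 1) = a * (2 * (1 + c)\<^sup>2)" for a
      by (simp add: power2_eq_square algebra_simps)
    ultimately have "3 * Re (of_real (r ^ n / of_nat n) * 1 ^ n) + 4 * Re (of_real (r ^ n / of_nat n) * z ^ n) + Re (of_real (r ^ n / of_nat n) * (z\<^sup>2) ^ n)
       = (r ^ n / of_nat n) * (2 * (1 + c)\<^sup>2)"
      unfolding rm c_def[symmetric] by (simp only: power_one one_complex.sel)
    also have "\<dots> \<ge> 0" using r by simp
    finally show ?thesis .
  qed
  have "0 \<le> 3 * (- ln (norm (1 - of_real r * 1 :: complex))) + 4 * (- ln (norm (1 - of_real r * z))) + (- ln (norm (1 - of_real r * z\<^sup>2)))"
    by (rule sums_le[OF nn sums_zero S123])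
  then have "3 * ln (norm (1 - of_real r :: complex)) + 4 * ln (norm (1 - of_real r * z)) + ln (norm (1 - of_real r * z\<^sup>2)) \<le> 0" by simp
  moreover have "ln (norm (1 - of_real r :: complex) ^ 3 * norm (1 - of_real r * z) ^ 4 * norm (1 - of_real r * z\<^sup>2))
     = 3 * ln (norm (1 - of_real r :: complex)) + 4 * ln (norm (1 - of_real r * z)) + ln (norm (1 - of_real r * z\<^sup>2))"
    using P[of 1] P[OF z] P[OF z2] by (simp add: ln_mult ln_realpow)
  ultimately have "ln (norm (1 - of_real r :: complex) ^ 3 * norm (1 - of_real r * z) ^ 4 * norm (1 - of_real r * z\<^sup>2)) \<le> 0" by simp
  moreover have "0 < norm (1 - of_real r :: complex) ^ 3 * norm (1 - of_real r * z) ^ 4 * norm (1 - of_real r * z\<^sup>2)"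
    using P[of 1] P[OF z] P[OF z2] by simp
  ultimately show ?thesis by (simp only: ln_le_zero_iff)
qed

section \<open>Euler factors by sifting and the zero-free half-plane\<close>

definition sifted :: "nat set \<Rightarrow> nat set" where
  "sifted P = {n. n > 0 \<and> (\<forall>p\<in>P. \<not> p dvd n)}"

lemma of_nat_powr_mult: "(of_nat (m * n) :: complex) powr s = of_nat m powr s * of_nat n powr s"
  using powr_times_real[of "of_nat m" "of_nat n" s] by simp

lemma Dirichlet_summable_on:
  assumes "Re s > 1"
  shows "(\<lambda>n. of_nat n powr (- s) :: complex) summable_on A"
    and "(\<lambda>n. norm (of_nat n powr (- s) :: complex)) summable_on A"
proof -
  have "summable (\<lambda>n. norm (of_nat n powr (- s) :: complex))"
    using summable_norm_Dirichlet[OF assms] by (subst (asm) summable_Suc_iff)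
  then have "(\<lambda>n. norm (of_nat n powr (- s) :: complex)) summable_on UNIV"
    by (intro norm_summable_imp_summable_on) simp
  then show 2: "(\<lambda>n. norm (of_nat n powr (- s) :: complex)) summable_on A" for A
    by (rule summable_on_subset_banach) simp
  show "(\<lambda>n. of_nat n powr (- s) :: complex) summable_on A"
    by (rule abs_summable_summable) (rule 2)
qed

lemma Dirichlet_zeta_infsum:
  assumes "Re s > 1"
  shows "Dirichlet_zeta s = (\<Sum>\<^sub>\<infinity>n\<in>sifted {}. of_nat n powr (- s))"
proof -
  have eq: "sifted {} = range Suc"
    by (auto simp: sifted_def image_iff) (metis Suc_pred)
  have sm: "summable (\<lambda>n. norm (of_nat (Suc n) powr (- s) :: complex))" by (rule summable_norm_Dirichlet[OF assms])
  have "((\<lambda>n. of_nat (Suc n) powr (- s) :: complex) has_sum Dirichlet_zeta s) UNIV"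
    unfolding Dirichlet_zeta_def
    by (rule norm_summable_imp_has_sum[OF sm summable_sums[OF summable_norm_cancel[OF sm]]])
  then have "infsum (\<lambda>n. of_nat (Suc n) powr (- s) :: complex) UNIV = Dirichlet_zeta s" by (rule infsumI)
  moreover have "infsum (\<lambda>n. of_nat n powr (- s) :: complex) (range Suc) = infsum (\<lambda>n. of_nat (Suc n) powr (- s)) UNIV"
    by (subst infsum_reindex) (auto simp: o_def)
  ultimately show ?thesis unfolding eq by simp
qed

text \<open>Euler's argument: the factor 1 - q^(-s) removes the multiples of q from the series,
  because multiplication by q maps the previously sifted set onto exactly those members that q
  divides.\<close>

lemma sifted_Dirichlet:
  assumes s: "Re s > 1" and P: "finite P" "\<And>p. p \<in> P \<Longrightarrow> prime p"
  shows "Dirichlet_zeta s * (\<Prod>p\<in>P. 1 - of_nat p powr (- s)) = (\<Sum>\<^sub>\<infinity>n\<in>sifted P. of_nat n powr (- s))"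
  using P
proof (induction P rule: finite_induct)
  case empty
  then show ?case by (simp add: Dirichlet_zeta_infsum[OF s])
next
  case (insert q P)
  let ?f = "\<lambda>n. of_nat n powr (- s) :: complex"
  have q: "prime q" and P: "\<And>p. p \<in> P \<Longrightarrow> prime p" using insert.prems by auto
  have q0: "q > 0" using q by (rule prime_gt_0_nat)
  have split: "sifted P = sifted (insert q P) \<union> (\<lambda>n. q * n) ` sifted P"
  proof (intro equalityI subsetI)
    fix n assume n: "n \<in> sifted P"
    show "n \<in> sifted (insert q P) \<union> (\<lambda>n. q * n) ` sifted P"
    proof (cases "q dvd n")
      case True
      then obtain m where m: "n = q * m" by auto
      then have "m \<in> sifted P" using n by (auto simp: sifted_def)
      then show ?thesis using m by blast
    next
      case False
      then show ?thesis using n by (auto simp: sifted_def)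
    qed
  next
    fix n assume "n \<in> sifted (insert q P) \<union> (\<lambda>n. q * n) ` sifted P"
    then show "n \<in> sifted P"
    proof
      assume "n \<in> (\<lambda>n. q * n) ` sifted P"
      then obtain m where m: "m \<in> sifted P" "n = q * m" by blast
      have "\<not> p dvd n" if p: "p \<in> P" for p
      proof
        assume "p dvd n"
        then have "p dvd q \<or> p dvd m" using P[OF p] m by (simp add: prime_dvd_mult_iff)
        then have "p dvd q" using m p by (auto simp: sifted_def)
        then have "p = q" using P[OF p] q primes_dvd_imp_eq by blast
        then show False using p insert.hyps by simp
      qed
      then show ?thesis using m q0 by (auto simp: sifted_def)
    qed (auto simp: sifted_def)
  qed
  have disj: "sifted (insert q P) \<inter> (\<lambda>n. q * n) ` sifted P = {}" by (auto simp: sifted_def)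
  have "infsum ?f (sifted P) = infsum ?f (sifted (insert q P)) + infsum ?f ((\<lambda>n. q * n) ` sifted P)"
    by (subst split) (intro infsum_Un_disjoint disj Dirichlet_summable_on s)
  also have "infsum ?f ((\<lambda>n. q * n) ` sifted P) = infsum (\<lambda>n. ?f (q * n)) (sifted P)"
    by (subst infsum_reindex) (use q0 in \<open>auto simp: inj_on_def o_def\<close>)
  also have "\<dots> = ?f q * infsum ?f (sifted P)"
    unfolding of_nat_powr_mult by (rule infsum_cmult_right) (intro Dirichlet_summable_on s)
  finally have "infsum ?f (sifted (insert q P)) = infsum ?f (sifted P) * (1 - ?f q)" by (simp add: algebra_simps)
  then show ?case using insert.IH[OF P] insert.hyps by (simp add: mult_ac)
qed

text \<open>After sifting by all primes up to N there remain 1 and integers larger than N, whose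
  contribution is dominated by a tail of the series.\<close>

lemma sifted_tendsto_1:
  assumes s: "Re s > 1"
  shows "(\<lambda>N. \<Sum>\<^sub>\<infinity>n\<in>sifted {p. prime p \<and> p \<le> N}. of_nat n powr (- s) :: complex) \<longlonglongrightarrow> 1"
proof -
  let ?f = "\<lambda>n. of_nat n powr (- s) :: complex"
  define g where "g n = norm (?f n)" for n
  have sg: "summable g"
    using summable_norm_Dirichlet[OF s] unfolding g_def by (subst (asm) summable_Suc_iff)
  have gN: "(\<lambda>N. \<Sum>n. g (n + Suc N)) \<longlonglongrightarrow> 0"
    using LIMSEQ_Suc[OF suminf_exist_split2[OF sg]] by simp
  have bound: "norm ((\<Sum>\<^sub>\<infinity>n\<in>sifted {p. prime p \<and> p \<le> N}. ?f n) - 1) \<le> (\<Sum>n. g (n + Suc N))" for N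
  proof -
    let ?P = "{p. prime p \<and> p \<le> N}"
    have split: "sifted ?P = {1} \<union> (sifted ?P - {1})" by (auto simp: sifted_def)
    have sub: "sifted ?P - {1} \<subseteq> {Suc N..}"
    proof
      fix n assume n: "n \<in> sifted ?P - {1}"
      then obtain p where p: "prime p" "p dvd n" using prime_factor_nat by blast
      have "n > 0" using n by (auto simp: sifted_def)
      then have "p \<le> n" using p by (intro dvd_imp_le)
      moreover have "\<not> p \<le> N" using n p by (auto simp: sifted_def)
      ultimately show "n \<in> {Suc N..}" by simp
    qed
    have "(\<Sum>\<^sub>\<infinity>n\<in>sifted ?P. ?f n) = infsum ?f {1} + infsum ?f (sifted ?P - {1})"
      by (subst split) (intro infsum_Un_disjoint Dirichlet_summable_on s, auto)
    then have "norm ((\<Sum>\<^sub>\<infinity>n\<in>sifted ?P. ?f n) - 1) = norm (infsum ?f (sifted ?P - {1}))" by simp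
    also have "\<dots> \<le> infsum g (sifted ?P - {1})"
      unfolding g_def by (rule norm_infsum_bound) (rule Dirichlet_summable_on(2)[OF s])
    also have "\<dots> \<le> infsum g {Suc N..}"
      by (rule infsum_mono_neutral) (use sub Dirichlet_summable_on(2)[OF s] in \<open>auto simp: g_def[abs_def]\<close>)
    also have "{Suc N..} = range (\<lambda>n. n + Suc N)" 
      by (auto simp: image_def) (metis le_add_diff_inverse2 add_Suc_right)
    also have "infsum g (range (\<lambda>n. n + Suc N)) = infsum (\<lambda>n. g (n + Suc N)) UNIV"
      by (subst infsum_reindex) (auto simp: o_def inj_on_def)
    also have "\<dots> = (\<Sum>n. g (n + Suc N))"
    proof -
      have "norm (g n) = g n" for n by (simp add: g_def)
      then have "summable (\<lambda>n. norm (g (n + Suc N)))"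
        using summable_ignore_initial_segment[OF sg, of "Suc N"] by (simp only:)
      then have "((\<lambda>n. g (n + Suc N)) has_sum (\<Sum>n. g (n + Suc N))) UNIV"
        by (rule norm_summable_imp_has_sum[OF _ summable_sums[OF summable_ignore_initial_segment[OF sg]]])
      then show ?thesis by (rule infsumI)
    qed
    finally show ?thesis .
  qed
  have "(\<lambda>N. (\<Sum>\<^sub>\<infinity>n\<in>sifted {p. prime p \<and> p \<le> N}. ?f n) - 1) \<longlonglongrightarrow> 0"
    by (rule Lim_null_comparison[OF always_eventually gN]) (use bound in auto)
  then show ?thesis by (simp add: LIM_zero_iff)
qed

text \<open>Each prime contributes a factor at most 1, by \<open>trigonometric_341\<close> with r =
  p^(-\<sigma>) and z = p^(-it). The finite products times the Dirichlet series tend to 1, which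
  turns this into a lower bound for the series.\<close>

lemma Dirichlet_zeta_341:
  assumes \<sigma>: "\<sigma> > 1"
  shows "1 \<le> norm (Dirichlet_zeta (of_real \<sigma>)) ^ 3 * norm (Dirichlet_zeta (Complex \<sigma> t)) ^ 4 * norm (Dirichlet_zeta (Complex \<sigma> (2 * t)))"
    (is "1 \<le> ?D")
proof -
  define f where "f s N = (\<Sum>\<^sub>\<infinity>n\<in>sifted {p. prime p \<and> p \<le> N}. of_nat n powr (- s) :: complex)" for s N
  define Q where "Q s N = (\<Prod>p\<in>{p. prime p \<and> p \<le> N}. 1 - of_nat p powr (- s) :: complex)" for s and N :: nat
  have re: "Re (of_real \<sigma>) > 1" "Re (Complex \<sigma> t) > 1" "Re (Complex \<sigma> (2 * t)) > 1" using \<sigma> by auto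
  have fQ: "f s N = Dirichlet_zeta s * Q s N" if "Re s > 1" for s N
    unfolding f_def Q_def by (rule sifted_Dirichlet[symmetric, OF that]) auto
  have le: "norm (f (of_real \<sigma>) N) ^ 3 * norm (f (Complex \<sigma> t) N) ^ 4 * norm (f (Complex \<sigma> (2 * t)) N) \<le> ?D" for N
  proof -
    have "norm (Q (of_real \<sigma>) N) ^ 3 * norm (Q (Complex \<sigma> t) N) ^ 4 * norm (Q (Complex \<sigma> (2 * t)) N)
       = (\<Prod>p\<in>{p. prime p \<and> p \<le> N}. norm (1 - of_nat p powr (- of_real \<sigma>) :: complex) ^ 3 * norm (1 - of_nat p powr (- Complex \<sigma> t) :: complex) ^ 4 * norm (1 - of_nat p powr (- Complex \<sigma> (2 * t)) :: complex))"
      unfolding Q_def prod_norm[symmetric] by (simp add: prod.distrib prod_power_distrib)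
    also have "\<dots> \<le> 1"
    proof (rule prod_le_1)
      fix p assume "p \<in> {p. prime p \<and> p \<le> N}"
      then have p: "p > 1" using prime_gt_1_nat by auto
      define r where "r = real p powr (- \<sigma>)"
      define z where "z = exp (- \<i> * of_real (t * ln (real p)))"
      have r: "0 \<le> r" "r < 1" using p \<sigma> by (auto simp: r_def powr_less_one)
      have z: "norm z = 1" by (simp add: z_def)
      have pw: "(of_nat p :: complex) powr (- Complex \<sigma> y) = of_real r * exp (- \<i> * of_real (y * ln (real p)))" for y
      proof -
        have "(of_nat p :: complex) powr (- Complex \<sigma> y) = exp (- Complex \<sigma> y * of_real (ln (real p)))"
          using p Ln_of_real[of "real p"] by (simp add: powr_def)
        also have "- Complex \<sigma> y * of_real (ln (real p)) = of_real (- \<sigma> * ln (real p)) + (- \<i> * of_real (y * ln (real p)))"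
          by (simp add: complex_eq_iff)
        also have "exp \<dots> = of_real r * exp (- \<i> * of_real (y * ln (real p)))"
          unfolding exp_add exp_of_real using p by (simp add: r_def powr_def)
        finally show ?thesis .
      qed
      have p1: "(of_nat p :: complex) powr (- of_real \<sigma>) = of_real r"
      proof -
        have c: "complex_of_real \<sigma> = Complex \<sigma> 0" by (simp add: complex_eq_iff)
        show ?thesis unfolding c pw by simp
      qed
      have p2: "(of_nat p :: complex) powr (- Complex \<sigma> t) = of_real r * z" by (simp add: pw z_def)
      have p3: "(of_nat p :: complex) powr (- Complex \<sigma> (2 * t)) = of_real r * z\<^sup>2"
        by (simp add: pw z_def exp_double[symmetric] mult_ac)
      show "0 \<le> norm (1 - of_nat p powr (- of_real \<sigma>) :: complex) ^ 3 * norm (1 - of_nat p powr (- Complex \<sigma> t) :: complex) ^ 4 * norm (1 - of_nat p powr (- Complex \<sigma> (2 * t)) :: complex)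
        \<and> norm (1 - of_nat p powr (- of_real \<sigma>) :: complex) ^ 3 * norm (1 - of_nat p powr (- Complex \<sigma> t) :: complex) ^ 4 * norm (1 - of_nat p powr (- Complex \<sigma> (2 * t)) :: complex) \<le> 1"
        unfolding p1 p2 p3 using trigonometric_341[OF z r] by simp
    qed
    finally have "?D * (norm (Q (of_real \<sigma>) N) ^ 3 * norm (Q (Complex \<sigma> t) N) ^ 4 * norm (Q (Complex \<sigma> (2 * t)) N)) \<le> ?D * 1"
      by (intro mult_left_mono) auto
    then show ?thesis unfolding fQ[OF re(1)] fQ[OF re(2)] fQ[OF re(3)]
      by (simp add: norm_mult power_mult_distrib mult_ac)
  qed
  have "(\<lambda>N. norm (f (of_real \<sigma>) N) ^ 3 * norm (f (Complex \<sigma> t) N) ^ 4 * norm (f (Complex \<sigma> (2 * t)) N)) \<longlonglongrightarrow> norm (1::complex) ^ 3 * norm (1::complex) ^ 4 * norm (1::complex)"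
    unfolding f_def by (intro tendsto_intros sifted_tendsto_1 re)
  then have "norm (1::complex) ^ 3 * norm (1::complex) ^ 4 * norm (1::complex) \<le> ?D"
    by (rule LIMSEQ_le_const2) (use le in auto)
  then show ?thesis by simp
qed

lemma Dirichlet_zeta_norm_le:
  assumes \<sigma>: "1 < \<sigma>" "\<sigma> \<le> Re s"
  shows "norm (Dirichlet_zeta s) \<le> norm (Dirichlet_zeta (of_real \<sigma>))"
proof -
  have n: "norm (of_nat (Suc n) powr (- w) :: complex) = real (Suc n) powr (- Re w)" for n w
    using norm_powr_real_powr[of "of_nat (Suc n)" "- w"] by simp
  have s: "Re s > 1" and s': "Re (complex_of_real \<sigma>) > 1" using \<sigma> by auto
  have sm: "summable (\<lambda>n. real (Suc n) powr (- \<sigma>))" using summable_norm_Dirichlet[OF s'] unfolding n by simp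
  have "norm (Dirichlet_zeta s) \<le> (\<Sum>n. norm (of_nat (Suc n) powr (- s) :: complex))"
    unfolding Dirichlet_zeta_def by (rule summable_norm[OF summable_norm_Dirichlet[OF s]])
  also have "\<dots> \<le> (\<Sum>n. real (Suc n) powr (- \<sigma>))"
    using summable_norm_Dirichlet[OF s] sm \<sigma> unfolding n by (intro suminf_le powr_mono) auto
  also have "\<dots> \<le> \<bar>\<Sum>n. real (Suc n) powr (- \<sigma>)\<bar>" by simp
  also have "\<dots> = norm (Dirichlet_zeta (of_real \<sigma>))"
  proof -
    have "(of_nat (Suc n) :: complex) powr (- of_real \<sigma>) = of_real (real (Suc n) powr (- \<sigma>))" for n
      by (subst powr_of_real[symmetric]) auto
    then have "Dirichlet_zeta (of_real \<sigma>) = of_real (\<Sum>n. real (Suc n) powr (- \<sigma>))"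
      unfolding Dirichlet_zeta_def by (simp only: suminf_of_real[OF sm])
    then show ?thesis by (simp only: norm_of_real)
  qed
  finally show ?thesis .
qed

text \<open>In the 3-4-1 inequality the factors at the real point and at twice the height are at
  most \<zeta>(\<sigma>), which leaves a fourth power. The resulting lower bound is uniform in the
  height.\<close>

lemma Dirichlet_zeta_norm_ge:
  assumes \<sigma>: "1 < \<sigma>" "\<sigma> \<le> Re s"
  shows "1 \<le> norm (Dirichlet_zeta s) * norm (Dirichlet_zeta (of_real \<sigma>))"
proof -
  define d where "d = norm (Dirichlet_zeta (of_real \<sigma>))"
  define x where "x = norm (Dirichlet_zeta s)"
  have "1 \<le> norm (Dirichlet_zeta (of_real (Re s))) ^ 3 * norm (Dirichlet_zeta (Complex (Re s) (Im s))) ^ 4 * norm (Dirichlet_zeta (Complex (Re s) (2 * Im s)))"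
    by (rule Dirichlet_zeta_341) (use \<sigma> in simp)
  also have "\<dots> \<le> d ^ 3 * x ^ 4 * d"
    unfolding d_def x_def complex_surj using \<sigma> by (intro mult_mono power_mono Dirichlet_zeta_norm_le) auto
  also have "\<dots> = (x * d) ^ 4" by (simp add: power_mult_distrib power_Suc2[symmetric] mult.assoc mult.commute[of d])
  finally have "1 ^ 4 \<le> (x * d) ^ 4" by simp
  then have "1 \<le> x * d" by (rule power_le_imp_le_base[of _ 3, simplified]) (auto simp: x_def d_def eval_nat_numeral)
  then show ?thesis by (simp add: x_def d_def)
qed

lemma completed_zeta_at_1: "completed_zeta 1 = 1"
  by (simp add: completed_zeta_def Mellin_complete_def)

text \<open>On Re s = 1 a zero would contribute (\<sigma> - 1)^4 to the 3-4-1 product, against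
  (\<sigma> - 1)^(-3) from the pole and a bounded factor at twice the height. The product would tend
  to 0 while staying at least 1.\<close>

lemma completed_zeta_nonzero:
  assumes "Re s \<ge> 1"
  shows "completed_zeta s \<noteq> 0"
proof
  assume z: "completed_zeta s = 0"
  show False
  proof (cases "Re s > 1")
    case True
    then have "Dirichlet_zeta s = 0" using arch_completed_zeta_right[OF True] z by simp
    then show False using Dirichlet_zeta_norm_ge[OF True order_refl] by simp
  next
    case False
    then have re: "Re s = 1" using assms by simp
    define t where "t = Im s"
    have s: "s = Complex 1 t" using re by (simp add: t_def complex_eq_iff)
    have t: "t \<noteq> 0"
    proof
      assume "t = 0"
      then have "s = 1" by (simp add: s complex_eq_iff)
      then show False using z completed_zeta_at_1 by simp
    qed
    define g where "g w = (if w = s then deriv completed_zeta s else (completed_zeta w - completed_zeta s) / (w - s))" for w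
    have gh: "g holomorphic_on UNIV"
      unfolding g_def by (rule pole_lemma_open[OF completed_zeta_holomorphic]) auto
    have cg: "completed_zeta w = (w - s) * g w" for w using z by (simp add: g_def)
    define A where "A w = of_real pi powr (w / 2) * rGamma (w / 2 + 1) / 2 * completed_zeta w" for w :: complex
    have Ah: "A holomorphic_on UNIV" unfolding A_def by (intro holomorphic_intros completed_zeta_holomorphic) auto
    \<comment> \<open>The 3-4-1 product with the pole and the zero made explicit; one factor
      \<sigma> - 1 is left over.\<close>
    define E where "E \<sigma> = (\<sigma> - 1) * norm (A (of_real \<sigma>)) ^ 3 * norm (arch (Complex \<sigma> t) * g (Complex \<sigma> t)) ^ 4
        * norm (arch (Complex \<sigma> (2 * t)) * completed_zeta (Complex \<sigma> (2 * t)))" for \<sigma> :: real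
    have E1: "1 \<le> E \<sigma>" if \<sigma>: "\<sigma> > 1" for \<sigma>
    proof -
      have D1: "norm (Dirichlet_zeta (of_real \<sigma>)) = norm (A (of_real \<sigma>)) / (\<sigma> - 1)"
      proof -
        have "Dirichlet_zeta (of_real \<sigma>) = A (of_real \<sigma>) / (of_real \<sigma> - 1)"
          using arch_completed_zeta_right[of "of_real \<sigma>"] \<sigma> by (simp add: A_def arch_def)
        moreover have "norm (complex_of_real \<sigma> - 1) = \<sigma> - 1"
          using \<sigma> by (metis abs_of_pos diff_gt_0_iff_gt norm_of_real of_real_1 of_real_diff)
        ultimately show ?thesis by (simp add: norm_divide)
      qed
      have D2: "norm (Dirichlet_zeta (Complex \<sigma> t)) = (\<sigma> - 1) * norm (arch (Complex \<sigma> t) * g (Complex \<sigma> t))"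
      proof -
        have "Complex \<sigma> t - s = of_real (\<sigma> - 1)" by (simp add: s complex_eq_iff)
        then have "Dirichlet_zeta (Complex \<sigma> t) = of_real (\<sigma> - 1) * (arch (Complex \<sigma> t) * g (Complex \<sigma> t))"
          using arch_completed_zeta_right[of "Complex \<sigma> t"] \<sigma> cg[of "Complex \<sigma> t"] by (simp add: mult_ac)
        then have "norm (Dirichlet_zeta (Complex \<sigma> t)) = \<bar>\<sigma> - 1\<bar> * norm (arch (Complex \<sigma> t) * g (Complex \<sigma> t))"
          by (simp only: norm_mult[of "of_real (\<sigma> - 1)"] norm_of_real)
        then show ?thesis using \<sigma> by simp
      qed
      have D3: "Dirichlet_zeta (Complex \<sigma> (2 * t)) = arch (Complex \<sigma> (2 * t)) * completed_zeta (Complex \<sigma> (2 * t))"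
        using arch_completed_zeta_right[of "Complex \<sigma> (2 * t)"] \<sigma> by simp
      have alg: "(a / h) ^ 3 * (h * b) ^ 4 * c = h * a ^ 3 * b ^ 4 * c" if "h > 0" for a b c h :: real
        using that by (simp add: field_simps eval_nat_numeral)
      have "1 \<le> norm (Dirichlet_zeta (of_real \<sigma>)) ^ 3 * norm (Dirichlet_zeta (Complex \<sigma> t)) ^ 4 * norm (Dirichlet_zeta (Complex \<sigma> (2 * t)))"
        by (rule Dirichlet_zeta_341[OF \<sigma>])
      also have "\<dots> = E \<sigma>" unfolding D1 D2 D3 E_def by (rule alg) (use \<sigma> in simp)
      finally show ?thesis .
    qed
    have c: "((\<lambda>\<sigma>. f (Complex \<sigma> y)) \<longlongrightarrow> f (Complex 1 y)) (at_right 1)" if "f holomorphic_on S" "open S" "Complex 1 y \<in> S" for f S y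
    proof -
      have "isCont f (Complex 1 y)" using that holomorphic_on_imp_continuous_on continuous_on_eq_continuous_at by blast
      moreover have "((\<lambda>\<sigma>. Complex \<sigma> y) \<longlongrightarrow> Complex 1 y) (at_right 1)" by (intro tendsto_Complex tendsto_intros)
      ultimately show ?thesis by (rule isCont_tendsto_compose)
    qed
    have ah: "(\<lambda>w. arch w * f w) holomorphic_on - {1}" if "f holomorphic_on UNIV" for f
      using that by (intro holomorphic_intros arch_holomorphic) (auto intro: holomorphic_on_subset)
    have "(E \<longlongrightarrow> (1 - 1) * norm (A (Complex 1 0)) ^ 3 * norm (arch (Complex 1 t) * g (Complex 1 t)) ^ 4
        * norm (arch (Complex 1 (2 * t)) * completed_zeta (Complex 1 (2 * t)))) (at_right 1)"
      unfolding E_def complex_of_real_def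
      by (intro tendsto_intros c[OF Ah] c[OF ah[OF gh]] c[OF ah[OF completed_zeta_holomorphic]])
        (use t in \<open>auto simp: complex_eq_iff\<close>)
    then have "(E \<longlongrightarrow> 0) (at_right 1)" by simp
    moreover have "eventually (\<lambda>\<sigma>. 1 \<le> E \<sigma>) (at_right 1)"
      using eventually_at_right_less[of 1] by eventually_elim (rule E1)
    ultimately have "1 \<le> (0::real)" by (rule tendsto_lowerbound) (rule trivial_limit_at_right_real)
    then show False by simp
  qed
qed

lemma completed_zeta_zero_strip:
  assumes "completed_zeta s = 0"
  shows "0 < Re s" "Re s < 1"
proof -
  show "0 < Re s" using completed_zeta_nonzero[of "1 - s"] assms completed_zeta_reflect[of s] by force
  show "Re s < 1" using completed_zeta_nonzero[of s] assms by force
qed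

text \<open>\<open>arch\<close> has neither zeros nor poles in the open strip, and all zeros of
  \<open>completed_zeta\<close> lie in it.\<close>

lemma nontrivial_zeros_iff: "s \<in> nontrivial_zeros \<longleftrightarrow> completed_zeta s = 0"
proof
  assume "s \<in> nontrivial_zeros"
  then have s: "0 < Re s" "Re s < 1" "riemann_zeta s = 0" by (auto simp: nontrivial_zeros_def)
  then have "s \<noteq> 1" by auto
  then show "completed_zeta s = 0" using riemann_zeta_eq[of s] arch_nonzero[of s] s by auto
next
  assume z: "completed_zeta s = 0"
  note st = completed_zeta_zero_strip[OF z]
  then have "s \<noteq> 1" by auto
  then show "s \<in> nontrivial_zeros" using riemann_zeta_eq[of s] st z by (simp add: nontrivial_zeros_def)
qed

section \<open>The fractional part integral and \<zeta> on the critical line\<close>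

lemma Laplace_bounded_integrable:
  fixes k :: "real \<Rightarrow> complex"
  assumes [measurable]: "k \<in> borel_measurable borel" and k: "\<And>u. norm (k u) \<le> 1" and s: "Re s > 0"
  shows "set_integrable lborel {0..} (\<lambda>u. k u * exp (- (of_real u * s)))"
  using integral_exp_minus_complex(1)[of "of_real (Re s)"] s unfolding set_integrable_def
  by (rule_tac Bochner_Integration.integrable_bound[where f = "\<lambda>u. indicator {0..} u *\<^sub>R exp (- (of_real u * of_real (Re s)))"])
    (auto simp: norm_mult indicator_def mult.commute intro!: mult_left_le_one_le k)

lemma Laplace_bounded_holomorphic:
  fixes k :: "real \<Rightarrow> complex"
  assumes [measurable]: "k \<in> borel_measurable borel" and k: "\<And>u. norm (k u) \<le> 1"
  shows "(\<lambda>s. LINT u:{0..}|lborel. k u * exp (- (of_real u * s))) holomorphic_on {s. Re s > 0}"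
  unfolding set_lebesgue_integral_def
proof (rule holomorphic_on_integral)
  show "open {s. Re s > 0}" by (rule open_halfspace_Re_gt)
  show "AE u in lborel. (\<lambda>s. indicator {0..} u *\<^sub>R (k u * exp (- (of_real u * s)))) holomorphic_on {s. Re s > 0}"
    by (auto intro!: holomorphic_intros simp: scaleR_conv_of_real)
  fix w0 :: complex assume w0: "w0 \<in> {s. Re s > 0}"
  define r where "r = Re w0 / 2"
  have r: "r > 0" using w0 by (simp add: r_def)
  define b where "b u = indicator {0..} u *\<^sub>R exp (- (u * r))" for u :: real
  have b: "integrable lborel b"
  proof -
    have "integrable lborel (\<lambda>u. norm (indicator {0..} u *\<^sub>R exp (- (of_real u * of_real r :: complex))))"
      using integral_exp_minus_complex(1)[of "of_real r"] r unfolding set_integrable_def by (intro integrable_norm) auto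
    then show ?thesis by (simp add: b_def[abs_def] indicator_def)
  qed
  have "norm (indicator {0..} u *\<^sub>R (k u * exp (- (of_real u * w)))) \<le> b u" if w: "w \<in> ball w0 r" for w u
  proof (cases "u \<ge> 0")
    case True
    have "Re w \<ge> r" using w abs_Re_le_cmod[of "w0 - w"] by (auto simp: dist_norm r_def)
    then have "u * r \<le> u * Re w" using True by (intro mult_left_mono)
    then have "norm (k u) * exp (- (u * Re w)) \<le> 1 * exp (- (u * r))" using k[of u] by (intro mult_mono) auto
    then show ?thesis using True by (simp add: b_def norm_mult)
  qed (simp add: b_def)
  with b r show "\<exists>r>0. \<exists>b. integrable lborel b \<and> (AE u in lborel. \<forall>w\<in>ball w0 r \<inter> {s. Re s > 0}. norm (indicator {0..} u *\<^sub>R (k u * exp (- (of_real u * w)))) \<le> b u)"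
    by (intro exI[of _ r] conjI exI[of _ b]) auto
qed measurable

lemma floor_eq_suminf_indicator:
  fixes x :: real
  assumes "x \<ge> 1"
  shows "(\<lambda>n. indicator {real (Suc n)..} x) sums (of_int \<lfloor>x\<rfloor> :: complex)"
proof -
  define N where "N = nat \<lfloor>x\<rfloor>"
  have N: "real (Suc n) \<le> x \<longleftrightarrow> n < N" for n
    unfolding N_def using assms by (simp add: zless_nat_eq_int_zless) linarith
  have "(\<lambda>n. indicator {real (Suc n)..} x :: complex) sums (\<Sum>n<N. indicator {real (Suc n)..} x)"
    by (rule sums_finite) (use N in \<open>auto simp: indicator_def\<close>)
  also have "(\<Sum>n<N. indicator {real (Suc n)..} x :: complex) = (\<Sum>n<N. 1)"
    by (intro sum.cong refl) (use N in \<open>auto simp: indicator_def\<close>)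
  also have "\<dots> = of_int \<lfloor>x\<rfloor>" using assms by (simp add: N_def)
  finally show ?thesis .
qed

text \<open>On x \<ge> 1 the floor is the sum of the indicators of [n, \<infinity>) over n \<ge> 1;
  with x = exp u, the n-th one integrates to n^(-s) / s.\<close>

lemma Dirichlet_zeta_floor:
  assumes s: "Re s > 1"
  shows "set_integrable lborel {0..} (\<lambda>u. of_int \<lfloor>exp u\<rfloor> * exp (- (of_real u * s)))"
    and "(LINT u:{0..}|lborel. of_int \<lfloor>exp u\<rfloor> * exp (- (of_real u * s))) = Dirichlet_zeta s / s"
proof -
  define F where "F n u = indicator {ln (real (Suc n))..} u *\<^sub>R exp (- (of_real u * s))" for n and u :: real
  have tr: "indicator {ln (real (Suc n))..} (ln (real (Suc n)) + 1 * u) *\<^sub>R exp (- (of_real (ln (real (Suc n)) + 1 * u) * w))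
      = of_nat (Suc n) powr (- w) * (indicator {0..} u *\<^sub>R exp (- (of_real u * w)))" for n u and w :: complex
  proof -
    have "exp (- (of_real (ln (real (Suc n)) + 1 * u) * w)) = of_nat (Suc n) powr (- w) * exp (- (of_real u * w))"
      using Ln_of_real[of "real (Suc n)"] by (simp add: powr_def exp_add[symmetric] algebra_simps del: of_nat_Suc)
    moreover have "indicator {ln (real (Suc n))..} (ln (real (Suc n)) + 1 * u) = (indicator {0..} u :: real)" by (auto simp: indicator_def)
    ultimately show ?thesis by simp
  qed
  have Fi: "integrable lborel (\<lambda>u. indicator {ln (real (Suc n))..} u *\<^sub>R exp (- (of_real u * w)))" 
    and Fv: "(LINT u|lborel. indicator {ln (real (Suc n))..} u *\<^sub>R exp (- (of_real u * w))) = of_nat (Suc n) powr (- w) / w"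
    if w: "Re w > 0" for w n
  proof -
    let ?G = "\<lambda>u. indicator {ln (real (Suc n))..} u *\<^sub>R exp (- (of_real u * w))"
    have "integrable lborel (\<lambda>u. ?G (ln (real (Suc n)) + 1 * u))"
      unfolding tr using integral_exp_minus_complex(1)[OF w] unfolding set_integrable_def by (intro integrable_mult_right)
    then show i: "integrable lborel ?G"
      using lborel_integrable_real_affine_iff[of 1 ?G "ln (real (Suc n))"] by simp
    have "(LINT u|lborel. ?G u) = (LINT u|lborel. ?G (ln (real (Suc n)) + 1 * u))"
      by (subst lborel_integral_real_affine[where c = 1 and t = "ln (real (Suc n))"]) auto
    also have "\<dots> = of_nat (Suc n) powr (- w) / w"
      unfolding tr integral_mult_right_zero using integral_exp_minus_complex(2)[OF w]
      by (simp add: set_lebesgue_integral_def del: of_nat_Suc)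
    finally show "(LINT u|lborel. ?G u) = of_nat (Suc n) powr (- w) / w" .
  qed
  have s0: "Re s > 0" and s0': "Re (complex_of_real (Re s)) > 0" using s by auto
  have nF: "(LINT u|lborel. norm (F n u)) = norm (of_nat (Suc n) powr (- s) :: complex) * (1 / Re s)" for n
  proof -
    have "complex_of_real (norm (F n u)) = indicator {ln (real (Suc n))..} u *\<^sub>R exp (- (of_real u * of_real (Re s)))" for u
      by (simp add: F_def indicator_def mult.commute flip: exp_of_real)
    then have "complex_of_real (LINT u|lborel. norm (F n u)) = of_nat (Suc n) powr (- of_real (Re s)) / of_real (Re s)"
      using Fv[OF s0', of n] by (simp only: integral_complex_of_real[symmetric])
    then have "norm (complex_of_real (LINT u|lborel. norm (F n u))) = norm (of_nat (Suc n) powr (- s) :: complex) * (1 / Re s)"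
      using norm_powr_real_powr[of "of_nat (Suc n)" "- s"] norm_powr_real_powr[of "of_nat (Suc n)" "- of_real (Re s)"] s0
      by (simp add: norm_divide)
    moreover have "(LINT u|lborel. norm (F n u)) \<ge> 0" by simp
    ultimately show ?thesis by (simp only: norm_of_real abs_of_nonneg)
  qed
  have Fsums: "(\<lambda>n. F n u) sums (indicator {0..} u *\<^sub>R (of_int \<lfloor>exp u\<rfloor> * exp (- (of_real u * s))))"
    and Fsn: "summable (\<lambda>n. norm (F n u))" for u
  proof -
    have i: "indicator {ln (real (Suc n))..} u = (indicator {real (Suc n)..} (exp u) :: real)" for n
      using ln_le_cancel_iff[of "real (Suc n)" "exp u"] by (auto simp: indicator_def)
    show "(\<lambda>n. F n u) sums (indicator {0..} u *\<^sub>R (of_int \<lfloor>exp u\<rfloor> * exp (- (of_real u * s))))"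
    proof (cases "u \<ge> 0")
      case True
      have "(\<lambda>n. indicator {real (Suc n)..} (exp u) * exp (- (of_real u * s))) sums (of_int \<lfloor>exp u\<rfloor> * exp (- (of_real u * s)))"
        using True by (intro sums_mult2 floor_eq_suminf_indicator) simp
      moreover have "F n u = indicator {real (Suc n)..} (exp u) * exp (- (of_real u * s))" for n
        unfolding F_def i by (simp add: indicator_def)
      ultimately show ?thesis using True by simp
    next
      case False
      have "F n u = 0" for n
      proof -
        have "0 \<le> ln (real (Suc n))" by (rule ln_ge_zero) simp
        then have "\<not> ln (real (Suc n)) \<le> u" using False by linarith
        then show ?thesis by (simp add: F_def indicator_def del: of_nat_Suc)
      qed
      then show ?thesis using False by simp
    qed
    obtain N :: nat where N: "exp u < real N" using reals_Archimedean2 by blast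
    have "norm (F n u) = 0" if "n \<notin> {..<N}" for n
      using that N unfolding F_def i by (auto simp: indicator_def)
    then show "summable (\<lambda>n. norm (F n u))" by (intro summable_finite[of "{..<N}"]) auto
  qed
  have su: "summable (\<lambda>n. LINT u|lborel. norm (F n u))"
    unfolding nF by (intro summable_mult2 summable_norm_Dirichlet s)
  have Fi': "integrable lborel (F n)" for n unfolding F_def by (rule Fi[OF s0])
  have eq: "(\<lambda>u. \<Sum>n. F n u) = (\<lambda>u. indicator {0..} u *\<^sub>R (of_int \<lfloor>exp u\<rfloor> * exp (- (of_real u * s))))"
    using Fsums by (simp add: sums_iff fun_eq_iff)
  have "integrable lborel (\<lambda>u. \<Sum>n. F n u)"
    by (rule integrable_suminf[OF Fi' _ su]) (use Fsn in auto)
  then show "set_integrable lborel {0..} (\<lambda>u. of_int \<lfloor>exp u\<rfloor> * exp (- (of_real u * s)))"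
    unfolding eq set_integrable_def .
  have "(LINT u|lborel. (\<Sum>n. F n u)) = (\<Sum>n. LINT u|lborel. F n u)"
    by (rule integral_suminf[OF Fi' _ su]) (use Fsn in auto)
  also have "\<dots> = (\<Sum>n. of_nat (Suc n) powr (- s) / s)" unfolding F_def Fv[OF s0] ..
  also have "\<dots> = Dirichlet_zeta s / s"
    unfolding Dirichlet_zeta_def by (rule suminf_divide[OF summable_norm_cancel[OF summable_norm_Dirichlet[OF s]]])
  finally show "(LINT u:{0..}|lborel. of_int \<lfloor>exp u\<rfloor> * exp (- (of_real u * s))) = Dirichlet_zeta s / s"
    unfolding eq set_lebesgue_integral_def .
qed

definition frac_Laplace :: "complex \<Rightarrow> complex" where
  "frac_Laplace s = (LINT u:{0..}|lborel. of_real (frac (exp u)) * exp (- (of_real u * s)))"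

lemma frac_measurable: "(\<lambda>u. complex_of_real (frac (exp u))) \<in> borel_measurable borel"
  unfolding frac_def by measurable

lemma frac_bounded: "norm (complex_of_real (frac (exp u))) \<le> 1"
  using frac_ge_0[of "exp u"] frac_lt_1[of "exp u"] by (simp add: less_imp_le)

lemma Dirichlet_zeta_frac:
  assumes s: "Re s > 1"
  shows "Dirichlet_zeta s = s / (s - 1) - s * frac_Laplace s"
proof -
  have s1: "Re (s - 1) > 0" using s by simp
  note e = integral_exp_minus_complex[OF s1]
  have i: "set_integrable lborel {0..} (\<lambda>u. of_real (frac (exp u)) * exp (- (of_real u * s)))"
    by (rule Laplace_bounded_integrable[OF frac_measurable frac_bounded]) (use s in simp)
  have "of_int \<lfloor>exp u\<rfloor> * exp (- (of_real u * s)) = exp (- (of_real u * (s - 1))) - of_real (frac (exp u)) * exp (- (of_real u * s))" for u :: real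
  proof -
    have "exp (- (of_real u * (s - 1))) = of_real (exp u) * exp (- (of_real u * s))"
      by (simp add: algebra_simps exp_add[symmetric] flip: exp_of_real)
    then show ?thesis by (simp add: frac_def left_diff_distrib)
  qed
  then have "Dirichlet_zeta s / s = (LINT u:{0..}|lborel. exp (- (of_real u * (s - 1))) - of_real (frac (exp u)) * exp (- (of_real u * s)))"
    using Dirichlet_zeta_floor(2)[OF s] by simp
  also have "\<dots> = 1 / (s - 1) - frac_Laplace s"
    unfolding frac_Laplace_def e(2)[symmetric] by (rule set_integral_diff(2)[OF e(1) i])
  finally have "s * (Dirichlet_zeta s / s) = s * (1 / (s - 1) - frac_Laplace s)" by simp
  moreover have "s \<noteq> 0" using s by auto
  ultimately show ?thesis by (simp add: right_diff_distrib)
qed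

text \<open>The classical formula with the fractional part, known to the right of 1, continues to Re
  s > 0; both sides are multiplied by s - 1 so that holomorphic functions are compared.\<close>

lemma zeta_frac:
  assumes s: "Re s > 0" "s \<noteq> 1"
  shows "arch s * completed_zeta s = s / (s - 1) - s * frac_Laplace s"
proof -
  define f where "f s = of_real pi powr (s / 2) * rGamma (s / 2 + 1) / 2 * completed_zeta s" for s :: complex
  define g where "g s = s - s * (s - 1) * frac_Laplace s" for s
  have fl: "frac_Laplace holomorphic_on {s. Re s > 0}"
    unfolding frac_Laplace_def[abs_def] by (rule Laplace_bounded_holomorphic[OF frac_measurable frac_bounded])
  have fs: "arch w * completed_zeta w = f w / (w - 1)" for w by (simp add: f_def arch_def)
  have "f s = g s"
  proof (rule analytic_continuation_open[where s = "{s. Re s > 1}" and s' = "{s. Re s > 0}" and f = f and g = g])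
    show "open {s. Re s > 1}" "open {s. Re s > 0}" by (auto intro: open_halfspace_Re_gt)
    show "{s. Re s > 1} \<noteq> {}" by (auto intro: exI[of _ 2])
    show "connected {s. Re s > 0}" by (intro convex_connected convex_halfspace_Re_gt)
    show "f holomorphic_on {s. Re s > 0}" unfolding f_def by (intro holomorphic_intros completed_zeta_holomorphic) auto
    show "g holomorphic_on {s. Re s > 0}" unfolding g_def by (intro holomorphic_intros fl)
    fix w :: complex assume "w \<in> {s. Re s > 1}"
    then have w: "Re w > 1" by simp
    then have w1: "w - 1 \<noteq> 0" by auto
    have "f w / (w - 1) = w / (w - 1) - w * frac_Laplace w"
      using arch_completed_zeta_right[OF w] Dirichlet_zeta_frac[OF w] by (simp add: fs)
    then have "f w = (w / (w - 1) - w * frac_Laplace w) * (w - 1)" using w1 by (simp add: divide_eq_eq)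
    then have "f w = w / (w - 1) * (w - 1) - w * frac_Laplace w * (w - 1)" by (simp only: left_diff_distrib)
    also have "w / (w - 1) * (w - 1) = w" using w1 by simp
    finally show "f w = g w" by (simp only: g_def mult_ac)
  qed (use s in auto)
  then have "arch s * completed_zeta s = g s / (s - 1)" by (simp add: fs)
  also have "\<dots> = s / (s - 1) - s * frac_Laplace s" using s(2) by (simp add: g_def diff_divide_distrib)
  finally show ?thesis .
qed

text \<open>Divided by s, \<zeta> becomes 1 / (s - 1) minus the Laplace transform of a bounded
  function; on the critical line |s - 1| = |s|, so both terms are square integrable.\<close>

lemma zeta_div_s_L2: "(\<lambda>s. arch s * completed_zeta s / s) \<in> L2 crit_line"
proof -
  have m: "(\<lambda>s. arch s * completed_zeta s / s) \<in> borel_measurable crit_line"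
  proof -
    have "(\<lambda>s. arch s * completed_zeta s / s) holomorphic_on - {0, 1}"
      by (intro holomorphic_intros completed_zeta_holomorphic holomorphic_on_subset[OF arch_holomorphic]) auto
    then have "(\<lambda>s. arch s * completed_zeta s / s) \<in> borel_measurable borel"
      by (intro borel_measurable_continuous_countable_exceptions[of "{0, 1}"] holomorphic_on_imp_continuous_on) auto
    then show ?thesis by (simp add: measurable_cong_sets[OF crit_line_sets refl])
  qed
  have "(\<lambda>s. 1 / (s - 1)) \<in> L2 crit_line"
  proof (rule L2_bounded_by[OF _ inverse_L2])
    show "(\<lambda>s. 1 / (s - 1)) \<in> borel_measurable crit_line" by measurable
    show "AE s in crit_line. norm (1 / (s - 1)) \<le> 1 * norm (1 / s)"
      using AE_crit_line_Re
    proof eventually_elim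
      case (elim s)
      have "(Re s - 1)\<^sup>2 = (Re s)\<^sup>2" unfolding elim by (simp add: power2_eq_square)
      then have "norm (s - 1) = norm s" by (simp add: cmod_def)
      then show ?case by (simp add: norm_divide)
    qed
  qed
  moreover have "frac_Laplace \<in> L2 crit_line"
    unfolding frac_Laplace_def[abs_def] by (rule Laplace_transform_L2[OF frac_measurable frac_bounded])
  ultimately have L: "(\<lambda>s. 1 / (s - 1) - frac_Laplace s) \<in> L2 crit_line" by (rule L2_diff)
  show ?thesis
  proof (rule L2_bounded_by[OF m L])
    show "AE s in crit_line. norm (arch s * completed_zeta s / s) \<le> 1 * norm (1 / (s - 1) - frac_Laplace s)"
      using AE_crit_line_Re
    proof eventually_elim
      case (elim s)
      then have "s \<noteq> 0" "s \<noteq> 1" "Re s > 0" by auto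
      then show ?case by (simp add: zeta_frac diff_divide_distrib)
    qed
  qed
qed

section \<open>Mellin transforms of cosine pairs\<close>

lemma norm_sin_le_exp: "norm (sin z) \<le> exp \<bar>Im z\<bar>" for z :: complex
proof -
  have "norm (sin z) = norm (exp (\<i> * z) - exp (- (\<i> * z))) / 2"
    by (simp add: sin_exp_eq norm_divide norm_mult)
  also have "\<dots> \<le> (norm (exp (\<i> * z)) + norm (exp (- (\<i> * z)))) / 2"
    by (intro divide_right_mono norm_triangle_ineq4) simp
  finally have 1: "norm (sin z) \<le> (norm (exp (\<i> * z)) + norm (exp (- (\<i> * z)))) / 2" .
  have "norm (exp (\<i> * z)) \<le> exp \<bar>Im z\<bar>" "norm (exp (- (\<i> * z))) \<le> exp \<bar>Im z\<bar>" by auto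
  then have "(norm (exp (\<i> * z)) + norm (exp (- (\<i> * z)))) / 2 \<le> (exp \<bar>Im z\<bar> + exp \<bar>Im z\<bar>) / 2"
    by (intro divide_right_mono add_mono) auto
  with 1 show ?thesis by (simp only: field_sum_of_halves add_divide_distrib)
qed

lemma norm_Gamma_le:
  assumes "Re z > 0"
  shows "norm (Gamma z) \<le> norm (Gamma (complex_of_real (Re z)))"
proof -
  let ?f = "\<lambda>w u. exp (of_real u * w - of_real (1 * exp u)) :: complex"
  have r: "Re (complex_of_real (Re z)) > 0" using assms by simp
  have G: "(LINT u|lborel. ?f w u) = Gamma w" if "Re w > 0" for w
    using Gamma_integral_log(2)[OF that, of 1] by simp
  have "norm (Gamma z) \<le> (LINT u|lborel. norm (?f z u))"
    unfolding G[OF assms, symmetric] by (rule integral_norm_bound)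
  also have "\<dots> = norm (complex_of_real (LINT u|lborel. norm (?f z u)))" by simp
  also have "complex_of_real (LINT u|lborel. norm (?f z u)) = (LINT u|lborel. of_real (norm (?f z u)))"
    by (rule integral_complex_of_real[symmetric])
  also have "\<dots> = (LINT u|lborel. ?f (of_real (Re z)) u)"
    by (intro Bochner_Integration.integral_cong) (simp_all flip: exp_of_real)
  also have "\<dots> = Gamma (of_real (Re z))" by (rule G[OF r])
  finally show ?thesis .
qed

text \<open>The reflection formula writes rGamma (s/2) as a sine times Gamma (1 - s/2). Here Re (1 -
  s/2) runs through [1/4, 3/4], where Gamma is bounded, and the sine grows at most like exp (pi |Im
  s| / 2), below exp (2 |Im s|). The condition |s - 1| \<ge> 1/4 keeps away from the pole.\<close>

lemma arch_bound:
  "\<exists>C>0. \<forall>s. 1/2 \<le> Re s \<and> Re s \<le> 3/2 \<and> 1/4 \<le> norm (s - 1) \<longrightarrow> norm (arch s) \<le> C * exp (2 * \<bar>Im s\<bar>)"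
proof -
  have "continuous_on {1/4..3/4} (\<lambda>x. Gamma (complex_of_real x))"
    by (intro continuous_on_compose2[OF continuous_on_Gamma[of "{z. 0 < Re z}"]] continuous_intros)
      (auto elim!: nonpos_Ints_cases)
  then have "compact ((\<lambda>x. Gamma (complex_of_real x)) ` {1/4..3/4})" by (rule compact_continuous_image) simp
  then obtain B where B: "\<And>x. x \<in> {1/4..3/4} \<Longrightarrow> norm (Gamma (complex_of_real x)) \<le> B"
    using compact_imp_bounded bounded_iff by (metis image_eqI)
  have B0: "B \<ge> 0" using order_trans[OF norm_ge_zero B[of "1/4"]] by simp
  have main: "norm (arch s) \<le> (8 * pi * B + 1) * exp (2 * \<bar>Im s\<bar>)"
    if s: "1/2 \<le> Re s" "Re s \<le> 3/2" "1/4 \<le> norm (s - 1)" for s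
  proof -
    have rg: "norm (rGamma (s / 2)) \<le> B * exp (2 * \<bar>Im s\<bar>)"
    proof -
      have "rGamma (s / 2) * rGamma (1 - s / 2) = sin (of_real pi * (s / 2)) / of_real pi" by (rule rGamma_reflection_complex)
      moreover have "1 - s / 2 \<notin> \<int>\<^sub>\<le>\<^sub>0" using s by (auto elim!: nonpos_Ints_cases simp: complex_eq_iff)
      then have "rGamma (1 - s / 2) * Gamma (1 - s / 2) = 1" by (simp add: rGamma_inverse_Gamma Gamma_eq_zero_iff)
      ultimately have "rGamma (s / 2) = sin (of_real pi * (s / 2)) / of_real pi * Gamma (1 - s / 2)"
        by (metis mult.assoc mult.right_neutral)
      then have "norm (rGamma (s / 2)) = norm (sin (of_real pi * (s / 2))) / pi * norm (Gamma (1 - s / 2))"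
        by (simp add: norm_mult norm_divide)
      also have "\<dots> \<le> (exp (2 * \<bar>Im s\<bar>) / 1) * B"
      proof (intro mult_mono frac_le)
        have "norm (sin (of_real pi * (s / 2))) \<le> exp \<bar>Im (of_real pi * (s / 2))\<bar>" by (rule norm_sin_le_exp)
        also have "\<bar>Im (of_real pi * (s / 2))\<bar> = (pi / 2) * \<bar>Im s\<bar>" by (simp add: abs_mult)
        also have "exp ((pi / 2) * \<bar>Im s\<bar>) \<le> exp (2 * \<bar>Im s\<bar>)"
          using pi_less_4 by (simp add: mult_right_mono)
        finally show "norm (sin (of_real pi * (s / 2))) \<le> exp (2 * \<bar>Im s\<bar>)" .
        have "norm (Gamma (1 - s / 2)) \<le> norm (Gamma (complex_of_real (Re (1 - s / 2))))" using s by (intro norm_Gamma_le) simp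
        also have "\<dots> \<le> B" using s by (intro B) auto
        finally show "norm (Gamma (1 - s / 2)) \<le> B" .
      qed (use pi_gt3 B0 in auto)
      finally show ?thesis by (simp add: mult.commute)
    qed
    have s0: "norm (s / 2) \<ge> 1/4" using s(1) abs_Re_le_cmod[of s] by (simp add: norm_divide)
    then have sn: "s \<noteq> 0" by auto
    have rr: "rGamma (s / 2) = (s / 2) * rGamma (s / 2 + 1)" by (rule rGamma_plus1[symmetric])
    have cancel: "x * y / k = x * (h * y) / (h * k)" if "h \<noteq> 0" for x y h k :: complex using that by simp
    have A: "arch s = of_real pi powr (s / 2) * rGamma (s / 2) / ((s / 2) * (2 * (s - 1)))"
      unfolding arch_def rr by (rule cancel) (use sn in simp)
    have "norm (arch s) = norm (of_real pi powr (s / 2) :: complex) * norm (rGamma (s / 2)) / (norm (s / 2) * (2 * norm (s - 1)))"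
      by (simp only: A norm_mult norm_divide norm_numeral)
    also have "\<dots> \<le> pi * (B * exp (2 * \<bar>Im s\<bar>)) / (1/4 * (2 * (1/4)))"
    proof (intro frac_le mult_mono rg)
      have "norm (of_real pi powr (s / 2) :: complex) = pi powr (Re s / 2)"
        using norm_powr_real_powr[of "of_real pi" "s / 2"] by simp
      also have "\<dots> \<le> pi powr 1" using s pi_gt3 by (intro powr_mono) auto
      finally show "norm (of_real pi powr (s / 2) :: complex) \<le> pi" by simp
    qed (use s s0 B0 in auto)
    also have "\<dots> \<le> (8 * pi * B + 1) * exp (2 * \<bar>Im s\<bar>)" by (simp add: algebra_simps)
    finally show ?thesis .
  qed
  have "8 * pi * B + 1 > 0" using B0 by (intro add_nonneg_pos) auto
  with main show ?thesis by blast
qed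

lemma of_real_exp_powr: "complex_of_real (exp u) powr w = exp (of_real u * w)"
  using Ln_of_real[of "exp u"] by (simp add: powr_def mult.commute)

lemma powr_tail_integrable:
  assumes "a > 1"
  shows "integrable lborel (\<lambda>x::real. indicator {1..} x * x powr (- a))"
proof -
  let ?f = "\<lambda>x::real. complex_of_real (indicator {1..} x * x powr (- a))"
  have m: "?f \<in> borel_measurable borel" by measurable
  have "integrable lborel (\<lambda>u. of_real (exp u) * ?f (exp u))"
  proof -
    have "of_real (exp u) * ?f (exp u) = indicator {0..} u *\<^sub>R exp (- (of_real u * of_real (a - 1)))" for u
    proof -
      have "exp u * exp u powr (- a) = exp (- (u * (a - 1)))" by (simp add: powr_def exp_add[symmetric] algebra_simps)
      then have "complex_of_real (exp u * exp u powr (- a)) = of_real (exp (- (u * (a - 1))))" by (simp only:)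
      then have "complex_of_real (exp u) * of_real (exp u powr (- a)) = exp (- (of_real u * of_real (a - 1)))"
        by (simp only: of_real_mult exp_of_real[symmetric] of_real_minus)
      then show ?thesis by (simp add: indicator_def)
    qed
    then show ?thesis using integral_exp_minus_complex(1)[of "of_real (a - 1)"] assms by (simp add: set_integrable_def)
  qed
  then have "set_integrable lborel {0<..} ?f" using set_integral_exp_substitution(1)[OF m] by simp
  then have "integrable lborel (\<lambda>x. Re (indicator {0<..} x *\<^sub>R ?f x))" unfolding set_integrable_def by (rule integrable_Re)
  moreover have "Re (indicator {0<..} x *\<^sub>R ?f x) = indicator {1..} x * x powr (- a)" for x :: real by (auto simp: indicator_def)
  ultimately show ?thesis by (simp only:)
qed

lemma powr_unit_integral:
  assumes "Re w < 1"
  shows "set_integrable lborel {0<..<1} (\<lambda>x. complex_of_real x powr (- w))"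
    and "(LINT x:{0<..<1}|lborel. complex_of_real x powr (- w)) = 1 / (1 - w)"
proof -
  let ?f = "\<lambda>x. indicator {..<1} x *\<^sub>R complex_of_real x powr (- w)"
  have m: "?f \<in> borel_measurable borel" by measurable
  have w: "Re (1 - w) > 0" using assms by simp
  define F where "F u = indicator {..<0} u *\<^sub>R exp (of_real u * (1 - w))" for u :: real
  have fF: "of_real (exp u) * ?f (exp u) = F u" for u
  proof -
    have "indicator {..<1} (exp u) = (indicator {..<0} u :: real)" by (auto simp: indicator_def)
    moreover have "of_real (exp u) * exp (of_real u * - w) = exp (of_real u * (1 - w))"
      by (simp add: exp_of_real[symmetric] exp_add[symmetric] algebra_simps)
    ultimately show ?thesis by (simp add: F_def of_real_exp_powr)
  qed
  have Fm: "F \<in> borel_measurable borel" unfolding F_def by measurable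
  have Fz: "indicator {0..} u *\<^sub>R F u = 0" for u by (auto simp: F_def indicator_def)
  have F1: "set_integrable lborel {0..} F" by (simp add: set_integrable_def Fz)
  have ae: "AE u in lborel. indicator {0..} u *\<^sub>R exp (- (of_real u * (1 - w))) = indicator {0..} u *\<^sub>R F (- u)"
    using AE_lborel_singleton[of 0] by eventually_elim (auto simp: F_def indicator_def)
  have m2: "(\<lambda>u. indicator {0..} u *\<^sub>R F (- u)) \<in> borel_measurable lborel" using Fm by measurable
  have m3: "(\<lambda>u::real. indicator {0..} u *\<^sub>R exp (- (of_real u * (1 - w)))) \<in> borel_measurable lborel" by measurable
  have F2: "set_integrable lborel {0..} (\<lambda>u. F (- u))"
    using integral_exp_minus_complex(1)[OF w] integrable_cong_AE[OF m3 m2 ae] unfolding set_integrable_def by simp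
  have F2v: "(LINT u:{0..}|lborel. F (- u)) = 1 / (1 - w)"
    using integral_exp_minus_complex(2)[OF w] integral_cong_AE[OF m3 m2 ae] unfolding set_lebesgue_integral_def by simp
  have F1v: "(LINT u:{0..}|lborel. F u) = 0"
    by (simp add: set_lebesgue_integral_def Fz)
  note sp = integral_split_at_0[OF Fm F1 F2]
  have ind: "indicator {0<..} x *\<^sub>R ?f x = indicator {0<..<1} x *\<^sub>R complex_of_real x powr (- w)" for x :: real
    by (auto simp: indicator_def)
  show "set_integrable lborel {0<..<1} (\<lambda>x. complex_of_real x powr (- w))"
    using sp(1) set_integral_exp_substitution(1)[OF m] unfolding fF set_integrable_def ind by simp
  show "(LINT x:{0<..<1}|lborel. complex_of_real x powr (- w)) = 1 / (1 - w)"
    using sp(2) set_integral_exp_substitution(2)[OF m] unfolding fF set_lebesgue_integral_def ind F1v F2v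
    by (simp add: F1v[unfolded set_lebesgue_integral_def] F2v[unfolded set_lebesgue_integral_def])
qed

text \<open>Twice the cosine is the sum of two conjugate exponentials, so the half-line integral
  unfolds to a Gaussian Fourier integral over the whole line.\<close>

lemma Gaussian_cosine_integral:
  assumes a: "a > 0"
  shows "set_integrable lborel {0..} (\<lambda>x. of_real (exp (- pi * a * x\<^sup>2)) * complex_of_real (2 * cos (2 * pi * x * y)))"
    and "(LINT x:{0..}|lborel. of_real (exp (- pi * a * x\<^sup>2)) * complex_of_real (2 * cos (2 * pi * x * y))) = of_real (exp (- pi * y\<^sup>2 / a) / sqrt a)"
proof -
  have sq: "sqrt (2 * pi * a) > 0" using a by simp
  have e: "- (sqrt (2 * pi * a) * x)\<^sup>2 / 2 = - pi * a * x\<^sup>2" for x using a by (simp add: power_mult_distrib)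
  define G where "G x = complex_of_real (exp (- pi * a * x\<^sup>2)) * iexp (x * (2 * pi * y))" for x
  have i: "integrable lborel G" unfolding G_def
    by (rule Bochner_Integration.integrable_bound[OF gaussian_Fourier(2)[OF sq]]) (use a in \<open>auto simp: norm_mult power_mult_distrib\<close>)
  have v: "(LINT x|lborel. G x) = of_real (exp (- pi * y\<^sup>2 / a) / sqrt a)"
  proof -
    have "sqrt (2 * pi) / sqrt (2 * pi * a) = 1 / sqrt a" using a by (simp add: real_sqrt_mult)
    moreover have "- (2 * pi * y / sqrt (2 * pi * a))\<^sup>2 / 2 = - pi * y\<^sup>2 / a"
      using a by (simp add: power_divide power_mult_distrib field_simps power2_eq_square)
    ultimately show ?thesis using gaussian_Fourier(1)[OF sq, of "2 * pi * y"] unfolding e G_def by simp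
  qed
  have i2: "integrable lborel (\<lambda>x. G (- x))"
    using lborel_integrable_real_affine[OF i, of "-1" 0] by simp
  have s1: "set_integrable lborel {0..} G" "set_integrable lborel {0..} (\<lambda>x. G (- x))"
    unfolding set_integrable_def using i i2 by (auto intro: integrable_mult_indicator)
  have Gs: "G x + G (- x) = of_real (exp (- pi * a * x\<^sup>2)) * complex_of_real (2 * cos (2 * pi * x * y))" for x
  proof -
    have "iexp (x * (2 * pi * y)) + iexp (- x * (2 * pi * y)) = complex_of_real (2 * cos (2 * pi * x * y))"
      by (simp add: complex_eq_iff Re_exp Im_exp mult_ac)
    then show ?thesis by (simp add: G_def distrib_left[symmetric] del: of_real_mult)
  qed
  show "set_integrable lborel {0..} (\<lambda>x. of_real (exp (- pi * a * x\<^sup>2)) * complex_of_real (2 * cos (2 * pi * x * y)))"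
    unfolding Gs[symmetric] by (intro set_integral_add s1)
  show "(LINT x:{0..}|lborel. of_real (exp (- pi * a * x\<^sup>2)) * complex_of_real (2 * cos (2 * pi * x * y))) = of_real (exp (- pi * y\<^sup>2 / a) / sqrt a)"
    unfolding Gs[symmetric] set_integral_add(2)[OF s1] v[symmetric]
    by (rule integral_split_at_0(2)[symmetric, OF _ s1]) (use i in auto)
qed

text \<open>L^2 convergence tested against \<open>v\<close>. The approximants \<open>k T\<close> are
  not assumed to lie in L^2, so Cauchy-Schwarz is applied to extended nonnegative integrals, where
  \<open>L2_dist_sq\<close> appears directly.\<close>

lemma L2_dist_tendsto_integral:
  assumes dist: "((\<lambda>T. L2_dist_sq M (k T) g) \<longlongrightarrow> 0) F"
    and v: "v \<in> L2 M" and [measurable]: "\<And>T. k T \<in> borel_measurable M" "g \<in> borel_measurable M"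
    and i: "\<And>T. integrable M (\<lambda>x. k T x * v x)" "integrable M (\<lambda>x. g x * v x)"
  shows "((\<lambda>T. \<integral>x. k T x * v x \<partial>M) \<longlongrightarrow> (\<integral>x. g x * v x \<partial>M)) F"
proof (rule tendstoI)
  fix e :: real assume e: "e > 0"
  have [measurable]: "v \<in> borel_measurable M" using v by (rule L2_measurable)
  define A where "A = (\<integral>x. (norm (v x))\<^sup>2 \<partial>M)"
  have A0: "A \<ge> 0" by (simp add: A_def)
  have A: "(\<integral>\<^sup>+x. (ennreal (norm (v x)))\<^sup>2 \<partial>M) = ennreal A"
    unfolding A_def by (subst nn_integral_eq_integral[OF L2_integrable[OF v], symmetric]) (auto simp: ennreal_power)
  \<comment> \<open>Dividing by A + 1 rather than by A allows \<open>v\<close> to vanish almost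
    everywhere.\<close>
  define \<delta> where "\<delta> = e\<^sup>2 / (A + 1)"
  have \<delta>: "\<delta> > 0" using e A0 by (simp add: \<delta>_def)
  have "eventually (\<lambda>T. L2_dist_sq M (k T) g < ennreal \<delta>) F"
    using dist \<delta> by (intro order_tendstoD(2)) auto
  then show "eventually (\<lambda>T. dist (\<integral>x. k T x * v x \<partial>M) (\<integral>x. g x * v x \<partial>M) < e) F"
  proof eventually_elim
    case (elim T)
    define I where "I = (\<integral>x. k T x * v x \<partial>M) - (\<integral>x. g x * v x \<partial>M)"
    have "I = (\<integral>x. (k T x - g x) * v x \<partial>M)"
      unfolding I_def left_diff_distrib by (rule Bochner_Integration.integral_diff[symmetric, OF i])
    then have "ennreal (norm I) \<le> (\<integral>\<^sup>+x. ennreal (norm ((k T x - g x) * v x)) \<partial>M)"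
      using ennreal_norm_integral_le by metis
    also have "\<dots> = (\<integral>\<^sup>+x. ennreal (norm (k T x - g x)) * ennreal (norm (v x)) \<partial>M)"
      by (simp add: norm_mult ennreal_mult)
    finally have "(ennreal (norm I))\<^sup>2 \<le> (\<integral>\<^sup>+x. ennreal (norm (k T x - g x)) * ennreal (norm (v x)) \<partial>M)\<^sup>2"
      by (intro power_mono) auto
    also have "\<dots> \<le> (\<integral>\<^sup>+x. (ennreal (norm (k T x - g x)))\<^sup>2 \<partial>M) * (\<integral>\<^sup>+x. (ennreal (norm (v x)))\<^sup>2 \<partial>M)"
      by (rule Cauchy_Schwarz_nn_integral) measurable
    also have "(\<integral>\<^sup>+x. (ennreal (norm (k T x - g x)))\<^sup>2 \<partial>M) = L2_dist_sq M (k T) g"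
      by (simp add: L2_dist_sq_def ennreal_power)
    also have "L2_dist_sq M (k T) g * (\<integral>\<^sup>+x. (ennreal (norm (v x)))\<^sup>2 \<partial>M) \<le> ennreal \<delta> * ennreal A"
      unfolding A using elim by (intro mult_mono) auto
    finally have "(norm I)\<^sup>2 \<le> \<delta> * A"
      using \<delta> A0 by (simp add: ennreal_power ennreal_mult[symmetric])
    also have "\<dots> < \<delta> * (A + 1)" using \<delta> by simp
    also have "\<dots> = e\<^sup>2" using A0 by (simp add: \<delta>_def)
    finally have "norm I < e" by (rule power_less_imp_less_base) (use e in simp)
    then show ?case by (simp add: I_def dist_norm)
  qed
qed

section \<open>Cosine pairs tested against Gaussians\<close>

definition ext_zero :: "(real \<Rightarrow> complex) \<Rightarrow> real \<Rightarrow> complex" where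
  "ext_zero f x = indicator {0<..} x *\<^sub>R f x"

text \<open>The continuous counterpart of \<open>theta_tail\<close>, with the weight
  \<open>F\<close> in place of the sum over integers.\<close>

definition Gauss_transform :: "(real \<Rightarrow> complex) \<Rightarrow> real \<Rightarrow> complex" where
  "Gauss_transform F a = (LINT x|lborel. F x * of_real (exp (- pi * a * x\<^sup>2)))"

lemma integral_halfline:
  fixes f :: "real \<Rightarrow> 'b :: {banach, second_countable_topology}"
  shows "integrable halfline f \<longleftrightarrow> integrable lborel (\<lambda>x. indicator {0<..} x *\<^sub>R f x)"
    and "(LINT x|halfline. f x) = (LINT x|lborel. indicator {0<..} x *\<^sub>R f x)"
  unfolding halfline_def by (subst integrable_restrict_space integral_restrict_space; simp)+

lemma ext_zero_measurable: "f \<in> borel_measurable halfline \<Longrightarrow> ext_zero f \<in> borel_measurable borel"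
  unfolding halfline_def ext_zero_def[abs_def] by (subst (asm) borel_measurable_restrict_space_iff) auto

lemma ext_zero_L2: "f \<in> L2 halfline \<Longrightarrow> ext_zero f \<in> L2 lborel"
proof -
  assume f: "f \<in> L2 halfline"
  have "integrable lborel (\<lambda>x. indicator {0<..} x *\<^sub>R (norm (f x))\<^sup>2)"
    using L2_integrable[OF f] unfolding integral_halfline(1) .
  moreover have "indicator {0<..} x *\<^sub>R (norm (f x))\<^sup>2 = (norm (ext_zero f x))\<^sup>2" for x by (simp add: ext_zero_def indicator_def)
  ultimately show ?thesis using ext_zero_measurable[OF L2_measurable[OF f]] by (simp add: L2_def)
qed

lemma Gaussian_integrable:
  assumes a: "a > 0"
  shows "integrable lborel (\<lambda>x. exp (- pi * a * x\<^sup>2))"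
proof -
  have sq: "sqrt (2 * pi * a) > 0" using a by simp
  have "- (sqrt (2 * pi * a) * x)\<^sup>2 / 2 = - pi * a * x\<^sup>2" for x using a by (simp add: power_mult_distrib)
  then show ?thesis using gaussian_Fourier(2)[OF sq] by (simp only:)
qed

lemma Gaussian_L2:
  assumes a: "a > 0"
  shows "(\<lambda>x. complex_of_real (exp (- pi * a * x\<^sup>2))) \<in> L2 lborel"
proof -
  have "(norm (complex_of_real (exp (- pi * a * x\<^sup>2))))\<^sup>2 = exp (- pi * (2 * a) * x\<^sup>2)" for x
    by (simp add: exp_double[symmetric] mult_ac)
  then show ?thesis using Gaussian_integrable[of "2 * a"] a by (simp add: L2_def)
qed

lemma indicator_L2:
  assumes "a \<le> b"
  shows "(\<lambda>x. indicator {a..b} x :: complex) \<in> L2 (lborel :: real measure)"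
proof -
  have "(norm (indicator {a..b} x :: complex))\<^sup>2 = indicator {a..b} x" for x :: real by (simp add: indicator_def)
  then show ?thesis using assms by (auto simp: L2_def intro!: integrable_real_indicator borel_measurable_indicator)
qed

text \<open>The cosine transform is symmetric and takes exp (- pi y^2 / a) to sqrt a times exp (- pi
  a x^2). Fubini holds for the truncated transforms \<open>k T\<close>; as T grows, L^2 convergence
  handles the side of \<open>h\<close> and dominated convergence the side of
  \<open>f\<close>.\<close>

lemma cosine_Parseval:
  assumes f: "f \<in> L2 halfline" and h: "h \<in> L2 halfline" and ct: "is_cosine_transform f h" and a: "a > 0"
  shows "Gauss_transform (ext_zero f) a = Gauss_transform (ext_zero h) (1 / a) / of_real (sqrt a)"
proof -
  define F where "F = ext_zero f"
  have FL: "F \<in> L2 lborel" unfolding F_def by (rule ext_zero_L2[OF f])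
  have [measurable]: "F \<in> borel_measurable borel" using L2_measurable[OF FL] by simp
  define v where "v y = complex_of_real (exp (- pi * (1 / a) * y\<^sup>2))" for y
  have vL: "v \<in> L2 lborel" unfolding v_def using a by (intro Gaussian_L2) simp
  have [measurable]: "v \<in> borel_measurable borel" unfolding v_def by measurable
  define k where "k T y = (LINT x:{0<..T}|lborel. complex_of_real (2 * cos (2 * pi * x * y)) * f x)" for T y
  have kF: "k T y = (LINT x|lborel. (indicator {0..T} x * F x) * complex_of_real (2 * cos (2 * pi * x * y)))" for T y
    unfolding k_def set_lebesgue_integral_def
    by (intro Bochner_Integration.integral_cong) (auto simp: F_def ext_zero_def indicator_def)
  have [measurable]: "k T \<in> borel_measurable borel" for T unfolding kF[abs_def] by measurable
  have FT: "integrable lborel (\<lambda>x. indicator {0..T} x * F x)" for T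
  proof (cases "T \<ge> 0")
    case True
    show ?thesis by (rule L2_mult_integrable[OF indicator_L2[OF True] FL])
  qed simp
  have kb: "norm (k T y) \<le> (LINT x|lborel. 2 * norm (indicator {0..T} x * F x))" for T y
    unfolding kF
  proof (rule Bochner_Integration.integral_norm_bound_integral)
    show i2: "integrable lborel (\<lambda>x. 2 * norm (indicator {0..T} x * F x))" using FT[of T] by (intro integrable_mult_right integrable_norm)
    have c: "norm (complex_of_real (2 * cos (2 * pi * x * y))) \<le> 2" for x
      unfolding norm_of_real abs_mult using abs_cos_le_one[of "2 * pi * x * y"] by simp
    show n: "norm (indicator {0..T} x * F x * complex_of_real (2 * cos (2 * pi * x * y))) \<le> 2 * norm (indicator {0..T} x * F x)" for x
      using mult_left_mono[OF c[of x], of "norm (indicator {0..T} x * F x)"] by (simp only: norm_mult mult_ac norm_ge_zero mult_nonneg_nonneg)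
    show "integrable lborel (\<lambda>x. indicator {0..T} x * F x * complex_of_real (2 * cos (2 * pi * x * y)))"
      by (rule Bochner_Integration.integrable_bound[OF i2]) (use n in \<open>auto intro!: AE_I2 order_trans[OF n]\<close>)
  qed
  have vi: "integrable lborel v" unfolding v_def using Gaussian_integrable[of "1/a"] a by simp
  have kv: "integrable lborel (\<lambda>y. k T y * v y)" for T
  proof (rule Bochner_Integration.integrable_bound)
    show "integrable lborel (\<lambda>y. (LINT x|lborel. 2 * norm (indicator {0..T} x * F x)) * norm (v y))" using vi by simp
    show "AE y in lborel. norm (k T y * v y) \<le> norm ((LINT x|lborel. 2 * norm (indicator {0..T} x * F x)) * norm (v y))"
      using kb by (auto simp: norm_mult abs_mult intro!: AE_I2 mult_right_mono order_trans[OF kb abs_ge_self])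
  qed measurable
  have tend: "((\<lambda>T. LINT y|halfline. k T y * v y) \<longlongrightarrow> (LINT y|halfline. h y * v y)) at_top"
  proof (rule L2_dist_tendsto_integral)
    show "((\<lambda>T. L2_dist_sq halfline (k T) h) \<longlongrightarrow> 0) at_top"
      using ct unfolding is_cosine_transform_def k_def .
    have "integrable lborel (\<lambda>x. indicator {0<..} x *\<^sub>R (norm (v x))\<^sup>2)"
      using L2_integrable[OF vL] by (intro integrable_mult_indicator) auto
    then show vh: "v \<in> L2 halfline" unfolding L2_def by (simp add: integral_halfline(1)) (simp add: halfline_def measurable_restrict_space1)
    show "k T \<in> borel_measurable halfline" for T unfolding halfline_def by (rule measurable_restrict_space1) simp
    show "h \<in> borel_measurable halfline" by (rule L2_measurable[OF h])
    show "integrable halfline (\<lambda>y. h y * v y)" by (rule L2_mult_integrable[OF h vh])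
    show "integrable halfline (\<lambda>y. k T y * v y)" for T
      unfolding integral_halfline(1) using kv by (intro integrable_mult_indicator) auto
  qed
  have hv: "(LINT y|halfline. h y * v y) = Gauss_transform (ext_zero h) (1 / a)"
    unfolding integral_halfline(2) Gauss_transform_def v_def ext_zero_def
    by (intro Bochner_Integration.integral_cong) (auto simp: indicator_def)
  have kval: "(LINT y|halfline. k T y * v y) = of_real (sqrt a) * (LINT x|lborel. indicator {0..T} x * F x * of_real (exp (- pi * a * x\<^sup>2)))" for T
  proof -
    define b where "b y = indicator {0..} y * v y" for y
    have b: "integrable lborel b" unfolding b_def using integrable_mult_indicator[OF _ vi, of "{0..}"] by (simp add: scaleR_conv_of_real of_real_indicator)
    have "(LINT y|halfline. k T y * v y) = (LINT y|lborel. b y * k T y)"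
      unfolding integral_halfline(2)
    proof (rule integral_cong_AE)
      show "AE y in lborel. indicator {0<..} y *\<^sub>R (k T y * v y) = b y * k T y"
        using AE_lborel_singleton[of 0] by eventually_elim (auto simp: b_def indicator_def)
    qed (use b in auto)
    also have "\<dots> = (LINT x|lborel. (indicator {0..T} x * F x) * (LINT y|lborel. b y * complex_of_real (2 * cos (2 * pi * x * y))))"
      unfolding kF
    proof (rule Fubini_bounded_kernel[OF sigma_finite_lborel sigma_finite_lborel b FT])
      show "norm (complex_of_real (2 * cos (2 * pi * x * y))) \<le> 2" for x y
        unfolding norm_of_real abs_mult using abs_cos_le_one[of "2 * pi * x * y"] by simp
    qed measurable
    also have "\<dots> = (LINT x|lborel. of_real (sqrt a) * (indicator {0..T} x * F x * of_real (exp (- pi * a * x\<^sup>2))))"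
    proof (rule Bochner_Integration.integral_cong[OF refl])
      fix x
      have "(LINT y|lborel. b y * complex_of_real (2 * cos (2 * pi * x * y))) = (LINT y:{0..}|lborel. of_real (exp (- pi * (1 / a) * y\<^sup>2)) * complex_of_real (2 * cos (2 * pi * y * x)))"
        unfolding set_lebesgue_integral_def b_def v_def by (intro Bochner_Integration.integral_cong) (auto simp: indicator_def mult_ac)
      also have "\<dots> = of_real (exp (- pi * x\<^sup>2 / (1 / a)) / sqrt (1 / a))"
        by (rule Gaussian_cosine_integral(2)) (use a in simp)
      also have "\<dots> = of_real (sqrt a) * of_real (exp (- pi * a * x\<^sup>2))"
        by (simp add: real_sqrt_divide mult_ac)
      finally show "indicator {0..T} x * F x * (LINT y|lborel. b y * complex_of_real (2 * cos (2 * pi * x * y))) = of_real (sqrt a) * (indicator {0..T} x * F x * of_real (exp (- pi * a * x\<^sup>2)))"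
        by simp
    qed
    also have "\<dots> = of_real (sqrt a) * (LINT x|lborel. indicator {0..T} x * F x * of_real (exp (- pi * a * x\<^sup>2)))"
      by (rule integral_mult_right_zero)
    finally show ?thesis .
  qed
  have Fg: "integrable lborel (\<lambda>x. F x * of_real (exp (- pi * a * x\<^sup>2)))" by (rule L2_mult_integrable[OF FL Gaussian_L2[OF a]])
  have "((\<lambda>T. LINT x|lborel. indicator {0..T} x * F x * of_real (exp (- pi * a * x\<^sup>2))) \<longlongrightarrow> (LINT x|lborel. F x * of_real (exp (- pi * a * x\<^sup>2)))) at_top"
  proof (rule integral_dominated_convergence_at_top)
    show "integrable lborel (\<lambda>x. norm (F x * of_real (exp (- pi * a * x\<^sup>2))))" using Fg by simp
    show "\<forall>\<^sub>F T in at_top. AE x in lborel. norm (indicator {0..T} x * F x * of_real (exp (- pi * a * x\<^sup>2))) \<le> norm (F x * of_real (exp (- pi * a * x\<^sup>2)))"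
      by (intro always_eventually allI AE_I2) (auto simp: indicator_def)
    show "AE x in lborel. ((\<lambda>T. indicator {0..T} x * F x * of_real (exp (- pi * a * x\<^sup>2))) \<longlongrightarrow> F x * of_real (exp (- pi * a * x\<^sup>2))) at_top"
    proof (rule AE_I2, rule tendsto_eventually)
      fix x
      show "\<forall>\<^sub>F T in at_top. indicator {0..T} x * F x * of_real (exp (- pi * a * x\<^sup>2)) = F x * of_real (exp (- pi * a * x\<^sup>2))"
        using eventually_ge_at_top[of x] by eventually_elim (auto simp: indicator_def F_def ext_zero_def)
    qed
  qed measurable
  then have "((\<lambda>T. LINT y|halfline. k T y * v y) \<longlongrightarrow> of_real (sqrt a) * Gauss_transform F a) at_top"
    unfolding kval Gauss_transform_def by (intro tendsto_intros)
  then have "of_real (sqrt a) * Gauss_transform F a = Gauss_transform (ext_zero h) (1 / a)"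
    using tend hv tendsto_unique[OF trivial_limit_at_top_linorder] by metis
  then show ?thesis using a by (simp add: F_def field_simps)
qed

definition pos_L2 :: "(real \<Rightarrow> complex) \<Rightarrow> complex \<Rightarrow> bool" where
  "pos_L2 F c \<longleftrightarrow> F \<in> L2 lborel \<and> (\<forall>x\<le>0. F x = 0) \<and> (AE x in lborel. 0 < x \<and> x < 1 \<longrightarrow> F x = c)"

text \<open>A constant \<open>c\<close> on the whole half-line would contribute c / (2 sqrt a),
  which at a = exp u is the term subtracted here.\<close>

definition Gauss_log :: "(real \<Rightarrow> complex) \<Rightarrow> complex \<Rightarrow> real \<Rightarrow> complex" where
  "Gauss_log F c u = Gauss_transform F (exp u) - c / 2 * exp (- of_real u / 2)"

text \<open>By constancy on (0,1) only x \<ge> 1 contributes after the subtraction, and there exp (-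
  pi e^u x^2) decays doubly exponentially in u.\<close>

lemma rapid_Gauss_log:
  assumes "pos_L2 F c"
  shows "rapid (Gauss_log F c)"
  unfolding rapid_def
proof (intro conjI allI)
  have FL: "F \<in> L2 lborel" and F0: "\<And>x. x \<le> 0 \<Longrightarrow> F x = 0" and Fc: "AE x in lborel. 0 < x \<and> x < 1 \<longrightarrow> F x = c"
    using assms by (auto simp: pos_L2_def)
  have [measurable]: "F \<in> borel_measurable borel" using L2_measurable[OF FL] by simp
  show "Gauss_log F c \<in> borel_measurable borel" unfolding Gauss_log_def Gauss_transform_def by measurable
  define D where "D x = indicator {1..} x * (F x - c)" for x
  have [measurable]: "D \<in> borel_measurable borel" unfolding D_def by measurable
  have gi: "integrable lborel (\<lambda>x. F x * of_real (exp (- pi * a * x\<^sup>2)))" if "a > 0" for a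
    by (rule L2_mult_integrable[OF FL Gaussian_L2[OF that]])
  have gc: "integrable lborel (\<lambda>x. indicator {0..} x * (c * of_real (exp (- pi * a * x\<^sup>2))))"
    and gcv: "(LINT x|lborel. indicator {0..} x * (c * of_real (exp (- pi * a * x\<^sup>2)))) = c / 2 * of_real (1 / sqrt a)" if a: "a > 0" for a
  proof -
    have eq: "indicator {0..} x * (c * of_real (exp (- pi * a * x\<^sup>2))) = c / 2 * (indicator {0..} x *\<^sub>R (of_real (exp (- pi * a * x\<^sup>2)) * complex_of_real (2 * cos (2 * pi * x * 0))))" for x
      by (simp add: indicator_def)
    show "integrable lborel (\<lambda>x. indicator {0..} x * (c * of_real (exp (- pi * a * x\<^sup>2))))"
      unfolding eq using Gaussian_cosine_integral(1)[OF a, of 0] unfolding set_integrable_def by (rule integrable_mult_right)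
    show "(LINT x|lborel. indicator {0..} x * (c * of_real (exp (- pi * a * x\<^sup>2)))) = c / 2 * of_real (1 / sqrt a)"
      unfolding eq integral_mult_right_zero Gaussian_cosine_integral(2)[OF a, of 0, unfolded set_lebesgue_integral_def]
      by simp
  qed
  have repr: "Gauss_log F c u = (LINT x|lborel. D x * of_real (exp (- pi * exp u * x\<^sup>2)))"
    and Di: "integrable lborel (\<lambda>x. D x * of_real (exp (- pi * exp u * x\<^sup>2)))" for u
  proof -
    have "sqrt (exp u) = exp (u / 2)" by (rule real_sqrt_unique) (auto simp flip: exp_double)
    then have "complex_of_real (1 / sqrt (exp u)) = exp (- of_real u / 2)"
      by (simp add: exp_minus inverse_eq_divide exp_of_real[symmetric])
    then have g: "Gauss_log F c u = (LINT x|lborel. F x * of_real (exp (- pi * exp u * x\<^sup>2)) - indicator {0..} x * (c * of_real (exp (- pi * exp u * x\<^sup>2))))"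
      unfolding Gauss_log_def Gauss_transform_def by (subst Bochner_Integration.integral_diff[OF gi gc]) (simp_all only: exp_gt_zero gcv)
    have ae: "AE x in lborel. F x * of_real (exp (- pi * exp u * x\<^sup>2)) - indicator {0..} x * (c * of_real (exp (- pi * exp u * x\<^sup>2))) = D x * of_real (exp (- pi * exp u * x\<^sup>2))"
      using Fc AE_lborel_singleton[of 0]
      by eventually_elim (use F0 in \<open>auto simp: D_def indicator_def left_diff_distrib not_le\<close>)
    show "Gauss_log F c u = (LINT x|lborel. D x * of_real (exp (- pi * exp u * x\<^sup>2)))"
      unfolding g by (rule integral_cong_AE[OF _ _ ae]) measurable
    have "integrable lborel (\<lambda>x. F x * of_real (exp (- pi * exp u * x\<^sup>2)) - indicator {0..} x * (c * of_real (exp (- pi * exp u * x\<^sup>2))))"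
      by (intro Bochner_Integration.integrable_diff gi gc) auto
    then show "integrable lborel (\<lambda>x. D x * of_real (exp (- pi * exp u * x\<^sup>2)))"
      by (subst integrable_cong_AE[OF _ _ ae, symmetric]) measurable
  qed
  define B where "B = (LINT x|lborel. norm (D x * of_real (exp (- pi * exp 0 * x\<^sup>2))))"
  have B0: "B \<ge> 0" by (simp add: B_def)
  have bound: "norm (Gauss_log F c u) \<le> exp pi * exp (- pi * exp u) * B" if u: "u \<ge> 0" for u
  proof -
    have "norm (Gauss_log F c u) \<le> (LINT x|lborel. exp pi * exp (- pi * exp u) * norm (D x * of_real (exp (- pi * exp 0 * x\<^sup>2))))"
      unfolding repr
    proof (rule Bochner_Integration.integral_norm_bound_integral[OF Di])
      show "integrable lborel (\<lambda>x. exp pi * exp (- pi * exp u) * norm (D x * of_real (exp (- pi * exp 0 * x\<^sup>2))))"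
        using Di[of 0] by (intro integrable_mult_right integrable_norm)
      fix x :: real
      show "norm (D x * of_real (exp (- pi * exp u * x\<^sup>2))) \<le> exp pi * exp (- pi * exp u) * norm (D x * of_real (exp (- pi * exp 0 * x\<^sup>2)))"
      proof (cases "x \<ge> 1")
        case True
        have eu: "exp u \<ge> 1" using u by simp
        have x2: "x\<^sup>2 \<ge> 1" using True by simp
        \<comment> \<open>Since e^u and x^2 are at least 1, the exponent separates into a function
          of u and one of x; the latter is the integrable weight at u = 0.\<close>
        have "0 \<le> (exp u - 1) * (x\<^sup>2 - 1)" using eu x2 by (intro mult_nonneg_nonneg) auto
        then have "exp u + x\<^sup>2 - 1 \<le> exp u * x\<^sup>2" by (simp add: algebra_simps)
        then have "pi * (exp u + x\<^sup>2 - 1) \<le> pi * (exp u * x\<^sup>2)" by (intro mult_left_mono) auto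
        then have "exp (- pi * exp u * x\<^sup>2) \<le> exp (pi + - pi * exp u + - pi * exp 0 * x\<^sup>2)"
          by (simp add: algebra_simps)
        then have "norm (D x) * exp (- pi * exp u * x\<^sup>2) \<le> norm (D x) * (exp pi * exp (- pi * exp u) * exp (- pi * exp 0 * x\<^sup>2))"
          unfolding exp_add by (intro mult_left_mono) auto
        then show ?thesis by (simp add: norm_mult mult_ac)
      qed (simp add: D_def)
    qed
    also have "\<dots> = exp pi * exp (- pi * exp u) * B" unfolding B_def by (rule integral_mult_right_zero)
    finally show ?thesis .
  qed
  fix K :: real
  obtain C where C: "\<And>u. u \<ge> 0 \<Longrightarrow> exp (- pi * exp u) \<le> C * exp (- K * u)"
    using exp_neg_exp_le[of pi K] pi_gt_zero by blast
  have "norm (Gauss_log F c u) \<le> (exp pi * B * C) * exp (- K * u)" if u: "u \<ge> 0" for u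
  proof -
    have "norm (Gauss_log F c u) \<le> exp pi * B * exp (- pi * exp u)" using bound[OF u] by (simp add: mult_ac)
    also have "\<dots> \<le> exp pi * B * (C * exp (- K * u))" using C[OF u] B0 by (intro mult_left_mono) auto
    finally show ?thesis by (simp add: mult_ac)
  qed
  then show "\<exists>C. \<forall>u\<ge>0. norm (Gauss_log F c u) \<le> C * exp (- K * u)" by blast
qed

text \<open>x^(-\<sigma>) is square integrable on [1, \<infinity>) for \<sigma> > 1/2, so the
  integrand is a product of two L^2 functions.\<close>

lemma pos_L2_tail_integrable:
  assumes F: "pos_L2 F c" and \<sigma>: "\<sigma> > 1/2"
  shows "integrable lborel (\<lambda>x. indicator {1..} x *\<^sub>R (F x * of_real (x powr (- \<sigma>))))"
proof -
  have FL: "F \<in> L2 lborel" using F by (simp add: pos_L2_def)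
  have "(\<lambda>x. complex_of_real (indicator {1..} x * x powr (- \<sigma>))) \<in> L2 lborel"
  proof -
    have "(norm (complex_of_real (indicator {1..} x * x powr (- \<sigma>))))\<^sup>2 = indicator {1..} x * x powr (- (2 * \<sigma>))" for x :: real
      by (auto simp: indicator_def power2_eq_square powr_add[symmetric])
    then show ?thesis using powr_tail_integrable[of "2 * \<sigma>"] \<sigma> by (simp add: L2_def)
  qed
  from L2_mult_integrable[OF FL this]
  have "integrable lborel (\<lambda>x. F x * complex_of_real (indicator {1..} x * x powr (- \<sigma>)))" .
  moreover have "F x * complex_of_real (indicator {1..} x * x powr (- \<sigma>)) = indicator {1..} x *\<^sub>R (F x * of_real (x powr (- \<sigma>)))" for x
    by (simp add: indicator_def)
  ultimately show ?thesis by simp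
qed

lemma pos_L2_power_split:
  assumes F: "pos_L2 F c"
  shows "AE x in lborel. F x * of_real x powr (- s) = indicator {0<..<1} x *\<^sub>R (c * of_real x powr (- s)) + indicator {1..} x *\<^sub>R (F x * of_real x powr (- s))"
proof -
  have F0: "\<And>x. x \<le> 0 \<Longrightarrow> F x = 0" and Fc: "AE x in lborel. 0 < x \<and> x < 1 \<longrightarrow> F x = c"
    using F by (auto simp: pos_L2_def)
  show ?thesis using Fc by eventually_elim (use F0 in \<open>auto simp: indicator_def not_less\<close>)
qed

lemma norm_of_real_powr: "x > 0 \<Longrightarrow> norm (complex_of_real x powr w) = x powr Re w"
  using norm_powr_real_powr[of "of_real x" w] by simp

lemma pos_L2_measurable: "pos_L2 F c \<Longrightarrow> F \<in> borel_measurable borel"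
  using L2_measurable[of F lborel] by (simp add: pos_L2_def)

lemma pos_L2_tail_integrable_complex:
  assumes F: "pos_L2 F c" and s: "Re s > 1/2"
  shows "integrable lborel (\<lambda>x. indicator {1..} x *\<^sub>R (F x * of_real x powr (- s)))"
proof (rule Bochner_Integration.integrable_bound[OF pos_L2_tail_integrable[OF F s]])
  note [measurable] = pos_L2_measurable[OF F]
  show "(\<lambda>x. indicator {1..} x *\<^sub>R (F x * of_real x powr (- s))) \<in> borel_measurable lborel" by measurable
  show "AE x in lborel. norm (indicator {1..} x *\<^sub>R (F x * of_real x powr (- s))) \<le> norm (indicator {1..} x *\<^sub>R (F x * of_real (x powr (- Re s))))"
    by (auto simp: indicator_def norm_mult norm_of_real_powr)
qed

text \<open>Re s < 1 serves the constant piece on (0,1), which accounts for the pole c / (1 - s),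
  and Re s > 1/2 serves the L^2 tail.\<close>

lemma pos_L2_power_integrable:
  assumes F: "pos_L2 F c" and s: "1/2 < Re s" "Re s < 1"
  shows "integrable lborel (\<lambda>x. F x * of_real x powr (- s))"
    and "(LINT x|lborel. F x * of_real x powr (- s)) = c / (1 - s) + (LINT x|lborel. indicator {1..} x *\<^sub>R (F x * of_real x powr (- s)))"
proof -
  note [measurable] = pos_L2_measurable[OF F]
  have i1: "integrable lborel (\<lambda>x. indicator {0<..<1} x *\<^sub>R (c * of_real x powr (- s)))"
    and v1: "(LINT x|lborel. indicator {0<..<1} x *\<^sub>R (c * of_real x powr (- s))) = c / (1 - s)"
  proof -
    have e: "indicator {0<..<1} x *\<^sub>R (c * of_real x powr (- s)) = c * (indicator {0<..<1} x *\<^sub>R complex_of_real x powr (- s))" for x :: real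
      by (simp add: indicator_def)
    show "integrable lborel (\<lambda>x. indicator {0<..<1} x *\<^sub>R (c * of_real x powr (- s)))"
      unfolding e using powr_unit_integral(1)[OF s(2)] unfolding set_integrable_def by (rule integrable_mult_right)
    show "(LINT x|lborel. indicator {0<..<1} x *\<^sub>R (c * of_real x powr (- s))) = c / (1 - s)"
      unfolding e integral_mult_right_zero powr_unit_integral(2)[OF s(2), unfolded set_lebesgue_integral_def] by simp
  qed
  note i2 = pos_L2_tail_integrable_complex[OF F s(1)]
  note ae = pos_L2_power_split[OF F, of s]
  have m: "(\<lambda>x. F x * of_real x powr (- s)) \<in> borel_measurable lborel" by measurable
  have m2: "(\<lambda>x. indicator {0<..<1} x *\<^sub>R (c * of_real x powr (- s)) + indicator {1..} x *\<^sub>R (F x * of_real x powr (- s))) \<in> borel_measurable lborel" by measurable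
  show "integrable lborel (\<lambda>x. F x * of_real x powr (- s))"
    unfolding integrable_cong_AE[OF m m2 ae] by (rule Bochner_Integration.integrable_add[OF i1 i2])
  show "(LINT x|lborel. F x * of_real x powr (- s)) = c / (1 - s) + (LINT x|lborel. indicator {1..} x *\<^sub>R (F x * of_real x powr (- s)))"
    unfolding integral_cong_AE[OF m m2 ae] Bochner_Integration.integral_add[OF i1 i2] v1 ..
qed

text \<open>Integrating the Gaussian in u first gives a Gamma integral with l = pi x^2. The absolute
  integrals have the same form at Re s, which justifies Fubini.\<close>

lemma Mellin_Gauss_transform:
  assumes F: "pos_L2 F c" and s: "1/2 < Re s" "Re s < 1"
  shows "(LINT u|lborel. Gauss_transform F (exp u) * exp (of_real u * s / 2))
      = of_real pi powr (- s / 2) * Gamma (s / 2) * (LINT x|lborel. F x * of_real x powr (- s))"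
proof -
  note [measurable] = pos_L2_measurable[OF F]
  have F0: "\<And>x. x \<le> 0 \<Longrightarrow> F x = 0" using F by (auto simp: pos_L2_def)
  define k where "k x u w = exp (of_real u * w - of_real ((pi * x\<^sup>2) * exp u))" for x u :: real and w :: complex
  have re: "Re (s / 2) > 0" "Re (complex_of_real (Re s / 2)) > 0" using s by auto
  have powr2: "complex_of_real (pi * x\<^sup>2) powr (- w / 2) = of_real pi powr (- w / 2) * of_real x powr (- w)" if x: "x > 0" for x w
  proof -
    have "ln (pi * x\<^sup>2) = ln pi + 2 * ln x" using x by (simp add: ln_mult ln_realpow)
    moreover have "Ln (of_real (pi * x\<^sup>2)) = of_real (ln (pi * x\<^sup>2))" using x by (intro Ln_of_real) simp
    ultimately have "Ln (of_real (pi * x\<^sup>2)) = of_real (ln pi) + 2 * of_real (ln x)" by simp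
    moreover have "Ln (of_real pi) = of_real (ln pi)" by (rule Ln_of_real) simp
    moreover have "Ln (of_real x) = of_real (ln x)" using x by (rule Ln_of_real)
    moreover have "pi * x\<^sup>2 \<noteq> 0" using x by simp
    ultimately show ?thesis using x by (simp add: powr_def exp_add[symmetric] algebra_simps del: of_real_mult)
  qed
  have G: "integrable lborel (\<lambda>u. F x * k x u w)"
    "(LINT u|lborel. F x * k x u w) = of_real pi powr (- (2 * w) / 2) * Gamma w * (F x * of_real x powr (- (2 * w)))"
    if w: "Re w > 0" for x w
  proof -
    have "integrable lborel (\<lambda>u. F x * k x u w) \<and> (LINT u|lborel. F x * k x u w) = of_real pi powr (- (2 * w) / 2) * Gamma w * (F x * of_real x powr (- (2 * w)))"
    proof (cases "x > 0")
      case True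
      then have l: "pi * x\<^sup>2 > 0" by simp
      show ?thesis using Gamma_integral_log[OF w l] powr2[OF True, of "2 * w"] unfolding k_def by (simp add: mult_ac)
    qed (use F0 in auto)
    then show "integrable lborel (\<lambda>u. F x * k x u w)"
      "(LINT u|lborel. F x * k x u w) = of_real pi powr (- (2 * w) / 2) * Gamma w * (F x * of_real x powr (- (2 * w)))" by auto
  qed
  have nk: "norm (k x u w) = norm (k x u (of_real (Re w)))" "k x u (of_real (Re w)) = of_real (norm (k x u w))" for x u w
    by (simp_all add: k_def flip: exp_of_real)
  have nG: "(LINT u|lborel. norm (F x * k x u (s / 2))) = norm (of_real pi powr (- of_real (Re s) / 2) * Gamma (of_real (Re s / 2)) :: complex) * norm (F x * of_real x powr (- s))" for x
  proof -
    have rs: "Re (s / 2) = Re s / 2" by simp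
    have eq: "complex_of_real (LINT u|lborel. norm (k x u (s / 2))) = (LINT u|lborel. k x u (of_real (Re s / 2)))"
      unfolding rs[symmetric] nk(2) by (rule integral_complex_of_real[symmetric])
    have "(LINT u|lborel. norm (k x u (s / 2))) = norm (complex_of_real (LINT u|lborel. norm (k x u (s / 2))))" by simp
    then have "norm (F x) * (LINT u|lborel. norm (k x u (s / 2))) = norm (F x * (LINT u|lborel. k x u (of_real (Re s / 2))))"
      unfolding eq by (simp only: norm_mult)
    also have "F x * (LINT u|lborel. k x u (of_real (Re s / 2))) = (LINT u|lborel. F x * k x u (of_real (Re s / 2)))"
      by (rule integral_mult_right_zero[symmetric])
    also have "\<dots> = of_real pi powr (- (2 * of_real (Re s / 2)) / 2) * Gamma (of_real (Re s / 2)) * (F x * of_real x powr (- (2 * of_real (Re s / 2))))"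
      by (rule G(2)[OF re(2)])
    also have "norm \<dots> = norm (of_real pi powr (- of_real (Re s) / 2) * Gamma (of_real (Re s / 2)) :: complex) * norm (F x * of_real x powr (- s))"
    proof (cases "x > 0")
      case True
      then show ?thesis by (simp add: norm_mult norm_of_real_powr)
    qed (use F0 in auto)
    finally show ?thesis by (simp add: norm_mult)
  qed
  have key: "(LINT x|lborel. F x * k x u (s / 2)) = Gauss_transform F (exp u) * exp (of_real u * s / 2)" for u
  proof -
    have "F x * k x u (s / 2) = F x * of_real (exp (- pi * exp u * x\<^sup>2)) * exp (of_real u * s / 2)" for x
    proof -
      have "k x u (s / 2) = of_real (exp (- pi * exp u * x\<^sup>2)) * exp (of_real u * s / 2)"
        unfolding k_def exp_of_real[symmetric] exp_add[symmetric] by (simp add: algebra_simps)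
      then show ?thesis by simp
    qed
    then show ?thesis unfolding Gauss_transform_def by (simp only: integral_mult_left_zero)
  qed
  have "integrable (lborel \<Otimes>\<^sub>M lborel) (\<lambda>(x, u). F x * k x u (s / 2))"
  proof (rule lborel_pair.Fubini_integrable)
    show "(\<lambda>(x, u). F x * k x u (s / 2)) \<in> borel_measurable (lborel \<Otimes>\<^sub>M lborel)" unfolding k_def by measurable
    show "integrable lborel (\<lambda>x. \<integral>u. norm (case (x, u) of (x, u) \<Rightarrow> F x * k x u (s / 2)) \<partial>lborel)"
      unfolding prod.case nG using pos_L2_power_integrable(1)[OF F s] by (intro integrable_mult_right integrable_norm)
    show "AE x in lborel. integrable lborel (\<lambda>u. case (x, u) of (x, u) \<Rightarrow> F x * k x u (s / 2))"
      using G(1)[OF re(1)] by auto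
  qed
  from lborel_pair.Fubini_integral[OF this]
  have "(LINT u|lborel. (LINT x|lborel. F x * k x u (s / 2))) = (LINT x|lborel. (LINT u|lborel. F x * k x u (s / 2)))" .
  also have "\<dots> = of_real pi powr (- s / 2) * Gamma (s / 2) * (LINT x|lborel. F x * of_real x powr (- s))"
    unfolding G(2)[OF re(1)] by (subst integral_mult_right_zero) simp
  finally show ?thesis unfolding key by simp
qed

text \<open>The tail carries no restriction on the right, so it serves to continue the Mellin
  transform past s = 1.\<close>

lemma holomorphic_tail:
  assumes F: "pos_L2 F c"
  shows "(\<lambda>s. LINT x|lborel. indicator {1..} x *\<^sub>R (F x * of_real x powr (- s))) holomorphic_on {s. Re s > 1/2}"
proof (rule holomorphic_on_integral)
  note [measurable] = pos_L2_measurable[OF F]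
  show "open {s. Re s > 1/2}" by (rule open_halfspace_Re_gt)
  show "(\<lambda>x. indicator {1..} x *\<^sub>R (F x * of_real x powr (- w))) \<in> borel_measurable lborel" for w by measurable
  show "AE x in lborel. (\<lambda>s. indicator {1..} x *\<^sub>R (F x * of_real x powr (- s))) holomorphic_on {s. Re s > 1/2}"
  proof (rule AE_I2)
    fix x :: real
    show "(\<lambda>s. indicator {1..} x *\<^sub>R (F x * of_real x powr (- s))) holomorphic_on {s. Re s > 1/2}"
      by (cases "x \<ge> 1") (auto intro!: holomorphic_intros simp: scaleR_conv_of_real)
  qed
  fix w0 :: complex assume w0: "w0 \<in> {s. Re s > 1/2}"
  define r where "r = (Re w0 - 1/2) / 2"
  have r: "r > 0" using w0 by (simp add: r_def)
  have "norm (indicator {1..} x *\<^sub>R (F x * of_real x powr (- w))) \<le> norm (indicator {1..} x *\<^sub>R (F x * of_real (x powr (- (1/2 + r)))))"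
    if w: "w \<in> ball w0 r" for w x
  proof (cases "x \<ge> 1")
    case True
    have "\<bar>Re (w0 - w)\<bar> < r" using w abs_Re_le_cmod[of "w0 - w"] by (simp add: dist_norm)
    then have "Re (w0 - w) < r" using abs_ge_self[of "Re (w0 - w)"] by linarith
    then have "Re w0 - Re w < r" by simp
    moreover have "Re w0 = 1/2 + 2 * r" by (simp add: r_def field_simps)
    ultimately have "1/2 + r \<le> Re w" by linarith
    then have "x powr (- Re w) \<le> x powr (- (1/2 + r))" using True by (intro powr_mono) auto
    then show ?thesis using True by (simp add: norm_mult norm_of_real_powr mult_left_mono)
  qed simp
  then show "\<exists>r>0. \<exists>b. integrable lborel b \<and> (AE x in lborel. \<forall>w\<in>ball w0 r \<inter> {s. Re s > 1/2}. norm (indicator {1..} x *\<^sub>R (F x * of_real x powr (- w))) \<le> b x)"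
    using r integrable_norm[OF pos_L2_tail_integrable[OF F, of "1/2 + r"]]
    by (intro exI[of _ r] conjI exI[of _ "\<lambda>x. norm (indicator {1..} x *\<^sub>R (F x * of_real (x powr (- (1/2 + r)))))"] AE_I2) auto
qed

text \<open>The terms subtracted in the two \<open>Gauss_log\<close> reappear as the exponential and
  the constant term of the relation used by \<open>Mellin_complete_strip\<close>.\<close>

lemma Gauss_log_modular:
  assumes mod: "\<And>a. a > 0 \<Longrightarrow> Gauss_transform F a = Gauss_transform H (1 / a) / of_real (sqrt a)"
  shows "Gauss_log F c u + c / 2 * exp (- of_real u / 2) = exp (- of_real u / 2) * Gauss_log H d (- u) + d / 2"
proof -
  have "sqrt (exp u) = exp (u / 2)" by (rule real_sqrt_unique) (auto simp flip: exp_double)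
  then have "Gauss_transform F (exp u) = exp (- of_real u / 2) * Gauss_transform H (exp (- u))"
    using mod[of "exp u"] by (simp add: exp_minus field_simps exp_of_real[symmetric])
  moreover have "exp (- complex_of_real u / 2) * exp (of_real u / 2) = 1" by (simp flip: exp_add)
  ultimately show ?thesis by (simp add: Gauss_log_def algebra_simps)
qed

text \<open>The cosine relation is recorded through its effect on Gaussian tests. The conditions are
  symmetric under exchange of the two functions.\<close>

locale cosine_pair =
  fixes F H :: "real \<Rightarrow> complex" and c d :: complex
  assumes F: "pos_L2 F c" and H: "pos_L2 H d"
    and mod: "\<And>a. a > 0 \<Longrightarrow> Gauss_transform F a = Gauss_transform H (1 / a) / of_real (sqrt a)"
begin

text \<open>The counterpart of \<open>completed_zeta\<close>, with \<open>Gauss_log\<close> in place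
  of \<open>theta_log\<close>.\<close>

definition X :: "complex \<Rightarrow> complex" where
  "X = Mellin_complete (Gauss_log F c) c (Gauss_log H d) d"

lemma X_holomorphic: "X holomorphic_on A"
  unfolding X_def by (intro Mellin_complete_holomorphic rapid_Gauss_log[OF F] rapid_Gauss_log[OF H])

lemma X_strip:
  assumes s: "1/2 < Re s" "Re s < 1"
  shows "arch s * X s = (LINT x|lborel. F x * of_real x powr (- s))"
proof -
  have s0: "0 < Re s" "s \<noteq> 1" using s by auto
  have "X s = s * (s - 1) * (LINT u|lborel. (Gauss_log F c u + c / 2 * exp (- of_real u / 2)) * exp (of_real u * s / 2))"
    unfolding X_def
    by (rule Mellin_complete_strip[OF rapid_Gauss_log[OF F] rapid_Gauss_log[OF H] Gauss_log_modular[OF mod] s0(1) s(2), symmetric])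
  also have "\<dots> = s * (s - 1) * (of_real pi powr (- s / 2) * Gamma (s / 2) * (LINT x|lborel. F x * of_real x powr (- s)))"
    by (simp add: Gauss_log_def Mellin_Gauss_transform[OF F s])
  finally show ?thesis using arch_mult[OF s0] by simp
qed

text \<open>The tail integral \<open>T\<close> continues \<open>arch s * X s\<close> past the pole
  at 1 as - c / (s - 1) + T s. For Re s \<ge> 3/2 the first term is bounded and the tail is
  dominated by the integral with weight x^(-3/2).\<close>

lemma X_right_bounded: "\<exists>C. \<forall>s. Re s \<ge> 3/2 \<longrightarrow> norm (arch s * X s) \<le> C"
proof -
  define T where "T s = (LINT x|lborel. indicator {1..} x *\<^sub>R (F x * of_real x powr (- s)))" for s
  define f where "f s = of_real pi powr (s / 2) * rGamma (s / 2 + 1) / 2 * X s" for s :: complex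
  define g where "g s = - c + (s - 1) * T s" for s
  have fs: "arch w * X w = f w / (w - 1)" for w by (simp add: f_def arch_def)
  have Th: "T holomorphic_on {s. Re s > 1/2}" unfolding T_def[abs_def] by (rule holomorphic_tail[OF F])
  have fg: "f s = g s" if "Re s > 1/2" for s
  proof (rule analytic_continuation_open[where s = "{s. Re s > 1/2} \<inter> {s. Re s < 1}" and s' = "{s. Re s > 1/2}" and f = f and g = g])
    show "open ({s. Re s > 1/2} \<inter> {s. Re s < 1})" "open {s. Re s > 1/2}" by (intro open_Int open_halfspace_Re_gt open_halfspace_Re_lt)+
    show "{s. Re s > 1/2} \<inter> {s. Re s < 1} \<noteq> {}" by (auto simp: set_eq_iff intro!: exI[of _ "3/4"])
    show "connected {s. Re s > 1/2}" by (intro convex_connected convex_halfspace_Re_gt)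
    show "f holomorphic_on {s. Re s > 1/2}" unfolding f_def by (intro holomorphic_intros X_holomorphic) auto
    show "g holomorphic_on {s. Re s > 1/2}" unfolding g_def by (intro holomorphic_intros Th)
    fix w assume "w \<in> {s. Re s > 1/2} \<inter> {s. Re s < 1}"
    then have w: "1/2 < Re w" "Re w < 1" by auto
    then have w1: "1 - w \<noteq> 0" "w - 1 \<noteq> 0" by auto
    have "f w / (w - 1) = c / (1 - w) + T w"
      using X_strip[OF w] pos_L2_power_integrable(2)[OF F w] by (simp add: fs T_def)
    then have "f w = (c / (1 - w) + T w) * (w - 1)" using w1 by (simp add: divide_eq_eq)
    also have "\<dots> = c * ((w - 1) / (1 - w)) + T w * (w - 1)" by (simp add: distrib_right)
    also have "(w - 1) / (1 - w) = - 1" using w1 by (simp add: divide_eq_eq)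
    finally show "f w = g w" by (simp add: g_def mult.commute)
  qed (use that in auto)
  define B where "B = (LINT x|lborel. norm (indicator {1..} x *\<^sub>R (F x * of_real (x powr (- (3/2))))))"
  have "norm (arch s * X s) \<le> 2 * norm c + B" if s: "Re s \<ge> 3/2" for s
  proof -
    have n: "norm (s - 1) \<ge> 1/2" using s abs_Re_le_cmod[of "s - 1"] by simp
    have "arch s * X s = (- c + (s - 1) * T s) / (s - 1)" using fg[of s] s by (simp add: fs g_def)
    also have "\<dots> = - c / (s - 1) + T s" using n by (subst add_divide_distrib) auto
    finally have "norm (arch s * X s) \<le> norm (- c / (s - 1)) + norm (T s)" using norm_triangle_ineq by metis
    moreover have "norm (- c / (s - 1)) \<le> 2 * norm c"
    proof -
      have "norm c * 1 \<le> norm c * (2 * norm (s - 1))" using n by (intro mult_left_mono) auto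
      moreover have "norm (s - 1) > 0" using n by linarith
      ultimately show ?thesis by (simp add: norm_divide divide_le_eq mult_ac)
    qed
    moreover have "norm (T s) \<le> B"
      unfolding T_def B_def
    proof (rule Bochner_Integration.integral_norm_bound_integral)
      show "integrable lborel (\<lambda>x. indicator {1..} x *\<^sub>R (F x * of_real x powr (- s)))"
        by (rule pos_L2_tail_integrable_complex[OF F]) (use s in simp)
      show "integrable lborel (\<lambda>x. norm (indicator {1..} x *\<^sub>R (F x * of_real (x powr (- (3/2))))))"
        by (intro integrable_norm pos_L2_tail_integrable[OF F]) simp
      fix x :: real
      show "norm (indicator {1..} x *\<^sub>R (F x * of_real x powr (- s))) \<le> norm (indicator {1..} x *\<^sub>R (F x * of_real (x powr (- (3/2)))))"
      proof (cases "x \<ge> 1")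
        case True
        then have "x powr (- Re s) \<le> x powr (- (3/2))" using s by (intro powr_mono) auto
        then show ?thesis using True by (simp add: norm_mult norm_of_real_powr mult_left_mono)
      qed simp
    qed
    ultimately show ?thesis by linarith
  qed
  then show ?thesis by blast
qed

end

section \<open>Boundary values on the critical line\<close>

text \<open>On the critical line this is exp (- t^2) times the character of frequency \<mu>, so
  tests against all \<mu> decide equality. Being entire in s, it can also be used on neighbouring
  vertical lines.\<close>

definition Gauss_test :: "real \<Rightarrow> complex \<Rightarrow> complex" where
  "Gauss_test \<mu> s = exp ((s - 1/2)\<^sup>2 + of_real \<mu> * (s - 1/2))"

lemma Gauss_test_measurable [measurable]: "Gauss_test \<mu> \<in> borel_measurable borel"
  unfolding Gauss_test_def[abs_def] by measurable

lemma Complex_measurable [measurable]: "(\<lambda>t. Complex \<sigma> t) \<in> borel_measurable borel"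
proof -
  have "(\<lambda>t. Complex \<sigma> t) = (\<lambda>t. of_real \<sigma> + \<i> * of_real t)" by (auto simp: complex_eq_iff)
  then show ?thesis by simp
qed

lemma norm_Gauss_test: "norm (Gauss_test \<mu> (Complex \<sigma> t)) = exp ((\<sigma> - 1/2)\<^sup>2 + \<mu> * (\<sigma> - 1/2)) * exp (- t\<^sup>2)"
proof -
  have "Re ((Complex \<sigma> t - 1/2)\<^sup>2 + of_real \<mu> * (Complex \<sigma> t - 1/2)) = ((\<sigma> - 1/2)\<^sup>2 + \<mu> * (\<sigma> - 1/2)) + - t\<^sup>2"
    by (simp add: power2_eq_square)
  then have "norm (exp ((Complex \<sigma> t - 1/2)\<^sup>2 + of_real \<mu> * (Complex \<sigma> t - 1/2))) = exp (((\<sigma> - 1/2)\<^sup>2 + \<mu> * (\<sigma> - 1/2)) + - t\<^sup>2)"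
    by (simp only: norm_exp_eq_Re)
  then show ?thesis unfolding Gauss_test_def by (simp only: exp_add[of "(\<sigma> - 1/2)\<^sup>2 + \<mu> * (\<sigma> - 1/2)" "- t\<^sup>2"])
qed

lemma exp_minus_square_integrable: "integrable lborel (\<lambda>t::real. exp (- t\<^sup>2))"
  and exp_minus_half_square_integrable: "integrable lborel (\<lambda>t::real. exp (- t\<^sup>2 / 2))"
  using gaussian_Fourier(2)[of "sqrt 2"] gaussian_Fourier(2)[of 1] by (simp_all add: power_mult_distrib)

lemma Gauss_test_integrable: "integrable lborel (\<lambda>t. Gauss_test \<mu> (Complex \<sigma> t))"
proof (rule Bochner_Integration.integrable_bound)
  show "integrable lborel (\<lambda>t. exp ((\<sigma> - 1/2)\<^sup>2 + \<mu> * (\<sigma> - 1/2)) * exp (- t\<^sup>2))"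
    by (intro integrable_mult_right exp_minus_square_integrable)
qed (auto simp: norm_Gauss_test)

text \<open>The inverse Mellin kernel of \<open>Gauss_test \<mu>\<close>, Gaussian in ln x around
  \<mu> apart from the power of x.\<close>

definition Gauss_kernel :: "real \<Rightarrow> real \<Rightarrow> complex" where
  "Gauss_kernel \<mu> x = of_real (sqrt pi * x powr (- (1/2)) * exp (- (\<mu> - ln x)\<^sup>2 / 4))"

text \<open>The result does not depend on \<sigma>; this replaces a contour shift between vertical
  lines.\<close>

lemma Gauss_kernel_integral:
  assumes x: "x > 0"
  shows "of_real x powr (- of_real \<sigma>) * (LINT t|lborel. Gauss_test \<mu> (Complex \<sigma> t) * iexp (- (t * ln x))) = Gauss_kernel \<mu> x"
proof -
  define \<tau> where "\<tau> = \<sigma> - 1/2"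
  define \<nu> where "\<nu> = \<mu> - ln x"
  have e: "Gauss_test \<mu> (Complex \<sigma> t) * iexp (- (t * ln x)) = of_real (exp (\<tau>\<^sup>2 + \<mu> * \<tau>)) * (of_real (exp (- (sqrt 2 * t)\<^sup>2 / 2)) * iexp (t * (2 * \<tau> + \<nu>)))" for t
  proof -
    have "(Complex \<sigma> t - 1/2)\<^sup>2 + of_real \<mu> * (Complex \<sigma> t - 1/2) + \<i> * of_real (- (t * ln x))
       = of_real (\<tau>\<^sup>2 + \<mu> * \<tau>) + (of_real (- t\<^sup>2) + \<i> * of_real (t * (2 * \<tau> + \<nu>)))"
      by (simp add: complex_eq_iff power2_eq_square \<tau>_def \<nu>_def algebra_simps)
    then have "Gauss_test \<mu> (Complex \<sigma> t) * iexp (- (t * ln x)) = of_real (exp (\<tau>\<^sup>2 + \<mu> * \<tau>)) * (of_real (exp (- t\<^sup>2)) * iexp (t * (2 * \<tau> + \<nu>)))"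
      unfolding Gauss_test_def exp_add[symmetric] by (simp only: exp_add exp_of_real)
    moreover have "- (sqrt 2 * t)\<^sup>2 / 2 = - t\<^sup>2" by (simp add: power_mult_distrib)
    ultimately show ?thesis by (simp only:)
  qed
  have "(LINT t|lborel. Gauss_test \<mu> (Complex \<sigma> t) * iexp (- (t * ln x))) = of_real (exp (\<tau>\<^sup>2 + \<mu> * \<tau>)) * of_real (sqrt (2 * pi) / sqrt 2 * exp (- ((2 * \<tau> + \<nu>) / sqrt 2)\<^sup>2 / 2))"
    unfolding e integral_mult_right_zero by (subst gaussian_Fourier(1)) auto
  also have "sqrt (2 * pi) / sqrt 2 = sqrt pi" by (simp add: real_sqrt_mult)
  also have "- ((2 * \<tau> + \<nu>) / sqrt 2)\<^sup>2 / 2 = - (2 * \<tau> + \<nu>)\<^sup>2 / 4" by (simp add: power_divide)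
  finally have "of_real x powr (- of_real \<sigma>) * (LINT t|lborel. Gauss_test \<mu> (Complex \<sigma> t) * iexp (- (t * ln x)))
     = of_real (x powr (- \<sigma>) * (exp (\<tau>\<^sup>2 + \<mu> * \<tau>) * (sqrt pi * exp (- (2 * \<tau> + \<nu>)\<^sup>2 / 4))))"
    using x powr_of_real[of x "- \<sigma>"] by simp
  also have "x powr (- \<sigma>) * (exp (\<tau>\<^sup>2 + \<mu> * \<tau>) * (sqrt pi * exp (- (2 * \<tau> + \<nu>)\<^sup>2 / 4))) = sqrt pi * x powr (- (1/2)) * exp (- \<nu>\<^sup>2 / 4)"
  proof -
    have "- \<sigma> * ln x + (\<tau>\<^sup>2 + \<mu> * \<tau>) + - (2 * \<tau> + \<nu>)\<^sup>2 / 4 = - (1/2) * ln x + - \<nu>\<^sup>2 / 4"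
      by (simp add: \<tau>_def \<nu>_def power2_eq_square field_simps)
    then have "exp (- \<sigma> * ln x) * exp (\<tau>\<^sup>2 + \<mu> * \<tau>) * exp (- (2 * \<tau> + \<nu>)\<^sup>2 / 4) = exp (- (1/2) * ln x) * exp (- \<nu>\<^sup>2 / 4)"
      unfolding exp_add[symmetric] by simp
    moreover have "x powr (- \<sigma>) = exp (- \<sigma> * ln x)" "x powr (- (1/2)) = exp (- (1/2) * ln x)" using x by (simp_all add: powr_def)
    ultimately show ?thesis by (simp only: mult_ac)
  qed
  finally show ?thesis by (simp add: Gauss_kernel_def \<nu>_def)
qed

lemma Mellin_Gauss_test:
  fixes G :: "real \<Rightarrow> complex"
  assumes G: "integrable lborel (\<lambda>x. G x * of_real x powr (- of_real \<sigma>))" and G0: "\<And>x. x \<le> 0 \<Longrightarrow> G x = 0"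
  shows "(LINT t|lborel. (LINT x|lborel. G x * of_real x powr (- Complex \<sigma> t)) * Gauss_test \<mu> (Complex \<sigma> t)) = (LINT x|lborel. G x * Gauss_kernel \<mu> x)"
proof -
  have e: "G x * of_real x powr (- Complex \<sigma> t) = (G x * of_real x powr (- of_real \<sigma>)) * iexp (- (t * ln x))" for x t
  proof (cases "x > 0")
    case True
    have "of_real x powr (- Complex \<sigma> t) = of_real x powr (- of_real \<sigma>) * iexp (- (t * ln x))"
    proof -
      have "- Complex \<sigma> t * of_real (ln x) = - of_real \<sigma> * of_real (ln x) + \<i> * of_real (- (t * ln x))" by (simp add: complex_eq_iff)
      then have "exp (- Complex \<sigma> t * of_real (ln x)) = exp (- of_real \<sigma> * of_real (ln x)) * iexp (- (t * ln x))"
        by (simp only: exp_add)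
      then show ?thesis using True by (simp add: powr_def Ln_of_real)
    qed
    then show ?thesis by simp
  qed (simp add: G0)
  have "(LINT t|lborel. (LINT x|lborel. G x * of_real x powr (- Complex \<sigma> t)) * Gauss_test \<mu> (Complex \<sigma> t))
      = (LINT t|lborel. Gauss_test \<mu> (Complex \<sigma> t) * (LINT x|lborel. (G x * of_real x powr (- of_real \<sigma>)) * iexp (- (t * ln x))))"
    unfolding e by (simp only: mult.commute)
  also have "\<dots> = (LINT x|lborel. (G x * of_real x powr (- of_real \<sigma>)) * (LINT t|lborel. Gauss_test \<mu> (Complex \<sigma> t) * iexp (- (t * ln x))))"
    by (rule Fubini_bounded_kernel[OF sigma_finite_lborel sigma_finite_lborel Gauss_test_integrable G, where C = 1]) auto
  also have "\<dots> = (LINT x|lborel. G x * Gauss_kernel \<mu> x)"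
  proof (intro Bochner_Integration.integral_cong refl)
    fix x
    show "(G x * of_real x powr (- of_real \<sigma>)) * (LINT t|lborel. Gauss_test \<mu> (Complex \<sigma> t) * iexp (- (t * ln x))) = G x * Gauss_kernel \<mu> x"
      by (cases "x > 0") (simp_all only: mult.assoc Gauss_kernel_integral, simp add: G0)
  qed
  finally show ?thesis .
qed

context cosine_pair
begin

lemma Gauss_kernel_integrable: "integrable lborel (\<lambda>x. F x * Gauss_kernel \<mu> x)"
proof (rule Bochner_Integration.integrable_bound)
  have [measurable]: "F \<in> borel_measurable borel" by (rule pos_L2_measurable[OF F])
  show "(\<lambda>x. F x * Gauss_kernel \<mu> x) \<in> borel_measurable lborel" unfolding Gauss_kernel_def by measurable
  show "integrable lborel (\<lambda>x. (sqrt pi * exp ((\<mu> + 1/4) / 4)) * norm (F x * of_real x powr (- of_real (3/4))))"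
    by (intro integrable_mult_right integrable_norm pos_L2_power_integrable(1)[OF F]) auto
  have "norm (F x * Gauss_kernel \<mu> x) \<le> (sqrt pi * exp ((\<mu> + 1/4) / 4)) * norm (F x * of_real x powr (- of_real (3/4)))" for x
  proof (cases "x > 0")
    case True
    have "0 \<le> (ln x - \<mu> - 1/2)\<^sup>2" by simp
    then have "- (1/2) * ln x + - (\<mu> - ln x)\<^sup>2 / 4 \<le> (\<mu> + 1/4) / 4 + - (3/4) * ln x"
      by (simp add: power2_eq_square field_simps)
    then have "x powr (- (1/2)) * exp (- (\<mu> - ln x)\<^sup>2 / 4) \<le> exp ((\<mu> + 1/4) / 4) * x powr (- (3/4))"
      using True by (simp add: powr_def exp_add[symmetric])
    then have "norm (F x) * (sqrt pi * (x powr (- (1/2)) * exp (- (\<mu> - ln x)\<^sup>2 / 4))) \<le> norm (F x) * (sqrt pi * (exp ((\<mu> + 1/4) / 4) * x powr (- (3/4))))"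
      by (intro mult_left_mono) auto
    then show ?thesis using True by (simp add: Gauss_kernel_def norm_mult norm_of_real_powr mult_ac abs_mult)
  next
    case False
    then have "F x = 0" using F by (simp add: pos_L2_def)
    then show ?thesis by simp
  qed
  then show "AE x in lborel. norm (F x * Gauss_kernel \<mu> x) \<le> norm ((sqrt pi * exp ((\<mu> + 1/4) / 4)) * norm (F x * of_real x powr (- of_real (3/4))))"
    by (intro AE_I2) (simp add: abs_mult)
qed

lemma archX_measurable [measurable]: "(\<lambda>s. arch s * X s) \<in> borel_measurable borel"
proof -
  have "(\<lambda>s. arch s * X s) holomorphic_on - {1}"
    by (intro holomorphic_intros X_holomorphic arch_holomorphic)
  then show ?thesis
    by (intro borel_measurable_continuous_countable_exceptions[of "{1}"] holomorphic_on_imp_continuous_on) auto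
qed

lemma X_bound: "\<exists>C. \<forall>s. \<bar>Re s\<bar> \<le> K \<longrightarrow> norm (X s) \<le> C * (1 + norm s)\<^sup>2"
  unfolding X_def by (rule Mellin_complete_bound[OF rapid_Gauss_log[OF F] rapid_Gauss_log[OF H]])

text \<open>Together \<open>arch\<close> and \<open>X\<close> grow at most like exp (4 |t|), while
  the test function decays like exp (- t^2). Half of the Gaussian remains as an integrable majorant,
  uniform in \<sigma>.\<close>

lemma archX_test_bound:
  "\<exists>B. \<forall>\<sigma> t. 1/2 \<le> \<sigma> \<and> \<sigma> \<le> 3/4 \<longrightarrow> norm (arch (Complex \<sigma> t) * X (Complex \<sigma> t) * Gauss_test \<mu> (Complex \<sigma> t)) \<le> B * exp (- t\<^sup>2 / 2)"
proof -
  obtain C1 where C1: "C1 > 0" "\<And>s. 1/2 \<le> Re s \<Longrightarrow> Re s \<le> 3/2 \<Longrightarrow> 1/4 \<le> norm (s - 1) \<Longrightarrow> norm (arch s) \<le> C1 * exp (2 * \<bar>Im s\<bar>)"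
    using arch_bound by blast
  obtain C2 where C2: "\<And>s. \<bar>Re s\<bar> \<le> 1 \<Longrightarrow> norm (X s) \<le> C2 * (1 + norm s)\<^sup>2" using X_bound by blast
  have C20: "C2 \<ge> 0" using order_trans[OF norm_ge_zero C2[of 0]] by simp
  have "norm (arch (Complex \<sigma> t) * X (Complex \<sigma> t) * Gauss_test \<mu> (Complex \<sigma> t)) \<le> (C1 * C2 * exp (2 + 1 + \<bar>\<mu>\<bar> + 8)) * exp (- t\<^sup>2 / 2)"
    if \<sigma>: "1/2 \<le> \<sigma>" "\<sigma> \<le> 3/4" for \<sigma> t
  proof -
    define s where "s = Complex \<sigma> t"
    have s: "Re s = \<sigma>" "Im s = t" by (auto simp: s_def)
    have "1/4 \<le> norm (s - 1)" using abs_Re_le_cmod[of "s - 1"] \<sigma> s by simp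
    then have n1: "norm (arch s) \<le> C1 * exp (2 * \<bar>t\<bar>)" using C1(2)[of s] \<sigma> s by simp
    have "norm s \<le> 1 + \<bar>t\<bar>" using cmod_le[of s] \<sigma> s by simp
    then have "(1 + norm s)\<^sup>2 \<le> (exp (1 + \<bar>t\<bar>))\<^sup>2"
      using exp_ge_add_one_self[of "1 + \<bar>t\<bar>"] by (intro power_mono) auto
    also have "\<dots> = exp (2 + 2 * \<bar>t\<bar>)" by (simp add: exp_double[symmetric])
    finally have n2: "norm (X s) \<le> C2 * exp (2 + 2 * \<bar>t\<bar>)"
      using order_trans[OF C2[of s] mult_left_mono[OF _ C20]] \<sigma> s by simp
    have n3: "norm (Gauss_test \<mu> s) \<le> exp (1 + \<bar>\<mu>\<bar>) * exp (- t\<^sup>2)"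
    proof -
      have a: "(\<sigma> - 1/2)\<^sup>2 \<le> 1" using \<sigma> by (intro power_le_one) auto
      have "\<mu> * (\<sigma> - 1/2) \<le> \<bar>\<mu>\<bar> * (\<sigma> - 1/2)" using \<sigma> by (intro mult_right_mono) auto
      also have "\<dots> \<le> \<bar>\<mu>\<bar> * 1" using \<sigma> by (intro mult_left_mono) auto
      finally have "(\<sigma> - 1/2)\<^sup>2 + \<mu> * (\<sigma> - 1/2) \<le> 1 + \<bar>\<mu>\<bar>" using a by linarith
      then show ?thesis unfolding s_def norm_Gauss_test by (intro mult_right_mono) auto
    qed
    have "norm (arch s * X s * Gauss_test \<mu> s) \<le> (C1 * exp (2 * \<bar>t\<bar>)) * (C2 * exp (2 + 2 * \<bar>t\<bar>)) * (exp (1 + \<bar>\<mu>\<bar>) * exp (- t\<^sup>2))"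
      unfolding norm_mult using n1 n2 n3 C1(1) C20 by (intro mult_mono) auto
    also have "\<dots> = C1 * C2 * exp (2 * \<bar>t\<bar> + (2 + 2 * \<bar>t\<bar>) + (1 + \<bar>\<mu>\<bar>) + - t\<^sup>2)"
      by (simp only: exp_add mult_ac)
    also have "\<dots> \<le> C1 * C2 * exp ((2 + 1 + \<bar>\<mu>\<bar> + 8) + - t\<^sup>2 / 2)"
    proof -
      \<comment> \<open>Completing the square: 4 |t| - t^2 / 2 \<le> 8, the source of the 8 in the
        constant.\<close>
      have "0 \<le> (\<bar>t\<bar> - 4)\<^sup>2" by simp
      then have "4 * \<bar>t\<bar> - t\<^sup>2 \<le> 8 - t\<^sup>2 / 2" by (simp add: power2_diff)
      then show ?thesis using C1(1) C20 by (intro mult_left_mono) auto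
    qed
    also have "\<dots> = (C1 * C2 * exp (2 + 1 + \<bar>\<mu>\<bar> + 8)) * exp (- t\<^sup>2 / 2)"
      using exp_add[of "2 + 1 + \<bar>\<mu>\<bar> + 8" "- t\<^sup>2 / 2"] by (simp only: mult.assoc)
    finally show ?thesis by (simp add: s_def)
  qed
  then show ?thesis by blast
qed

lemma archX_test_integrable: "integrable lborel (\<lambda>t. arch (Complex (1/2) t) * X (Complex (1/2) t) * Gauss_test \<mu> (Complex (1/2) t))"
proof -
  obtain B where B: "\<And>\<sigma> t. 1/2 \<le> \<sigma> \<Longrightarrow> \<sigma> \<le> 3/4 \<Longrightarrow> norm (arch (Complex \<sigma> t) * X (Complex \<sigma> t) * Gauss_test \<mu> (Complex \<sigma> t)) \<le> B * exp (- t\<^sup>2 / 2)"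
    using archX_test_bound by blast
  show ?thesis
  proof (rule Bochner_Integration.integrable_bound)
    show "integrable lborel (\<lambda>t. B * exp (- t\<^sup>2 / 2))" by (intro integrable_mult_right exp_minus_half_square_integrable)
    show "(\<lambda>t. arch (Complex (1/2) t) * X (Complex (1/2) t) * Gauss_test \<mu> (Complex (1/2) t)) \<in> borel_measurable lborel"
      using measurable_compose[OF Complex_measurable[of "1/2"] archX_measurable] by simp
    show "AE t in lborel. norm (arch (Complex (1/2) t) * X (Complex (1/2) t) * Gauss_test \<mu> (Complex (1/2) t)) \<le> norm (B * exp (- t\<^sup>2 / 2))"
      using B[of "1/2"] by (intro AE_I2) (auto intro: order_trans[OF _ abs_ge_self])
  qed
qed

text \<open>\<open>X_strip\<close> holds for Re s > 1/2. On the lines \<sigma> n decreasing to 1/2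
  the tested integral has a value independent of n, and dominated convergence carries it to the
  critical line.\<close>

lemma archX_test_integral:
  "(LINT t|lborel. arch (Complex (1/2) t) * X (Complex (1/2) t) * Gauss_test \<mu> (Complex (1/2) t)) = (LINT x|lborel. F x * Gauss_kernel \<mu> x)"
proof -
  obtain B where B: "\<And>\<sigma> t. 1/2 \<le> \<sigma> \<Longrightarrow> \<sigma> \<le> 3/4 \<Longrightarrow> norm (arch (Complex \<sigma> t) * X (Complex \<sigma> t) * Gauss_test \<mu> (Complex \<sigma> t)) \<le> B * exp (- t\<^sup>2 / 2)"
    using archX_test_bound by blast
  define Y where "Y s = arch s * X s * Gauss_test \<mu> s" for s
  define \<sigma> where "\<sigma> n = 1/2 + 1/4 * (1 / real (Suc n))" for n
  have \<sigma>: "1/2 < \<sigma> n" "\<sigma> n \<le> 3/4" for n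
  proof -
    have "0 < 1 / real (Suc n)" "1 / real (Suc n) \<le> 1" by auto
    then show "1/2 < \<sigma> n" "\<sigma> n \<le> 3/4" unfolding \<sigma>_def by linarith+
  qed
  have \<sigma>lim: "\<sigma> \<longlonglongrightarrow> 1/2 + 1/4 * 0" unfolding \<sigma>_def by (intro tendsto_intros LIMSEQ_Suc[OF lim_1_over_n])
  have Ym: "Y \<in> borel_measurable borel" unfolding Y_def using archX_measurable by measurable
  have Yc: "isCont Y (Complex (1/2) t)" for t
  proof -
    have "Y holomorphic_on - {1}" unfolding Y_def Gauss_test_def by (intro holomorphic_intros X_holomorphic arch_holomorphic)
    then have c: "continuous_on (- {1}) Y" by (rule holomorphic_on_imp_continuous_on)
    have "Complex (1/2) t \<in> - {1}" by (simp add: complex_eq_iff)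
    moreover have "open (- {1 :: complex})" by (intro open_Compl closed_singleton)
    from iffD1[OF continuous_on_eq_continuous_at[OF this] c] have "\<forall>x\<in>- {1}. isCont Y x" .
    ultimately show ?thesis by blast
  qed
  have "(\<lambda>n. LINT t|lborel. Y (Complex (\<sigma> n) t)) \<longlonglongrightarrow> (LINT t|lborel. Y (Complex (1/2) t))"
  proof (rule integral_dominated_convergence)
    show "integrable lborel (\<lambda>t. B * exp (- t\<^sup>2 / 2))" by (intro integrable_mult_right exp_minus_half_square_integrable)
    show "(\<lambda>t. Y (Complex (1/2) t)) \<in> borel_measurable lborel" using measurable_compose[OF Complex_measurable Ym] by simp
    show "(\<lambda>t. Y (Complex (\<sigma> n) t)) \<in> borel_measurable lborel" for n using measurable_compose[OF Complex_measurable Ym] by simp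
    show "AE t in lborel. (\<lambda>n. Y (Complex (\<sigma> n) t)) \<longlonglongrightarrow> Y (Complex (1/2) t)"
    proof (rule AE_I2)
      fix t
      have "(\<lambda>n. Complex (\<sigma> n) t) \<longlonglongrightarrow> Complex (1/2) t" using \<sigma>lim by (intro tendsto_Complex tendsto_const) simp
      then show "(\<lambda>n. Y (Complex (\<sigma> n) t)) \<longlonglongrightarrow> Y (Complex (1/2) t)" by (rule isCont_tendsto_compose[OF Yc])
    qed
    show "AE t in lborel. norm (Y (Complex (\<sigma> n) t)) \<le> B * exp (- t\<^sup>2 / 2)" for n
      unfolding Y_def using B[of "\<sigma> n"] \<sigma>[of n] by (intro AE_I2) auto
  qed
  moreover have "(LINT t|lborel. Y (Complex (\<sigma> n) t)) = (LINT x|lborel. F x * Gauss_kernel \<mu> x)" for n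
  proof -
    have s: "1/2 < Re (Complex (\<sigma> n) t)" "Re (Complex (\<sigma> n) t) < 1" for t using \<sigma>[of n] by auto
    have "integrable lborel (\<lambda>x. F x * of_real x powr (- of_real (\<sigma> n)))"
      by (rule pos_L2_power_integrable(1)[OF F]) (use \<sigma>[of n] in auto)
    moreover have "F x = 0" if "x \<le> 0" for x using F that by (simp add: pos_L2_def)
    ultimately show ?thesis unfolding Y_def X_strip[OF s] by (rule Mellin_Gauss_test)
  qed
  ultimately have "(\<lambda>n::nat. (LINT x|lborel. F x * Gauss_kernel \<mu> x)) \<longlonglongrightarrow> (LINT t|lborel. Y (Complex (1/2) t))" by simp
  from LIMSEQ_unique[OF this tendsto_const] show ?thesis unfolding Y_def .
qed

text \<open>The L^2 limit defining the Mellin transform and the continued function have equal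
  integrals against every \<open>Gauss_test\<close>. Fourier uniqueness for their difference times
  exp (- t^2) gives equality almost everywhere.\<close>

lemma boundary_values:
  assumes f: "F = ext_zero f" "f \<in> L2 halfline" and g: "g \<in> L2 crit_line" and m: "is_mellin_transform f g"
  shows "AE s in crit_line. g s = arch s * X s"
proof -
  have [measurable]: "g \<in> borel_measurable borel"
    using L2_measurable[OF g] by (simp add: measurable_cong_sets[OF crit_line_sets refl])
  have [measurable]: "F \<in> borel_measurable borel" by (rule pos_L2_measurable[OF F])
  have FL: "F \<in> L2 lborel" using F by (simp add: pos_L2_def)
  have WL: "Gauss_test \<mu> \<in> L2 crit_line" for \<mu>
  proof -
    have "(norm (Gauss_test \<mu> (Complex (1/2) t)))\<^sup>2 = exp (- (2 * t)\<^sup>2 / 2)" for t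
      by (simp add: norm_Gauss_test exp_double[symmetric] power_mult_distrib)
    then have "integrable lborel (\<lambda>t. (norm (Gauss_test \<mu> (Complex (1/2) t)))\<^sup>2)" using gaussian_Fourier(2)[of 2] by simp
    then show ?thesis by (simp add: L2_def crit_line_integrable_iff measurable_cong_sets[OF crit_line_sets refl])
  qed
  have gW: "integrable lborel (\<lambda>t. g (Complex (1/2) t) * Gauss_test \<mu> (Complex (1/2) t))" for \<mu>
    using L2_mult_integrable[OF g WL[of \<mu>]] by (simp add: crit_line_integrable_iff)
  have gI: "(LINT t|lborel. g (Complex (1/2) t) * Gauss_test \<mu> (Complex (1/2) t)) = (LINT x|lborel. F x * Gauss_kernel \<mu> x)" for \<mu>
  proof -
    define k where "k T s = (LINT x:{1/T..T}|lborel. f x * complex_of_real x powr (- s))" for T s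
    define FT where "FT T x = indicator {1/T..T} x *\<^sub>R F x" for T x
    have [measurable]: "FT T \<in> borel_measurable borel" for T unfolding FT_def by measurable
    have pos: "x > 0" if "x \<in> {1/T..T}" "T \<ge> 1" for x T :: real
      using that by (auto intro: less_le_trans[of 0 "1/T"])
    \<comment> \<open>Truncation at 1 makes [1/T, T] a nonempty interval of positive numbers for
      every T, without affecting the limit.\<close>
    define T' where "T' T = max 1 T" for T :: real
    have kF: "k (T' T) s = (LINT x|lborel. FT (T' T) x * of_real x powr (- s))" for T s
      unfolding k_def set_lebesgue_integral_def FT_def f(1) ext_zero_def
      by (intro Bochner_Integration.integral_cong refl) (use pos[of _ "T' T"] in \<open>auto simp: indicator_def T'_def\<close>)
    have km: "k (T' T) \<in> borel_measurable borel" for T unfolding kF[abs_def] by measurable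
    have FTi: "integrable lborel (\<lambda>x. FT (T' T) x)" for T
    proof -
      have "1 / T' T \<le> T' T" by (simp add: T'_def divide_le_eq) (smt (verit) max.cobounded1 mult_le_cancel_left1 mult_less_cancel_left2)
      from L2_mult_integrable[OF indicator_L2[OF this] FL] show ?thesis
        unfolding FT_def by (rule Bochner_Integration.integrable_cong[THEN iffD1, rotated 2]) (auto simp: indicator_def)
    qed
    \<comment> \<open>On [1/T, T] the factor x^(-1/2) is at most T: it is \<le> 1 for x \<ge> 1 and
      \<le> 1 / x otherwise.\<close>
    have nb: "norm (FT (T' T) x * of_real x powr (- s)) \<le> T' T * norm (FT (T' T) x)" if s: "Re s = 1/2" for T x s
    proof (cases "x \<in> {1 / T' T..T' T}")
      case True
      have T1: "T' T \<ge> 1" by (simp add: T'_def)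
      have x0: "x > 0" using pos[OF True T1] .
      have "x powr (- (1/2)) \<le> T' T"
      proof (cases "x \<ge> 1")
        case True
        then have "x powr (- (1/2)) \<le> 1" using powr_mono[of "-(1/2)" 0 x] by simp
        then show ?thesis using T1 by linarith
      next
        case False
        have "x powr (- (1/2)) \<le> x powr (- 1)" using False x0 by (intro powr_mono') auto
        also have "\<dots> = 1 / x" using x0 by (simp add: powr_minus inverse_eq_divide)
        also have "\<dots> \<le> T' T" using True x0 T1 by (simp add: divide_le_eq mult.commute)
        finally show ?thesis .
      qed
      then have "norm (FT (T' T) x) * x powr (- (1/2)) \<le> norm (FT (T' T) x) * T' T" by (intro mult_left_mono) auto
      then have "norm (FT (T' T) x) * x powr (- Re s) \<le> T' T * norm (FT (T' T) x)" unfolding s by (simp only: mult.commute)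
      then show ?thesis using x0 by (simp add: norm_mult norm_of_real_powr)
    qed (simp add: FT_def)
    have FTi2: "integrable lborel (\<lambda>x. FT (T' T) x * of_real x powr (- s))" if s: "Re s = 1/2" for T s
    proof (rule Bochner_Integration.integrable_bound)
      show "integrable lborel (\<lambda>x. T' T * norm (FT (T' T) x))" using FTi by simp
      show "AE x in lborel. norm (FT (T' T) x * of_real x powr (- s)) \<le> norm (T' T * norm (FT (T' T) x))"
        using nb[OF s] by (intro AE_I2) (auto intro: order_trans[OF _ abs_ge_self])
    qed measurable
    have kb: "norm (k (T' T) s) \<le> T' T * (LINT x|lborel. norm (FT (T' T) x))" if s: "Re s = 1/2" for T s
    proof -
      have "norm (k (T' T) s) \<le> (LINT x|lborel. T' T * norm (FT (T' T) x))"
        unfolding kF by (rule Bochner_Integration.integral_norm_bound_integral[OF FTi2[OF s]]) (use FTi nb[OF s] in auto)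
      then show ?thesis by simp
    qed
    have l1: "((\<lambda>T. LINT s|crit_line. k (T' T) s * Gauss_test \<mu> s) \<longlongrightarrow> (LINT s|crit_line. g s * Gauss_test \<mu> s)) at_top"
    proof (rule L2_dist_tendsto_integral[OF _ WL])
      have "eventually (\<lambda>T. L2_dist_sq crit_line (k T) g = L2_dist_sq crit_line (k (T' T)) g) at_top"
        using eventually_ge_at_top[of 1] by eventually_elim (simp add: T'_def)
      then show "((\<lambda>T. L2_dist_sq crit_line (k (T' T)) g) \<longlongrightarrow> 0) at_top"
        using m unfolding is_mellin_transform_def k_def[symmetric] by (rule Lim_transform_eventually[rotated])
      show "k (T' T) \<in> borel_measurable crit_line" for T using km by (simp add: measurable_cong_sets[OF crit_line_sets refl])
      show "g \<in> borel_measurable crit_line" by (rule L2_measurable[OF g])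
      show "integrable crit_line (\<lambda>s. g s * Gauss_test \<mu> s)" by (rule L2_mult_integrable[OF g WL])
      show "integrable crit_line (\<lambda>s. k (T' T) s * Gauss_test \<mu> s)" for T
      proof (subst crit_line_integrable_iff)
        show "(\<lambda>s. k (T' T) s * Gauss_test \<mu> s) \<in> borel_measurable borel" using km[of T] by measurable
        show "integrable lborel (\<lambda>t. k (T' T) (Complex (1/2) t) * Gauss_test \<mu> (Complex (1/2) t))"
        proof (rule Bochner_Integration.integrable_bound)
          show "integrable lborel (\<lambda>t. (T' T * (LINT x|lborel. norm (FT (T' T) x))) * norm (Gauss_test \<mu> (Complex (1/2) t)))"
            by (intro integrable_mult_right integrable_norm Gauss_test_integrable)
          show "(\<lambda>t. k (T' T) (Complex (1/2) t) * Gauss_test \<mu> (Complex (1/2) t)) \<in> borel_measurable lborel" using km[of T] by measurable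
          show "AE t in lborel. norm (k (T' T) (Complex (1/2) t) * Gauss_test \<mu> (Complex (1/2) t)) \<le> norm ((T' T * (LINT x|lborel. norm (FT (T' T) x))) * norm (Gauss_test \<mu> (Complex (1/2) t)))"
          proof (rule AE_I2)
            fix t :: real
            have "norm (k (T' T) (Complex (1/2) t)) \<le> T' T * (LINT x|lborel. norm (FT (T' T) x))" by (rule kb) simp
            then have "norm (k (T' T) (Complex (1/2) t) * Gauss_test \<mu> (Complex (1/2) t)) \<le> (T' T * (LINT x|lborel. norm (FT (T' T) x))) * norm (Gauss_test \<mu> (Complex (1/2) t))"
              unfolding norm_mult by (rule mult_right_mono) simp
            then show "norm (k (T' T) (Complex (1/2) t) * Gauss_test \<mu> (Complex (1/2) t)) \<le> norm ((T' T * (LINT x|lborel. norm (FT (T' T) x))) * norm (Gauss_test \<mu> (Complex (1/2) t)))"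
              unfolding real_norm_def using abs_ge_self by (rule order_trans)
          qed
        qed
      qed
    qed
    have l2: "(LINT s|crit_line. k (T' T) s * Gauss_test \<mu> s) = of_real (1 / (2 * pi)) * (LINT x|lborel. FT (T' T) x * Gauss_kernel \<mu> x)" for T
    proof -
      have "(LINT s|crit_line. k (T' T) s * Gauss_test \<mu> s) = of_real (1 / (2 * pi)) * (LINT t|lborel. k (T' T) (Complex (1/2) t) * Gauss_test \<mu> (Complex (1/2) t))"
        by (rule crit_line_integral) (use km[of T] in measurable)
      also have "(LINT t|lborel. k (T' T) (Complex (1/2) t) * Gauss_test \<mu> (Complex (1/2) t)) = (LINT x|lborel. FT (T' T) x * Gauss_kernel \<mu> x)"
        unfolding kF
      proof (rule Mellin_Gauss_test)
        show "integrable lborel (\<lambda>x. FT (T' T) x * of_real x powr (- of_real (1/2)))" by (rule FTi2) simp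
        show "FT (T' T) x = 0" if "x \<le> 0" for x using F that by (simp add: FT_def pos_L2_def)
      qed
      finally show ?thesis .
    qed
    have l3: "((\<lambda>T. of_real (1 / (2 * pi)) * (LINT x|lborel. FT (T' T) x * Gauss_kernel \<mu> x)) \<longlongrightarrow> of_real (1 / (2 * pi)) * (LINT x|lborel. F x * Gauss_kernel \<mu> x)) at_top"
    proof (intro tendsto_mult tendsto_const integral_dominated_convergence_at_top)
      have [measurable]: "Gauss_kernel \<mu> \<in> borel_measurable borel" unfolding Gauss_kernel_def[abs_def] by measurable
      show "(\<lambda>x. F x * Gauss_kernel \<mu> x) \<in> borel_measurable lborel" by measurable
      show "(\<lambda>x. FT (T' T) x * Gauss_kernel \<mu> x) \<in> borel_measurable lborel" for T by measurable
      show "integrable lborel (\<lambda>x. norm (F x * Gauss_kernel \<mu> x))" using Gauss_kernel_integrable by (rule integrable_norm)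
      show "\<forall>\<^sub>F T in at_top. AE x in lborel. norm (FT (T' T) x * Gauss_kernel \<mu> x) \<le> norm (F x * Gauss_kernel \<mu> x)"
        by (intro always_eventually allI AE_I2) (auto simp: FT_def indicator_def)
      show "AE x in lborel. ((\<lambda>T. FT (T' T) x * Gauss_kernel \<mu> x) \<longlongrightarrow> F x * Gauss_kernel \<mu> x) at_top"
      proof (rule AE_I2, rule tendsto_eventually)
        fix x
        show "\<forall>\<^sub>F T in at_top. FT (T' T) x * Gauss_kernel \<mu> x = F x * Gauss_kernel \<mu> x"
        proof (cases "x > 0")
          case True
          show ?thesis using eventually_ge_at_top[of "max 1 (max x (1 / x))"]
          proof eventually_elim
            case (elim T)
            then have "T' T = T" "x \<le> T" "1 / x \<le> T" "T > 0" by (auto simp: T'_def)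
            moreover from this have "1 / T \<le> x" using True by (simp add: field_simps)
            ultimately show ?case by (simp add: FT_def)
          qed
        next
          case False
          then have "F x = 0" using F by (simp add: pos_L2_def)
          then show ?thesis by (simp add: FT_def)
        qed
      qed
    qed
    have l4: "(LINT s|crit_line. g s * Gauss_test \<mu> s) = of_real (1 / (2 * pi)) * (LINT x|lborel. F x * Gauss_kernel \<mu> x)"
      by (rule tendsto_unique[OF trivial_limit_at_top_linorder l1[unfolded l2] l3])
    have l5: "(LINT s|crit_line. g s * Gauss_test \<mu> s) = of_real (1 / (2 * pi)) * (LINT t|lborel. g (Complex (1/2) t) * Gauss_test \<mu> (Complex (1/2) t))"
      by (rule crit_line_integral) measurable
    have l6: "complex_of_real (1 / (2 * pi)) \<noteq> 0" by simp
    show ?thesis using l4[unfolded l5] l6 by (simp only: mult_left_cancel[OF l6])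
  qed
  define D where "D t = (g (Complex (1/2) t) - arch (Complex (1/2) t) * X (Complex (1/2) t)) * of_real (exp (- t\<^sup>2))" for t
  have W: "Gauss_test \<mu> (Complex (1/2) t) = of_real (exp (- t\<^sup>2)) * iexp (\<mu> * t)" for \<mu> t
  proof -
    have "(Complex (1/2) t - 1/2)\<^sup>2 + of_real \<mu> * (Complex (1/2) t - 1/2) = of_real (- t\<^sup>2) + \<i> * of_real (\<mu> * t)"
      by (simp add: complex_eq_iff power2_eq_square)
    then show ?thesis by (simp only: Gauss_test_def exp_add exp_of_real)
  qed
  have Dt: "D t * iexp (\<mu> * t) = g (Complex (1/2) t) * Gauss_test \<mu> (Complex (1/2) t) - arch (Complex (1/2) t) * X (Complex (1/2) t) * Gauss_test \<mu> (Complex (1/2) t)" for \<mu> t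
    unfolding W D_def by (simp add: algebra_simps)
  have "AE t in lborel. D t = 0"
  proof (rule Fourier_unique)
    show "(LINT t|lborel. D t * iexp (\<mu> * t)) = 0" for \<mu>
      unfolding Dt Bochner_Integration.integral_diff[OF gW archX_test_integrable] gI archX_test_integral by simp
    have "integrable lborel (\<lambda>t. D t * iexp (0 * t))"
      unfolding Dt by (intro Bochner_Integration.integrable_diff gW archX_test_integrable)
    then show "integrable lborel D" by simp
  qed
  then have "AE t in lborel. g (Complex (1/2) t) = arch (Complex (1/2) t) * X (Complex (1/2) t)"
    by eventually_elim (simp add: D_def)
  then show ?thesis using archX_measurable by (subst AE_crit_line_iff) measurable
qed

end

text \<open>The modular relation is invariant under replacing a by 1 / a, and reflection exchanges
  the two tails: this is the functional equation of the pair.\<close>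

lemma cosine_pair_swap:
  assumes "cosine_pair F H c d"
  shows "cosine_pair H F d c" "cosine_pair.X H F d c s = cosine_pair.X F H c d (1 - s)"
proof -
  interpret cosine_pair F H c d by fact
  show sw: "cosine_pair H F d c"
  proof
    fix a :: real assume a: "a > 0"
    then have "Gauss_transform F (1 / a) = Gauss_transform H a / of_real (sqrt (1 / a))" using mod[of "1 / a"] by simp
    then show "Gauss_transform H a = Gauss_transform F (1 / a) / of_real (sqrt a)" using a by (simp add: real_sqrt_divide field_simps)
  qed (use F H in auto)
  show "cosine_pair.X H F d c s = X (1 - s)"
    unfolding cosine_pair.X_def[OF sw] X_def Mellin_complete_reflect ..
qed

lemma pos_L2_ext_zero:
  assumes "f \<in> L2 halfline" "AE x in lborel. 0 < x \<and> x < 1 \<longrightarrow> f x = c"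
  shows "pos_L2 (ext_zero f) c"
  unfolding pos_L2_def
proof (intro conjI allI impI)
  show "ext_zero f \<in> L2 lborel" by (rule ext_zero_L2[OF assms(1)])
  show "AE x in lborel. 0 < x \<and> x < 1 \<longrightarrow> ext_zero f x = c" using assms(2) by eventually_elim (auto simp: ext_zero_def)
qed (auto simp: ext_zero_def)

text \<open>Collects what the sequel uses about \<open>L_space\<close>. The last bound is
  \<open>X_right_bounded\<close> for the swapped pair, that is, for the cosine transform of
  \<open>f\<close>; it controls \<open>X\<close> to the left of the strip.\<close>

theorem L_space_continuation:
  assumes "g \<in> L_space"
  shows "\<exists>X C. X holomorphic_on UNIV \<and> (\<forall>K. \<exists>B. \<forall>s. \<bar>Re s\<bar> \<le> K \<longrightarrow> norm (X s) \<le> B * (1 + norm s)\<^sup>2) \<and>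
    (AE s in crit_line. g s = arch s * X s) \<and>
    (\<forall>s. Re s \<ge> 3/2 \<longrightarrow> norm (arch s * X s) \<le> C) \<and> (\<forall>s. Re s \<ge> 3/2 \<longrightarrow> norm (arch s * X (1 - s)) \<le> C)"
proof -
  obtain f h where fh: "g \<in> L2 crit_line" "f \<in> L2 halfline" "h \<in> L2 halfline" "is_cosine_transform f h" "const_on_unit f" "const_on_unit h" "is_mellin_transform f g"
    using assms by (auto simp: L_space_def)
  obtain c where c: "AE x in lborel. 0 < x \<and> x < 1 \<longrightarrow> f x = c" using fh(5) by (auto simp: const_on_unit_def)
  obtain d where d: "AE x in lborel. 0 < x \<and> x < 1 \<longrightarrow> h x = d" using fh(6) by (auto simp: const_on_unit_def)
  interpret cosine_pair "ext_zero f" "ext_zero h" c d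
    by unfold_locales (use pos_L2_ext_zero[OF fh(2) c] pos_L2_ext_zero[OF fh(3) d] cosine_Parseval[OF fh(2-4)] in auto)
  note sw = cosine_pair_swap[OF cosine_pair_axioms]
  obtain C1 where C1: "\<And>s. Re s \<ge> 3/2 \<Longrightarrow> norm (arch s * X s) \<le> C1" using X_right_bounded by blast
  obtain C2 where C2: "\<And>s. Re s \<ge> 3/2 \<Longrightarrow> norm (arch s * X (1 - s)) \<le> C2"
    using cosine_pair.X_right_bounded[OF sw(1)] unfolding sw(2) by blast
  show ?thesis
  proof (rule exI[of _ X], rule exI[of _ "max C1 C2"], intro conjI allI impI)
    show "AE s in crit_line. g s = arch s * X s" by (rule boundary_values[OF refl fh(2,1,7)])
    show "norm (arch s * X s) \<le> max C1 C2" "norm (arch s * X (1 - s)) \<le> max C1 C2" if "Re s \<ge> 3/2" for s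
      using C1[OF that] C2[OF that] by auto
  qed (use X_holomorphic X_bound in auto)
qed

section \<open>Functions orthogonal to the span\<close>

lemma entire_Lipschitz:
  assumes f: "f holomorphic_on UNIV" and B: "\<And>z. z \<in> cball w 2 \<Longrightarrow> norm (f z) \<le> B" and s: "norm (s - w) < 1"
  shows "norm (f s - f w) \<le> B * norm (s - w)"
proof (rule field_differentiable_bound[of "ball w 1"])
  show "(f has_field_derivative deriv f z) (at z within ball w 1)" for z
    using f holomorphic_derivI[OF f] by auto
  fix z assume z: "z \<in> ball w 1"
  have "norm ((deriv ^^ 1) f z) \<le> fact 1 * B / 1 ^ 1"
  proof (rule Cauchy_inequality)
    show "f holomorphic_on ball z 1" using f by (rule holomorphic_on_subset) simp
    show "continuous_on (cball z 1) f" using holomorphic_on_imp_continuous_on[OF f] by (rule continuous_on_subset) simp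
    show "norm (f x) \<le> B" if "norm (z - x) = 1" for x
    proof (rule B)
      have "dist w x \<le> dist w z + dist z x" by (rule dist_triangle)
      then show "x \<in> cball w 2" using z that by (simp add: dist_norm)
    qed
  qed simp
  then show "norm (deriv f z) \<le> B" by simp
qed (use s in \<open>auto simp: dist_norm norm_minus_commute\<close>)

lemma entire_order_factor:
  assumes f: "f holomorphic_on UNIV" and nz: "\<exists>w. f w \<noteq> 0"
  shows "\<exists>r h. r > 0 \<and> h holomorphic_on cball z r \<and>
    (\<forall>w\<in>cball z r. f w = h w * (w - z) ^ nat (zorder f z) \<and> h w \<noteq> 0) \<and> (f z = 0 \<longrightarrow> nat (zorder f z) \<ge> 1)"
proof -
  have e: "\<exists>w\<in>UNIV. f w \<noteq> 0" using nz by blast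
  note Z = zorder_exist_zero[OF f open_UNIV connected_UNIV UNIV_I e, of z]
  obtain r where r: "r > 0" "zor_poly f z holomorphic_on cball z r"
    "\<forall>w\<in>cball z r. f w = zor_poly f z w * (w - z) ^ nat (zorder f z) \<and> zor_poly f z w \<noteq> 0"
    using Z by blast
  have "f z = 0 \<longrightarrow> nat (zorder f z) \<ge> 1" using Z by auto
  with r show ?thesis by blast
qed

text \<open>Orders of zeros are integers, so at a pole z of N / Z the products with the steps
  \<open>d\<close> could not tend to 0, whatever the sequence. One sequence of approach per zero
  therefore decides, and it can be chosen off the critical line, where formulas for \<open>N\<close>
  are available.\<close>

lemma entire_quotient:
  assumes N: "N holomorphic_on UNIV" and Z: "Z holomorphic_on UNIV" and Z0: "\<exists>w. Z w \<noteq> 0"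
    and d: "d \<longlonglongrightarrow> 0" "\<And>n. d n \<noteq> 0"
    and lim: "\<And>z. Z z = 0 \<Longrightarrow> (\<lambda>n. d n * (N (z + d n) / Z (z + d n))) \<longlonglongrightarrow> 0"
  obtains F where "F holomorphic_on UNIV" "\<And>w. Z w \<noteq> 0 \<Longrightarrow> F w = N w / Z w"
proof (cases "\<exists>w. N w \<noteq> 0")
  case False
  then show thesis by (intro that[of "\<lambda>_. 0"]) auto
next
  case N0: True
  define Q where "Q = (\<lambda>w. N w / Z w)"
  have ana: "Q analytic_on {z}" if "Z z \<noteq> 0" for z
    unfolding Q_def using N Z that by (intro analytic_on_divide) (auto simp: analytic_on_holomorphic intro!: exI[of _ UNIV])
  have "remove_sings Q analytic_on {z}" for z
  proof (cases "Z z = 0")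
    case False
    then show ?thesis by (intro remove_sings_analytic_on ana)
  next
    case True
    obtain r1 N1 where N1: "r1 > 0" "N1 holomorphic_on cball z r1"
      "\<And>w. w \<in> cball z r1 \<Longrightarrow> N w = N1 w * (w - z) ^ nat (zorder N z)" "\<And>w. w \<in> cball z r1 \<Longrightarrow> N1 w \<noteq> 0"
      using entire_order_factor[OF N N0, of z] by blast
    obtain r2 Z1 where Z1: "r2 > 0" "Z1 holomorphic_on cball z r2"
      "\<And>w. w \<in> cball z r2 \<Longrightarrow> Z w = Z1 w * (w - z) ^ nat (zorder Z z)" "\<And>w. w \<in> cball z r2 \<Longrightarrow> Z1 w \<noteq> 0"
      using entire_order_factor[OF Z Z0, of z] by blast
    define p where "p = nat (zorder N z)"
    define m where "m = nat (zorder Z z)"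
    define r where "r = min r1 r2"
    have r: "r > 0" "r \<le> r1" "r \<le> r2" using N1(1) Z1(1) by (auto simp: r_def)
    have cN: "isCont N1 z" using holomorphic_on_imp_continuous_on[OF N1(2)] N1(1) by (intro continuous_on_interior[of "cball z r1"]) auto
    have cZ: "isCont Z1 z" using holomorphic_on_imp_continuous_on[OF Z1(2)] Z1(1) by (intro continuous_on_interior[of "cball z r2"]) auto
    have nz: "N1 z \<noteq> 0" "Z1 z \<noteq> 0" using N1(4)[of z] Z1(4)[of z] N1(1) Z1(1) by auto
    have zl: "(\<lambda>n. z + d n) \<longlonglongrightarrow> z + 0" by (intro tendsto_intros d)
    then have zl': "(\<lambda>n. z + d n) \<longlonglongrightarrow> z" by simp
    have near: "\<forall>\<^sub>F n in sequentially. z + d n \<in> ball z r"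
      by (rule topological_tendstoD[OF zl']) (use r in auto)
    have "m \<le> p"
    proof (rule ccontr)
      assume pm: "\<not> m \<le> p"
      \<comment> \<open>If \<open>Z\<close> vanished to higher order than \<open>N\<close>, the
        powers of \<open>d n\<close> would cancel and leave \<open>N1\<close>, which does not vanish
        at z.\<close>
      have "(\<lambda>n. d n ^ (m - p - 1) * Z1 (z + d n) * (d n * Q (z + d n))) \<longlonglongrightarrow> 0 ^ (m - p - 1) * Z1 z * 0"
        unfolding Q_def by (intro tendsto_mult tendsto_power d lim True isCont_tendsto_compose[OF cZ] zl')
      moreover have "\<forall>\<^sub>F n in sequentially. d n ^ (m - p - 1) * Z1 (z + d n) * (d n * Q (z + d n)) = N1 (z + d n)"
        using near
      proof eventually_elim
        case (elim n)
        then have b: "z + d n \<in> cball z r1" "z + d n \<in> cball z r2" using r by auto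
        have NZ: "N (z + d n) = N1 (z + d n) * d n ^ p" "Z (z + d n) = Z1 (z + d n) * d n ^ m"
          using N1(3)[OF b(1)] Z1(3)[OF b(2)] by (auto simp: p_def m_def)
        have dm: "d n ^ m = d n ^ (m - p - 1) * d n * d n ^ p"
        proof -
          have "m = (m - p - 1) + 1 + p" using pm by simp
          then have "d n ^ m = d n ^ ((m - p - 1) + 1 + p)" by (rule arg_cong)
          then show ?thesis by (simp only: power_add power_one_right)
        qed
        show ?case unfolding Q_def NZ dm using d(2)[of n] Z1(4)[OF b(2)] by simp
      qed
      ultimately have "(\<lambda>n. N1 (z + d n)) \<longlonglongrightarrow> 0 ^ (m - p - 1) * Z1 z * 0" by (rule Lim_transform_eventually)
      moreover have "(\<lambda>n. N1 (z + d n)) \<longlonglongrightarrow> N1 z" by (rule isCont_tendsto_compose[OF cN zl'])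
      ultimately show False using LIMSEQ_unique nz(1) by force
    qed
    have Qeq: "Q w = (w - z) ^ (p - m) * (N1 w / Z1 w)" if w: "w \<in> ball z r" "w \<noteq> z" for w
    proof -
      have b: "w \<in> cball z r1" "w \<in> cball z r2" using w r by auto
      have "(w - z) ^ p = (w - z) ^ (p - m) * (w - z) ^ m" using \<open>m \<le> p\<close> by (simp flip: power_add)
      then show ?thesis unfolding Q_def N1(3)[OF b(1)] Z1(3)[OF b(2)] p_def[symmetric] m_def[symmetric] using w(2) by simp
    qed
    show ?thesis
    proof (rule remove_sings_analytic_at)
      have "Q analytic_on ball z r - {z}"
      proof (subst analytic_on_analytic_at, intro ballI ana)
        fix w assume w: "w \<in> ball z r - {z}"
        then have "w \<in> cball z r2" using r by auto
        then show "Z w \<noteq> 0" using Z1(3)[of w] Z1(4)[of w] w by auto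
      qed
      then show "isolated_singularity_at Q z" using r(1) by (auto simp: isolated_singularity_at_def)
      have "((\<lambda>w. (w - z) ^ (p - m) * (N1 w / Z1 w)) \<longlongrightarrow> (z - z) ^ (p - m) * (N1 z / Z1 z)) (at z)"
        using cN cZ nz(2) by (intro tendsto_intros) (auto simp: isCont_def)
      moreover have "\<forall>\<^sub>F w in at z. (w - z) ^ (p - m) * (N1 w / Z1 w) = Q w"
        using eventually_at_ball[OF r(1), of z UNIV] by (auto simp: eventually_at_filter Qeq elim!: eventually_mono)
      ultimately show "Q \<midarrow>z\<rightarrow> (z - z) ^ (p - m) * (N1 z / Z1 z)" by (rule Lim_transform_eventually)
    qed
  qed
  then have "remove_sings Q holomorphic_on UNIV"
    using analytic_on_analytic_at[of "remove_sings Q" UNIV] analytic_imp_holomorphic by blast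
  moreover have "remove_sings Q w = N w / Z w" if "Z w \<noteq> 0" for w
    using remove_sings_at_analytic[OF ana[OF that]] by (simp add: Q_def)
  ultimately show thesis by (rule that)
qed

text \<open>Phragmen-Lindelof is applied to the divided difference \<open>G\<close> at -2, a point
  outside the strip, which turns the linear bound on the edges into a constant one. So
  \<open>F\<close> grows linearly everywhere and is affine by Liouville; along the integers its
  increments tend to 0, hence the slope is 0, and then so is the constant.\<close>

lemma entire_zero_criterion:
  assumes F: "F holomorphic_on UNIV"
    and out: "\<And>w. Re w \<le> -1/2 \<or> 3/2 \<le> Re w \<Longrightarrow> norm (F w) \<le> C * (1 + norm w)"
    and ins: "\<And>w. -1/2 \<le> Re w \<Longrightarrow> Re w \<le> 3/2 \<Longrightarrow> norm (F w) \<le> B * exp (B * \<bar>Im w\<bar>)"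
    and lim: "(\<lambda>n. F (of_nat n)) \<longlonglongrightarrow> 0"
  shows "F w = 0"
proof -
  have C0: "C \<ge> 0" using order_trans[OF norm_ge_zero out[of 2]] by (simp add: zero_le_mult_iff)
  have B0: "B \<ge> 0" using order_trans[OF norm_ge_zero ins[of 0]] by simp
  define f0 where "f0 = norm (F (-2))"
  have f0: "f0 \<ge> 0" by (simp add: f0_def)
  define G where "G = (\<lambda>z. if z = - 2 then deriv F (- 2) else (F z - F (- 2)) / (z - (- 2)))"
  have G: "G holomorphic_on UNIV" unfolding G_def by (rule pole_lemma[OF F]) simp
  have w2: "norm (w + 2) \<ge> 3/2" if "- 1/2 \<le> Re w" for w :: complex
    using abs_Re_le_cmod[of "w + 2"] that by simp
  have n2: "norm (w + 2) \<le> 2 * (1 + norm w)" for w :: complex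
  proof -
    have "norm (w + 2) \<le> norm w + norm (2 :: complex)" by (rule norm_triangle_ineq)
    also have "\<dots> \<le> 2 * (1 + norm w)" by simp
    finally show ?thesis .
  qed
  have Gn: "norm (G w) \<le> (norm (F w) + f0) / norm (w + 2)" if "- 1/2 \<le> Re w" for w
  proof -
    have "w \<noteq> -2" using that by auto
    then show ?thesis using norm_triangle_ineq4[of "F w" "F (-2)"] by (simp add: G_def f0_def norm_divide divide_right_mono)
  qed
  have strip: "norm (G w) \<le> 3 * C + f0" if w: "- 1/2 \<le> Re w" "Re w \<le> 3/2" for w
  proof (rule Phragmen_Lindelof_strip[OF G _ _ w, where B = "B + f0"])
    fix w :: complex assume e: "Re w = - 1/2 \<or> Re w = 3/2"
    then have e1: "- 1/2 \<le> Re w" by auto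
    have "norm w \<le> norm (w + 2) + norm (2::complex)" using norm_triangle_ineq4[of "w + 2" 2] by simp
    then have "1 + norm w \<le> 3 * norm (w + 2)" using w2[OF e1] by simp
    then have "norm (F w) \<le> C * (3 * norm (w + 2))" using out[of w] e C0 mult_left_mono[of "1 + norm w" "3 * norm (w + 2)" C] by (auto intro: order_trans)
    moreover have "f0 \<le> f0 * norm (w + 2)" using w2[OF e1] f0 by (simp add: mult_le_cancel_left1)
    ultimately have "norm (F w) + f0 \<le> (3 * C + f0) * norm (w + 2)" by (simp add: algebra_simps)
    then have "(norm (F w) + f0) / norm (w + 2) \<le> 3 * C + f0" using w2[OF e1] by (subst pos_divide_le_eq) auto
    then show "norm (G w) \<le> 3 * C + f0" using Gn[OF e1] by linarith
  next
    fix w :: complex assume w: "- 1/2 \<le> Re w" "Re w \<le> 3/2"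
    have "norm (G w) \<le> (norm (F w) + f0) / norm (w + 2)" by (rule Gn[OF w(1)])
    also have "\<dots> \<le> norm (F w) + f0" 
    proof (subst pos_divide_le_eq)
      show "0 < norm (w + 2)" using w2[OF w(1)] by linarith
      have "(norm (F w) + f0) * 1 \<le> (norm (F w) + f0) * norm (w + 2)" using w2[OF w(1)] f0 by (intro mult_left_mono) auto
      then show "norm (F w) + f0 \<le> (norm (F w) + f0) * norm (w + 2)" by simp
    qed
    also have "\<dots> \<le> B * exp (B * \<bar>Im w\<bar>) + f0 * 1" using ins[OF w] by simp
    also have "\<dots> \<le> B * exp ((B + f0) * \<bar>Im w\<bar>) + f0 * exp ((B + f0) * \<bar>Im w\<bar>)"
      using B0 f0 by (intro add_mono mult_left_mono) (auto simp: algebra_simps)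
    also have "\<dots> = (B + f0) * exp ((B + f0) * \<bar>Im w\<bar>)" by (simp add: algebra_simps)
    finally show "norm (G w) \<le> (B + f0) * exp ((B + f0) * \<bar>Im w\<bar>)" .
  qed
  have lin: "norm (F w) \<le> (7 * C + 4 * f0) * (1 + norm w)" for w
  proof (cases "Re w \<le> -1/2 \<or> 3/2 \<le> Re w")
    case True
    have "C * (1 + norm w) \<le> (7 * C + 4 * f0) * (1 + norm w)" using C0 f0 by (intro mult_right_mono) auto
    then show ?thesis using out[OF True] by linarith
  next
    case False
    then have w: "- 1/2 \<le> Re w" "Re w \<le> 3/2" by auto
    have "w + 2 \<noteq> 0" "w \<noteq> -2" using w by (auto simp: complex_eq_iff)
    then have "F w = G w * (w + 2) + F (-2)" by (simp add: G_def)
    then have "norm (F w) \<le> norm (G w) * norm (w + 2) + f0" unfolding f0_def by (metis norm_mult norm_triangle_ineq)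
    also have "\<dots> \<le> (3 * C + f0) * (2 * (1 + norm w)) + f0 * (1 + norm w)"
    proof (intro add_mono mult_mono strip w)
      show "norm (w + 2) \<le> 2 * (1 + norm w)" by (rule n2)
      show "f0 \<le> f0 * (1 + norm w)" using f0 by (simp add: mult_le_cancel_left1)
    qed (use C0 f0 in auto)
    also have "\<dots> = (6 * C + 3 * f0) * (1 + norm w)" by (simp add: algebra_simps)
    also have "\<dots> \<le> (7 * C + 4 * f0) * (1 + norm w)" using C0 f0 by (intro mult_right_mono) auto
    finally show ?thesis .
  qed
  have poly: "F w = (\<Sum>k\<le>1. (deriv ^^ k) F 0 / fact k * w ^ k)" for w
  proof (rule Liouville_polynomial[OF F, where A = 1 and B = "2 * (7 * C + 4 * f0)"])
    fix z :: complex assume "1 \<le> norm z"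
    then have "(7 * C + 4 * f0) * (1 + norm z) \<le> (7 * C + 4 * f0) * (2 * norm z)" using C0 f0 by (intro mult_left_mono) auto
    with lin[of z] have "norm (F z) \<le> (7 * C + 4 * f0) * (2 * norm z)" by (rule order_trans)
    then show "norm (F z) \<le> 2 * (7 * C + 4 * f0) * norm z ^ 1" by (simp only: power_one_right mult_ac)
  qed
  have aff: "F w = F 0 + deriv F 0 * w" for w by (subst poly[of w]) simp
  have "(\<lambda>n. F (of_nat (Suc n)) - F (of_nat n)) \<longlonglongrightarrow> 0 - 0" by (intro tendsto_diff lim LIMSEQ_Suc[OF lim])
  moreover have "F (of_nat (Suc n)) - F (of_nat n) = deriv F 0" for n
    unfolding aff[of "of_nat (Suc n)"] aff[of "of_nat n"] by (simp add: algebra_simps)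
  ultimately have b: "deriv F 0 = 0" by (simp add: LIMSEQ_const_iff del: of_nat_Suc)
  have "F (of_nat n) = F 0" for n using aff[of "of_nat n"] b by simp
  then have "(\<lambda>n::nat. F 0) \<longlonglongrightarrow> 0" using lim by (simp only:)
  then have "F 0 = 0" by (simp only: LIMSEQ_const_iff)
  then show ?thesis using aff[of w] b by simp
qed

section \<open>Dominating functions on the critical line\<close>

lemma inverse_shift_bound:
  fixes s w :: complex
  assumes "d > 0" "norm (s - w) \<ge> d"
  shows "norm s \<le> (1 + norm w / d) * norm (s - w)"
proof -
  have "norm s \<le> norm (s - w) + norm w" using norm_triangle_ineq[of "s - w" w] by simp
  moreover have "norm w * 1 \<le> norm w * (norm (s - w) / d)" using assms by (intro mult_left_mono) (auto simp: le_divide_eq)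
  ultimately show ?thesis by (simp add: algebra_simps)
qed

lemma norm_ge_half:
  assumes "Re s = 1/2"
  shows "norm s > 0"
  using assms by auto

text \<open>Dominates every quotient of \<open>\<zeta>\<close> by a power of \<open>s - \<rho>\<close> on the critical line.\<close>

definition zeta_weight :: "complex \<Rightarrow> real" where
  "zeta_weight s = norm (arch s * completed_zeta s) / norm s + 1 / norm s"

lemma zeta_line_measurable [measurable]: "(\<lambda>s. arch s * completed_zeta s) \<in> borel_measurable borel"
  by (rule borel_measurable_continuous_countable_exceptions[of "{1}"])
     (auto intro!: holomorphic_on_imp_continuous_on holomorphic_intros arch_holomorphic completed_zeta_holomorphic)

lemma zeta_weight_L2: "(\<lambda>s. of_real (zeta_weight s)) \<in> L2 crit_line"
  using L2_add[OF L2_norm[OF zeta_div_s_L2] L2_norm[OF inverse_L2]]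
  by (simp add: zeta_weight_def[abs_def] norm_divide)

lemma zeta_weight_nonneg: "zeta_weight s \<ge> 0"
  by (simp add: zeta_weight_def)

lemma completed_zeta_not_identically_0: "\<exists>w. completed_zeta w \<noteq> 0"
  using completed_zeta_nonzero[of 1] by auto

text \<open>The zero \<rho> may lie on the line itself. Near \<rho> the factorisation of order m
  \<ge> k keeps the quotient bounded; elsewhere k \<ge> 1 supplies the decay 1 / |s|.\<close>

lemma zeta_quotient_bound:
  assumes zero: "completed_zeta \<rho> = 0" and k: "1 \<le> k" "k \<le> nat (zorder completed_zeta \<rho>)"
  shows "\<exists>C\<ge>0. \<forall>s. Re s = 1/2 \<longrightarrow> norm (arch s * completed_zeta s / (s - \<rho>) ^ k) \<le> C * zeta_weight s"
proof -
  define m where "m = nat (zorder completed_zeta \<rho>)"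
  obtain r h where h: "r > 0" "h holomorphic_on cball \<rho> r"
    "\<And>w. w \<in> cball \<rho> r \<Longrightarrow> completed_zeta w = h w * (w - \<rho>) ^ m" "\<And>w. w \<in> cball \<rho> r \<Longrightarrow> h w \<noteq> 0"
    using entire_order_factor[OF completed_zeta_holomorphic completed_zeta_not_identically_0, of \<rho>] unfolding m_def by blast
  obtain C1 where C1: "C1 > 0" "\<And>s. 1/2 \<le> Re s \<Longrightarrow> Re s \<le> 3/2 \<Longrightarrow> 1/4 \<le> norm (s - 1) \<Longrightarrow> norm (arch s) \<le> C1 * exp (2 * \<bar>Im s\<bar>)"
    using arch_bound by blast
  obtain b where b': "\<forall>w\<in>cball \<rho> r. norm (h w) \<le> b"
    using compact_imp_bounded[OF compact_continuous_image[OF holomorphic_on_imp_continuous_on[OF h(2)] compact_cball]]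
    by (auto simp: bounded_iff)
  then have b: "norm (h w) \<le> b" if "w \<in> cball \<rho> r" for w using that by blast
  have b0: "b \<ge> 0" using order_trans[OF norm_ge_zero b[of \<rho>]] h(1) by simp
  \<comment> \<open>Radius at most 1, so that powers of |s - \<rho>| are at most 1 and |Im s|
    exceeds |Im \<rho>| by at most 1.\<close>
  define e where "e = min r 1"
  have e: "e > 0" "e \<le> r" "e \<le> 1" using h(1) by (auto simp: e_def)
  define P where "P = C1 * exp (2 * (\<bar>Im \<rho>\<bar> + 1)) * b * (1 + norm \<rho>)"
  define Q where "Q = (1 + norm \<rho> / e) / e ^ (k - 1)"
  have PQ: "P \<ge> 0" "Q \<ge> 0" using C1(1) b0 e(1) by (auto simp: P_def Q_def)
  show ?thesis
  proof (intro exI[of _ "P + Q"] conjI allI impI)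
    show "P + Q \<ge> 0" using PQ by simp
    fix s :: complex assume s: "Re s = 1/2"
    have s0: "norm s > 0" by (rule norm_ge_half[OF s])
    have w: "1 / norm s \<le> zeta_weight s" "norm (arch s * completed_zeta s) / norm s \<le> zeta_weight s" by (auto simp: zeta_weight_def)
    show "norm (arch s * completed_zeta s / (s - \<rho>) ^ k) \<le> (P + Q) * zeta_weight s"
    proof (cases "norm (s - \<rho>) < e")
      case True
      have sb: "s \<in> cball \<rho> r" using True e by (auto simp: dist_norm norm_minus_commute)
      have "1/4 \<le> norm (s - 1)" using abs_Re_le_cmod[of "s - 1"] s by simp
      then have "norm (arch s) \<le> C1 * exp (2 * \<bar>Im s\<bar>)" using C1(2)[of s] s by simp
      also have "\<dots> \<le> C1 * exp (2 * (\<bar>Im \<rho>\<bar> + 1))"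
        using abs_Im_le_cmod[of "s - \<rho>"] True e(3) C1(1) by (intro mult_left_mono) auto
      finally have a: "norm (arch s) \<le> C1 * exp (2 * (\<bar>Im \<rho>\<bar> + 1))" .
      have q: "norm (completed_zeta s / (s - \<rho>) ^ k) \<le> b"
      proof (cases "s = \<rho>")
        case True
        then show ?thesis using b0 zero by simp
      next
        case False
        have "(s - \<rho>) ^ m = (s - \<rho>) ^ (m - k) * (s - \<rho>) ^ k" using k(2) by (simp add: m_def flip: power_add)
        then have "completed_zeta s / (s - \<rho>) ^ k = h s * (s - \<rho>) ^ (m - k)" using False h(3)[OF sb] by simp
        moreover have "norm (s - \<rho>) ^ (m - k) \<le> 1" using True e(3) by (intro power_le_one) auto
        ultimately show ?thesis using mult_mono[OF b[OF sb] \<open>norm (s - \<rho>) ^ (m - k) \<le> 1\<close> b0] by (simp add: norm_mult norm_power)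
      qed
      have "norm s \<le> norm (s - \<rho>) + norm \<rho>" using norm_triangle_ineq[of "s - \<rho>" \<rho>] by simp
      then have o: "1 \<le> (1 + norm \<rho>) * (1 / norm s)" using True e(3) s0 by (simp add: field_simps)
      have "norm (arch s * completed_zeta s / (s - \<rho>) ^ k) = norm (arch s) * norm (completed_zeta s / (s - \<rho>) ^ k) * 1"
        by (simp add: norm_mult norm_divide)
      also have "\<dots> \<le> (C1 * exp (2 * (\<bar>Im \<rho>\<bar> + 1))) * b * ((1 + norm \<rho>) * (1 / norm s))"
        using a q o C1(1) b0 by (intro mult_mono) auto
      also have "\<dots> = P * (1 / norm s)" by (simp add: P_def)
      also have "\<dots> \<le> (P + Q) * zeta_weight s" using PQ w(1) by (intro mult_mono) auto
      finally show ?thesis .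
    next
      case False
      then have l: "norm (s - \<rho>) \<ge> e" by simp
      then have l0: "norm (s - \<rho>) > 0" using e(1) by linarith
      have "norm s \<le> (1 + norm \<rho> / e) * norm (s - \<rho>)" by (rule inverse_shift_bound[OF e(1) l])
      moreover have "e ^ (k - 1) \<le> norm (s - \<rho>) ^ (k - 1)" using l e(1) by (intro power_mono) auto
      ultimately have "norm s * e ^ (k - 1) \<le> ((1 + norm \<rho> / e) * norm (s - \<rho>)) * norm (s - \<rho>) ^ (k - 1)"
        using e(1) by (intro mult_mono) auto
      also have "\<dots> = (1 + norm \<rho> / e) * norm (s - \<rho>) ^ k" using k(1) by (simp add: power_eq_if)
      finally have "norm s / norm (s - \<rho>) ^ k \<le> Q"
        using e(1) l0 unfolding Q_def by (simp add: divide_simps mult_ac)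
      then have "(norm (arch s * completed_zeta s) / norm s) * (norm s / norm (s - \<rho>) ^ k) \<le> zeta_weight s * Q"
        using w(2) s0 zeta_weight_nonneg by (intro mult_mono) auto
      moreover have "norm (arch s * completed_zeta s / (s - \<rho>) ^ k) = (norm (arch s * completed_zeta s) / norm s) * (norm s / norm (s - \<rho>) ^ k)"
        using s0 by (simp add: norm_divide norm_power)
      ultimately have "norm (arch s * completed_zeta s / (s - \<rho>) ^ k) \<le> Q * zeta_weight s" by (simp add: mult.commute)
      also have "\<dots> \<le> (P + Q) * zeta_weight s" using PQ zeta_weight_nonneg by (intro mult_right_mono) auto
      finally show ?thesis .
    qed
  qed
qed

lemma zeta_quotient_L2:
  assumes "completed_zeta \<rho> = 0" "1 \<le> k" "k \<le> nat (zorder completed_zeta \<rho>)"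
  shows "(\<lambda>s. arch s * completed_zeta s / (s - \<rho>) ^ k) \<in> L2 crit_line"
proof -
  obtain C where C: "C \<ge> 0" "\<forall>s. Re s = 1/2 \<longrightarrow> norm (arch s * completed_zeta s / (s - \<rho>) ^ k) \<le> C * zeta_weight s"
    using zeta_quotient_bound[OF assms] by blast
  show ?thesis
  proof (rule L2_bounded_by[OF _ zeta_weight_L2])
    show "(\<lambda>s. arch s * completed_zeta s / (s - \<rho>) ^ k) \<in> borel_measurable crit_line"
      unfolding measurable_cong_sets[OF crit_line_sets refl] by measurable
    show "AE s in crit_line. norm (arch s * completed_zeta s / (s - \<rho>) ^ k) \<le> C * norm (complex_of_real (zeta_weight s))"
      using AE_crit_line_Re by eventually_elim (use C(2) zeta_weight_nonneg in auto)
  qed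
qed

section \<open>Cauchy transforms against an orthogonal function\<close>

text \<open>The element tested is \<open>arch s * X s\<close>. The factor s in
  \<open>X_right\<close> records that s g(s) lies in the space as well. The multiplicity condition
  in \<open>orth\<close> is written as a sum, which avoids truncated subtraction.\<close>

locale zeta_orthogonal =
  fixes X \<phi> :: "complex \<Rightarrow> complex" and C :: real
  assumes X: "X holomorphic_on UNIV" and X0: "\<exists>w. X w \<noteq> 0"
    and X_bound: "\<And>K. \<exists>B. \<forall>s. \<bar>Re s\<bar> \<le> K \<longrightarrow> norm (X s) \<le> B * (1 + norm s)\<^sup>2"
    and X_L2: "(\<lambda>s. arch s * X s) \<in> L2 crit_line"
    and X_right: "\<And>s. Re s \<ge> 3/2 \<Longrightarrow> norm (s * (arch s * X s)) \<le> C"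
    and X_left: "\<And>s. Re s \<ge> 3/2 \<Longrightarrow> norm (arch s * X (1 - s)) \<le> C"
    and \<phi>: "\<phi> \<in> L2 crit_line"
    and orth: "\<And>\<rho> k. completed_zeta \<rho> = 0 \<Longrightarrow> 1 \<le> k \<Longrightarrow> k + nat (zorder X \<rho>) \<le> nat (zorder completed_zeta \<rho>) \<Longrightarrow>
      (LINT s|crit_line. arch s * completed_zeta s / (s - \<rho>) ^ k * cnj (\<phi> s)) = 0"
begin

abbreviation Z where "Z \<equiv> completed_zeta"

text \<open>A common majorant on the line for the integrands below; it is square integrable, so its
  product \<open>U\<close> with |\<phi>| is integrable.\<close>

definition u where "u s = zeta_weight s + norm (arch s * X s)"
definition U where "U s = u s * norm (\<phi> s)"
definition I where "I = (LINT s|crit_line. U s)"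
text \<open>The numerator vanishes at s = w; the division convention gives the value 0 there, which
  affects only a null set.\<close>

definition V where "V w s = (arch s * Z s * X w - arch s * X s * Z w) / (s - w)"
definition N where "N w = (LINT s|crit_line. V w s * cnj (\<phi> s))"
text \<open>\<open>A\<close> and \<open>B\<close> are the Cauchy transforms of \<zeta> and of the
  tested element. They are used off the line, where N w = X w * A w - Z w * B w.\<close>

definition A where "A w = (LINT s|crit_line. arch s * Z s / (s - w) * cnj (\<phi> s))"
definition B where "B w = (LINT s|crit_line. arch s * X s / (s - w) * cnj (\<phi> s))"

lemma archX_borel [measurable]: "(\<lambda>s. arch s * X s) \<in> borel_measurable borel"
  by (rule borel_measurable_continuous_countable_exceptions[of "{1}"])
     (auto intro!: holomorphic_on_imp_continuous_on holomorphic_intros arch_holomorphic holomorphic_on_subset[OF X])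

lemma phi_borel [measurable]: "\<phi> \<in> borel_measurable borel"
  using L2_measurable[OF \<phi>] unfolding measurable_cong_sets[OF crit_line_sets refl] .

lemma V_borel [measurable]: "V w \<in> borel_measurable borel"
  unfolding V_def[abs_def] by measurable

lemma crit_line_borel: "f \<in> borel_measurable borel \<Longrightarrow> f \<in> borel_measurable crit_line"
  by (simp add: measurable_cong_sets[OF crit_line_sets refl])

lemma u_nonneg: "u s \<ge> 0" using zeta_weight_nonneg by (simp add: u_def)

lemma u_ge:
  "zeta_weight s \<le> u s" "norm (arch s * Z s) / norm s \<le> u s" "1 / norm s \<le> u s" "norm (arch s * X s) \<le> u s"
  using zeta_weight_nonneg[of s] by (auto simp: u_def zeta_weight_def)

lemma U_nonneg: "U s \<ge> 0" using u_nonneg by (simp add: U_def)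

lemma U_integrable: "integrable crit_line U"
proof -
  have "(\<lambda>s. of_real (zeta_weight s) + of_real (norm (arch s * X s))) \<in> L2 crit_line"
    by (intro L2_add zeta_weight_L2 L2_norm X_L2)
  from L2_norm_mult_integrable[OF this \<phi>]
  show ?thesis using zeta_weight_nonneg by (simp add: U_def[abs_def] u_def flip: of_real_add)
qed

lemma I_nonneg: "I \<ge> 0" unfolding I_def using U_nonneg by simp

lemma dominated_integrable:
  assumes "f \<in> borel_measurable borel" "\<And>s. Re s = 1/2 \<Longrightarrow> norm (f s) \<le> K * u s"
  shows "integrable crit_line (\<lambda>s. f s * cnj (\<phi> s))"
    "norm (LINT s|crit_line. f s * cnj (\<phi> s)) \<le> K * I"
proof -
  note [measurable] = assms(1)
  have m: "(\<lambda>s. f s * cnj (\<phi> s)) \<in> borel_measurable borel" by measurable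
  have b: "AE s in crit_line. norm (f s * cnj (\<phi> s)) \<le> K * U s"
    using AE_crit_line_Re
  proof eventually_elim
    case (elim s)
    then show ?case using mult_right_mono[OF assms(2)[OF elim], of "norm (\<phi> s)"] by (simp add: norm_mult U_def mult.assoc)
  qed
  show i: "integrable crit_line (\<lambda>s. f s * cnj (\<phi> s))"
  proof (rule Bochner_Integration.integrable_bound)
    show "integrable crit_line (\<lambda>s. K * U s)" using U_integrable by simp
    show "AE s in crit_line. norm (f s * cnj (\<phi> s)) \<le> norm (K * U s)" using b by eventually_elim auto
  qed (rule crit_line_borel[OF m])
  have "norm (LINT s|crit_line. f s * cnj (\<phi> s)) \<le> (LINT s|crit_line. norm (f s * cnj (\<phi> s)))" by (rule integral_norm_bound)
  also have "\<dots> \<le> (LINT s|crit_line. K * U s)" using i U_integrable b by (intro integral_mono_AE integrable_norm integrable_mult_right)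
  finally show "norm (LINT s|crit_line. f s * cnj (\<phi> s)) \<le> K * I" by (simp add: I_def)
qed

lemma dominated_limit:
  assumes f: "\<And>n. f n \<in> borel_measurable borel" "h \<in> borel_measurable borel"
    and b: "\<forall>\<^sub>F n in sequentially. \<forall>s. Re s = 1/2 \<longrightarrow> norm (f n s) \<le> K * u s"
    and lim: "AE s in crit_line. (\<lambda>n. f n s) \<longlonglongrightarrow> h s"
  shows "(\<lambda>n. LINT s|crit_line. f n s * cnj (\<phi> s)) \<longlonglongrightarrow> (LINT s|crit_line. h s * cnj (\<phi> s))"
proof -
  obtain n0 where n0: "\<And>n s. n \<ge> n0 \<Longrightarrow> Re s = 1/2 \<Longrightarrow> norm (f n s) \<le> K * u s"
    using b by (auto simp: eventually_sequentially)
  note [measurable] = f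
  have "(\<lambda>n. LINT s|crit_line. f (n + n0) s * cnj (\<phi> s)) \<longlonglongrightarrow> (LINT s|crit_line. h s * cnj (\<phi> s))"
  proof (rule integral_dominated_convergence)
    show "integrable crit_line (\<lambda>s. K * U s)" using U_integrable by simp
    show "(\<lambda>s. h s * cnj (\<phi> s)) \<in> borel_measurable crit_line" by (rule crit_line_borel) measurable
    show "(\<lambda>s. f (n + n0) s * cnj (\<phi> s)) \<in> borel_measurable crit_line" for n by (rule crit_line_borel) measurable
    show "AE s in crit_line. (\<lambda>n. f (n + n0) s * cnj (\<phi> s)) \<longlonglongrightarrow> h s * cnj (\<phi> s)"
      using lim
    proof eventually_elim
      case (elim s)
      from LIMSEQ_ignore_initial_segment[OF elim, of n0] show ?case by (intro tendsto_intros)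
    qed
    show "AE s in crit_line. norm (f (n + n0) s * cnj (\<phi> s)) \<le> K * U s" for n
      using AE_crit_line_Re
    proof eventually_elim
      case (elim s)
      then show ?case using mult_right_mono[OF n0[of "n + n0" s], of "norm (\<phi> s)"] by (simp add: norm_mult U_def mult.assoc)
    qed
  qed
  then show ?thesis by (rule LIMSEQ_offset)
qed

text \<open>For |s - w| \<ge> 1 the two terms are estimated separately. For |s - w| < 1 the common
  factor \<open>arch s\<close> is taken out and the rest is expressed through Z s - Z w and X s - X
  w, which are of order |s - w|. The rate 7 is 2 from \<open>arch\<close> plus 5 from the fifth
  power of 3 + |w|.\<close>

lemma V_bound:
  assumes a: "a \<ge> 0"
  shows "\<exists>K\<ge>0. \<forall>w s. \<bar>Re w\<bar> \<le> a \<longrightarrow> Re s = 1/2 \<longrightarrow> norm (V w s) \<le> K * exp (7 * \<bar>Im w\<bar>) * u s"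
proof -
  obtain b1 where b1: "\<And>s. \<bar>Re s\<bar> \<le> a + 2 \<Longrightarrow> norm (X s) \<le> b1 * (1 + norm s)\<^sup>2" using X_bound by blast
  obtain b2 where b2: "\<And>s. \<bar>Re s\<bar> \<le> a + 2 \<Longrightarrow> norm (Z s) \<le> b2 * (1 + norm s)\<^sup>2"
    unfolding completed_zeta_def using Mellin_complete_bound[OF rapid_theta_log rapid_theta_log] by blast
  obtain C1 where C1: "C1 > 0" "\<And>s. 1/2 \<le> Re s \<Longrightarrow> Re s \<le> 3/2 \<Longrightarrow> 1/4 \<le> norm (s - 1) \<Longrightarrow> norm (arch s) \<le> C1 * exp (2 * \<bar>Im s\<bar>)"
    using arch_bound by blast
  define b where "b = max b1 b2"
  have "b1 \<ge> 0" using order_trans[OF norm_ge_zero b1[of 0]] a by simp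
  then have b0: "b \<ge> 0" by (simp add: b_def)
  have bX: "norm (X s) \<le> b * (3 + norm w)\<^sup>2" and bZ: "norm (Z s) \<le> b * (3 + norm w)\<^sup>2"
    if "norm (s - w) \<le> 2" "\<bar>Re w\<bar> \<le> a" for s w
  proof -
    have r: "\<bar>Re s\<bar> \<le> a + 2" using abs_Re_le_cmod[of "s - w"] that by simp
    have "norm s \<le> norm (s - w) + norm w" using norm_triangle_ineq[of "s - w" w] by simp
    then have sq: "(1 + norm s)\<^sup>2 \<le> (3 + norm w)\<^sup>2" using that by (intro power_mono) auto
    have "b1 * (1 + norm s)\<^sup>2 \<le> b * (3 + norm w)\<^sup>2" "b2 * (1 + norm s)\<^sup>2 \<le> b * (3 + norm w)\<^sup>2"
      using sq b0 by (auto simp: b_def intro!: mult_mono)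
    then show "norm (X s) \<le> b * (3 + norm w)\<^sup>2" "norm (Z s) \<le> b * (3 + norm w)\<^sup>2" using b1[OF r] b2[OF r] by linarith+
  qed
  define K where "K = (b + 2 * C1 * exp 2 * b\<^sup>2) * exp (15 + 5 * a)"
  have K0: "b + 2 * C1 * exp 2 * b\<^sup>2 \<ge> 0" using b0 C1(1) by simp
  show ?thesis
  proof (intro exI[of _ K] conjI allI impI)
    show "K \<ge> 0" using K0 by (simp add: K_def)
    fix w s :: complex assume w: "\<bar>Re w\<bar> \<le> a" and s: "Re s = 1/2"
    have s0: "norm s > 0" by (rule norm_ge_half[OF s])
    define y where "y = 3 + norm w"
    have y: "y \<ge> 3" "1 + norm w \<le> y" by (auto simp: y_def)
    have y5: "y ^ 5 \<le> exp (15 + 5 * a) * exp (5 * \<bar>Im w\<bar>)"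
    proof -
      have "y \<le> exp (3 + a + \<bar>Im w\<bar>)"
        using cmod_le[of w] w exp_ge_add_one_self[of "3 + a + \<bar>Im w\<bar>"] by (simp add: y_def)
      then have "y ^ 5 \<le> exp (3 + a + \<bar>Im w\<bar>) ^ 5" using y by (intro power_mono) auto
      also have "\<dots> = exp (5 * (3 + a + \<bar>Im w\<bar>))" by (simp flip: exp_of_nat_mult)
      also have "\<dots> = exp (15 + 5 * a) * exp (5 * \<bar>Im w\<bar>)" by (simp flip: exp_add add: algebra_simps)
      finally show ?thesis .
    qed
    have main: "norm (V w s) \<le> (b + 2 * C1 * exp 2 * b\<^sup>2) * exp (2 * \<bar>Im w\<bar>) * y ^ 5 * u s"
    proof (cases "norm (s - w) < 1")
      case False
      have XZ: "norm (X w) \<le> b * y\<^sup>2" "norm (Z w) \<le> b * y\<^sup>2" using bX[of w w] bZ[of w w] w by (auto simp: y_def)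
      have l0: "norm (s - w) > 0" using False by linarith
      have "norm s \<le> (1 + norm w / 1) * norm (s - w)" using False by (intro inverse_shift_bound) auto
      also have "\<dots> \<le> y * norm (s - w)" using y(2) by (intro mult_right_mono) auto
      finally have q: "norm s / norm (s - w) \<le> y" using l0 by (subst pos_divide_le_eq) auto
      have "norm (V w s) \<le> (norm (arch s * Z s * X w) + norm (arch s * X s * Z w)) / norm (s - w)"
        unfolding V_def norm_divide by (intro divide_right_mono norm_triangle_ineq4) simp
      also have "\<dots> = (norm (arch s * Z s) / norm s) * (norm s / norm (s - w)) * norm (X w) + norm (arch s * X s) * (1 / norm (s - w)) * norm (Z w)"
        using s0 l0 by (simp add: norm_mult field_simps)
      also have "\<dots> \<le> norm (arch s * Z s) / norm s * y * (b * y\<^sup>2) + norm (arch s * X s) * y * (b * y\<^sup>2)"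
      proof (intro add_mono mult_mono q XZ)
        show "1 / norm (s - w) \<le> y" using False y by (simp add: divide_le_eq) (smt (verit) mult_le_cancel_left1)
      qed (use y b0 in auto)
      also have "\<dots> = (norm (arch s * Z s) / norm s + norm (arch s * X s)) * (b * y ^ 3)" by (simp add: algebra_simps power2_eq_square power3_eq_cube)
      also have "\<dots> \<le> u s * (b * y ^ 3)"
        using b0 y by (intro mult_right_mono) (auto simp: u_def zeta_weight_def)
      also have "u s * (b * y ^ 3) \<le> u s * ((b + 2 * C1 * exp 2 * b\<^sup>2) * exp (2 * \<bar>Im w\<bar>) * y ^ 5)"
      proof -
        have "b * 1 * y ^ 3 \<le> (b + 2 * C1 * exp 2 * b\<^sup>2) * exp (2 * \<bar>Im w\<bar>) * y ^ 5"
          using b0 C1(1) y K0 by (intro mult_mono power_increasing) auto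
        then show ?thesis using u_nonneg by (intro mult_left_mono) simp_all
      qed
      finally show ?thesis by (simp only: mult_ac)
    next
      case True
      have Lip: "norm (X s - X w) \<le> b * y\<^sup>2 * norm (s - w)" "norm (Z s - Z w) \<le> b * y\<^sup>2 * norm (s - w)"
        using w bX bZ True unfolding y_def
        by (auto intro!: entire_Lipschitz X completed_zeta_holomorphic simp: dist_norm norm_minus_commute)
      have XZ: "norm (X s) \<le> b * y\<^sup>2" "norm (Z s) \<le> b * y\<^sup>2" using bX[of s w] bZ[of s w] True w by (auto simp: y_def)
      have "1/4 \<le> norm (s - 1)" using abs_Re_le_cmod[of "s - 1"] s by simp
      then have "norm (arch s) \<le> C1 * exp (2 * \<bar>Im s\<bar>)" using C1(2)[of s] s by simp
      also have "\<dots> \<le> C1 * exp (2 + 2 * \<bar>Im w\<bar>)"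
        using abs_Im_le_cmod[of "s - w"] True C1(1) by (intro mult_left_mono) auto
      finally have ar: "norm (arch s) \<le> C1 * exp 2 * exp (2 * \<bar>Im w\<bar>)" by (simp add: exp_add)
      have "norm s \<le> norm (s - w) + norm w" using norm_triangle_ineq[of "s - w" w] by simp
      then have o: "1 \<le> y * (1 / norm s)" using True s0 y by (simp add: le_divide_eq)
      have q: "norm ((Z s * X w - X s * Z w) / (s - w)) \<le> 2 * (b * y\<^sup>2) * (b * y\<^sup>2)"
      proof (cases "s = w")
        case True
        then show ?thesis using b0 by simp
      next
        case False
        have "Z s * X w - X s * Z w = X s * (Z s - Z w) - Z s * (X s - X w)" by (simp add: algebra_simps)
        then have "norm (Z s * X w - X s * Z w) \<le> norm (X s) * norm (Z s - Z w) + norm (Z s) * norm (X s - X w)"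
          by (metis norm_mult norm_triangle_ineq4)
        also have "\<dots> \<le> (b * y\<^sup>2) * (b * y\<^sup>2 * norm (s - w)) + (b * y\<^sup>2) * (b * y\<^sup>2 * norm (s - w))"
          using b0 by (intro add_mono mult_mono XZ Lip) auto
        also have "\<dots> = 2 * (b * y\<^sup>2) * (b * y\<^sup>2) * norm (s - w)" by (simp add: algebra_simps)
        finally have f: "norm (Z s * X w - X s * Z w) \<le> 2 * (b * y\<^sup>2) * (b * y\<^sup>2) * norm (s - w)" .
        have sw: "norm (s - w) > 0" using False by simp
        show ?thesis unfolding norm_divide pos_divide_le_eq[OF sw] by (rule f)
      qed
      have "norm (V w s) = norm (arch s) * norm ((Z s * X w - X s * Z w) / (s - w)) * 1"
        unfolding V_def by (simp add: norm_mult norm_divide flip: right_diff_distrib mult.assoc) (simp add: algebra_simps flip: norm_mult)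
      also have "\<dots> \<le> (C1 * exp 2 * exp (2 * \<bar>Im w\<bar>)) * (2 * (b * y\<^sup>2) * (b * y\<^sup>2)) * (y * (1 / norm s))"
        using ar q o C1(1) b0 by (intro mult_mono) auto
      also have "\<dots> = (2 * C1 * exp 2 * b\<^sup>2) * exp (2 * \<bar>Im w\<bar>) * y ^ 5 * (1 / norm s)"
        by (simp add: power2_eq_square eval_nat_numeral)
      also have "\<dots> \<le> (b + 2 * C1 * exp 2 * b\<^sup>2) * exp (2 * \<bar>Im w\<bar>) * y ^ 5 * u s"
        using b0 C1(1) y u_ge(3)[of s] K0 by (intro mult_mono) auto
      finally show ?thesis .
    qed
    also have "\<dots> \<le> (b + 2 * C1 * exp 2 * b\<^sup>2) * exp (2 * \<bar>Im w\<bar>) * (exp (15 + 5 * a) * exp (5 * \<bar>Im w\<bar>)) * u s"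
      using y5 K0 u_nonneg by (intro mult_right_mono mult_left_mono) auto
    also have "\<dots> = K * (exp (2 * \<bar>Im w\<bar>) * exp (5 * \<bar>Im w\<bar>)) * u s" by (simp only: K_def mult_ac)
    also have "exp (2 * \<bar>Im w\<bar>) * exp (5 * \<bar>Im w\<bar>) = exp (7 * \<bar>Im w\<bar>)" by (simp flip: exp_add)
    finally show "norm (V w s) \<le> K * exp (7 * \<bar>Im w\<bar>) * u s" .
  qed
qed

lemma N_bound:
  assumes a: "a \<ge> 0"
  shows "\<exists>K\<ge>0. \<forall>w. \<bar>Re w\<bar> \<le> a \<longrightarrow> norm (N w) \<le> K * exp (7 * \<bar>Im w\<bar>)"
proof -
  obtain K where K: "K \<ge> 0" "\<And>w s. \<bar>Re w\<bar> \<le> a \<Longrightarrow> Re s = 1/2 \<Longrightarrow> norm (V w s) \<le> K * exp (7 * \<bar>Im w\<bar>) * u s"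
    using V_bound[OF a] by blast
  have "norm (N w) \<le> K * I * exp (7 * \<bar>Im w\<bar>)" if "\<bar>Re w\<bar> \<le> a" for w
    using dominated_integrable(2)[OF V_borel K(2)[OF that]] by (simp add: N_def mult_ac)
  moreover have "K * I \<ge> 0" using K(1) I_nonneg by simp
  ultimately show ?thesis by blast
qed

lemma V_local_bound:
  assumes "norm (w - w0) \<le> r" "Re s = 1/2"
    and K: "\<And>w s. \<bar>Re w\<bar> \<le> \<bar>Re w0\<bar> + r \<Longrightarrow> Re s = 1/2 \<Longrightarrow> norm (V w s) \<le> K * exp (7 * \<bar>Im w\<bar>) * u s" "K \<ge> 0"
  shows "norm (V w s) \<le> K * exp (7 * (\<bar>Im w0\<bar> + r)) * u s"
proof -
  have "\<bar>Re w\<bar> \<le> \<bar>Re w0\<bar> + r" using abs_Re_le_cmod[of "w - w0"] assms(1) by simp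
  from K(1)[OF this assms(2)] have "norm (V w s) \<le> K * exp (7 * \<bar>Im w\<bar>) * u s" .
  also have "\<dots> \<le> K * exp (7 * (\<bar>Im w0\<bar> + r)) * u s"
    using abs_Im_le_cmod[of "w - w0"] assms(1) K(2) u_nonneg by (intro mult_right_mono mult_left_mono) auto
  finally show ?thesis .
qed

text \<open>For fixed s on the line the convention at w = s in general spoils holomorphy of the
  integrand in w, so differentiation under the integral is done off the line only. Continuity on the
  whole plane then pastes the two halves together.\<close>

lemma N_holomorphic: "N holomorphic_on UNIV"
proof -
  have cont: "isCont N w0" for w0
    unfolding isCont_def tendsto_at_iff_sequentially comp_def
  proof (intro allI impI)
    fix x :: "nat \<Rightarrow> complex" assume x: "\<forall>i. x i \<in> UNIV - {w0}" "x \<longlonglongrightarrow> w0"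
    obtain K where K: "K \<ge> 0" "\<And>w s. \<bar>Re w\<bar> \<le> \<bar>Re w0\<bar> + 1 \<Longrightarrow> Re s = 1/2 \<Longrightarrow> norm (V w s) \<le> K * exp (7 * \<bar>Im w\<bar>) * u s"
      using V_bound[of "\<bar>Re w0\<bar> + 1"] by auto
    have ev: "\<forall>\<^sub>F n in sequentially. dist (x n) w0 < 1" using tendstoD[OF x(2), of 1] by simp
    show "(\<lambda>n. N (x n)) \<longlonglongrightarrow> N w0" unfolding N_def
    proof (rule dominated_limit[where K = "K * exp (7 * (\<bar>Im w0\<bar> + 1))"])
      show "\<forall>\<^sub>F n in sequentially. \<forall>s. Re s = 1/2 \<longrightarrow> norm (V (x n) s) \<le> K * exp (7 * (\<bar>Im w0\<bar> + 1)) * u s"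
        using ev
      proof eventually_elim
        case (elim n)
        then have "norm (x n - w0) \<le> 1" by (simp add: dist_norm)
        then show ?case using V_local_bound K by blast
      qed
      show "AE s in crit_line. (\<lambda>n. V (x n) s) \<longlonglongrightarrow> V w0 s"
        using AE_crit_line_neq[of w0]
      proof eventually_elim
        case (elim s)
        have "(\<lambda>n. f (x n)) \<longlonglongrightarrow> f w0" if "f holomorphic_on UNIV" for f
          using holomorphic_on_imp_continuous_on[OF that] x(2) by (auto simp: continuous_on_eq_continuous_at intro: isCont_tendsto_compose)
        then show ?case unfolding V_def using elim X completed_zeta_holomorphic x(2) by (intro tendsto_intros) auto
      qed
    qed (auto intro: V_borel)
  qed
  have hol: "N holomorphic_on W" if W: "open W" "\<And>w. w \<in> W \<Longrightarrow> Re w \<noteq> 1/2" for W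
    unfolding N_def
  proof (rule holomorphic_on_integral[OF W(1)])
    show "(\<lambda>s. V w s * cnj (\<phi> s)) \<in> borel_measurable crit_line" for w by (rule crit_line_borel) measurable
    show "AE s in crit_line. (\<lambda>w. V w s * cnj (\<phi> s)) holomorphic_on W"
      using AE_crit_line_Re
    proof eventually_elim
      case (elim s)
      have "s - w \<noteq> 0" if "w \<in> W" for w using W(2)[OF that] elim by auto
      then show ?case unfolding V_def
        by (intro holomorphic_intros holomorphic_on_subset[OF X] completed_zeta_holomorphic) auto
    qed
    fix w0 assume "w0 \<in> W"
    obtain K where K: "K \<ge> 0" "\<And>w s. \<bar>Re w\<bar> \<le> \<bar>Re w0\<bar> + 1 \<Longrightarrow> Re s = 1/2 \<Longrightarrow> norm (V w s) \<le> K * exp (7 * \<bar>Im w\<bar>) * u s"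
      using V_bound[of "\<bar>Re w0\<bar> + 1"] by auto
    have "AE s in crit_line. \<forall>w\<in>ball w0 1 \<inter> W. norm (V w s * cnj (\<phi> s)) \<le> (K * exp (7 * (\<bar>Im w0\<bar> + 1))) * U s"
      using AE_crit_line_Re
    proof eventually_elim
      case (elim s)
      show ?case
      proof
        fix w assume "w \<in> ball w0 1 \<inter> W"
        then have "norm (w - w0) \<le> 1" by (simp add: dist_norm norm_minus_commute)
        from mult_right_mono[OF V_local_bound[OF this elim K(2,1)], of "norm (\<phi> s)"]
        show "norm (V w s * cnj (\<phi> s)) \<le> (K * exp (7 * (\<bar>Im w0\<bar> + 1))) * U s" by (simp add: norm_mult U_def mult.assoc)
      qed
    qed
    then show "\<exists>r>0. \<exists>b. integrable crit_line b \<and> (AE s in crit_line. \<forall>w\<in>ball w0 r \<inter> W. norm (V w s * cnj (\<phi> s)) \<le> b s)"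
      using U_integrable by (intro exI[of _ 1] conjI exI[of _ "\<lambda>s. (K * exp (7 * (\<bar>Im w0\<bar> + 1))) * U s"]) auto
  qed
  show ?thesis
  \<comment> \<open>The line Re z = 1/2 in inner product form, with normal vector 1.\<close>
  proof (rule holomorphic_on_paste_across_line[where d = 1 and k = "1/2"])
    show "continuous_on UNIV N" using cont by (simp add: continuous_at_imp_continuous_on)
    have e: "UNIV \<inter> {z. 1 \<bullet> z < 1/2} = {z. Re z < 1/2}" "UNIV \<inter> {z. 1/2 < 1 \<bullet> z} = {z. 1/2 < Re z}"
      by (auto simp: inner_complex_def)
    show "N holomorphic_on UNIV \<inter> {z. 1 \<bullet> z < 1/2}" unfolding e by (rule hol[OF open_halfspace_Re_lt]) auto
    show "N holomorphic_on UNIV \<inter> {z. 1/2 < 1 \<bullet> z}" unfolding e by (rule hol[OF open_halfspace_Re_gt]) auto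
  qed auto
qed

end

context zeta_orthogonal
begin

lemma A_B_bound:
  assumes d: "d > 0" "d \<le> \<bar>Re w - 1/2\<bar>"
  shows "integrable crit_line (\<lambda>s. arch s * Z s / (s - w) * cnj (\<phi> s))"
    "integrable crit_line (\<lambda>s. arch s * X s / (s - w) * cnj (\<phi> s))"
    "norm (A w) \<le> (1 + norm w / d) * I" "norm (B w) \<le> 1 / d * I"
    "N w = X w * A w - Z w * B w"
proof -
  have l: "norm (s - w) \<ge> d" if "Re s = 1/2" for s
    using abs_Re_le_cmod[of "s - w"] d that by simp
  have a: "norm (arch s * Z s / (s - w)) \<le> (1 + norm w / d) * u s" if s: "Re s = 1/2" for s
  proof -
    have s0: "norm s > 0" "norm (s - w) > 0" using norm_ge_half[OF s] l[OF s] d(1) by auto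
    have q: "norm s / norm (s - w) \<le> 1 + norm w / d"
      using inverse_shift_bound[OF d(1) l[OF s]] s0(2) by (subst pos_divide_le_eq) auto
    have "norm (arch s * Z s / (s - w)) = (norm s / norm (s - w)) * (norm (arch s * Z s) / norm s)" using s0 by (simp add: norm_divide)
    also have "\<dots> \<le> (1 + norm w / d) * u s" using q u_ge(2)[of s] d(1) by (intro mult_mono) auto
    finally show ?thesis .
  qed
  have b: "norm (arch s * X s / (s - w)) \<le> 1 / d * u s" if s: "Re s = 1/2" for s
  proof -
    have "norm (arch s * X s) / norm (s - w) \<le> u s / d" using l[OF s] d(1) u_ge(4)[of s] u_nonneg by (intro frac_le) auto
    then show ?thesis by (simp add: norm_divide)
  qed
  have m: "(\<lambda>s. arch s * Z s / (s - w)) \<in> borel_measurable borel" "(\<lambda>s. arch s * X s / (s - w)) \<in> borel_measurable borel"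
    by measurable
  show i1: "integrable crit_line (\<lambda>s. arch s * Z s / (s - w) * cnj (\<phi> s))" by (rule dominated_integrable(1)[OF m(1) a])
  show i2: "integrable crit_line (\<lambda>s. arch s * X s / (s - w) * cnj (\<phi> s))" by (rule dominated_integrable(1)[OF m(2) b])
  show "norm (A w) \<le> (1 + norm w / d) * I" unfolding A_def by (rule dominated_integrable(2)[OF m(1) a])
  show "norm (B w) \<le> 1 / d * I" unfolding B_def by (rule dominated_integrable(2)[OF m(2) b])
  have "N w = (LINT s|crit_line. X w * (arch s * Z s / (s - w) * cnj (\<phi> s)) - Z w * (arch s * X s / (s - w) * cnj (\<phi> s)))"
    unfolding N_def V_def by (rule Bochner_Integration.integral_cong) (auto simp: diff_divide_distrib algebra_simps)
  also have "\<dots> = X w * A w - Z w * B w"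
    unfolding A_def B_def Bochner_Integration.integral_diff[OF integrable_mult_right[OF i1] integrable_mult_right[OF i2]] integral_mult_right_zero ..
  finally show "N w = X w * A w - Z w * B w" .
qed

text \<open>Expanding \<open>1 / (s - w)\<close> in powers of \<open>w - \<rho>\<close>, every term but the remainder is orthogonal to \<open>\<phi>\<close>.\<close>

lemma A_expansion:
  assumes zero: "Z \<rho> = 0" and w: "Re w \<noteq> 1/2"
    and j: "j + nat (zorder X \<rho>) \<le> nat (zorder Z \<rho>)"
  shows "A w = (w - \<rho>) ^ j * (LINT s|crit_line. arch s * Z s / ((s - \<rho>) ^ j * (s - w)) * cnj (\<phi> s))"
  using j
proof (induction j)
  case 0
  then show ?case by (simp add: A_def)
next
  case (Suc j)
  let ?m = "nat (zorder Z \<rho>)"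
  define d where "d = \<bar>Re w - 1/2\<bar>"
  have d: "d > 0" using w by (simp add: d_def)
  have l: "norm (s - w) \<ge> d" if "Re s = 1/2" for s
    using abs_Re_le_cmod[of "s - w"] that by (simp add: d_def)
  obtain K where K: "K \<ge> 0" "\<forall>s. Re s = 1/2 \<longrightarrow> norm (arch s * Z s / (s - \<rho>) ^ Suc j) \<le> K * zeta_weight s"
    using zeta_quotient_bound[OF zero, of "Suc j"] Suc.prems by auto
  have Ku: "norm (arch s * Z s / (s - \<rho>) ^ Suc j) \<le> K * u s" if "Re s = 1/2" for s
    using K(2) that mult_left_mono[OF u_ge(1)[of s] K(1)] order_trans by blast
  have m1: "(\<lambda>s. arch s * Z s / (s - \<rho>) ^ Suc j) \<in> borel_measurable borel" by measurable
  have m2: "(\<lambda>s. arch s * Z s / ((s - \<rho>) ^ Suc j * (s - w))) \<in> borel_measurable borel" by measurable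
  have i1: "integrable crit_line (\<lambda>s. arch s * Z s / (s - \<rho>) ^ Suc j * cnj (\<phi> s))"
    by (rule dominated_integrable(1)[OF m1 Ku])
  have Ku2: "norm (arch s * Z s / ((s - \<rho>) ^ Suc j * (s - w))) \<le> (K / d) * u s" if s: "Re s = 1/2" for s
  proof -
    have "norm (arch s * Z s / (s - \<rho>) ^ Suc j) / norm (s - w) \<le> (K * u s) / d"
      using Ku[OF s] l[OF s] d K(1) u_nonneg by (intro frac_le) auto
    then show ?thesis by (simp add: norm_divide norm_mult)
  qed
  have i2: "integrable crit_line (\<lambda>s. arch s * Z s / ((s - \<rho>) ^ Suc j * (s - w)) * cnj (\<phi> s))"
    by (rule dominated_integrable(1)[OF m2 Ku2])
  have o: "(LINT s|crit_line. arch s * Z s / (s - \<rho>) ^ Suc j * cnj (\<phi> s)) = 0"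
    by (rule orth[OF zero]) (use Suc.prems in auto)
  \<comment> \<open>The partial fraction behind the expansion, to be used with p = s - \<rho>, q = s
    - w and r = w - \<rho>.\<close>
  have pf: "1 / (p ^ j * q) = 1 / p ^ Suc j + r / (p ^ Suc j * q)" if "p \<noteq> 0" "q \<noteq> 0" "q + r = p" for p q r :: complex
  proof -
    have "1 / p ^ Suc j + r / (p ^ Suc j * q) = (q + r) / (p ^ Suc j * q)"
      using that(1,2) by (simp add: add_divide_distrib del: power_Suc)
    then show ?thesis using that by simp
  qed
  have "(LINT s|crit_line. arch s * Z s / ((s - \<rho>) ^ j * (s - w)) * cnj (\<phi> s))
    = (LINT s|crit_line. arch s * Z s / (s - \<rho>) ^ Suc j * cnj (\<phi> s) + (w - \<rho>) * (arch s * Z s / ((s - \<rho>) ^ Suc j * (s - w)) * cnj (\<phi> s)))"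
  proof (rule integral_cong_AE)
    show "AE s in crit_line. arch s * Z s / ((s - \<rho>) ^ j * (s - w)) * cnj (\<phi> s)
      = arch s * Z s / (s - \<rho>) ^ Suc j * cnj (\<phi> s) + (w - \<rho>) * (arch s * Z s / ((s - \<rho>) ^ Suc j * (s - w)) * cnj (\<phi> s))"
      using AE_crit_line_neq[of \<rho>] AE_crit_line_neq[of w]
    proof eventually_elim
      case (elim s)
      have "1 / ((s - \<rho>) ^ j * (s - w)) = 1 / (s - \<rho>) ^ Suc j + (w - \<rho>) / ((s - \<rho>) ^ Suc j * (s - w))"
        by (rule pf) (use elim in auto)
      from arg_cong[OF this, of "\<lambda>x. arch s * Z s * cnj (\<phi> s) * x"] show ?case by (simp add: algebra_simps)
    qed
  qed (rule crit_line_borel, measurable)+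
  also have "\<dots> = (w - \<rho>) * (LINT s|crit_line. arch s * Z s / ((s - \<rho>) ^ Suc j * (s - w)) * cnj (\<phi> s))"
    unfolding Bochner_Integration.integral_add[OF i1 integrable_mult_right[OF i2]] o integral_mult_right_zero by (rule add_0)
  finally show ?case using Suc by (simp add: mult_ac)
qed

text \<open>Off the line N / Z = (X / Z) A - B. With m and k the orders of \<open>Z\<close> and
  \<open>X\<close> at \<rho> and j = m - k (truncated), X / Z contributes \<delta>^(k - m) and
  \<open>A_expansion\<close> contributes \<delta>^j, so no negative power remains. On the line |s -
  \<rho> - \<delta>| \<ge> |\<delta>|, hence \<delta> times either remaining Cauchy integral tends
  to 0 by dominated convergence.\<close>

lemma no_pole:
  assumes zero: "Z \<rho> = 0"
  defines "\<delta> \<equiv> \<lambda>n. complex_of_real (1 / real (Suc n))"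
  shows "(\<lambda>n. \<delta> n * (N (\<rho> + \<delta> n) / Z (\<rho> + \<delta> n))) \<longlonglongrightarrow> 0"
proof -
  have \<delta>: "\<delta> \<longlonglongrightarrow> 0" "\<delta> n \<noteq> 0" for n
  proof -
    have "(\<lambda>n. 1 / real (Suc n)) \<longlonglongrightarrow> 0" by (rule LIMSEQ_Suc[OF lim_1_over_n])
    from tendsto_of_real[OF this] show "\<delta> \<longlonglongrightarrow> 0" unfolding \<delta>_def by (simp only: of_real_0)
  qed (simp add: \<delta>_def del: of_nat_Suc)
  have wl: "(\<lambda>n. \<rho> + \<delta> n) \<longlonglongrightarrow> \<rho>" using tendsto_add[OF tendsto_const \<delta>(1), of \<rho>] by simp
  define m where "m = nat (zorder Z \<rho>)"
  define k where "k = nat (zorder X \<rho>)"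
  define j where "j = m - k"
  obtain r1 Z1 where Z1: "r1 > 0" "Z1 holomorphic_on cball \<rho> r1"
    "\<And>w. w \<in> cball \<rho> r1 \<Longrightarrow> Z w = Z1 w * (w - \<rho>) ^ m" "\<And>w. w \<in> cball \<rho> r1 \<Longrightarrow> Z1 w \<noteq> 0" "m \<ge> 1"
    using entire_order_factor[OF completed_zeta_holomorphic completed_zeta_not_identically_0, of \<rho>] zero unfolding m_def by blast
  obtain r2 X1 where X1: "r2 > 0" "X1 holomorphic_on cball \<rho> r2"
    "\<And>w. w \<in> cball \<rho> r2 \<Longrightarrow> X w = X1 w * (w - \<rho>) ^ k"
    using entire_order_factor[OF X X0, of \<rho>] unfolding k_def by blast
  have cZ: "isCont Z1 \<rho>" using holomorphic_on_imp_continuous_on[OF Z1(2)] Z1(1) by (intro continuous_on_interior[of "cball \<rho> r1"]) auto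
  have cX: "isCont X1 \<rho>" using holomorphic_on_imp_continuous_on[OF X1(2)] X1(1) by (intro continuous_on_interior[of "cball \<rho> r2"]) auto
  \<comment> \<open>For \<rho> to the left of the line the step stays below half the distance to it,
    so that \<rho> + \<delta> is never closer to the line than \<delta>. For \<rho> on the line or
    to its right, moving right only increases the distance.\<close>
  define r where "r = min (min r1 r2) (if Re \<rho> < 1/2 then (1/2 - Re \<rho>) / 2 else 1)"
  have r: "r > 0" "r \<le> r1" "r \<le> r2" "Re \<rho> < 1/2 \<Longrightarrow> r \<le> (1/2 - Re \<rho>) / 2" "r \<le> 1"
    using Z1(1) X1(1) completed_zeta_zero_strip[OF zero] by (auto simp: r_def min_def)
  have near: "\<forall>\<^sub>F n in sequentially. norm (\<delta> n) < r" using tendstoD[OF \<delta>(1) r(1)] by simp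
  have small: "norm (\<delta> n) \<le> norm (s - (\<rho> + \<delta> n))" if "norm (\<delta> n) < r" "Re s = 1/2" for n s
  proof -
    have nd: "norm (\<delta> n) = Re (\<delta> n)" unfolding \<delta>_def norm_of_real Re_complex_of_real by simp
    have d0: "Re (\<delta> n) > 0" by (simp add: \<delta>_def del: of_nat_Suc)
    have "Re (\<delta> n) \<le> \<bar>1/2 - Re \<rho> - Re (\<delta> n)\<bar>"
    proof (cases "Re \<rho> < 1/2")
      case True
      then have "Re (\<delta> n) < (1/2 - Re \<rho>) / 2" using r(4) that(1) nd by simp
      then have "Re (\<delta> n) * 2 < 1/2 - Re \<rho>" by (simp only: pos_less_divide_eq[OF zero_less_numeral])
      then have "Re (\<delta> n) \<le> 1/2 - Re \<rho> - Re (\<delta> n)" by (simp add: algebra_simps | linarith)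
      also have "\<dots> \<le> \<bar>1/2 - Re \<rho> - Re (\<delta> n)\<bar>" by (rule abs_ge_self)
      finally show ?thesis .
    qed (use d0 in linarith)
    also have "\<dots> \<le> norm (s - (\<rho> + \<delta> n))" using abs_Re_le_cmod[of "s - (\<rho> + \<delta> n)"] that(2) by (simp add: algebra_simps)
    finally show ?thesis using nd by simp
  qed
  have dpos: "norm (\<delta> n) > 0" for n using \<delta>(2) by simp
  have re: "Re (\<rho> + \<delta> n) \<noteq> 1/2" if "norm (\<delta> n) < r" for n
    using small[OF that, of "Complex (1/2) (Im (\<rho> + \<delta> n))"] dpos[of n]
    by (metis cancel_comm_monoid_add_class.diff_cancel complex.sel(1) complex_surj norm_zero not_le)
  have limB: "(\<lambda>n. \<delta> n * B (\<rho> + \<delta> n)) \<longlonglongrightarrow> 0"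
  proof -
    have "(\<lambda>n. LINT s|crit_line. (\<delta> n * (arch s * X s / (s - (\<rho> + \<delta> n)))) * cnj (\<phi> s)) \<longlonglongrightarrow> (LINT s|crit_line. 0 * cnj (\<phi> s))"
    proof (rule dominated_limit[where K = 1])
      show "\<forall>\<^sub>F n in sequentially. \<forall>s. Re s = 1/2 \<longrightarrow> norm (\<delta> n * (arch s * X s / (s - (\<rho> + \<delta> n)))) \<le> 1 * u s"
        using near
      proof (eventually_elim, intro allI impI)
        fix n s assume n: "norm (\<delta> n) < r" and s: "Re s = 1/2"
        have "norm (\<delta> n) / norm (s - (\<rho> + \<delta> n)) * norm (arch s * X s) \<le> 1 * u s"
          using small[OF n s] dpos[of n] u_ge(4)[of s] by (intro mult_mono) (auto simp: divide_le_eq)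
        then show "norm (\<delta> n * (arch s * X s / (s - (\<rho> + \<delta> n)))) \<le> 1 * u s" by (simp add: norm_mult norm_divide)
      qed
      show "AE s in crit_line. (\<lambda>n. \<delta> n * (arch s * X s / (s - (\<rho> + \<delta> n)))) \<longlonglongrightarrow> 0"
        using AE_crit_line_neq[of \<rho>]
      proof eventually_elim
        case (elim s)
        have "(\<lambda>n. \<delta> n * (arch s * X s / (s - (\<rho> + \<delta> n)))) \<longlonglongrightarrow> 0 * (arch s * X s / (s - \<rho>))"
          using elim by (intro tendsto_intros \<delta> wl) auto
        then show ?case by simp
      qed
    qed measurable
    moreover have "(LINT s|crit_line. (\<delta> n * (arch s * X s / (s - (\<rho> + \<delta> n)))) * cnj (\<phi> s)) = \<delta> n * B (\<rho> + \<delta> n)" for n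
      unfolding B_def by (simp only: mult.assoc integral_mult_right_zero)
    ultimately show ?thesis by simp
  qed
  have limA: "(\<lambda>n. \<delta> n * (LINT s|crit_line. arch s * Z s / ((s - \<rho>) ^ j * (s - (\<rho> + \<delta> n))) * cnj (\<phi> s))) \<longlonglongrightarrow> 0"
  proof -
    obtain K where K: "\<And>n s. norm (\<delta> n) < r \<Longrightarrow> Re s = 1/2 \<Longrightarrow> norm (\<delta> n * (arch s * Z s / ((s - \<rho>) ^ j * (s - (\<rho> + \<delta> n))))) \<le> K * u s"
    \<comment> \<open>\<open>zeta_quotient_bound\<close> asks for an exponent of at least 1; for j =
      0 the factor 1 / |s| in the majorant must come from the Cauchy kernel instead.\<close>
    proof (cases "j = 0")
      case True
      show thesis
      proof (rule that[of "3 + norm \<rho>"])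
        fix n s assume n: "norm (\<delta> n) < r" and s: "Re s = 1/2"
        have s0: "norm s > 0" by (rule norm_ge_half[OF s])
        note sm = small[OF n s]
        have l0: "norm (s - (\<rho> + \<delta> n)) > 0" using sm dpos[of n] by linarith
        have "norm (\<delta> n) \<le> 1" using n r(5) by linarith
        have "norm s \<le> norm (s - (\<rho> + \<delta> n)) + norm (\<rho> + \<delta> n)" using norm_triangle_ineq[of "s - (\<rho> + \<delta> n)" "\<rho> + \<delta> n"] by simp
        moreover have "norm (\<rho> + \<delta> n) \<le> norm \<rho> + 1" using norm_triangle_ineq[of \<rho> "\<delta> n"] \<open>norm (\<delta> n) \<le> 1\<close> by linarith
        ultimately have "norm (\<delta> n) * norm s \<le> norm (\<delta> n) * (norm (s - (\<rho> + \<delta> n)) + (norm \<rho> + 1))"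
          by (intro mult_left_mono) auto
        also have "\<dots> = norm (\<delta> n) * norm (s - (\<rho> + \<delta> n)) + norm (\<delta> n) * (norm \<rho> + 1)" by (rule distrib_left)
        also have "\<dots> \<le> 1 * norm (s - (\<rho> + \<delta> n)) + norm (s - (\<rho> + \<delta> n)) * (norm \<rho> + 1)"
          using sm \<open>norm (\<delta> n) \<le> 1\<close> by (intro add_mono mult_right_mono) auto
        also have "\<dots> \<le> (3 + norm \<rho>) * norm (s - (\<rho> + \<delta> n))" by (simp add: algebra_simps)
        finally have q: "norm (\<delta> n) * norm s / norm (s - (\<rho> + \<delta> n)) \<le> 3 + norm \<rho>" using l0 by (subst pos_divide_le_eq) auto
        have "norm (\<delta> n * (arch s * Z s / ((s - \<rho>) ^ j * (s - (\<rho> + \<delta> n))))) = (norm (\<delta> n) * norm s / norm (s - (\<rho> + \<delta> n))) * (norm (arch s * Z s) / norm s)"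
          using s0 True by (simp add: norm_mult norm_divide)
        also have "\<dots> \<le> (3 + norm \<rho>) * u s" using q u_ge(2)[of s] by (intro mult_mono) auto
        finally show "norm (\<delta> n * (arch s * Z s / ((s - \<rho>) ^ j * (s - (\<rho> + \<delta> n))))) \<le> (3 + norm \<rho>) * u s" .
      qed
    next
      case False
      obtain K where K: "K \<ge> 0" "\<forall>s. Re s = 1/2 \<longrightarrow> norm (arch s * Z s / (s - \<rho>) ^ j) \<le> K * zeta_weight s"
        using zeta_quotient_bound[OF zero, of j] False unfolding j_def m_def by auto
      show thesis
      proof (rule that[of K])
        fix n s assume n: "norm (\<delta> n) < r" and s: "Re s = 1/2"
        have "norm (arch s * Z s / (s - \<rho>) ^ j) \<le> K * zeta_weight s" using K(2) s by blast
        also have "\<dots> \<le> K * u s" by (rule mult_left_mono[OF u_ge(1) K(1)])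
        finally have "norm (\<delta> n) / norm (s - (\<rho> + \<delta> n)) * norm (arch s * Z s / (s - \<rho>) ^ j) \<le> 1 * (K * u s)"
          using small[OF n s] dpos[of n] by (intro mult_mono) (auto simp: divide_le_eq)
        then show "norm (\<delta> n * (arch s * Z s / ((s - \<rho>) ^ j * (s - (\<rho> + \<delta> n))))) \<le> K * u s" by (simp add: norm_mult norm_divide mult_ac)
      qed
    qed
    have "(\<lambda>n. LINT s|crit_line. (\<delta> n * (arch s * Z s / ((s - \<rho>) ^ j * (s - (\<rho> + \<delta> n))))) * cnj (\<phi> s)) \<longlonglongrightarrow> (LINT s|crit_line. 0 * cnj (\<phi> s))"
    proof (rule dominated_limit[where K = K])
      show "\<forall>\<^sub>F n in sequentially. \<forall>s. Re s = 1/2 \<longrightarrow> norm (\<delta> n * (arch s * Z s / ((s - \<rho>) ^ j * (s - (\<rho> + \<delta> n))))) \<le> K * u s"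
        using near by eventually_elim (use K in blast)
      show "AE s in crit_line. (\<lambda>n. \<delta> n * (arch s * Z s / ((s - \<rho>) ^ j * (s - (\<rho> + \<delta> n))))) \<longlonglongrightarrow> 0"
        using AE_crit_line_neq[of \<rho>]
      proof eventually_elim
        case (elim s)
        have "(\<lambda>n. \<delta> n * (arch s * Z s / ((s - \<rho>) ^ j * (s - (\<rho> + \<delta> n))))) \<longlonglongrightarrow> 0 * (arch s * Z s / ((s - \<rho>) ^ j * (s - \<rho>)))"
          using elim by (intro tendsto_intros \<delta> wl) auto
        then show ?case by simp
      qed
    qed measurable
    moreover have "(LINT s|crit_line. (\<delta> n * (arch s * Z s / ((s - \<rho>) ^ j * (s - (\<rho> + \<delta> n))))) * cnj (\<phi> s))
      = \<delta> n * (LINT s|crit_line. arch s * Z s / ((s - \<rho>) ^ j * (s - (\<rho> + \<delta> n))) * cnj (\<phi> s))" for n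
      by (simp only: mult.assoc integral_mult_right_zero)
    ultimately show ?thesis by simp
  qed
  have "(\<lambda>n. \<delta> n ^ (j + k - m) * (X1 (\<rho> + \<delta> n) / Z1 (\<rho> + \<delta> n)) * (\<delta> n * (LINT s|crit_line. arch s * Z s / ((s - \<rho>) ^ j * (s - (\<rho> + \<delta> n))) * cnj (\<phi> s))) - \<delta> n * B (\<rho> + \<delta> n))
    \<longlonglongrightarrow> 0 ^ (j + k - m) * (X1 \<rho> / Z1 \<rho>) * 0 - 0"
    using Z1(4)[of \<rho>] Z1(1)
    by (intro tendsto_diff tendsto_mult tendsto_divide tendsto_power \<delta>(1) limA limB isCont_tendsto_compose[OF cX] isCont_tendsto_compose[OF cZ] wl) auto
  moreover have "\<forall>\<^sub>F n in sequentially. \<delta> n ^ (j + k - m) * (X1 (\<rho> + \<delta> n) / Z1 (\<rho> + \<delta> n)) * (\<delta> n * (LINT s|crit_line. arch s * Z s / ((s - \<rho>) ^ j * (s - (\<rho> + \<delta> n))) * cnj (\<phi> s))) - \<delta> n * B (\<rho> + \<delta> n)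
    = \<delta> n * (N (\<rho> + \<delta> n) / Z (\<rho> + \<delta> n))"
    using near
  proof eventually_elim
    case (elim n)
    define w where "w = \<rho> + \<delta> n"
    define J where "J = (LINT s|crit_line. arch s * Z s / ((s - \<rho>) ^ j * (s - w)) * cnj (\<phi> s))"
    have b: "w \<in> cball \<rho> r1" "w \<in> cball \<rho> r2" using elim r by (auto simp: w_def dist_norm)
    have Re: "Re w \<noteq> 1/2" unfolding w_def by (rule re[OF elim])
    have wr: "w - \<rho> = \<delta> n" by (simp add: w_def)
    have Aw: "A w = \<delta> n ^ j * J"
    proof (cases "k \<le> m")
      case True
      show ?thesis unfolding J_def wr[symmetric] by (rule A_expansion[OF zero Re]) (use True in \<open>auto simp: j_def m_def k_def\<close>)
    next
      \<comment> \<open>Truncation gives j = 0 here, and the surplus order of \<open>X\<close>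
        survives as the power j + k - m of \<delta>.\<close>
      case False
      then show ?thesis by (simp add: j_def J_def A_def)
    qed
    have NN: "N w = X w * A w - Z w * B w" using A_B_bound(5)[of "\<bar>Re w - 1/2\<bar>" w] Re by auto
    have Zw: "Z w \<noteq> 0" "Z w = Z1 w * \<delta> n ^ m" "Z1 w \<noteq> 0" using Z1(3,4)[OF b(1)] \<delta>(2)[of n] by (auto simp: wr)
    have Xw: "X w = X1 w * \<delta> n ^ k" using X1(3)[OF b(2)] by (simp add: wr)
    have p: "\<delta> n ^ k * \<delta> n ^ j = \<delta> n ^ (j + k - m) * \<delta> n ^ m" by (simp add: j_def add.commute flip: power_add)
    have "X w * A w / Z w = X1 w * (\<delta> n ^ k * \<delta> n ^ j) * J / (Z1 w * \<delta> n ^ m)" unfolding Xw Aw Zw(2) by (simp only: mult_ac)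
    also have "\<dots> = \<delta> n ^ (j + k - m) * (X1 w / Z1 w) * J" unfolding p using \<delta>(2)[of n] by simp
    finally have NZ: "N w / Z w = \<delta> n ^ (j + k - m) * (X1 w / Z1 w) * J - B w" using Zw(1) by (simp add: NN diff_divide_distrib)
    show ?case unfolding w_def[symmetric] J_def[symmetric] NZ by (simp only: right_diff_distrib mult_ac)
  qed
  ultimately have "(\<lambda>n. \<delta> n * (N (\<rho> + \<delta> n) / Z (\<rho> + \<delta> n))) \<longlonglongrightarrow> 0 ^ (j + k - m) * (X1 \<rho> / Z1 \<rho>) * 0 - 0"
    by (rule Lim_transform_eventually)
  then show ?thesis by simp
qed

end

text \<open>A lower bound is available only for the product a z, so the archimedean factor a is
  cancelled against a x without being estimated itself.\<close>

lemma quotient_norm_le: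
  fixes a x z :: complex
  assumes "norm (a * x) \<le> C" "1 \<le> norm (a * z) * D"
  shows "z \<noteq> 0" "norm (x / z) \<le> C * D"
proof -
  have az: "norm (a * z) > 0" using assms(2) by (cases "a * z = 0") auto
  then have nz: "a \<noteq> 0" "z \<noteq> 0" by auto
  then show "z \<noteq> 0" by simp
  have C: "C \<ge> 0" using order_trans[OF norm_ge_zero assms(1)] .
  have "norm (a * x) \<le> C * 1" using assms(1) by simp
  also have "\<dots> \<le> C * (norm (a * z) * D)" by (rule mult_left_mono[OF assms(2) C])
  also have "\<dots> = C * D * norm (a * z)" by (simp only: mult_ac)
  finally have "norm (a * x) / norm (a * z) \<le> C * D" using az by (subst pos_divide_le_eq) auto
  moreover have "x / z = (a * x) / (a * z)" using nz by simp
  ultimately show "norm (x / z) \<le> C * D" by (simp only: norm_divide)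
qed

context zeta_orthogonal
begin

text \<open>Once the quotient \<open>F\<close> of \<open>N\<close> by \<open>Z\<close> is known to
  vanish, B = (X / Z) A to the right of the strip. There w X / Z is bounded and \<open>A\<close>
  tends to 0 along the integers, so w B w tends to 0; but its limit is also minus the integral in
  question.\<close>

lemma vanishing: "(LINT s|crit_line. arch s * X s * cnj (\<phi> s)) = 0"
proof -
  \<comment> \<open>|\<zeta>(3/2)|, the reciprocal of the lower bound for |\<zeta>| on Re w \<ge>
    3/2.\<close>
  define D0 where "D0 = norm (Dirichlet_zeta (of_real (3/2)))"
  have D0: "1 \<le> norm (arch w * Z w) * D0" if "Re w \<ge> 3/2" for w
    using Dirichlet_zeta_norm_ge[of "3/2" w] arch_completed_zeta_right[of w] that by (simp add: D0_def)
  define \<delta> where "\<delta> n = complex_of_real (1 / real (Suc n))" for n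
  have \<delta>: "\<delta> \<longlonglongrightarrow> 0" "\<delta> n \<noteq> 0" for n
  proof -
    have "(\<lambda>n. 1 / real (Suc n)) \<longlonglongrightarrow> 0" by (rule LIMSEQ_Suc[OF lim_1_over_n])
    from tendsto_of_real[OF this] show "\<delta> \<longlonglongrightarrow> 0" unfolding \<delta>_def by (simp only: of_real_0)
  qed (simp add: \<delta>_def del: of_nat_Suc)
  obtain F where F: "F holomorphic_on UNIV" "\<And>w. Z w \<noteq> 0 \<Longrightarrow> F w = N w / Z w"
    using entire_quotient[OF N_holomorphic completed_zeta_holomorphic completed_zeta_not_identically_0 \<delta> no_pole[folded \<delta>_def]] by blast
  \<comment> \<open>On the right through \<open>X_right\<close>, on the left through
    \<open>X_left\<close> at 1 - w and the functional equation of \<open>Z\<close>.\<close>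
  have R: "Z w \<noteq> 0 \<and> norm (X w / Z w) \<le> C * D0" if "Re w \<le> -1/2 \<or> 3/2 \<le> Re w" for w
  proof (cases "3/2 \<le> Re w")
    case True
    have "norm w \<ge> 1" using abs_Re_le_cmod[of w] True by simp
    then have "1 * norm (arch w * X w) \<le> norm w * norm (arch w * X w)" by (rule mult_right_mono) simp
    also have "\<dots> \<le> C" using X_right[OF True] by (simp only: norm_mult)
    finally have "norm (arch w * X w) \<le> C" by simp
    from quotient_norm_le[OF this D0[OF True]] show ?thesis by blast
  next
    case False
    then have v: "3/2 \<le> Re (1 - w)" using that by simp
    have "norm (arch (1 - w) * X w) \<le> C" using X_left[OF v] by simp
    from quotient_norm_le[OF this D0[OF v]] show ?thesis unfolding completed_zeta_reflect by blast
  qed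
  have FR: "F w = X w / Z w * A w - B w" if "Re w \<le> -1/2 \<or> 3/2 \<le> Re w" for w
  proof -
    have "F w = (X w * A w - Z w * B w) / Z w" using F(2) R[OF that] A_B_bound(5)[of 1 w] that by auto
    then show ?thesis using R[OF that] by (simp add: diff_divide_distrib)
  qed
  have C0: "C \<ge> 0" using order_trans[OF norm_ge_zero X_left[of 2]] by simp
  have D00: "D0 \<ge> 0" by (simp add: D0_def)
  have out: "norm (F w) \<le> (C * D0 * I + I) * (1 + norm w)" if w: "Re w \<le> -1/2 \<or> 3/2 \<le> Re w" for w
  proof -
    have d: "(1::real) \<le> \<bar>Re w - 1/2\<bar>" using w by auto
    have "norm (F w) \<le> norm (X w / Z w) * norm (A w) + norm (B w)"
      unfolding FR[OF w] by (metis norm_mult norm_triangle_ineq4)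
    also have "\<dots> \<le> C * D0 * ((1 + norm w) * I) + I * (1 + norm w)"
    proof (intro add_mono mult_mono)
      show "norm (A w) \<le> (1 + norm w) * I" using A_B_bound(3)[OF zero_less_one d] by simp
      have "norm (B w) \<le> I * 1" using A_B_bound(4)[OF zero_less_one d] by simp
      also have "\<dots> \<le> I * (1 + norm w)" using I_nonneg by (intro mult_left_mono) auto
      finally show "norm (B w) \<le> I * (1 + norm w)" .
    qed (use R[OF w] C0 D00 in auto)
    also have "\<dots> = (C * D0 * I + I) * (1 + norm w)" by (simp add: algebra_simps)
    finally show ?thesis .
  qed
  \<comment> \<open>Discs of radius 6 around points of Re = 3/2 lie in |Re z| \<le> 15/2, within the
    bound 8.\<close>
  obtain K where K: "K \<ge> 0" "\<And>w. \<bar>Re w\<bar> \<le> 8 \<Longrightarrow> norm (N w) \<le> K * exp (7 * \<bar>Im w\<bar>)" using N_bound[of 8] by auto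
  obtain b2 where b2: "\<And>s. \<bar>Re s\<bar> \<le> 8 \<Longrightarrow> norm (Z s) \<le> b2 * (1 + norm s)\<^sup>2"
    unfolding completed_zeta_def using Mellin_complete_bound[OF rapid_theta_log rapid_theta_log] by blast
  have b20: "b2 \<ge> 0" using order_trans[OF norm_ge_zero b2[of 0]] by simp
  obtain C1 where C1: "C1 > 0" "\<And>s. 1/2 \<le> Re s \<Longrightarrow> Re s \<le> 3/2 \<Longrightarrow> 1/4 \<le> norm (s - 1) \<Longrightarrow> norm (arch s) \<le> C1 * exp (2 * \<bar>Im s\<bar>)"
    using arch_bound by blast
  \<comment> \<open>28 = 2 * 14 comes from (1 + |z|)^2 with |z| \<le> 14 + T, and 42 = 7 * 6 from
    the rate 7 of \<open>N_bound\<close> and the vertical reach 6 of the disc.\<close>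
  define M0 where "M0 = b2 * exp 28 + K * exp 42"
  have M00: "M0 \<ge> 0" using b20 K(1) by (simp add: M0_def)
  define E where "E = (2 * M0 * (C1 * D0)) ^ 3"
  have E0: "E \<ge> 0" using M00 C1(1) D00 by (simp add: E_def)
  have ins: "norm (F w) \<le> (E + 27) * exp ((E + 27) * \<bar>Im w\<bar>)" if w: "-1/2 \<le> Re w" "Re w \<le> 3/2" for w
  proof -
    define T where "T = \<bar>Im w\<bar>"
    have T: "T \<ge> 0" by (simp add: T_def)
    \<comment> \<open>Centre at the height of w on the line where \<zeta> is bounded below; a third
      of the radius 6 is 2, the width of the strip -1/2 \<le> Re w \<le> 3/2.\<close>
    define c where "c = Complex (3/2) (Im w)"
    have zb: "\<bar>Re z\<bar> \<le> 8" "\<bar>Im z\<bar> \<le> T + 6" if "z \<in> cball c 6" for z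
    proof -
      have n: "norm (z - c) \<le> 6" using that by (simp add: dist_norm norm_minus_commute)
      have "\<bar>Re z - 3/2\<bar> \<le> 6" "\<bar>Im z - Im w\<bar> \<le> 6"
        using order_trans[OF abs_Re_le_cmod n] order_trans[OF abs_Im_le_cmod n] by (auto simp: c_def)
      then show "\<bar>Re z\<bar> \<le> 8" "\<bar>Im z\<bar> \<le> T + 6" by (auto simp: T_def)
    qed
    have Zb: "norm (Z z) \<le> M0 * exp (7 * T)" if z: "z \<in> cball c 6" for z
    proof -
      have "1 + norm z \<le> exp (norm z)" by (rule exp_ge_add_one_self)
      also have "\<dots> \<le> exp (14 + T)" using cmod_le[of z] zb[OF z] by simp
      finally have "(1 + norm z)\<^sup>2 \<le> (exp (14 + T))\<^sup>2" by (intro power_mono) auto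
      also have "\<dots> = exp (28 + 2 * T)" by (simp add: exp_double[symmetric])
      also have "\<dots> \<le> exp 28 * exp (7 * T)" using T by (simp flip: exp_add)
      finally have "b2 * (1 + norm z)\<^sup>2 \<le> b2 * (exp 28 * exp (7 * T))" by (rule mult_left_mono[OF _ b20])
      also have "\<dots> = b2 * exp 28 * exp (7 * T)" by (simp only: mult.assoc)
      also have "\<dots> \<le> M0 * exp (7 * T)" using K(1) by (intro mult_right_mono) (auto simp: M0_def)
      finally show ?thesis using b2[OF zb(1)[OF z]] by (rule order_trans[rotated])
    qed
    have FZb: "norm (F z * Z z) \<le> M0 * exp (7 * T)" if z: "z \<in> cball c 6" for z
    proof (cases "Z z = 0")
      case False
      then have "F z * Z z = N z" using F(2)[OF False] by simp
      then have "norm (F z * Z z) \<le> K * exp (7 * \<bar>Im z\<bar>)" using K(2)[OF zb(1)[OF z]] by simp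
      also have "\<dots> \<le> K * exp (42 + 7 * T)" using zb(2)[OF z] K(1) by (intro mult_left_mono) auto
      also have "\<dots> = K * exp 42 * exp (7 * T)" by (simp add: exp_add)
      also have "\<dots> \<le> M0 * exp (7 * T)" using b20 by (intro mult_right_mono) (auto simp: M0_def)
      finally show ?thesis .
    qed (use M00 in simp)
    have rc: "Re c = 3/2" "\<bar>Im c\<bar> = T" by (auto simp: c_def T_def)
    have "1/4 \<le> norm (c - 1)" using abs_Re_le_cmod[of "c - 1"] rc by simp
    then have ac: "norm (arch c) \<le> C1 * exp (2 * T)" using C1(2)[of c] rc by simp
    have Zc: "Z c \<noteq> 0" using R[of c] rc by simp
    have "1 \<le> norm (arch c) * norm (Z c) * D0" using D0[of c] rc by (simp add: norm_mult)
    also have "\<dots> \<le> C1 * exp (2 * T) * norm (Z c) * D0" using ac D00 by (intro mult_right_mono) auto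
    finally have "1 / norm (Z c) \<le> C1 * D0 * exp (2 * T)" using Zc by (subst pos_divide_le_eq) (auto simp: mult_ac)
    then have "2 * (M0 * exp (7 * T)) * (1 / norm (Z c)) \<le> 2 * (M0 * exp (7 * T)) * (C1 * D0 * exp (2 * T))"
      using M00 by (intro mult_left_mono) auto
    also have "\<dots> = 2 * M0 * (C1 * D0) * exp (9 * T)"
    proof -
      have e: "exp (7 * T) * exp (2 * T) = exp (9 * T)" by (simp flip: exp_add)
      show ?thesis unfolding e[symmetric] by (simp only: mult_ac)
    qed
    \<comment> \<open>The rate 9 adds 7 from the bound on the disc and 2 from \<open>arch c\<close>;
      the cube below turns it into 27.\<close>
    finally have q: "2 * (M0 * exp (7 * T)) / norm (Z c) \<le> 2 * M0 * (C1 * D0) * exp (9 * T)"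
      by (simp only: times_divide_eq_right mult_1_right)
    have wc: "norm (w - c) \<le> 6 / 3"
    proof -
      have "w - c = of_real (Re w - 3/2)" by (simp add: complex_eq_iff c_def)
      then have "norm (w - c) = \<bar>Re w - 3/2\<bar>" by (simp only: norm_of_real)
      then show ?thesis using w by auto
    qed
    have "norm (F w) \<le> (2 * (M0 * exp (7 * T)) / norm (Z c)) ^ 3"
      by (rule quotient_bound_disc[OF F(1) completed_zeta_holomorphic _ Zb FZb Zc wc]) auto
    also have "\<dots> \<le> (2 * M0 * (C1 * D0) * exp (9 * T)) ^ 3" using q M00 by (intro power_mono) auto
    also have "\<dots> = E * exp (27 * T)" unfolding E_def power_mult_distrib by (simp flip: exp_of_nat_mult)
    also have "\<dots> \<le> (E + 27) * exp ((E + 27) * T)" using E0 T by (intro mult_mono) (auto intro: mult_right_mono)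
    finally show ?thesis unfolding T_def .
  qed
  have re2: "Re (of_nat n :: complex) \<ge> 3/2" if "n \<ge> 2" for n using that by simp
  have inv: "(\<lambda>n. 1 / of_nat n :: complex) \<longlonglongrightarrow> 0" by (rule lim_1_over_n)
  have shift: "a / (s - of_nat n) = (a * (1 / of_nat n)) / (s * (1 / of_nat n) - 1)"
    "of_nat n * (a / (s - of_nat n)) = a / (s * (1 / of_nat n) - 1)" if "n \<ge> 2" for n and a s :: complex
  proof -
    have n0: "of_nat n \<noteq> (0::complex)" using that by simp
    have e: "s * (1 / of_nat n) - 1 = (s - of_nat n) / of_nat n" using n0 by (simp add: diff_divide_distrib)
    show "a / (s - of_nat n) = (a * (1 / of_nat n)) / (s * (1 / of_nat n) - 1)"
      "of_nat n * (a / (s - of_nat n)) = a / (s * (1 / of_nat n) - 1)" unfolding e using n0 by auto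
  qed
  have far: "norm s \<le> norm (s - of_nat n)" "real n / 2 \<le> norm (s - of_nat n)" if "n \<ge> 2" "Re s = 1/2" for n s
  proof -
    have n: "real n \<ge> 2" using that by simp
    have "(Re s)\<^sup>2 \<le> (Re s - real n)\<^sup>2" unfolding that(2) using n by (intro abs_le_square_iff[THEN iffD1]) auto
    then show "norm s \<le> norm (s - of_nat n)" unfolding cmod_def by simp
    show "real n / 2 \<le> norm (s - of_nat n)" using abs_Re_le_cmod[of "s - of_nat n"] that(2) n by simp
  qed
  have pt: "(\<lambda>n. a / (s - of_nat n)) \<longlonglongrightarrow> 0" "(\<lambda>n. of_nat n * (a / (s - of_nat n))) \<longlonglongrightarrow> - a" for a s :: complex
  proof -
    have "(\<lambda>n. (a * (1 / of_nat n)) / (s * (1 / of_nat n) - 1)) \<longlonglongrightarrow> (a * 0) / (s * 0 - 1)"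
      "(\<lambda>n. a / (s * (1 / of_nat n) - 1)) \<longlonglongrightarrow> a / (s * 0 - 1)" by (intro tendsto_intros inv; simp)+
    then have l: "(\<lambda>n. (a * (1 / of_nat n)) / (s * (1 / of_nat n) - 1)) \<longlonglongrightarrow> 0"
      "(\<lambda>n. a / (s * (1 / of_nat n) - 1)) \<longlonglongrightarrow> - a" by simp_all
    have e1: "\<forall>\<^sub>F n in sequentially. (a * (1 / of_nat n)) / (s * (1 / of_nat n) - 1) = a / (s - of_nat n)"
      using eventually_ge_at_top[of "2::nat"] by eventually_elim (rule shift(1)[symmetric])
    have e2: "\<forall>\<^sub>F n in sequentially. a / (s * (1 / of_nat n) - 1) = of_nat n * (a / (s - of_nat n))"
      using eventually_ge_at_top[of "2::nat"] by eventually_elim (rule shift(2)[symmetric])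
    show "(\<lambda>n. a / (s - of_nat n)) \<longlonglongrightarrow> 0" by (rule Lim_transform_eventually[OF l(1) e1])
    show "(\<lambda>n. of_nat n * (a / (s - of_nat n))) \<longlonglongrightarrow> - a" by (rule Lim_transform_eventually[OF l(2) e2])
  qed
  have limA: "(\<lambda>n. A (of_nat n)) \<longlonglongrightarrow> 0"
  proof -
    have "(\<lambda>n. LINT s|crit_line. arch s * Z s / (s - of_nat n) * cnj (\<phi> s)) \<longlonglongrightarrow> (LINT s|crit_line. 0 * cnj (\<phi> s))"
    proof (rule dominated_limit[where K = 1])
      show "\<forall>\<^sub>F n in sequentially. \<forall>s. Re s = 1/2 \<longrightarrow> norm (arch s * Z s / (s - of_nat n)) \<le> 1 * u s"
        using eventually_ge_at_top[of 2]
      proof (eventually_elim, intro allI impI)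
        fix n s assume n: "(2::nat) \<le> n" and s: "Re s = 1/2"
        have "norm (arch s * Z s) / norm (s - of_nat n) \<le> norm (arch s * Z s) / norm s"
          using far(1)[OF n s] norm_ge_half[OF s] by (intro frac_le) auto
        also have "\<dots> \<le> u s" by (rule u_ge(2))
        finally show "norm (arch s * Z s / (s - of_nat n)) \<le> 1 * u s" by (simp add: norm_divide)
      qed
      show "AE s in crit_line. (\<lambda>n. arch s * Z s / (s - of_nat n)) \<longlonglongrightarrow> 0" by (intro AE_I2 pt)
    qed measurable
    then show ?thesis by (simp add: A_def)
  qed
  have limB: "(\<lambda>n. of_nat n * B (of_nat n)) \<longlonglongrightarrow> - (LINT s|crit_line. arch s * X s * cnj (\<phi> s))"
  proof -
    have "(\<lambda>n. LINT s|crit_line. (of_nat n * (arch s * X s / (s - of_nat n))) * cnj (\<phi> s)) \<longlonglongrightarrow> (LINT s|crit_line. (- (arch s * X s)) * cnj (\<phi> s))"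
    proof (rule dominated_limit[where K = 2])
      show "\<forall>\<^sub>F n in sequentially. \<forall>s. Re s = 1/2 \<longrightarrow> norm (of_nat n * (arch s * X s / (s - of_nat n))) \<le> 2 * u s"
        using eventually_ge_at_top[of 2]
      proof (eventually_elim, intro allI impI)
        fix n s assume n: "(2::nat) \<le> n" and s: "Re s = 1/2"
        have l: "norm (s - of_nat n) > 0" using far(1)[OF n s] norm_ge_half[OF s] by (rule less_le_trans[rotated])
        have "real n \<le> 2 * norm (s - of_nat n)" using far(2)[OF n s] by simp
        then have "real n / norm (s - of_nat n) \<le> 2" using l by (subst pos_divide_le_eq) auto
        then have "real n / norm (s - of_nat n) * norm (arch s * X s) \<le> 2 * u s" using u_ge(4)[of s] by (intro mult_mono) auto
        then show "norm (of_nat n * (arch s * X s / (s - of_nat n))) \<le> 2 * u s" by (simp add: norm_mult norm_divide)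
      qed
      show "AE s in crit_line. (\<lambda>n. of_nat n * (arch s * X s / (s - of_nat n))) \<longlonglongrightarrow> - (arch s * X s)" by (intro AE_I2 pt)
    qed measurable
    moreover have "(LINT s|crit_line. (of_nat n * (arch s * X s / (s - of_nat n))) * cnj (\<phi> s)) = of_nat n * B (of_nat n)" for n
      unfolding B_def by (simp only: mult.assoc integral_mult_right_zero)
    ultimately show ?thesis by simp
  qed
  have limnull: "(\<lambda>n. r n * A (of_nat n)) \<longlonglongrightarrow> 0" if "\<And>n. n \<ge> 2 \<Longrightarrow> norm (r n) \<le> C * D0" for r
  proof (rule Lim_null_comparison)
    show "\<forall>\<^sub>F n in sequentially. norm (r n * A (of_nat n)) \<le> C * D0 * norm (A (of_nat n))"
      using eventually_ge_at_top[of 2] by eventually_elim (simp add: norm_mult mult_right_mono that)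
    show "(\<lambda>n. C * D0 * norm (A (of_nat n))) \<longlonglongrightarrow> 0" using tendsto_mult[OF tendsto_const tendsto_norm[OF limA], of "C * D0"] by simp
  qed
  have limF: "(\<lambda>n. F (of_nat n)) \<longlonglongrightarrow> 0"
  proof -
    have "(\<lambda>n. 1 / of_nat n * (of_nat n * B (of_nat n))) \<longlonglongrightarrow> 0 * - (LINT s|crit_line. arch s * X s * cnj (\<phi> s))"
      by (intro tendsto_mult inv limB)
    moreover have "(\<lambda>n. X (of_nat n) / Z (of_nat n) * A (of_nat n)) \<longlonglongrightarrow> 0"
      by (rule limnull) (use R re2 in auto)
    ultimately have "(\<lambda>n. X (of_nat n) / Z (of_nat n) * A (of_nat n) - 1 / of_nat n * (of_nat n * B (of_nat n))) \<longlonglongrightarrow>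
        0 - 0 * - (LINT s|crit_line. arch s * X s * cnj (\<phi> s))" by (intro tendsto_diff)
    moreover have "\<forall>\<^sub>F n in sequentially. X (of_nat n) / Z (of_nat n) * A (of_nat n) - 1 / of_nat n * (of_nat n * B (of_nat n)) = F (of_nat n)"
      using eventually_ge_at_top[of "2::nat"]
    proof eventually_elim
      case (elim n)
      then have "1 / of_nat n * (of_nat n * B (of_nat n)) = B (of_nat n)" by simp
      then show ?case using FR[of "of_nat n"] re2[OF elim] by simp
    qed
    ultimately have "(\<lambda>n. F (of_nat n)) \<longlonglongrightarrow> 0 - 0 * - (LINT s|crit_line. arch s * X s * cnj (\<phi> s))" by (rule Lim_transform_eventually)
    then show ?thesis by simp
  qed
  have F0: "F w = 0" for w by (rule entire_zero_criterion[OF F(1) out ins limF])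
  \<comment> \<open>Here the factor s in \<open>X_right\<close> enters: n X(n) / Z(n) stays
    bounded.\<close>
  have "(\<lambda>n. (of_nat n * (X (of_nat n) / Z (of_nat n))) * A (of_nat n)) \<longlonglongrightarrow> 0"
  proof (rule limnull)
    fix n :: nat assume n: "n \<ge> 2"
    have "norm (arch (of_nat n) * (of_nat n * X (of_nat n))) \<le> C"
      using X_right[OF re2[OF n]] by (simp only: mult.left_commute)
    from quotient_norm_le(2)[OF this D0[OF re2[OF n]]]
    show "norm (of_nat n * (X (of_nat n) / Z (of_nat n))) \<le> C * D0" by simp
  qed
  moreover have "\<forall>\<^sub>F n in sequentially. (of_nat n * (X (of_nat n) / Z (of_nat n))) * A (of_nat n) = of_nat n * B (of_nat n)"
    using eventually_ge_at_top[of "2::nat"]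
  proof eventually_elim
    case (elim n)
    have "X (of_nat n) / Z (of_nat n) * A (of_nat n) = B (of_nat n)" using FR[of "of_nat n"] F0 re2[OF elim] by simp
    then show ?case by (simp only: mult.assoc)
  qed
  ultimately have "(\<lambda>n. of_nat n * B (of_nat n)) \<longlonglongrightarrow> 0" by (rule Lim_transform_eventually)
  from LIMSEQ_unique[OF this limB] show ?thesis by simp
qed

end

section \<open>Continuations, multiplicities and the closed span\<close>

text \<open>Otherwise F and G would differ throughout a punctured neighbourhood of 1/2, which meets
  the line in a set of positive length.\<close>

lemma nicely_meromorphic_eq_on_crit_line:
  assumes F: "F nicely_meromorphic_on UNIV" and G: "G nicely_meromorphic_on UNIV"
    and ae: "AE s in crit_line. F s = G s"
  shows "F = G"
proof (rule nicely_meromorphic_unique[OF F G, where ?z0.0 = "1/2"], rule ccontr)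
  assume "\<not> (\<exists>\<^sub>F w in at (1/2). F w = G w)"
  then have "\<forall>\<^sub>F w in at (1/2). F w \<noteq> G w" by (simp add: not_frequently)
  then obtain r where r: "r > 0" "\<forall>w. w \<noteq> 1/2 \<and> dist w (1/2) < r \<longrightarrow> F w \<noteq> G w" by (auto simp: eventually_at)
  have "AE s in crit_line. \<not> (0 < dist s (1/2) \<and> dist s (1/2) < r)"
    using ae by eventually_elim (use r(2) in auto)
  moreover have "Measurable.pred borel (\<lambda>s::complex. \<not> (0 < dist s (1/2) \<and> dist s (1/2) < r))" by measurable
  ultimately have "AE t in lborel. \<not> (0 < dist (Complex (1/2) t) (1/2) \<and> dist (Complex (1/2) t) (1/2) < r)"
    using AE_crit_line_iff by blast
  moreover have "dist (Complex (1/2) t) (1/2) = \<bar>t\<bar>" for t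
  proof -
    have "Complex (1/2) t - 1/2 = \<i> * of_real t" by (simp add: complex_eq_iff)
    then show ?thesis by (simp add: dist_norm norm_mult)
  qed
  ultimately have "AE t in lborel. t \<notin> {0<..<r}" by (auto elim: eventually_mono)
  then have "{0<..<r} \<in> null_sets lborel" using AE_iff_null_sets[of "{0<..<r}" lborel] by simp
  then have "emeasure lborel {0<..<r} = 0" by (rule null_setsD1)
  then show False using r(1) by simp
qed

text \<open>\<open>arch\<close> is holomorphic and nonzero near such a \<rho>, so it does not change
  the order of vanishing.\<close>

lemma zero_mult_arch_mult:
  assumes f: "f holomorphic_on UNIV" "\<exists>w. f w \<noteq> 0"
    and h: "\<And>s. s \<noteq> 1 \<Longrightarrow> h s = arch s * f s" and \<rho>: "Re \<rho> > 0" "\<rho> \<noteq> 1"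
  shows "zero_mult h \<rho> = enat (nat (zorder f \<rho>))"
proof -
  define n where "n = nat (zorder f \<rho>)"
  obtain r q where q: "r > 0" "q holomorphic_on cball \<rho> r" "\<And>w. w \<in> cball \<rho> r \<Longrightarrow> f w = q w * (w - \<rho>) ^ n" "\<And>w. w \<in> cball \<rho> r \<Longrightarrow> q w \<noteq> 0"
    using entire_order_factor[OF f, of \<rho>] unfolding n_def by blast
  define W where "W = ball \<rho> r \<inter> (- {1}) \<inter> {w. 0 < Re w}"
  have oW: "open W" unfolding W_def by (intro open_Int open_ball open_Compl closed_singleton open_halfspace_Re_gt)
  have rW: "\<rho> \<in> W" using q(1) \<rho> by (simp add: W_def)
  have hW: "h w = (arch w * q w) * (w - \<rho>) ^ n" "arch w * q w \<noteq> 0" if "w \<in> W" for w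
  proof -
    have w: "w \<in> cball \<rho> r" "w \<noteq> 1" "0 < Re w" using that by (auto simp: W_def)
    have "arch w \<noteq> 0" by (rule arch_nonzero) (use w in auto)
    then show "h w = (arch w * q w) * (w - \<rho>) ^ n" "arch w * q w \<noteq> 0"
      using h[OF w(2)] q(3,4)[OF w(1)] by auto
  qed
  have "zorder h \<rho> = int n"
  proof (rule zorder_eqI[OF oW rW, of "\<lambda>w. arch w * q w"])
    show "(\<lambda>w. arch w * q w) holomorphic_on W"
      by (intro holomorphic_intros holomorphic_on_subset[OF arch_holomorphic] holomorphic_on_subset[OF q(2)]) (auto simp: W_def)
    show "arch \<rho> * q \<rho> \<noteq> 0" by (rule hW(2)[OF rW])
    show "h w = arch w * q w * (w - \<rho>) powi int n" if "w \<in> W" for w using hW(1)[OF that] by simp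
  qed
  moreover have "\<not> eventually (\<lambda>w. h w = 0) (at \<rho>)"
  proof
    assume "eventually (\<lambda>w. h w = 0) (at \<rho>)"
    moreover have "eventually (\<lambda>w. w \<in> W - {\<rho>}) (at \<rho>)" by (rule eventually_at_in_open[OF oW rW])
    ultimately have "eventually (\<lambda>w::complex. False) (at \<rho>)"
    proof eventually_elim
      case (elim w)
      then show ?case using hW[of w] by auto
    qed
    then show False by simp
  qed
  ultimately show ?thesis by (simp add: zero_mult_def n_def)
qed

lemma L2_dist_sq_eq_integral:
  assumes "g \<in> L2 M" "h \<in> L2 M"
  shows "L2_dist_sq M g h = ennreal (LINT x|M. (norm (g x - h x))\<^sup>2)"
  unfolding L2_dist_sq_def by (rule nn_integral_eq_integral[OF L2_integrable[OF L2_diff[OF assms]]]) simp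

lemma riemann_zeta_measurable [measurable]: "riemann_zeta \<in> borel_measurable borel"
proof (rule borel_measurable_continuous_countable_exceptions[of "{1}"])
  have "continuous_on (- {1}) (\<lambda>s. arch s * completed_zeta s)"
    by (intro holomorphic_on_imp_continuous_on holomorphic_intros arch_holomorphic completed_zeta_holomorphic)
  then show "continuous_on (- {1}) riemann_zeta"
    by (rule continuous_on_eq) (simp add: riemann_zeta_eq)
qed simp

lemma AE_riemann_zeta_quotient:
  "AE s in crit_line. riemann_zeta s / (s - \<rho>) ^ k = arch s * completed_zeta s / (s - \<rho>) ^ k"
  using AE_crit_line_neq[of 1] by eventually_elim (simp add: riemann_zeta_eq)

lemma riemann_zeta_quotient_L2:
  assumes "completed_zeta \<rho> = 0" "1 \<le> k" "k \<le> nat (zorder completed_zeta \<rho>)"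
  shows "(\<lambda>s. riemann_zeta s / (s - \<rho>) ^ k) \<in> L2 crit_line"
proof (rule L2_bounded_by[OF _ zeta_quotient_L2[OF assms]])
  show "(\<lambda>s. riemann_zeta s / (s - \<rho>) ^ k) \<in> borel_measurable crit_line"
    unfolding measurable_cong_sets[OF crit_line_sets refl] by measurable
  show "AE s in crit_line. norm (riemann_zeta s / (s - \<rho>) ^ k) \<le> 1 * norm (arch s * completed_zeta s / (s - \<rho>) ^ k)"
    using AE_riemann_zeta_quotient[of \<rho> k] by eventually_elim (simp only: mult_1 order_refl)
qed

text \<open>The linear span satisfies the closure conditions of
  \<open>L2_approximation_by_duality\<close>, whose test functions range over the whole of
  \<open>L2 crit_line\<close>.\<close>

lemma closed_span_L_eqI:
  assumes g: "g \<in> L_space" and S: "S \<subseteq> L2 crit_line"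
    and dual: "\<And>\<phi>. \<phi> \<in> L2 crit_line \<Longrightarrow> (\<And>v. v \<in> S \<Longrightarrow> (LINT s|crit_line. v s * cnj (\<phi> s)) = 0) \<Longrightarrow>
      (LINT s|crit_line. g s * cnj (\<phi> s)) = 0"
  shows "g \<in> closed_span_L S"
proof -
  interpret fm: module "\<lambda>(c::complex) (f::complex \<Rightarrow> complex) s. c * f s"
    by unfold_locales (auto simp: fun_eq_iff algebra_simps)
  have gL: "g \<in> L2 crit_line" using g by (simp add: L_space_def)
  have "fm.subspace (L2 crit_line)"
  proof (rule fm.subspaceI)
    show "0 \<in> L2 crit_line" by (simp add: L2_def zero_fun_def)
    show "x + y \<in> L2 crit_line" if "x \<in> L2 crit_line" "y \<in> L2 crit_line" for x y
      using L2_add[OF that] by (simp add: plus_fun_def)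
    show "(\<lambda>s. c * x s) \<in> L2 crit_line" if "x \<in> L2 crit_line" for c x by (rule L2_cmult[OF that])
  qed
  then have V: "fm.span S \<subseteq> L2 crit_line" by (rule fm.span_minimal[OF S])
  have "\<exists>h\<in>fm.span S. (LINT s|crit_line. (norm (g s - h s))\<^sup>2) < \<epsilon>" if "\<epsilon> > 0" for \<epsilon>
  proof (rule L2_approximation_by_duality[OF V _ _ _ gL _ that])
    show "fm.span S \<noteq> {}" using fm.span_zero by blast
    show "(\<lambda>s. u s + v s) \<in> fm.span S" if "u \<in> fm.span S" "v \<in> fm.span S" for u v
      using fm.span_add[OF that] by (simp add: plus_fun_def)
    show "(\<lambda>s. c * u s) \<in> fm.span S" if "u \<in> fm.span S" for c u by (rule fm.span_scale[OF that])
    show "(LINT s|crit_line. g s * cnj (\<phi> s)) = 0"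
      if "\<phi> \<in> L2 crit_line" "\<And>v. v \<in> fm.span S \<Longrightarrow> (LINT s|crit_line. v s * cnj (\<phi> s)) = 0" for \<phi>
      by (rule dual[OF that(1)]) (rule that(2)[OF fm.span_base])
  qed
  then have "\<forall>\<epsilon>>0. \<exists>h\<in>fm.span S. L2_dist_sq crit_line g h < ennreal \<epsilon>"
  proof (intro allI impI)
    fix \<epsilon> :: real assume "\<epsilon> > 0"
    then obtain h where h: "h \<in> fm.span S" "(LINT s|crit_line. (norm (g s - h s))\<^sup>2) < \<epsilon>"
      using \<open>\<And>\<epsilon>. 0 < \<epsilon> \<Longrightarrow> \<exists>h\<in>fm.span S. (LINT s|crit_line. (norm (g s - h s))\<^sup>2) < \<epsilon>\<close>[of \<epsilon>] by blast
    have "h \<in> L2 crit_line" using h(1) V by blast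
    from L2_dist_sq_eq_integral[OF gL this] h(2) have "L2_dist_sq crit_line g h < ennreal \<epsilon>"
      using \<open>\<epsilon> > 0\<close> by (simp add: ennreal_lessI)
    with h(1) show "\<exists>h\<in>fm.span S. L2_dist_sq crit_line g h < ennreal \<epsilon>" by blast
  qed
  then show ?thesis using g by (simp add: closed_span_L_def)
qed

text \<open>The description is unique because a nicely meromorphic function is determined by its
  values almost everywhere on the line. Multiplicities of the continuation can thus be read off from
  \<open>X\<close>.\<close>

lemma mero_continuation_eq:
  assumes X: "X holomorphic_on UNIV" and ae: "AE s in crit_line. g s = arch s * X s" and s: "s \<noteq> 1"
  shows "mero_continuation g s = arch s * X s"
proof -
  define f where "f s = arch s * X s" for s
  have fh: "f holomorphic_on - {1}"
    unfolding f_def by (intro holomorphic_intros arch_holomorphic holomorphic_on_subset[OF X]) auto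
  have fan: "f analytic_on {s}" if "s \<noteq> 1" for s
    using fh that by (auto simp: analytic_at intro!: exI[of _ "- {1}"])
  have fm: "f meromorphic_on UNIV"
    unfolding f_def arch_def
    by (intro meromorphic_intros analytic_on_imp_meromorphic_on[OF analytic_on_subset[of _ UNIV]])
      (auto simp: analytic_on_open X intro!: holomorphic_intros)
  have rn: "remove_sings f nicely_meromorphic_on UNIV" by (rule remove_sings_nicely_meromorphic[OF fm])
  have rf: "remove_sings f s = f s" if "s \<noteq> 1" for s using fan[OF that] by simp
  have rg: "AE s in crit_line. remove_sings f s = g s"
    using ae AE_crit_line_neq[of 1] by eventually_elim (auto simp: rf f_def)
  have "mero_continuation g = remove_sings f"
    unfolding mero_continuation_def
  proof (rule the_equality)
    show "remove_sings f nicely_meromorphic_on UNIV \<and> (AE s in crit_line. remove_sings f s = g s)" using rn rg by simp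
    fix G assume G: "G nicely_meromorphic_on UNIV \<and> (AE s in crit_line. G s = g s)"
    then have "AE s in crit_line. G s = g s" by blast
    then have "AE s in crit_line. G s = remove_sings f s" using rg by eventually_elim simp
    then show "G = remove_sings f" using nicely_meromorphic_eq_on_crit_line G rn by blast
  qed
  then show ?thesis using rf[OF s] by (simp add: f_def)
qed

theorem theorem2:
  fixes g :: "complex \<Rightarrow> complex"
  assumes "g \<in> L_space"
    and "(\<lambda>s. s * g s) \<in> L_space"
  shows "g \<in> closed_span_L
    {(\<lambda>s. riemann_zeta s / (s - \<rho>) ^ k) | \<rho> k.
       \<rho> \<in> nontrivial_zeros \<and> 1 \<le> k \<and>
       enat k \<le> zero_mult riemann_zeta \<rho> - zero_mult (mero_continuation g) \<rho>}"
proof -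
  obtain X C where X: "X holomorphic_on UNIV"
    and Xb: "\<forall>K. \<exists>B. \<forall>s. \<bar>Re s\<bar> \<le> K \<longrightarrow> norm (X s) \<le> B * (1 + norm s)\<^sup>2"
    and gX: "AE s in crit_line. g s = arch s * X s"
    and Xr: "\<forall>s. Re s \<ge> 3/2 \<longrightarrow> norm (arch s * X (1 - s)) \<le> C"
    using L_space_continuation[OF assms(1)] by (elim exE conjE) (rule that; assumption)
  obtain X1 C1 where X1: "X1 holomorphic_on UNIV"
    and gX1: "AE s in crit_line. s * g s = arch s * X1 s"
    and X1r: "\<forall>s. Re s \<ge> 3/2 \<longrightarrow> norm (arch s * X1 s) \<le> C1"
    using L_space_continuation[OF assms(2)] by (elim exE conjE) (rule that; assumption)
  \<comment> \<open>Two entire functions that agree almost everywhere on the line; the right-hand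
    bound for \<open>X1\<close> thereby becomes the extra decay of \<open>X\<close>.\<close>
  have "(\<lambda>s. s * X s) = X1"
  proof (rule nicely_meromorphic_eq_on_crit_line)
    show "(\<lambda>s. s * X s) nicely_meromorphic_on UNIV" "X1 nicely_meromorphic_on UNIV"
      using X X1 by (auto intro!: analytic_on_imp_nicely_meromorphic_on holomorphic_intros simp: analytic_on_open)
    show "AE s in crit_line. s * X s = X1 s"
      using gX gX1 AE_crit_line_neq[of 1] AE_crit_line_Re
    proof eventually_elim
      case (elim s)
      have "arch s \<noteq> 0" by (rule arch_nonzero) (use elim in auto)
      moreover have "arch s * (s * X s) = arch s * X1 s" using elim(1,2) by (simp add: mult_ac)
      ultimately show ?case by simp
    qed
  qed
  then have XX: "s * (arch s * X s) = arch s * X1 s" for s by (auto simp: mult_ac dest: fun_cong[of _ _ s])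
  have gL: "g \<in> L2 crit_line" using assms(1) by (simp add: L_space_def)
  have mX: "(\<lambda>s. arch s * X s) \<in> borel_measurable borel"
    by (rule borel_measurable_continuous_countable_exceptions[of "{1}"])
       (auto intro!: holomorphic_on_imp_continuous_on holomorphic_intros arch_holomorphic holomorphic_on_subset[OF X])
  have XL: "(\<lambda>s. arch s * X s) \<in> L2 crit_line"
  proof (rule L2_bounded_by[OF _ gL])
    show "(\<lambda>s. arch s * X s) \<in> borel_measurable crit_line"
      unfolding measurable_cong_sets[OF crit_line_sets refl] by (rule mX)
    show "AE s in crit_line. norm (arch s * X s) \<le> 1 * norm (g s)" using gX by eventually_elim simp
  qed
  have order_Z: "zero_mult riemann_zeta \<rho> = enat (nat (zorder completed_zeta \<rho>))" if "\<rho> \<in> nontrivial_zeros" for \<rho>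
    using that by (intro zero_mult_arch_mult completed_zeta_holomorphic completed_zeta_not_identically_0 riemann_zeta_eq)
      (auto simp: nontrivial_zeros_def)
  have order_X: "zero_mult (mero_continuation g) \<rho> = enat (nat (zorder X \<rho>))" if "\<rho> \<in> nontrivial_zeros" "\<exists>w. X w \<noteq> 0" for \<rho>
    using that by (intro zero_mult_arch_mult X mero_continuation_eq gX) (auto simp: nontrivial_zeros_def)
  show ?thesis
  proof (rule closed_span_L_eqI[OF assms(1)])
    let ?S = "{(\<lambda>s. riemann_zeta s / (s - \<rho>) ^ k) | \<rho> k.
       \<rho> \<in> nontrivial_zeros \<and> 1 \<le> k \<and> enat k \<le> zero_mult riemann_zeta \<rho> - zero_mult (mero_continuation g) \<rho>}"
    show "?S \<subseteq> L2 crit_line"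
    proof clarify
      fix \<rho> and k :: nat
      assume \<rho>: "\<rho> \<in> nontrivial_zeros" and k: "1 \<le> k" and le: "enat k \<le> zero_mult riemann_zeta \<rho> - zero_mult (mero_continuation g) \<rho>"
      \<comment> \<open>The case distinction covers an infinite multiplicity of the continuation,
        where the difference is 0.\<close>
      have "enat k \<le> zero_mult riemann_zeta \<rho>"
        using le unfolding order_Z[OF \<rho>] by (cases "zero_mult (mero_continuation g) \<rho>") auto
      then have "k \<le> nat (zorder completed_zeta \<rho>)" unfolding order_Z[OF \<rho>] by simp
      with \<rho> k show "(\<lambda>s. riemann_zeta s / (s - \<rho>) ^ k) \<in> L2 crit_line"
        by (intro riemann_zeta_quotient_L2) (simp_all add: nontrivial_zeros_iff)
    qed
    fix \<phi> assume \<phi>: "\<phi> \<in> L2 crit_line" and orth: "\<And>v. v \<in> ?S \<Longrightarrow> (LINT s|crit_line. v s * cnj (\<phi> s)) = 0"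
    have m\<phi>: "\<phi> \<in> borel_measurable crit_line" by (rule L2_measurable[OF \<phi>])
    have "(LINT s|crit_line. g s * cnj (\<phi> s)) = (LINT s|crit_line. arch s * X s * cnj (\<phi> s))"
    proof (rule integral_cong_AE)
      show "(\<lambda>s. g s * cnj (\<phi> s)) \<in> borel_measurable crit_line" "(\<lambda>s. arch s * X s * cnj (\<phi> s)) \<in> borel_measurable crit_line"
        by (intro borel_measurable_times borel_measurable_cnj m\<phi> L2_measurable[OF gL] L2_measurable[OF XL])+
      show "AE s in crit_line. g s * cnj (\<phi> s) = arch s * X s * cnj (\<phi> s)" using gX by eventually_elim simp
    qed
    also have "\<dots> = 0"
    \<comment> \<open>For \<open>X\<close> identically 0 the integral vanishes at once; otherwise
      the order of \<open>X\<close> is meaningful at every zero.\<close>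
    proof (cases "\<exists>w. X w \<noteq> 0")
      case False
      then show ?thesis by simp
    next
      case True
      have "zeta_orthogonal X \<phi> (max C C1)"
      proof
        show "norm (s * (arch s * X s)) \<le> max C C1" if "Re s \<ge> 3/2" for s
          unfolding XX using X1r that by (auto simp: le_max_iff_disj)
        show "norm (arch s * X (1 - s)) \<le> max C C1" if "Re s \<ge> 3/2" for s
          using Xr that by (auto simp: le_max_iff_disj)
        show "\<exists>B. \<forall>s. \<bar>Re s\<bar> \<le> K \<longrightarrow> norm (X s) \<le> B * (1 + norm s)\<^sup>2" for K using Xb by blast
        fix \<rho> and k :: nat
        assume zero: "completed_zeta \<rho> = 0" and k: "1 \<le> k" "k + nat (zorder X \<rho>) \<le> nat (zorder completed_zeta \<rho>)"
        have \<rho>: "\<rho> \<in> nontrivial_zeros" using zero by (simp add: nontrivial_zeros_iff)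
        have "enat k \<le> zero_mult riemann_zeta \<rho> - zero_mult (mero_continuation g) \<rho>"
          unfolding order_Z[OF \<rho>] order_X[OF \<rho> True] using k(2) by simp
        then have "(LINT s|crit_line. riemann_zeta s / (s - \<rho>) ^ k * cnj (\<phi> s)) = 0"
          using \<rho> k(1) by (intro orth) blast
        moreover have "(LINT s|crit_line. arch s * completed_zeta s / (s - \<rho>) ^ k * cnj (\<phi> s)) = (LINT s|crit_line. riemann_zeta s / (s - \<rho>) ^ k * cnj (\<phi> s))"
        proof (rule integral_cong_AE)
          have "k \<le> nat (zorder completed_zeta \<rho>)" using k(2) by simp
          note q = zeta_quotient_L2[OF zero k(1) this] riemann_zeta_quotient_L2[OF zero k(1) this]
          show "(\<lambda>s. arch s * completed_zeta s / (s - \<rho>) ^ k * cnj (\<phi> s)) \<in> borel_measurable crit_line"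
            "(\<lambda>s. riemann_zeta s / (s - \<rho>) ^ k * cnj (\<phi> s)) \<in> borel_measurable crit_line"
            by (intro borel_measurable_times borel_measurable_cnj m\<phi> L2_measurable[OF q(1)] L2_measurable[OF q(2)])+
          show "AE s in crit_line. arch s * completed_zeta s / (s - \<rho>) ^ k * cnj (\<phi> s) = riemann_zeta s / (s - \<rho>) ^ k * cnj (\<phi> s)"
            using AE_riemann_zeta_quotient[of \<rho> k] by eventually_elim (simp only:)
        qed
        ultimately show "(LINT s|crit_line. arch s * completed_zeta s / (s - \<rho>) ^ k * cnj (\<phi> s)) = 0" by simp
      qed (fact X True XL \<phi>)+
      then show ?thesis by (rule zeta_orthogonal.vanishing)
    qed
    finally show "(LINT s|crit_line. g s * cnj (\<phi> s)) = 0" .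
  qed
qed

end
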